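(* For any $D = O(n^{1/3})$, there is a deterministic algorithm that, given a directed graph $G$ with $n$ vertices and $m$ edges, runs in $\widetilde{O}(m\cdot n/D)$ time and computes a shortcut set of $G$ of size $\widetilde{O}(n^2/D^3)$ with hopbound $O(D)$.
   Context: The transitive closure $\mathrm{TC}(G)$ of a directed graph $G$ is the set of pairs $(u,v)$ such that $v$ is reachable from $u$ in $G$. A shortcut set with hopbound $\beta$ is a set $H\subseteq \mathrm{TC}(G)$ of additional unweighted edges such that for every pair $(s,t)\in \mathrm{TC}(G)$ the (unweighted) distance from $s$ to $t$ in $G\cup H$ is at most $\beta$. $\widetilde{O}(\cdot)$ hides factors polylogarithmic in $n$. *)

theory Defs
  imports Complex_Main "HOL-Library.Extended_Nat"
begin

section \<open>Shortcut sets\<close>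

definition digraph :: "nat \<Rightarrow> (nat \<times> nat) set \<Rightarrow> bool" where
  "digraph n E \<longleftrightarrow> E \<subseteq> {..<n} \<times> {..<n}"

definition TC :: "nat \<Rightarrow> (nat \<times> nat) set \<Rightarrow> (nat \<times> nat) set" where
  "TC n E = {(u, v). u < n \<and> v < n \<and> (u, v) \<in> E\<^sup>*}"

text \<open>Unweighted distance; the infimum of the empty set is \<open>\<infinity>\<close>.\<close>

definition hop_dist :: "('a \<times> 'a) set \<Rightarrow> 'a \<Rightarrow> 'a \<Rightarrow> enat" where
  "hop_dist E s t = (INF k \<in> {k. (s, t) \<in> E ^^ k}. enat k)"

definition shortcut_set :: "nat \<Rightarrow> (nat \<times> nat) set \<Rightarrow> nat \<Rightarrow> (nat \<times> nat) set \<Rightarrow> bool" where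
  "shortcut_set n E \<beta> H \<longleftrightarrow>
     H \<subseteq> TC n E \<and> (\<forall>(s, t) \<in> TC n E. hop_dist (E \<union> H) s t \<le> enat \<beta>)"


section \<open>Deterministic word RAM programs\<close>

text \<open>
  Programs are finite syntax trees over word variables and random-access arrays of words.
  Words have \<open>w\<close> bits: the result of every operation is reduced modulo \<open>2 ^ w\<close> (subtraction is
  truncated at 0). Comparisons return 0 or 1, and a condition holds iff it is non-zero.
  Every operation, memory access and branch takes one time unit. A program mentions finitely many
  variables and arrays, so keeping the arrays in separate address spaces instead of
  one memory affects running times by a constant factor only.
\<close>

datatype bop = Add | Sub | Mul | Div | Mod | Less | Eq

datatype exp =
    Lit nat
  | Var string
  | Read string exp
  | Op bop exp exp

datatype com =
    Skip
  | Assign string exp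
  | Write string exp exp
  | Seq com com
  | Cond exp com com
  | While exp com

record store =
  var :: "string \<Rightarrow> nat"
  arr :: "string \<Rightarrow> nat \<Rightarrow> nat"

fun bop_val :: "bop \<Rightarrow> nat \<Rightarrow> nat \<Rightarrow> nat" where
  "bop_val Add x y = x + y"
| "bop_val Sub x y = x - y"
| "bop_val Mul x y = x * y"
| "bop_val Div x y = x div y"
| "bop_val Mod x y = x mod y"
| "bop_val Less x y = of_bool (x < y)"
| "bop_val Eq x y = of_bool (x = y)"

fun exp_val :: "nat \<Rightarrow> store \<Rightarrow> exp \<Rightarrow> nat" where
  "exp_val w s (Lit k) = k mod 2 ^ w"
| "exp_val w s (Var x) = var s x"
| "exp_val w s (Read a i) = arr s a (exp_val w s i)"
| "exp_val w s (Op f e1 e2) = bop_val f (exp_val w s e1) (exp_val w s e2) mod 2 ^ w"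

fun exp_cost :: "exp \<Rightarrow> nat" where
  "exp_cost (Lit k) = 1"
| "exp_cost (Var x) = 1"
| "exp_cost (Read a i) = exp_cost i + 1"
| "exp_cost (Op f e1 e2) = exp_cost e1 + exp_cost e2 + 1"

text \<open>\<open>exec w P s t s'\<close>: with word length \<open>w\<close>, program \<open>P\<close> started in store \<open>s\<close> halts after
  \<open>t\<close> time units in store \<open>s'\<close>.\<close>

inductive exec :: "nat \<Rightarrow> com \<Rightarrow> store \<Rightarrow> nat \<Rightarrow> store \<Rightarrow> bool" for w where
  Skip: "exec w Skip s 1 s"
| Assign: "exec w (Assign x e) s (exp_cost e + 1)
     (s\<lparr>var := (var s)(x := exp_val w s e)\<rparr>)"
| Write: "exec w (Write a i e) s (exp_cost i + exp_cost e + 1)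
     (s\<lparr>arr := (arr s)(a := (arr s a)(exp_val w s i := exp_val w s e))\<rparr>)"
| Seq: "exec w P s t s' \<Longrightarrow> exec w Q s' t' s'' \<Longrightarrow> exec w (Seq P Q) s (t + t') s''"
| CondTrue: "exp_val w s b \<noteq> 0 \<Longrightarrow> exec w P s t s' \<Longrightarrow>
     exec w (Cond b P Q) s (exp_cost b + 1 + t) s'"
| CondFalse: "exp_val w s b = 0 \<Longrightarrow> exec w Q s t s' \<Longrightarrow>
     exec w (Cond b P Q) s (exp_cost b + 1 + t) s'"
| WhileFalse: "exp_val w s b = 0 \<Longrightarrow> exec w (While b P) s (exp_cost b + 1) s"
| WhileTrue: "exp_val w s b \<noteq> 0 \<Longrightarrow> exec w P s t s' \<Longrightarrow> exec w (While b P) s' t' s'' \<Longrightarrow>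
     exec w (While b P) s (exp_cost b + 1 + t + t') s''"

inductive_cases SeqE: "exec w (Seq P Q) s t s'"
inductive_cases CondE: "exec w (Cond b P Q) s t s'"
inductive_cases WhileE: "exec w (While b P) s t s'"

lemma exec_deterministic:
  "exec w P s t s' \<Longrightarrow> exec w P s u r \<Longrightarrow> t = u \<and> s' = r"
proof (induction arbitrary: u r rule: exec.induct)
  case (Skip s)
  then show ?case by (cases rule: exec.cases) simp_all
next
  case (Assign x e s)
  then show ?case by (cases rule: exec.cases) simp_all
next
  case (Write a i e s)
  then show ?case by (cases rule: exec.cases) simp_all
next
  case (Seq P s t s' Q t' s'')
  from Seq.prems obtain t1 r1 t2 where
    "exec w P s t1 r1" "exec w Q r1 t2 r" "u = t1 + t2" by (rule SeqE)
  with Seq.IH(1)[of t1 r1] Seq.IH(2)[of t2 r] show ?case by simp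
next
  case (CondTrue s b P t s' Q)
  from CondTrue.prems CondTrue.hyps(1) obtain t1 where
    "exec w P s t1 r" "u = exp_cost b + 1 + t1" by (elim CondE) simp_all
  with CondTrue.IH[of t1 r] show ?case by simp
next
  case (CondFalse s b Q t s' P)
  from CondFalse.prems CondFalse.hyps(1) obtain t1 where
    "exec w Q s t1 r" "u = exp_cost b + 1 + t1" by (elim CondE) simp_all
  with CondFalse.IH[of t1 r] show ?case by simp
next
  case (WhileFalse s b P)
  from WhileFalse.prems show ?case by (rule WhileE) (use WhileFalse.hyps in simp_all)
next
  case (WhileTrue s b P t s' t' s'')
  from WhileTrue.prems obtain t1 r1 t2 where
    "exec w P s t1 r1" "exec w (While b P) r1 t2 r" "u = exp_cost b + 1 + t1 + t2"
    by (rule WhileE) (use WhileTrue.hyps(1) in simp_all)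
  with WhileTrue.IH(1)[of t1 r1] WhileTrue.IH(2)[of t2 r] show ?case by simp
qed


section \<open>Input and output\<close>

text \<open>The input consists of the number of vertices, the parameter \<open>D\<close> and a list of the edges in
  arbitrary order; all remaining variables and array cells are initially 0.\<close>

definition input_store :: "nat \<Rightarrow> (nat \<times> nat) list \<Rightarrow> nat \<Rightarrow> store" where
  "input_store n es D = \<lparr>
     var = (\<lambda>_. 0)(''n'' := n, ''m'' := length es, ''D'' := D),
     arr = (\<lambda>_ _. 0)(
       ''src'' := (\<lambda>i. if i < length es then fst (es ! i) else 0),
       ''dst'' := (\<lambda>i. if i < length es then snd (es ! i) else 0))\<rparr>"

definition output_list :: "store \<Rightarrow> (nat \<times> nat) list" where
  "output_list s = map (\<lambda>i. (arr s ''hsrc'' i, arr s ''hdst'' i)) [0..<var s ''h'']"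

definition edge_list_of :: "(nat \<times> nat) list \<Rightarrow> (nat \<times> nat) set \<Rightarrow> bool" where
  "edge_list_of es E \<longleftrightarrow> distinct es \<and> set es = E"

end

(*
  After contracting strongly connected components (Kosaraju) we work on a DAG. Repeatedly removing
  chains of D vertices leaves at most n/D chains and a rest without chains of length D. On every chain,
  O(D log D) shortcuts make all forward distances at most 2, so a shortest path meets every chain in at
  most three vertices and has fewer than D vertices outside the chains. Hence every window of 4 D
  consecutive vertices of a shortest path meets at least D different chains.

  For every chain, a shortest path forest leading to the first reachable vertex of the chain is computed
  in O(m) time up to logarithms, and the same for the reversed graph; this dominates the running time
  m n / D. Windows of these forests are collected at one residue class of depths modulo 4 D. Since every
  window meets D of at most n/D chains, a deterministic greedy algorithm finds O~(n/D^2) chains that hit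
  all windows. From every vertex of a picked chain there is a final shortcut to the first reachable
  vertex of every other picked chain: D * (n/D^2)^2 = n^2/D^3 edges.

  A long shortest path from s to t passes through some chain vertex x. The forest towards the chain of x
  yields, within 8 D hops of s, a vertex v on a picked chain that still reaches x; symmetrically there is
  such a vertex z near t. Then one final shortcut and two hops on the chain of z lead from v to z.
*)

theory Submission
  imports Defs
begin

text \<open>The bound D = O(n^(1/3)) enters only in the final estimates: the O(n log n) edges of the
  component stars and of the chain shortcuts fit into n^2/D^3 because D^3 = O(n), and an additive D
  in the running time is absorbed because D = O(n/D). The constants come from one count. A shortest
  path of 4 D vertices has at most D - 1 vertices off the chains and at most three on each chain,
  hence meets D chains. A window starts within 4 D steps, at the right residue, and has 4 D
  vertices, which gives 8 D. Two such halves, one final shortcut and two chain hops stay below 25 D.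
  Each hop of the condensation costs three hops in the graph, and two more join the endpoints to
  their representatives: 75 D + 2 \<le> 77 D. The running time has no room for an additive n, so
  isolated vertices are never touched. On edges sorted by descending source, longest paths and
  shortest path forests are dynamic programs that need a single pass. Because words are bounded,
  stored numbers may grow only by constants.\<close>

section \<open>Total correctness with unbounded words\<close>

fun ival :: "store \<Rightarrow> exp \<Rightarrow> nat" where
  "ival s (Lit k) = k"
| "ival s (Var x) = var s x"
| "ival s (Read a i) = arr s a (ival s i)"
| "ival s (Op f e1 e2) = bop_val f (ival s e1) (ival s e2)"

definition setv :: "store \<Rightarrow> string \<Rightarrow> nat \<Rightarrow> store" where
  "setv s x v = s\<lparr>var := (var s)(x := v)\<rparr>"

definition seta :: "store \<Rightarrow> string \<Rightarrow> nat \<Rightarrow> nat \<Rightarrow> store" where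
  "seta s a i v = s\<lparr>arr := (arr s)(a := (arr s a)(i := v))\<rparr>"

lemma var_setv [simp]: "var (setv s x v) y = (if y = x then v else var s y)"
  and arr_setv [simp]: "arr (setv s x v) = arr s"
  and var_seta [simp]: "var (seta s a i v) = var s"
  and arr_seta [simp]: "arr (seta s a i v) b = (if b = a then (arr s a)(i := v) else arr s b)"
  by (simp_all add: setv_def seta_def)

text \<open>Programs are verified in a semantics with unbounded words and transferred to \<open>exec\<close> afterwards.\<close>

inductive iexec :: "com \<Rightarrow> store \<Rightarrow> nat \<Rightarrow> store \<Rightarrow> bool" where
  Skip: "iexec Skip s 1 s"
| Assign: "iexec (Assign x e) s (exp_cost e + 1) (setv s x (ival s e))"
| Write: "iexec (Write a i e) s (exp_cost i + exp_cost e + 1) (seta s a (ival s i) (ival s e))"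
| Seq: "iexec P s t s' \<Longrightarrow> iexec Q s' t' s'' \<Longrightarrow> iexec (Seq P Q) s (t + t') s''"
| CondTrue: "ival s b \<noteq> 0 \<Longrightarrow> iexec P s t s' \<Longrightarrow> iexec (Cond b P Q) s (exp_cost b + 1 + t) s'"
| CondFalse: "ival s b = 0 \<Longrightarrow> iexec Q s t s' \<Longrightarrow> iexec (Cond b P Q) s (exp_cost b + 1 + t) s'"
| WhileFalse: "ival s b = 0 \<Longrightarrow> iexec (While b P) s (exp_cost b + 1) s"
| WhileTrue: "ival s b \<noteq> 0 \<Longrightarrow> iexec P s t s' \<Longrightarrow> iexec (While b P) s' t' s'' \<Longrightarrow>
     iexec (While b P) s (exp_cost b + 1 + t + t') s''"

inductive_cases iSkipE: "iexec Skip s t s'"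
inductive_cases iAssignE: "iexec (Assign x e) s t s'"
inductive_cases iWriteE: "iexec (Write a i e) s t s'"
inductive_cases iSeqE: "iexec (Seq P Q) s t s'"
inductive_cases iCondE: "iexec (Cond b P Q) s t s'"

text \<open>Weakest precondition for total correctness; the postcondition also sees the running time.\<close>

definition W :: "com \<Rightarrow> store \<Rightarrow> (nat \<Rightarrow> store \<Rightarrow> bool) \<Rightarrow> bool" where
  "W P s Q \<longleftrightarrow> (\<exists>t s'. iexec P s t s' \<and> Q t s')"

lemma W_Skip [simp]: "W Skip s Q = Q 1 s"
  unfolding W_def by (metis iSkipE iexec.Skip)

lemma W_Assign [simp]: "W (Assign x e) s Q = Q (exp_cost e + 1) (setv s x (ival s e))"
  unfolding W_def by (metis iAssignE iexec.Assign)

lemma W_Write [simp]: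
  "W (Write a i e) s Q = Q (exp_cost i + exp_cost e + 1) (seta s a (ival s i) (ival s e))"
  unfolding W_def by (metis iWriteE iexec.Write)

lemma W_Seq [simp]: "W (Seq P R) s Q = W P s (\<lambda>t s'. W R s' (\<lambda>t' s''. Q (t + t') s''))"
  unfolding W_def by (metis iSeqE iexec.Seq)

lemma W_Cond [simp]: "W (Cond b P R) s Q =
    (if ival s b \<noteq> 0 then W P s (\<lambda>t. Q (exp_cost b + 1 + t)) else W R s (\<lambda>t. Q (exp_cost b + 1 + t)))"
proof
  assume "W (Cond b P R) s Q"
  then obtain t s' where "iexec (Cond b P R) s t s'" "Q t s'" unfolding W_def by blast
  then show "if ival s b \<noteq> 0 then W P s (\<lambda>t. Q (exp_cost b + 1 + t)) else W R s (\<lambda>t. Q (exp_cost b + 1 + t))"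
    by (cases rule: iCondE) (auto simp: W_def)
next
  assume "if ival s b \<noteq> 0 then W P s (\<lambda>t. Q (exp_cost b + 1 + t)) else W R s (\<lambda>t. Q (exp_cost b + 1 + t))"
  then show "W (Cond b P R) s Q"
    unfolding W_def by (metis iexec.CondTrue iexec.CondFalse)
qed

section \<open>Frame conditions and loop rules\<close>

fun mod_vars :: "com \<Rightarrow> string set" where
  "mod_vars Skip = {}"
| "mod_vars (Assign x e) = {x}"
| "mod_vars (Write a i e) = {}"
| "mod_vars (Seq P Q) = mod_vars P \<union> mod_vars Q"
| "mod_vars (Cond b P Q) = mod_vars P \<union> mod_vars Q"
| "mod_vars (While b P) = mod_vars P"

fun mod_arrs :: "com \<Rightarrow> string set" where
  "mod_arrs Skip = {}"
| "mod_arrs (Assign x e) = {}"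
| "mod_arrs (Write a i e) = {a}"
| "mod_arrs (Seq P Q) = mod_arrs P \<union> mod_arrs Q"
| "mod_arrs (Cond b P Q) = mod_arrs P \<union> mod_arrs Q"
| "mod_arrs (While b P) = mod_arrs P"

definition eqx :: "string set \<Rightarrow> string set \<Rightarrow> store \<Rightarrow> store \<Rightarrow> bool" where
  "eqx X Y s s' \<longleftrightarrow> (\<forall>x. x \<notin> X \<longrightarrow> var s' x = var s x) \<and> (\<forall>a. a \<notin> Y \<longrightarrow> arr s' a = arr s a)"

lemma eqx_refl [simp]: "eqx X Y s s"
  by (simp add: eqx_def)

lemma eqx_trans: "eqx X Y s s' \<Longrightarrow> eqx X Y s' s'' \<Longrightarrow> eqx X Y s s''"
  by (simp add: eqx_def)

lemma iexec_eqx: "iexec P s t s' \<Longrightarrow> eqx (mod_vars P) (mod_arrs P) s s'"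
  by (induction rule: iexec.induct) (auto simp: eqx_def)

lemma W_eqx:
  "W P s Q \<Longrightarrow> (\<And>t s'. eqx (mod_vars P) (mod_arrs P) s s' \<Longrightarrow> Q t s' \<Longrightarrow> Q' t s') \<Longrightarrow> W P s Q'"
  unfolding W_def using iexec_eqx by blast

text \<open>\<open>\<mu>\<close> is termination measure and time account at once: a round has to
  lower it by its own cost, which is positive. The frame relation to the initial store is carried
  along, so \<open>I\<close> has to mention only what the body changes.\<close>

lemma W_While:
  assumes "I s"
    and "\<And>s'. eqx (mod_vars P) (mod_arrs P) s s' \<Longrightarrow> I s' \<Longrightarrow> ival s' b \<noteq> 0 \<Longrightarrow>
      W P s' (\<lambda>t s''. I s'' \<and> exp_cost b + 1 + t + \<mu> s'' \<le> \<mu> s')"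
    and "\<And>t s'. eqx (mod_vars P) (mod_arrs P) s s' \<Longrightarrow> I s' \<Longrightarrow> ival s' b = 0 \<Longrightarrow>
      t + \<mu> s' \<le> \<mu> s + exp_cost b + 1 \<Longrightarrow> Q t s'"
  shows "W (While b P) s Q"
proof -
  have "\<exists>t s''. iexec (While b P) s' t s'' \<and> eqx (mod_vars P) (mod_arrs P) s s'' \<and> I s'' \<and> ival s'' b = 0 \<and>
      t + \<mu> s'' \<le> \<mu> s' + exp_cost b + 1"
    if "I s'" "eqx (mod_vars P) (mod_arrs P) s s'" for s'
    using that
  proof (induction "\<mu> s'" arbitrary: s' rule: less_induct)
    case less
    show ?case
    proof (cases "ival s' b = 0")
      case True
      with less.prems show ?thesis
        by (intro exI[of _ "exp_cost b + 1"] exI[of _ s']) (use iexec.WhileFalse[of s' b P] in auto)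
    next
      case False
      with assms(2)[of s'] less.prems obtain t u where u: "iexec P s' t u" "I u"
        "exp_cost b + 1 + t + \<mu> u \<le> \<mu> s'"
        unfolding W_def by blast
      have "eqx (mod_vars P) (mod_arrs P) s u"
        using less.prems u(1) iexec_eqx eqx_trans by blast
      moreover have "\<mu> u < \<mu> s'" using u(3) by simp
      ultimately obtain t' v where v: "iexec (While b P) u t' v" "eqx (mod_vars P) (mod_arrs P) s v" "I v"
        "ival v b = 0" "t' + \<mu> v \<le> \<mu> u + exp_cost b + 1"
        using less.hyps[of u] u(2) by blast
      have "iexec (While b P) s' (exp_cost b + 1 + t + t') v"
        using False u(1) v(1) by (rule iexec.WhileTrue)
      moreover have "exp_cost b + 1 + t + t' + \<mu> v \<le> \<mu> s' + exp_cost b + 1"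
        using u(3) v(5) by simp
      ultimately show ?thesis using v by blast
    qed
  qed
  from this[of s] assms(1) show ?thesis
    unfolding W_def using assms(3) by (auto simp: W_def)
qed

definition For :: "string \<Rightarrow> exp \<Rightarrow> com \<Rightarrow> com" where
  "For i hi P = Seq (Assign i (Lit 0))
     (While (Op Less (Var i) hi) (Seq P (Assign i (Op Add (Var i) (Lit 1)))))"

lemma mod_vars_For [simp]: "mod_vars (For i hi P) = insert i (mod_vars P)"
  and mod_arrs_For [simp]: "mod_arrs (For i hi P) = mod_arrs P"
  by (auto simp: For_def)

text \<open>Amortised rule: a single round may be expensive if it lowers \<open>\<Phi>\<close>, and
  in total only the drop of \<open>\<Phi>\<close> is charged. Per round,
  \<open>exp_cost hi + 7\<close> pays for test and increment; the final
  \<open>exp_cost hi + 5\<close> is the initialisation together with the failing test.\<close>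

lemma W_For_pot:
  assumes "i \<notin> mod_vars P"
    and init: "I 0 (setv s i 0)"
    and hi: "\<And>s'. eqx (insert i (mod_vars P)) (mod_arrs P) s s' \<Longrightarrow> ival s' hi = N"
    and body: "\<And>k s'. eqx (insert i (mod_vars P)) (mod_arrs P) s s' \<Longrightarrow> var s' i = k \<Longrightarrow> k < N \<Longrightarrow> I k s' \<Longrightarrow>
      W P s' (\<lambda>t s''. I (Suc k) (setv s'' i (Suc k)) \<and> t + \<Phi> (setv s'' i (Suc k)) \<le> T + \<Phi> s')"
    and fin: "\<And>t s'. eqx (insert i (mod_vars P)) (mod_arrs P) s s' \<Longrightarrow> I N s' \<Longrightarrow> var s' i = N \<Longrightarrow>
      t + \<Phi> s' \<le> N * (T + exp_cost hi + 7) + exp_cost hi + 5 + \<Phi> (setv s i 0) \<Longrightarrow> Q t s'"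
  shows "W (For i hi P) s Q"
proof -
  let ?b = "Op Less (Var i) hi" and ?P = "Seq P (Assign i (Op Add (Var i) (Lit 1)))"
  have e0: "eqx (insert i (mod_vars P)) (mod_arrs P) s (setv s i 0)" by (simp add: eqx_def)
  have tr: "eqx (insert i (mod_vars P)) (mod_arrs P) s s'"
    if "eqx (mod_vars ?P) (mod_arrs ?P) (setv s i 0) s'" for s'
    using that by (auto simp: eqx_def)
  have "W (While ?b ?P) (setv s i 0) (\<lambda>t s'. Q (2 + t) s')"
  proof (rule W_While[where I = "\<lambda>s'. var s' i \<le> N \<and> I (var s' i) s'" and
        \<mu> = "\<lambda>s'. (N - var s' i) * (T + exp_cost hi + 7) + \<Phi> s'"], goal_cases)
    case 1
    show ?case using init by simp
  next
    case (2 s')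
    let ?k = "var s' i"
    have lt: "?k < N" and I: "I ?k s'" using 2 hi[OF tr[OF 2(1)]] by (auto split: if_splits)
    have "W P s' (\<lambda>t s''. I (Suc ?k) (setv s'' i (Suc ?k)) \<and> t + \<Phi> (setv s'' i (Suc ?k)) \<le> T + \<Phi> s')"
      by (rule body[OF tr[OF 2(1)] refl lt I])
    then show ?case
      unfolding W_Seq
    proof (rule W_eqx, goal_cases)
      case (1 t u)
      have k: "var u i = ?k" using 1(1) assms(1) by (simp add: eqx_def)
      obtain d where d: "N = Suc (?k + d)" using lt less_natE by blast
      show ?case using 1(2) by (auto simp: k d)
    qed
  next
    case (3 t s')
    have "var s' i = N" using 3(3) 3(2) hi[OF tr[OF 3(1)]] by (auto split: if_splits)
    then show ?case
      using 3 by (intro fin tr) auto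
  qed
  then show ?thesis by (simp add: For_def)
qed

lemma W_For:
  assumes "i \<notin> mod_vars P"
    and "I 0 (setv s i 0)"
    and "\<And>s'. eqx (insert i (mod_vars P)) (mod_arrs P) s s' \<Longrightarrow> ival s' hi = N"
    and "\<And>k s'. eqx (insert i (mod_vars P)) (mod_arrs P) s s' \<Longrightarrow> var s' i = k \<Longrightarrow> k < N \<Longrightarrow> I k s' \<Longrightarrow>
      W P s' (\<lambda>t s''. I (Suc k) (setv s'' i (Suc k)) \<and> t \<le> T)"
    and "\<And>t s'. eqx (insert i (mod_vars P)) (mod_arrs P) s s' \<Longrightarrow> I N s' \<Longrightarrow> var s' i = N \<Longrightarrow>
      t \<le> N * (T + exp_cost hi + 7) + exp_cost hi + 5 \<Longrightarrow> Q t s'"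
  shows "W (For i hi P) s Q"
  by (rule W_For_pot[where I = I and \<Phi> = "\<lambda>_. 0" and T = T]) (use assms in auto)

section \<open>Transfer to bounded words\<close>

text \<open>If \<open>growth e = Some c\<close>, then the value of \<open>e\<close> exceeds the largest stored number by at most \<open>c\<close>.
  When all stored expressions have this property, stored numbers grow linearly in the running time, and
  intermediate results, which may contain products, stay polynomial. The second case for subtraction
  recognises \<open>min x y\<close> written as \<open>x - (x - y)\<close>.\<close>

fun cbound :: "exp \<Rightarrow> nat option" where
  "cbound (Lit k) = Some k"
| "cbound (Op Less e1 e2) = Some 1"
| "cbound (Op Eq e1 e2) = Some 1"
| "cbound _ = None"

fun growth :: "exp \<Rightarrow> nat option" where
  "growth (Lit k) = Some k"
| "growth (Var x) = Some 0"
| "growth (Read a i) = Some 0"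
| "growth (Op Add e1 e2) = (case (growth e1, cbound e2) of (Some g, Some c) \<Rightarrow> Some (g + c) | _ \<Rightarrow> None)"
| "growth (Op Sub e1 e2) = (case growth e1 of Some g \<Rightarrow> Some g | None \<Rightarrow>
     (case e2 of Op Sub e3 e4 \<Rightarrow> if e3 = e1 then growth e4 else None | _ \<Rightarrow> None))"
| "growth (Op Div e1 e2) = growth e1"
| "growth (Op Mod e1 e2) = growth e1"
| "growth (Op Mul e1 e2) = None"
| "growth (Op Less e1 e2) = Some 1"
| "growth (Op Eq e1 e2) = Some 1"

fun grows :: "nat \<Rightarrow> com \<Rightarrow> bool" where
  "grows g Skip = True"
| "grows g (Assign x e) = (\<exists>c\<le>g. growth e = Some c)"
| "grows g (Write a i e) = (\<exists>c\<le>g. growth e = Some c)"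
| "grows g (Seq P Q) = (grows g P \<and> grows g Q)"
| "grows g (Cond b P Q) = (grows g P \<and> grows g Q)"
| "grows g (While b P) = grows g P"

text \<open>A degree: if all stored numbers are at most \<open>B\<close> and
  \<open>B \<ge> 2\<close>, neither \<open>e\<close> nor any of its subexpressions exceeds
  \<open>B ^ esize e\<close>. A read has the degree of its index because its value is again a stored
  number.\<close>

fun esize :: "exp \<Rightarrow> nat" where
  "esize (Lit k) = k + 1"
| "esize (Var x) = 1"
| "esize (Read a i) = esize i"
| "esize (Op f e1 e2) = esize e1 + esize e2"

fun csize :: "com \<Rightarrow> nat" where
  "csize Skip = 1"
| "csize (Assign x e) = esize e"
| "csize (Write a i e) = max (esize i) (esize e)"
| "csize (Seq P Q) = max (csize P) (csize Q)"
| "csize (Cond b P Q) = max (esize b) (max (csize P) (csize Q))"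
| "csize (While b P) = max (esize b) (csize P)"

definition bounded :: "nat \<Rightarrow> store \<Rightarrow> bool" where
  "bounded B s \<longleftrightarrow> (\<forall>x. var s x \<le> B) \<and> (\<forall>a i. arr s a i \<le> B)"

lemma bounded_mono: "bounded B s \<Longrightarrow> B \<le> B' \<Longrightarrow> bounded B' s"
  by (auto simp: bounded_def intro: le_trans)

lemma esize_pos: "1 \<le> esize e"
  by (induction e) auto

lemma ival_growth:
  assumes "bounded B s"
  shows "growth e = Some g \<Longrightarrow> ival s e \<le> B + g"
    and "cbound e = Some g \<Longrightarrow> ival s e \<le> g"
proof -
  show c: "ival s e \<le> g" if "cbound e = Some g" for e g
    using that by (cases e rule: cbound.cases) auto
  show "growth e = Some g \<Longrightarrow> ival s e \<le> B + g"
  proof (induction e arbitrary: g rule: growth.induct)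
    case (4 e1 e2)
    then obtain h d where hd: "growth e1 = Some h" "cbound e2 = Some d" "g = h + d"
      by (auto split: option.splits)
    have "ival s e1 + ival s e2 \<le> (B + h) + d"
      using "4.IH"[OF hd(1)] c[OF hd(2)] by (rule add_le_mono)
    then show ?case by (simp add: hd(3) add.assoc)
  next
    case (5 e1 e2)
    show ?case
    proof (cases "growth e1")
      case (Some h)
      then show ?thesis using 5(1)[OF Some] 5(3) by (auto intro: le_trans[OF diff_le_self])
    next
      case None
      with 5(3) obtain e4 where e: "e2 = Op Sub e1 e4" "growth e4 = Some g"
        by (auto split: exp.splits bop.splits if_splits)
      have "ival s e4 \<le> B + g" using 5(2)[OF None] e by blast
      then show ?thesis by (simp add: e)
    qed
  next
    case (6 e1 e2)
    then show ?case by simp (meson div_le_dividend le_trans)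
  next
    case (7 e1 e2)
    then show ?case by simp (meson mod_less_eq_dividend le_trans)
  qed (use assms in \<open>auto simp: bounded_def\<close>)
qed

text \<open>Exponents add under multiplication. Both bounds are at least 2, so their product
  dominates their sum as well; the remaining operations do not exceed their first operand or
  1.\<close>

lemma ival_le_power:
  assumes "bounded B s" "2 \<le> B"
  shows "ival s e \<le> B ^ esize e"
proof (induction e)
  case (Lit k)
  have "k < 2 ^ k" by simp
  also have "\<dots> \<le> B ^ (k + 1)"
    using assms(2) by (meson le_add1 le_trans power_increasing power_mono one_le_numeral zero_le)
  finally show ?case by simp
next
  case (Var x)
  then show ?case using assms by (simp add: bounded_def)
next
  case (Read a i)
  have "ival s (Read a i) \<le> B ^ 1" using assms by (simp add: bounded_def)
  also have "\<dots> \<le> B ^ esize i"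
    by (rule power_increasing) (use assms(2) esize_pos in auto)
  finally show ?case by simp
next
  case (Op f e1 e2)
  have ge: "B \<le> B ^ esize e" for e
    using power_increasing[of 1 "esize e" B] assms(2) esize_pos by simp
  have mul: "x * y \<le> B ^ esize e1 * B ^ esize e2"
    if "x \<le> B ^ esize e1" "y \<le> B ^ esize e2" for x y
    using that by (rule mult_le_mono)
  have add: "x + y \<le> x * y" if "2 \<le> x" "2 \<le> y" for x y :: nat
  proof -
    have "2 * y \<le> x * y" "x * 2 \<le> x * y"
      using that by (simp_all only: mult_le_mono1 mult_le_mono2)
    then show ?thesis by linarith
  qed
  have P: "B ^ esize e1 \<le> B ^ esize (Op f e1 e2)" "1 \<le> B ^ esize (Op f e1 e2)"
    using assms(2) by (auto intro: power_increasing)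
  have S: "B ^ esize e1 + B ^ esize e2 \<le> B ^ esize e1 * B ^ esize e2"
    by (rule add) (use ge[of e1] ge[of e2] assms(2) in auto)
  show ?case
  proof (cases f)
    case Add
    then show ?thesis using Op S by (simp add: power_add)
  next
    case Mul
    then show ?thesis using Op mul by (simp add: power_add)
  next
    case Sub
    then show ?thesis using Op(1) P(1) by simp
  next
    case Div
    have "ival s e1 div ival s e2 \<le> B ^ esize (Op f e1 e2)"
      using Op(1) P(1) by (meson div_le_dividend le_trans)
    then show ?thesis using Div by simp
  next
    case Mod
    have "ival s e1 mod ival s e2 \<le> B ^ esize (Op f e1 e2)"
      using Op(1) P(1) by (meson mod_less_eq_dividend le_trans)
    then show ?thesis using Mod by simp
  qed (use P(2) in auto)
qed

lemma exp_val_eq_ival: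
  assumes "bounded B s" "2 \<le> B" "B ^ esize e < 2 ^ w"
  shows "exp_val w s e = ival s e"
  using assms(3)
proof (induction e)
  case (Lit k)
  then show ?case using ival_le_power[OF assms(1,2), of "Lit k"] by simp
next
  case (Op f e1 e2)
  have "B ^ esize e1 \<le> B ^ esize (Op f e1 e2)" "B ^ esize e2 \<le> B ^ esize (Op f e1 e2)"
    using assms(2) by (auto intro: power_increasing)
  with Op have "exp_val w s e1 = ival s e1" "exp_val w s e2 = ival s e2" by simp_all
  moreover have "ival s (Op f e1 e2) < 2 ^ w"
    using ival_le_power[OF assms(1,2), of "Op f e1 e2"] Op.prems by simp
  ultimately show ?case by simp
qed simp_all

text \<open>A store operation costs at least one time unit and raises the largest stored number by
  at most \<open>g\<close>, so numbers stay below \<open>B + g * t\<close>. Intermediate results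
  stay below the power \<open>csize P\<close> of this, hence no reduction modulo
  \<open>2 ^ w\<close> ever takes effect.\<close>

lemma iexec_exec:
  assumes "iexec P s t s'" "grows g P" "bounded B s" "2 \<le> B" "(B + g * t) ^ csize P < 2 ^ w"
  shows "exec w P s t s' \<and> bounded (B + g * t) s'"
  using assms
proof (induction arbitrary: B rule: iexec.induct)
  have mono: "x ^ a < 2 ^ w" if "y ^ b < 2 ^ w" "x \<le> y" "a \<le> b" "2 \<le> y" for x y a b :: nat
  proof -
    have "x ^ a \<le> y ^ a" using that by (simp add: power_mono)
    also have "\<dots> \<le> y ^ b" using that by (intro power_increasing) auto
    finally show ?thesis using that by simp
  qed
  {
    case (Skip s)
    show ?case using exec.Skip[of w s] bounded_mono[OF Skip(2), of "B + g * 1"] by simp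
  next
    case (Assign x e s)
    have v: "exp_val w s e = ival s e"
      by (rule exp_val_eq_ival[OF Assign(2,3)]) (rule mono[OF Assign(4)], use Assign(3) in auto)
    obtain c where c: "c \<le> g" "growth e = Some c" using Assign(1) by auto
    have "ival s e \<le> B + c" using ival_growth(1)[OF Assign(2) c(2)] .
    also have "\<dots> \<le> B + g * (exp_cost e + 1)" using c(1) by (simp add: trans_le_add2)
    finally have "bounded (B + g * (exp_cost e + 1)) (setv s x (ival s e))"
      using Assign(2) by (auto simp: bounded_def intro: trans_le_add1)
    then show ?case using exec.Assign[of w x e s] v by (simp add: setv_def)
  next
    case (Write a i e s)
    have v: "exp_val w s e = ival s e" "exp_val w s i = ival s i"
      by (rule exp_val_eq_ival[OF Write(2,3)], rule mono[OF Write(4)], use Write(3) in auto)+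
    obtain c where c: "c \<le> g" "growth e = Some c" using Write(1) by auto
    have "ival s e \<le> B + c" using ival_growth(1)[OF Write(2) c(2)] .
    also have "\<dots> \<le> B + g * (exp_cost i + exp_cost e + 1)" using c(1) by (simp add: trans_le_add2)
    finally have "bounded (B + g * (exp_cost i + exp_cost e + 1)) (seta s a (ival s i) (ival s e))"
      using Write(2) by (auto simp: bounded_def intro: trans_le_add1)
    then show ?case using exec.Write[of w a i e s] v by (simp add: seta_def)
  next
    case (Seq P s t s' Q t' s'')
    have 1: "exec w P s t s'" "bounded (B + g * t) s'"
      using Seq.IH(1)[OF _ Seq.prems(2,3)] mono[OF Seq.prems(4), of "B + g * t" "csize P"] Seq.prems
      by (auto simp: algebra_simps)
    have "exec w Q s' t' s'' \<and> bounded (B + g * t + g * t') s''"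
      by (rule Seq.IH(2)[OF _ 1(2)])
        (use Seq.prems mono[OF Seq.prems(4), of "B + g * t + g * t'" "csize Q"] in \<open>auto simp: algebra_simps\<close>)
    then show ?case using exec.Seq[OF 1(1)] by (simp add: algebra_simps)
  next
    case (CondTrue s b P t s' Q)
    have v: "exp_val w s b = ival s b"
      by (rule exp_val_eq_ival[OF CondTrue.prems(2,3)]) (rule mono[OF CondTrue.prems(4)], use CondTrue.prems(3) in auto)
    have "exec w P s t s' \<and> bounded (B + g * t) s'"
      by (rule CondTrue.IH[OF _ CondTrue.prems(2,3)])
       (use CondTrue.prems mono[OF CondTrue.prems(4), of "B + g * t" "csize P"] in \<open>auto simp: algebra_simps\<close>)
    then show ?case using exec.CondTrue[of w s b P t s' Q] v CondTrue.hyps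
      by (auto elim!: bounded_mono simp: algebra_simps)
  next
    case (CondFalse s b Q t s' P)
    have v: "exp_val w s b = ival s b"
      by (rule exp_val_eq_ival[OF CondFalse.prems(2,3)]) (rule mono[OF CondFalse.prems(4)], use CondFalse.prems(3) in auto)
    have "exec w Q s t s' \<and> bounded (B + g * t) s'"
      by (rule CondFalse.IH[OF _ CondFalse.prems(2,3)])
       (use CondFalse.prems mono[OF CondFalse.prems(4), of "B + g * t" "csize Q"] in \<open>auto simp: algebra_simps\<close>)
    then show ?case using exec.CondFalse[of w s b Q t s' P] v CondFalse.hyps
      by (auto elim!: bounded_mono simp: algebra_simps)
  next
    case (WhileFalse s b P)
    have v: "exp_val w s b = ival s b"
      by (rule exp_val_eq_ival[OF WhileFalse.prems(2,3)]) (rule mono[OF WhileFalse.prems(4)], use WhileFalse.prems(3) in auto)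
    then show ?case using exec.WhileFalse[of w s b P] WhileFalse
      by (auto elim!: bounded_mono simp: algebra_simps)
  next
    case (WhileTrue s b P t s' t' s'')
    have v: "exp_val w s b = ival s b"
      by (rule exp_val_eq_ival[OF WhileTrue.prems(2,3)]) (rule mono[OF WhileTrue.prems(4)], use WhileTrue.prems(3) in auto)
    have 1: "exec w P s t s'" "bounded (B + g * t) s'"
      using WhileTrue.IH(1)[OF _ WhileTrue.prems(2,3)]
        mono[OF WhileTrue.prems(4), of "B + g * t" "csize P"] WhileTrue.prems
      by (auto simp: algebra_simps)
    have "exec w (While b P) s' t' s'' \<and> bounded (B + g * t + g * t') s''"
      by (rule WhileTrue.IH(2)[OF _ 1(2)])
        (use WhileTrue.prems mono[OF WhileTrue.prems(4), of "B + g * t + g * t'" "csize (While b P)"] in \<open>auto simp: algebra_simps\<close>)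
    then show ?case using exec.WhileTrue[of w s b P t s' t' s''] v WhileTrue.hyps 1(1)
      by (auto elim!: bounded_mono simp: algebra_simps)
  }
qed

abbreviation "vv \<equiv> exp.Var"
abbreviation "ll \<equiv> Lit"
abbreviation (input) add_exp (infixl "[+]" 65) where "e1 [+] e2 \<equiv> Op Add e1 e2"
abbreviation (input) sub_exp (infixl "[-]" 65) where "e1 [-] e2 \<equiv> Op Sub e1 e2"
abbreviation (input) mul_exp (infixl "[*]" 70) where "e1 [*] e2 \<equiv> Op Mul e1 e2"
abbreviation (input) less_exp (infix "[<]" 50) where "e1 [<] e2 \<equiv> Op Less e1 e2"
abbreviation (input) eq_exp (infix "[=]" 50) where "e1 [=] e2 \<equiv> Op Eq e1 e2"
abbreviation (input) asg (infix "::=" 61) where "x ::= e \<equiv> Assign x e"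
abbreviation (input) sq (infixr ";;" 60) where "P ;; Q \<equiv> Seq P Q"

section \<open>Linked adjacency lists\<close>

text \<open>The link to edge number \<open>e\<close> is stored as \<open>Suc e\<close>, since 0 ends a list.\<close>

primrec prv :: "(nat \<Rightarrow> nat) \<Rightarrow> nat \<Rightarrow> nat \<Rightarrow> nat" where
  "prv A u 0 = 0"
| "prv A u (Suc k) = (if A k = u then Suc k else prv A u k)"

lemma prv_le: "prv A u k \<le> k"
  by (induction k) (auto intro: le_SucI)

lemma prv_edge: "e < k \<Longrightarrow> A e = u \<Longrightarrow> Suc e \<le> prv A u k"
  by (induction k) (auto simp: less_Suc_eq)

lemma prv_Suc: "prv A u k = Suc e \<Longrightarrow> e < k \<and> A e = u"
  by (induction k) (auto split: if_splits)

lemma prv_eq_0: "(\<And>e. e < k \<Longrightarrow> A e \<noteq> u) \<Longrightarrow> prv A u k = 0"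
  by (induction k) auto

definition edges :: "(nat \<Rightarrow> nat) \<Rightarrow> (nat \<Rightarrow> nat) \<Rightarrow> nat \<Rightarrow> (nat \<times> nat) set" where
  "edges A B m = (\<lambda>e. (A e, B e)) ` {..<m}"

definition adj :: "store \<Rightarrow> (nat \<Rightarrow> nat) \<Rightarrow> nat \<Rightarrow> bool" where
  "adj s A m \<longleftrightarrow> (\<forall>e<m. arr s ''nx'' (Suc e) = prv A (A e) e)"

definition BUILD :: com where
  "BUILD = For ''e'' (vv ''M'')
     (Write ''nx'' (vv ''e'' [+] ll 1) (Read ''hd'' (Read ''A'' (vv ''e''))) ;;
      Write ''hd'' (Read ''A'' (vv ''e'')) (vv ''e'' [+] ll 1))"

lemma W_BUILD:
  assumes "\<And>u. arr s ''hd'' u = 0"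
    and "\<And>t s'. eqx {''e''} {''nx'', ''hd''} s s' \<Longrightarrow> adj s' (arr s ''A'') (var s ''M'') \<Longrightarrow>
      (\<And>u. arr s' ''hd'' u = prv (arr s ''A'') u (var s ''M'')) \<Longrightarrow> t \<le> 40 * var s ''M'' + 40 \<Longrightarrow> Q t s'"
  shows "W BUILD s Q"
  unfolding BUILD_def
proof (rule W_For[where N = "var s ''M''" and T = "30" and
    I = "\<lambda>k s'. adj s' (arr s ''A'') k \<and> (\<forall>u. arr s' ''hd'' u = prv (arr s ''A'') u k)"], goal_cases)
  case (4 k s')
  have "arr s' ''A'' = arr s ''A''" using 4(1) by (simp add: eqx_def)
  then show ?case using 4 by (auto simp: adj_def less_Suc_eq)
next
  case (5 t s')
  show ?case by (rule assms(2)) (use 5 in \<open>auto simp: insert_commute\<close>)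
qed (use assms(1) in \<open>auto simp: eqx_def adj_def\<close>)

section \<open>Depth-first search\<close>

text \<open>For reachable \<open>y\<close>, either \<open>y\<close> is listed before \<open>x = ord ! i\<close>, or the component of \<open>x\<close> is completed
  only later. On a full list this is what Kosaraju's algorithm needs of the finishing times.\<close>

definition finish_order :: "(nat \<times> nat) set \<Rightarrow> nat list \<Rightarrow> bool" where
  "finish_order E ord \<longleftrightarrow> (\<forall>i<length ord. \<forall>y. (ord ! i, y) \<in> E\<^sup>* \<longrightarrow> y \<in> set (take (Suc i) ord) \<or>
     (\<exists>z. z \<notin> set (take (Suc i) ord) \<and> (ord ! i, z) \<in> E\<^sup>* \<and> (z, ord ! i) \<in> E\<^sup>*))"

lemma finish_order_append:
  assumes "finish_order E ord"
    and "\<And>y. (x, y) \<in> E\<^sup>* \<Longrightarrow> y \<in> insert x (set ord) \<or>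
      (\<exists>z. z \<notin> insert x (set ord) \<and> (x, z) \<in> E\<^sup>* \<and> (z, x) \<in> E\<^sup>*)"
  shows "finish_order E (ord @ [x])"
  unfolding finish_order_def
proof (intro allI impI)
  fix i y assume i: "i < length (ord @ [x])" "((ord @ [x]) ! i, y) \<in> E\<^sup>*"
  show "y \<in> set (take (Suc i) (ord @ [x])) \<or> (\<exists>z. z \<notin> set (take (Suc i) (ord @ [x])) \<and>
    ((ord @ [x]) ! i, z) \<in> E\<^sup>* \<and> (z, (ord @ [x]) ! i) \<in> E\<^sup>*)"
  proof (cases "i < length ord")
    case True
    then show ?thesis using assms(1) i(2) by (simp add: finish_order_def nth_append)
  next
    case False
    then have "i = length ord" using i(1) by simp
    then show ?thesis using assms(2)[of y] i(2) by simp
  qed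
qed

text \<open>\<open>mko\<close> are the marks before the current tree, whose root is \<open>r\<close>
  and whose number is \<open>k\<close>; \<open>g\<close> is the stack and \<open>ord\<close> the
  list of finished vertices. \<open>hp u\<close> points into the adjacency list of \<open>u\<close>.
  Lists run from large to small edge numbers, so the edges \<open>e\<close> from \<open>u\<close>
  with \<open>Suc e \<le> hp u\<close> are still pending. A vertex stays on the stack while its list
  is scanned, therefore \<open>g\<close> is a path.\<close>

definition dfs_inv :: "(nat \<Rightarrow> nat) \<Rightarrow> (nat \<Rightarrow> nat) \<Rightarrow> nat \<Rightarrow> (nat \<Rightarrow> nat) \<Rightarrow> nat \<Rightarrow> nat \<Rightarrow>
    (nat \<Rightarrow> nat) \<Rightarrow> (nat \<Rightarrow> nat) \<Rightarrow> nat list \<Rightarrow> nat list \<Rightarrow> bool" where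
  "dfs_inv A B m mko r k hp mk g ord \<longleftrightarrow>
     (\<forall>u. \<exists>p\<le>m. hp u = prv A u p) \<and>
     (\<forall>u. mk u = 0 \<longrightarrow> hp u = prv A u m) \<and>
     (\<forall>u\<in>set ord. hp u = 0) \<and> (\<forall>u\<in>set g. mko u = 0) \<and>
     (\<forall>e<m. mk (B e) = 0 \<longrightarrow> Suc e \<le> hp (A e)) \<and>
     distinct (g @ ord) \<and> {u. mk u \<noteq> 0} = set g \<union> set ord \<and>
     (\<forall>i. Suc i < length g \<longrightarrow> (g ! i, g ! Suc i) \<in> edges A B m) \<and>
     finish_order (edges A B m) ord \<and>
     (\<forall>u. mko u \<noteq> 0 \<longrightarrow> mk u = mko u) \<and>
     (\<forall>u. mko u = 0 \<longrightarrow> mk u \<noteq> 0 \<longrightarrow> mk u = k \<and> (r, u) \<in> (edges A B m)\<^sup>*)"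

lemma path_list_reach:
  assumes "\<forall>i. Suc i < length g \<longrightarrow> (g ! i, g ! Suc i) \<in> E" "i \<le> j" "j < length g"
  shows "(g ! i, g ! j) \<in> E\<^sup>*"
  using assms(2,3)
proof (induction j rule: dec_induct)
  case (step j)
  then show ?case using assms(1) by (meson Suc_lessD rtrancl.rtrancl_into_rtrancl)
qed simp

lemma rtrancl_leave:
  assumes "(x, y) \<in> E\<^sup>*" "x \<in> S" "y \<notin> S"
  obtains u v where "(x, u) \<in> E\<^sup>*" "u \<in> S" "(u, v) \<in> E" "v \<notin> S"
  using assms by (induction rule: rtrancl_induct) blast+

text \<open>A path from \<open>u\<close> that leaves the finished vertices does so at a vertex whose
  list is exhausted, so it enters a marked, unfinished vertex. This vertex is on the stack and
  therefore reaches \<open>u\<close>: it belongs to the component of \<open>u\<close>, which is thus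
  incomplete.\<close>

lemma dfs_pop:
  assumes inv: "dfs_inv A B m mko r k hp mk (g @ [u]) ord" and "hp u = 0"
  shows "dfs_inv A B m mko r k hp mk g (ord @ [u])"
proof -
  let ?E = "edges A B m"
  have E: "mk y \<noteq> 0" if "(x, y) \<in> ?E" "hp x = 0" for x y
    using inv that by (fastforce simp: dfs_inv_def edges_def)
  have gE: "\<forall>i. Suc i < length (g @ [u]) \<longrightarrow> ((g @ [u]) ! i, (g @ [u]) ! Suc i) \<in> ?E"
    and gmk: "{u. mk u \<noteq> 0} = set (g @ [u]) \<union> set ord"
    and bl: "\<forall>u\<in>set ord. hp u = 0"
    using inv unfolding dfs_inv_def by blast+
  have "finish_order ?E (ord @ [u])"
  proof (rule finish_order_append)
    show "finish_order ?E ord" using inv unfolding dfs_inv_def by blast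
    fix y assume y: "(u, y) \<in> ?E\<^sup>*"
    show "y \<in> insert u (set ord) \<or> (\<exists>z. z \<notin> insert u (set ord) \<and> (u, z) \<in> ?E\<^sup>* \<and> (z, u) \<in> ?E\<^sup>*)"
    proof (cases "y \<in> insert u (set ord)")
      case False
      then obtain p z where pz: "(u, p) \<in> ?E\<^sup>*" "p \<in> insert u (set ord)" "(p, z) \<in> ?E" "z \<notin> insert u (set ord)"
        using rtrancl_leave[OF y, of "insert u (set ord)"] by blast
      have "mk z \<noteq> 0" using E[OF pz(3)] pz(2) bl \<open>hp u = 0\<close> by auto
      then have "z \<in> set (g @ [u])" using gmk pz(4) by auto
      then obtain i where i: "i < length (g @ [u])" "(g @ [u]) ! i = z" by (metis in_set_conv_nth)
      have "((g @ [u]) ! i, (g @ [u]) ! length g) \<in> ?E\<^sup>*"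
        by (rule path_list_reach[OF gE]) (use i in auto)
      then have "(z, u) \<in> ?E\<^sup>*" using i by simp
      then show ?thesis using pz by (meson rtrancl.rtrancl_into_rtrancl)
    qed simp
  qed
  moreover have "\<forall>i. Suc i < length g \<longrightarrow> (g ! i, g ! Suc i) \<in> ?E"
  proof (intro allI impI)
    fix i assume "Suc i < length g"
    then show "(g ! i, g ! Suc i) \<in> ?E" using gE[rule_format, of i] by (simp add: nth_append)
  qed
  ultimately show ?thesis
    using inv \<open>hp u = 0\<close> unfolding dfs_inv_def by auto
qed

text \<open>Moving the pointer of \<open>u\<close> past \<open>e\<close> gives up no other pending
  edge, because all pending edges of \<open>u\<close> have numbers up to \<open>e\<close>.\<close>

lemma dfs_step:
  assumes inv: "dfs_inv A B m mko r k hp mk (g @ [u]) ord" and hp: "hp u = Suc e" and k: "k \<noteq> 0"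
  shows "e < m" "A e = u"
    and "mk (B e) \<noteq> 0 \<Longrightarrow> dfs_inv A B m mko r k (hp(u := prv A u e)) mk (g @ [u]) ord"
    and "mk (B e) = 0 \<Longrightarrow> dfs_inv A B m mko r k (hp(u := prv A u e)) (mk(B e := k)) (g @ [u, B e]) ord"
proof -
  let ?E = "edges A B m"
  obtain p where p: "p \<le> m" "hp u = prv A u p" using inv unfolding dfs_inv_def by blast
  have e: "e < p" "A e = u" using prv_Suc[of A u p e] p hp by auto
  show em: "e < m" "A e = u" using e p by auto
  have mku: "mk u \<noteq> 0" "u \<notin> set ord" using inv unfolding dfs_inv_def by auto
  have hd1: "\<forall>x. \<exists>p\<le>m. (hp(u := prv A u e)) x = prv A x p"
    using inv em(1) unfolding dfs_inv_def by (auto intro: less_imp_le)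
  have hd4: "Suc e' \<le> (hp(u := prv A u e)) (A e')" if "e' < m" "mk (B e') = 0" "e' \<noteq> e" for e'
  proof (cases "A e' = u")
    case True
    have "Suc e' \<le> Suc e" using inv that hp True unfolding dfs_inv_def by metis
    then show ?thesis using prv_edge[of e' e A u] that True by simp
  next
    case False
    then show ?thesis using inv that unfolding dfs_inv_def by simp
  qed
  have ue: "(u, B e) \<in> ?E" using em unfolding edges_def by force
  {
    assume mke: "mk (B e) \<noteq> 0"
    then have "\<forall>e'<m. mk (B e') = 0 \<longrightarrow> Suc e' \<le> (hp(u := prv A u e)) (A e')"
      using hd4 by metis
    then show "dfs_inv A B m mko r k (hp(u := prv A u e)) mk (g @ [u]) ord"
      using inv hd1 mku unfolding dfs_inv_def by auto
  next
    assume mke: "mk (B e) = 0"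
    let ?mk = "mk(B e := k)"
    have "\<forall>e'<m. ?mk (B e') = 0 \<longrightarrow> Suc e' \<le> (hp(u := prv A u e)) (A e')"
      using hd4 k by (metis fun_upd_apply)
    moreover have "\<forall>i. Suc i < length (g @ [u, B e]) \<longrightarrow> ((g @ [u, B e]) ! i, (g @ [u, B e]) ! Suc i) \<in> ?E"
    proof (intro allI impI)
      fix i assume i: "Suc i < length (g @ [u, B e])"
      show "((g @ [u, B e]) ! i, (g @ [u, B e]) ! Suc i) \<in> ?E"
      proof (cases "Suc i < length (g @ [u])")
        case True
        then have "((g @ [u]) ! i, (g @ [u]) ! Suc i) \<in> ?E" using inv unfolding dfs_inv_def by blast
        with True show ?thesis by (auto simp: nth_append less_Suc_eq split: if_splits)
      next
        case False
        then have "i = length g" using i by simp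
        then show ?thesis using ue by (simp add: nth_append)
      qed
    qed
    moreover have "(r, B e) \<in> ?E\<^sup>*" if "mko (B e) = 0"
    proof -
      have "mko u = 0" using inv unfolding dfs_inv_def by simp
      then have "(r, u) \<in> ?E\<^sup>*" using inv mku unfolding dfs_inv_def by blast
      then show ?thesis using ue by (meson rtrancl.rtrancl_into_rtrancl)
    qed
    moreover have "mko (B e) = 0" using inv mke unfolding dfs_inv_def by metis
    moreover have "{x. ?mk x \<noteq> 0} = set (g @ [u, B e]) \<union> set ord"
    proof -
      have "{x. mk x \<noteq> 0} = set (g @ [u]) \<union> set ord" using inv unfolding dfs_inv_def by blast
      then show ?thesis using k by auto
    qed
    moreover have "u \<noteq> B e" using mku(1) mke by metis
    moreover have "B e \<notin> set (g @ [u]) \<union> set ord"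
    proof -
      have "set (g @ [u]) \<union> set ord = {x. mk x \<noteq> 0}" using inv unfolding dfs_inv_def by blast
      then show ?thesis using mke by simp
    qed
    moreover have "\<forall>x. ?mk x = 0 \<longrightarrow> (hp(u := prv A u e)) x = prv A x m"
      using inv mku(1) k unfolding dfs_inv_def by simp
    moreover have "\<forall>x\<in>set ord. (hp(u := prv A u e)) x = 0"
      using inv mku(2) unfolding dfs_inv_def by auto
    moreover have "\<forall>x\<in>set (g @ [u, B e]). mko x = 0" "distinct (g @ [u, B e] @ ord)"
      using inv calculation unfolding dfs_inv_def by auto
    moreover have "finish_order ?E ord" "\<forall>x. mko x \<noteq> 0 \<longrightarrow> mk x = mko x"
      "\<forall>x. mko x = 0 \<longrightarrow> mk x \<noteq> 0 \<longrightarrow> mk x = k \<and> (r, x) \<in> ?E\<^sup>*"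
      using inv unfolding dfs_inv_def by blast+
    ultimately show "dfs_inv A B m mko r k (hp(u := prv A u e)) ?mk (g @ [u, B e]) ord"
      using hd1 unfolding dfs_inv_def by simp
  }
qed

text \<open>Marks are tree numbers and \<open>rep\<close> gives the roots. The marked set is closed
  under reachability after every tree, so edges between trees lead to smaller numbers. By the last
  clause, the root of a tree is its first member in the order of \<open>rt\<close>; this is what
  identifies the roots in the second pass of Kosaraju's algorithm.\<close>

definition forest_inv :: "(nat \<times> nat) set \<Rightarrow> (nat \<Rightarrow> nat) \<Rightarrow> nat \<Rightarrow> (nat \<Rightarrow> nat) \<Rightarrow> (nat \<Rightarrow> nat) \<Rightarrow>
    nat \<Rightarrow> (nat \<Rightarrow> nat) \<Rightarrow> (nat \<Rightarrow> nat) \<Rightarrow> nat \<Rightarrow> nat list \<Rightarrow> bool" where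
  "forest_inv E rt i hp A m mk rep k ord \<longleftrightarrow>
     distinct ord \<and> set ord = {u. mk u \<noteq> 0} \<and> finish_order E ord \<and>
     (\<forall>u. hp u = (if mk u = 0 then prv A u m else 0)) \<and>
     (\<forall>j<i. mk (rt j) \<noteq> 0) \<and>
     (\<forall>u. mk u \<noteq> 0 \<longrightarrow> (\<exists>j<i. (rt j, u) \<in> E\<^sup>*)) \<and>
     (\<forall>u. mk u \<le> k) \<and>
     (\<forall>q. 1 \<le> q \<and> q \<le> k \<longrightarrow> mk (rep q) = q \<and> (\<exists>j<i. rt j = rep q)) \<and>
     (\<forall>u. mk u \<noteq> 0 \<longrightarrow> (rep (mk u), u) \<in> E\<^sup>*) \<and>
     (\<forall>u v. (u, v) \<in> E\<^sup>* \<longrightarrow> mk u \<noteq> 0 \<longrightarrow> mk v \<noteq> 0 \<and> mk v \<le> mk u) \<and>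
     (\<forall>j<i. \<exists>j'\<le>j. rt j' = rep (mk (rt j)))"

lemma forest_skip:
  assumes inv: "forest_inv E rt i hp A m mk rep k ord" and "mk (rt i) \<noteq> 0"
  shows "forest_inv E rt (Suc i) hp A m mk rep k ord"
proof -
  have "1 \<le> mk (rt i)" using assms(2) by linarith
  moreover have "mk (rt i) \<le> k" using inv unfolding forest_inv_def by blast
  ultimately have "\<exists>j<i. rt j = rep (mk (rt i))" using inv unfolding forest_inv_def by blast
  then have "\<exists>j'\<le>i. rt j' = rep (mk (rt i))" by (meson less_imp_le)
  then show ?thesis
    using assms unfolding forest_inv_def by (auto simp: less_Suc_eq; meson less_Suc_eq)
qed

lemma dfs_start:
  assumes inv: "forest_inv (edges A B m) rt i hp A m mk rep k ord" and "mk (rt i) = 0"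
  shows "dfs_inv A B m mk (rt i) (Suc k) hp (mk(rt i := Suc k)) [rt i] ord"
proof -
  let ?E = "edges A B m" and ?r = "rt i"
  have hp: "hp u = (if mk u = 0 then prv A u m else 0)" for u
    using inv unfolding forest_inv_def by blast
  have 4: "Suc e \<le> hp (A e)" if "e < m" "mk (B e) = 0" for e
  proof -
    have "(A e, B e) \<in> ?E\<^sup>*" using that(1) by (auto simp: edges_def)
    then have "mk (A e) = 0" using inv that(2) unfolding forest_inv_def by blast
    then show ?thesis using hp prv_edge[of e m A "A e"] that(1) by simp
  qed
  have "\<exists>p\<le>m. hp u = prv A u p" for u
    using hp[of u] by (cases "mk u = 0") (auto intro: exI[of _ 0])
  moreover have "\<forall>u\<in>set ord. hp u = 0" "set ord = {u. mk u \<noteq> 0}" "distinct ord" "finish_order ?E ord"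
    using inv hp unfolding forest_inv_def by auto
  moreover have "\<forall>e<m. (mk(rt i := Suc k)) (B e) = 0 \<longrightarrow> Suc e \<le> hp (A e)" using 4 by simp
  moreover have "\<forall>u. (mk(rt i := Suc k)) u = 0 \<longrightarrow> hp u = prv A u m" using hp by simp
  ultimately show ?thesis
    using assms(2) unfolding dfs_inv_def by auto
qed

text \<open>When the stack is empty, every marked vertex is finished and has no pending edge, so the
  marked set is closed. New vertices carry the largest number \<open>Suc k\<close>, which keeps the
  numbers monotone along paths.\<close>

lemma dfs_end:
  assumes inv: "forest_inv (edges A B m) rt i hp A m mk rep k ord" and mko: "mk (rt i) = 0"
    and D: "dfs_inv A B m mk (rt i) (Suc k) hp' mk' [] ord'" and r: "mk' (rt i) \<noteq> 0"
  shows "forest_inv (edges A B m) rt (Suc i) hp' A m mk' (rep(Suc k := rt i)) (Suc k) ord'"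
proof -
  let ?E = "edges A B m" and ?rep = "rep(Suc k := rt i)"
  have old: "mk u \<noteq> 0 \<Longrightarrow> mk' u = mk u" and new: "mk u = 0 \<Longrightarrow> mk' u \<noteq> 0 \<Longrightarrow> mk' u = Suc k \<and> (rt i, u) \<in> ?E\<^sup>*" for u
    using D unfolding dfs_inv_def by blast+
  have le: "mk u \<le> k" for u using inv unfolding forest_inv_def by blast
  have ord': "set ord' = {u. mk' u \<noteq> 0}" using D unfolding dfs_inv_def by auto
  have hp': "mk' u \<noteq> 0 \<Longrightarrow> hp' u = 0" for u using D ord' unfolding dfs_inv_def by blast
  have step: "mk' v \<noteq> 0" if uv: "(u, v) \<in> ?E" "mk' u \<noteq> 0" for u v
  proof -
    obtain e where "e < m" "u = A e" "v = B e" using uv(1) by (auto simp: edges_def)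
    then show ?thesis using D hp'[OF uv(2)] unfolding dfs_inv_def by fastforce
  qed
  have closed: "mk' v \<noteq> 0" if "(u, v) \<in> ?E\<^sup>*" "mk' u \<noteq> 0" for u v
    using that by (induction rule: rtrancl_induct) (auto dest: step)
  have mono: "mk' v \<le> mk' u" if uv: "(u, v) \<in> ?E\<^sup>*" "mk' u \<noteq> 0" for u v
  proof (cases "mk u = 0")
    case True
    then have "mk' u = Suc k" using new uv by blast
    then show ?thesis using old[of v] new[of v] le[of v] by (cases "mk v = 0"; cases "mk' v = 0") auto
  next
    case False
    then have "mk v \<noteq> 0 \<and> mk v \<le> mk u" using inv uv(1) unfolding forest_inv_def by blast
    then show ?thesis using old False by simp
  qed
  have rti: "mk' (rt i) = Suc k" using new mko r by blast
  have 1: "\<forall>u. hp' u = (if mk' u = 0 then prv A u m else 0)"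
    using hp' D unfolding dfs_inv_def by auto
  have 2: "\<forall>j<Suc i. mk' (rt j) \<noteq> 0"
    using r old inv unfolding forest_inv_def by (auto simp: less_Suc_eq)
  have 3: "\<exists>j<Suc i. (rt j, u) \<in> ?E\<^sup>*" if "mk' u \<noteq> 0" for u
  proof (cases "mk u = 0")
    case True
    then show ?thesis using new that by blast
  next
    case False
    then show ?thesis using inv unfolding forest_inv_def by (meson less_SucI)
  qed
  have 4: "mk' u \<le> Suc k" for u
    using new[of u] old[of u] le[of u] by (cases "mk u = 0"; cases "mk' u = 0") auto
  have 5: "mk' (?rep q) = q \<and> (\<exists>j<Suc i. rt j = ?rep q)" if "1 \<le> q" "q \<le> Suc k" for q
  proof (cases "q = Suc k")
    case True
    then show ?thesis using rti by auto
  next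
    case False
    then have "mk (rep q) = q \<and> (\<exists>j<i. rt j = rep q)" using inv that unfolding forest_inv_def by simp
    then show ?thesis using old[of "rep q"] that False by (auto intro: less_SucI)
  qed
  have 6: "(?rep (mk' u), u) \<in> ?E\<^sup>*" if "mk' u \<noteq> 0" for u
  proof (cases "mk u = 0")
    case True
    then show ?thesis using new that by auto
  next
    case False
    then have "(rep (mk u), u) \<in> ?E\<^sup>*" using inv unfolding forest_inv_def by blast
    then show ?thesis using old[OF False] le[of u] by simp
  qed
  have 7: "\<exists>j'\<le>j. rt j' = ?rep (mk' (rt j))" if "j < Suc i" for j
  proof (cases "j = i")
    case True
    then show ?thesis using rti by auto
  next
    case False
    then have j: "j < i" using that by simp
    then have "mk (rt j) \<noteq> 0" "\<exists>j'\<le>j. rt j' = rep (mk (rt j))" using inv unfolding forest_inv_def by blast+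
    then show ?thesis using old[of "rt j"] le[of "rt j"] by simp
  qed
  show ?thesis
    unfolding forest_inv_def
    using ord' D 1 2 3 4 5 6 7 closed mono unfolding dfs_inv_def by auto
qed

definition DFS :: com where
  "DFS = While (ll 0 [<] vv ''sp'')
    (''u'' ::= Read ''stk'' (vv ''sp'' [-] ll 1) ;;
     ''e'' ::= Read ''hd'' (vv ''u'') ;;
     Cond (vv ''e'' [=] ll 0)
       (Write ''ord'' (vv ''c'') (vv ''u'') ;;
        ''c'' ::= vv ''c'' [+] ll 1 ;;
        ''sp'' ::= vv ''sp'' [-] ll 1)
       (Write ''hd'' (vv ''u'') (Read ''nx'' (vv ''e'')) ;;
        ''v'' ::= Read ''B'' (vv ''e'' [-] ll 1) ;;
        Cond (Read ''mk'' (vv ''v'') [=] ll 0)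
          (Write ''mk'' (vv ''v'') (vv ''k'') ;;
           Write ''stk'' (vv ''sp'') (vv ''v'') ;;
           ''sp'' ::= vv ''sp'' [+] ll 1)
          Skip))"

abbreviation alist :: "store \<Rightarrow> string \<Rightarrow> nat \<Rightarrow> nat list" where
  "alist s a l \<equiv> map (arr s a) [0..<l]"

text \<open>The edges still ahead of the list pointers. Their number is the potential that pays for
  searches and for sorting, over all roots or buckets together.\<close>

definition unproc :: "(nat \<Rightarrow> nat) \<Rightarrow> nat \<Rightarrow> (nat \<Rightarrow> nat) \<Rightarrow> nat set" where
  "unproc A m hp = {e. e < m \<and> Suc e \<le> hp (A e)}"

lemma finite_unproc [simp]: "finite (unproc A m hp)"
  by (simp add: unproc_def)

lemma unproc_step:
  assumes "hp u = Suc e" "hp u = prv A u q" "q \<le> m"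
  shows "e < m" "A e = u" "unproc A m (hp(u := prv A u e)) = unproc A m hp - {e}" "e \<in> unproc A m hp"
proof -
  show 1: "e < m" "A e = u" using prv_Suc[of A u q e] assms by auto
  show "e \<in> unproc A m hp" using 1 assms(1) by (simp add: unproc_def)
  show "unproc A m (hp(u := prv A u e)) = unproc A m hp - {e}"
  proof (intro set_eqI iffI)
    fix e' assume "e' \<in> unproc A m (hp(u := prv A u e))"
    then show "e' \<in> unproc A m hp - {e}"
      using 1 assms(1) prv_le[of A u e] by (auto simp: unproc_def split: if_splits)
  next
    fix e' assume e': "e' \<in> unproc A m hp - {e}"
    show "e' \<in> unproc A m (hp(u := prv A u e))"
    proof (cases "A e' = u")
      case True
      then have "e' < e" using e' assms(1) by (auto simp: unproc_def)
      then show ?thesis using True e' prv_edge[of e' e A u] by (simp add: unproc_def)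
    qed (use e' in \<open>simp add: unproc_def\<close>)
  qed
qed

lemma card_unproc_step:
  assumes "hp (A e) = Suc e" "e < m"
  shows "Suc (card (unproc A m (hp(A e := prv A (A e) e)))) \<le> card (unproc A m hp)"
proof -
  let ?T = "unproc A m (hp(A e := prv A (A e) e))"
  have "?T \<subseteq> unproc A m hp" using prv_le[of A "A e" e] assms(1) by (auto simp: unproc_def split: if_splits)
  moreover have "e \<in> unproc A m hp - ?T" using prv_le[of A "A e" e] assms by (auto simp: unproc_def)
  ultimately have "?T \<subset> unproc A m hp" by blast
  then show ?thesis by (simp add: psubset_card_mono Suc_le_eq)
qed

lemma card_unproc_le: "card (unproc A m hp) \<le> m"
proof -
  have "card (unproc A m hp) \<le> card {..<m}" by (rule card_mono) (auto simp: unproc_def)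
  then show ?thesis by simp
qed

text \<open>An edge brings in 100 units when it is scanned; if it pushes a vertex, 50 of them are
  set aside for the removal of that vertex. So the whole search is charged to edges and to the
  initial stack.\<close>

lemma W_DFS:
  assumes A: "adj s (arr s ''A'') m" and k: "var s ''k'' \<noteq> 0"
    and inv: "dfs_inv (arr s ''A'') (arr s ''B'') m mko r (var s ''k'') (arr s ''hd'') (arr s ''mk'')
      (alist s ''stk'' (var s ''sp'')) (alist s ''ord'' (var s ''c''))"
    and Q: "\<And>t s'. eqx {''u'', ''e'', ''c'', ''sp'', ''v''} {''ord'', ''hd'', ''mk'', ''stk''} s s' \<Longrightarrow>
      dfs_inv (arr s ''A'') (arr s ''B'') m mko r (var s ''k'') (arr s' ''hd'') (arr s' ''mk'')
        [] (alist s' ''ord'' (var s' ''c'')) \<Longrightarrow>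
      (\<And>u. arr s ''mk'' u \<noteq> 0 \<Longrightarrow> arr s' ''mk'' u \<noteq> 0) \<Longrightarrow>
      t + 100 * card (unproc (arr s ''A'') m (arr s' ''hd'')) \<le>
        100 * card (unproc (arr s ''A'') m (arr s ''hd'')) + 50 * var s ''sp'' + 4 \<Longrightarrow> Q t s'"
  shows "W DFS s Q"
  unfolding DFS_def
proof (rule W_While[where
    I = "\<lambda>s'. dfs_inv (arr s ''A'') (arr s ''B'') m mko r (var s ''k'') (arr s' ''hd'') (arr s' ''mk'')
      (alist s' ''stk'' (var s' ''sp'')) (alist s' ''ord'' (var s' ''c'')) \<and>
      (\<forall>u. arr s ''mk'' u \<noteq> 0 \<longrightarrow> arr s' ''mk'' u \<noteq> 0)" and
    \<mu> = "\<lambda>s'. 100 * card (unproc (arr s ''A'') m (arr s' ''hd'')) + 50 * var s' ''sp''"], goal_cases)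
  case 1
  show ?case using inv by simp
next
  case (2 s')
  let ?A = "arr s ''A''" and ?B = "arr s ''B''"
  have fr: "arr s' ''A'' = ?A" "arr s' ''B'' = ?B" "arr s' ''nx'' = arr s ''nx''" "var s' ''k'' = var s ''k''"
    using 2(1) by (simp_all add: eqx_def)
  obtain l where l: "var s' ''sp'' = Suc l" using 2(3) by (cases "var s' ''sp''") auto
  define u where "u = arr s' ''stk'' l"
  have I: "dfs_inv ?A ?B m mko r (var s ''k'') (arr s' ''hd'') (arr s' ''mk'')
     (alist s' ''stk'' l @ [u]) (alist s' ''ord'' (var s' ''c''))"
    using 2(2) by (simp add: l u_def)
  show ?case
  proof (cases "arr s' ''hd'' u")
    case 0
    show ?thesis using dfs_pop[OF I 0] 2(2) 0 by (simp add: l flip: u_def)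
  next
    case (Suc e)
    note st = dfs_step[OF I Suc k]
    have nx: "arr s ''nx'' (Suc e) = prv ?A u e" using A st(1,2) by (simp add: adj_def)
    have rem: "Suc (card (unproc ?A m ((arr s' ''hd'')(u := prv ?A u e)))) \<le> card (unproc ?A m (arr s' ''hd''))"
      using card_unproc_step[of "arr s' ''hd''" ?A e m] st(1,2) Suc by simp
    show ?thesis
    proof (cases "arr s' ''mk'' (?B e) = 0")
      case True
      show ?thesis using st(4)[OF True] 2(2) rem k by (simp add: l Suc True fr nx flip: u_def)
    next
      case False
      show ?thesis using st(3)[OF False] 2(2) rem by (simp add: l Suc False fr nx flip: u_def)
    qed
  qed
next
  case (3 t s')
  have "var s' ''sp'' = 0" using 3(3) by (simp split: if_splits)
  then show ?case
    using 3 by (intro Q) (auto simp: insert_commute)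
qed

definition FOREST :: com where
  "FOREST = For ''i'' (vv ''R'')
    (''r'' ::= Read ''rt'' (vv ''i'') ;;
     Cond (Read ''mk'' (vv ''r'') [=] ll 0)
       (''k'' ::= vv ''k'' [+] ll 1 ;;
        Write ''rep'' (vv ''k'') (vv ''r'') ;;
        Write ''mk'' (vv ''r'') (vv ''k'') ;;
        Write ''stk'' (ll 0) (vv ''r'') ;;
        ''sp'' ::= ll 1 ;;
        DFS)
       Skip)"

lemma mod_vars_DFS [simp]: "mod_vars DFS = {''u'', ''e'', ''c'', ''sp'', ''v''}"
  and mod_arrs_DFS [simp]: "mod_arrs DFS = {''ord'', ''hd'', ''mk'', ''stk''}"
  by (auto simp: DFS_def)

lemma W_FOREST:
  fixes s :: store
  defines "A \<equiv> arr s ''A''" and "B \<equiv> arr s ''B''" and "m \<equiv> var s ''M''" and "rt \<equiv> arr s ''rt''"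
  assumes adj: "adj s A m" and hp: "\<And>u. arr s ''hd'' u = prv A u m"
    and mk: "\<And>u. arr s ''mk'' u = 0" and k: "var s ''k'' = 0" and c: "var s ''c'' = 0"
    and Q: "\<And>t s'. eqx {''i'', ''r'', ''k'', ''u'', ''e'', ''c'', ''sp'', ''v''} {''rep'', ''ord'', ''hd'', ''mk'', ''stk''} s s' \<Longrightarrow>
      forest_inv (edges A B m) rt (var s ''R'') (arr s' ''hd'') A m (arr s' ''mk'') (arr s' ''rep'')
         (var s' ''k'') (alist s' ''ord'' (var s' ''c'')) \<Longrightarrow>
      t \<le> 200 * (var s ''R'' + m) + 50 \<Longrightarrow> Q t s'"
  shows "W FOREST s Q"
  unfolding FOREST_def
proof (rule W_For_pot[where N = "var s ''R''" and T = "150" and \<Phi> = "\<lambda>s'. 100 * card (unproc A m (arr s' ''hd''))" and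
    I = "\<lambda>i s'. forest_inv (edges A B m) rt i (arr s' ''hd'') A m (arr s' ''mk'') (arr s' ''rep'')
         (var s' ''k'') (alist s' ''ord'' (var s' ''c''))"], goal_cases)
  case 2
  show ?case using hp mk k c by (simp add: forest_inv_def finish_order_def)
next
  case (4 i s')
  note finv = 4(4)
  have fr: "arr s' ''A'' = A" "arr s' ''B'' = B" "arr s' ''nx'' = arr s ''nx''" "arr s' ''rt'' = rt"
    using 4(1) by (simp_all add: eqx_def A_def B_def rt_def)
  show ?case
  proof (cases "arr s' ''mk'' (rt i) = 0")
    case False
    then show ?thesis using forest_skip[OF 4(4) False] 4(2) by (simp add: fr)
  next
    case True
    show ?thesis using True 4(2) apply (simp add: fr)
    proof (rule W_DFS[where m = m and mko = "arr s' ''mk''" and r = "rt i"], goal_cases)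
      case 1
      show ?case using adj by (simp add: adj_def fr)
    next
      case 3
      show ?case using dfs_start[OF 4(4) True] by (simp add: fr)
    next
      case (4 t s'')
      have e: "arr s'' ''rep'' = (arr s' ''rep'')(Suc (var s' ''k'') := rt i)" "var s'' ''k'' = Suc (var s' ''k'')"
        using 4(3) by (simp_all add: eqx_def)
      have "forest_inv (edges A B m) rt (Suc i) (arr s'' ''hd'') A m (arr s'' ''mk'')
          ((arr s' ''rep'')(Suc (var s' ''k'') := rt i)) (Suc (var s' ''k'')) (alist s'' ''ord'' (var s'' ''c''))"
        by (rule dfs_end[OF finv True]) (use 4(4,5) in \<open>simp_all add: fr\<close>)
      then show ?case using 4(6) by (simp add: fr e)
      qed simp
  qed
next
  case (5 t s')
  show ?case
  proof (rule Q, goal_cases)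
    case 1
    show ?case using 5(1) by (simp add: insert_commute)
  next
    case 2
    show ?case using 5(2) .
  next
    case 3
    have "t \<le> 158 * var s ''R'' + 6 + 100 * card (unproc A m (arr s ''hd''))" using 5(4) by simp
    then show ?case using card_unproc_le[of A m "arr s ''hd''"] by simp
  qed
qed (simp_all add: eqx_def)

section \<open>Strongly connected components\<close>

lemma forest_invD:
  assumes "forest_inv E rt i hp A m mk rep k ord"
  shows "distinct ord" "set ord = {u. mk u \<noteq> 0}" "mk u \<le> k" "1 \<le> q \<Longrightarrow> q \<le> k \<Longrightarrow> mk (rep q) = q"
    "j < i \<Longrightarrow> mk (rt j) \<noteq> 0" "mk u \<noteq> 0 \<Longrightarrow> \<exists>j<i. (rt j, u) \<in> E\<^sup>*"
proof -
  note I = assms[unfolded forest_inv_def]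
  show "distinct ord" using I by (elim conjE)
  show "set ord = {u. mk u \<noteq> 0}" using I by (elim conjE)
  have "\<forall>u. mk u \<le> k" using I by (elim conjE)
  then show "mk u \<le> k" ..
  have "\<forall>q. 1 \<le> q \<and> q \<le> k \<longrightarrow> mk (rep q) = q \<and> (\<exists>j<i. rt j = rep q)" using I by (elim conjE)
  then show "1 \<le> q \<Longrightarrow> q \<le> k \<Longrightarrow> mk (rep q) = q" by simp
  have "\<forall>j<i. mk (rt j) \<noteq> 0" using I by (elim conjE)
  then show "j < i \<Longrightarrow> mk (rt j) \<noteq> 0" by simp
  have "\<forall>u. mk u \<noteq> 0 \<longrightarrow> (\<exists>j<i. (rt j, u) \<in> E\<^sup>*)" using I by (elim conjE)
  then show "mk u \<noteq> 0 \<Longrightarrow> \<exists>j<i. (rt j, u) \<in> E\<^sup>*" by simp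
qed

text \<open>Kosaraju's algorithm. Let \<open>y\<close> be the vertex of the component of
  \<open>u\<close> that the first search finishes last. The root of the second tree containing
  \<open>u\<close> comes no later than \<open>y\<close> in \<open>rt\<close>, hence is finished no
  earlier than \<open>y\<close>. It is also reachable from \<open>y\<close>. If it differed from
  \<open>y\<close>, then \<open>finish_order\<close> at \<open>y\<close> would yield a vertex of the
  component that is finished after \<open>y\<close>.\<close>

lemma forest_twice:
  assumes F1: "forest_inv E rt R hp A m mk rep k ord"
    and F2: "forest_inv (E\<inverse>) rt' (length ord) hp' A' m mk' rep' k' ord'"
    and rt'_all: "\<forall>j<length ord. rt' j = ord ! (length ord - 1 - j)"
    and field: "Field E \<subseteq> set ord"
  shows "{u. mk' u \<noteq> 0} = set ord"
    and "u \<in> set ord \<Longrightarrow> (u, rep' (mk' u)) \<in> E\<^sup>* \<and> (rep' (mk' u), u) \<in> E\<^sup>*"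
    and "(u, v) \<in> E \<Longrightarrow> mk' u \<le> mk' v"
    and "k' \<le> card (set ord)"
proof -
  let ?N = "length ord"
  note rt' = rt'_all[rule_format]
  have conv: "(x, y) \<in> (E\<inverse>)\<^sup>* \<longleftrightarrow> (y, x) \<in> E\<^sup>*" for x y
    by (simp add: rtrancl_converse)
  have idx: "\<exists>j<?N. rt' j = ord ! i" if "i < ?N" for i
    using that rt'[of "?N - 1 - i"] by (intro exI[of _ "?N - 1 - i"]) auto
  have F1d: "distinct ord" "finish_order E ord" using F1 unfolding forest_inv_def by blast+
  have F1c: "v \<in> set ord" if "(u, v) \<in> E\<^sup>*" "u \<in> set ord" for u v
    using that F1 unfolding forest_inv_def by (metis (mono_tags) mem_Collect_eq)
  have F2c: "mk' v \<noteq> 0 \<and> mk' v \<le> mk' u" if "(v, u) \<in> E\<^sup>*" "mk' u \<noteq> 0" for u v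
    using that F2 unfolding forest_inv_def conv by blast
  show X: "{u. mk' u \<noteq> 0} = set ord"
  proof (intro set_eqI iffI)
    fix u assume "u \<in> {u. mk' u \<noteq> 0}"
    moreover have "\<forall>u. mk' u \<noteq> 0 \<longrightarrow> (\<exists>j<?N. (rt' j, u) \<in> (E\<inverse>)\<^sup>*)"
      using F2 unfolding forest_inv_def by (elim conjE)
    ultimately obtain j where j: "j < ?N" "(u, rt' j) \<in> E\<^sup>*"
      unfolding conv by blast
    then have r: "rt' j \<in> set ord" using rt' by simp
    show "u \<in> set ord"
      using j(2) by (cases rule: converse_rtranclE) (use r field in \<open>auto simp: Field_def\<close>)
  next
    fix u assume "u \<in> set ord"
    then obtain i where "i < ?N" "ord ! i = u" by (metis in_set_conv_nth)
    with idx obtain j where "j < ?N" "rt' j = u" by metis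
    then show "u \<in> {u. mk' u \<noteq> 0}" using F2 unfolding forest_inv_def by blast
  qed
  show "(u, rep' (mk' u)) \<in> E\<^sup>* \<and> (rep' (mk' u), u) \<in> E\<^sup>*" if u: "u \<in> set ord" for u
  proof -
    let ?r = "rep' (mk' u)"
    have mu: "mk' u \<noteq> 0" using u X by blast
    then have ur: "(u, ?r) \<in> E\<^sup>*" using F2 unfolding forest_inv_def conv by blast
    define S where "S = {i. i < ?N \<and> (u, ord ! i) \<in> E\<^sup>* \<and> (ord ! i, u) \<in> E\<^sup>*}"
    have "S \<noteq> {}" using u unfolding S_def by (metis (mono_tags, lifting) empty_iff in_set_conv_nth mem_Collect_eq rtrancl.rtrancl_refl)
    moreover have finS: "finite S" unfolding S_def by simp
    ultimately have "Max S \<in> S" by simp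
    define i where "i = Max S"
    define y where "y = ord ! i"
    have i: "i < ?N" and uy: "(u, y) \<in> E\<^sup>*" "(y, u) \<in> E\<^sup>*"
      using \<open>Max S \<in> S\<close> unfolding S_def i_def y_def by auto
    \<comment> \<open>Mutual reachability bounds each of the two tree numbers by the other.\<close>
    have my: "mk' y = mk' u"
      using F2c[OF uy(2) mu] F2c[OF uy(1)] by simp
    have j: "?N - 1 - i < ?N" "rt' (?N - 1 - i) = y"
      using i rt'[of "?N - 1 - i"] by (auto simp: y_def)
    then obtain j' where j': "j' \<le> ?N - 1 - i" "rt' j' = ?r"
      using F2 my unfolding forest_inv_def by metis
    define p where "p = ?N - 1 - j'"
    have p: "i \<le> p" "p < ?N" "ord ! p = ?r"
      using j' i rt'[of j'] by (auto simp: p_def)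
    have "?r = y"
    proof (rule ccontr)
      assume "?r \<noteq> y"
      then have ip: "i < p" using p by (metis le_neq_implies_less y_def)
      have "(ord ! i, ?r) \<in> E\<^sup>*" using uy(2) ur unfolding y_def by (rule rtrancl_trans)
      then consider "?r \<in> set (take (Suc i) ord)" |
        z where "z \<notin> set (take (Suc i) ord)" "(y, z) \<in> E\<^sup>*" "(z, y) \<in> E\<^sup>*"
        using F1d(2) i unfolding finish_order_def y_def by blast
      then show False
      proof cases
        case 1
        then obtain l where "l < Suc i" "l < ?N" "ord ! l = ord ! p" using p(3) by (auto simp: in_set_conv_nth)
        then show False using F1d(1) p(2) ip nth_eq_iff_index_eq by fastforce
      next
        case (2 z)
        have "z \<in> set ord" using F1c[OF 2(2)] i by (simp add: y_def)
        then obtain l where l: "l < ?N" "ord ! l = z" by (metis in_set_conv_nth)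
        have "\<not> l \<le> i"
        proof
          assume "l \<le> i"
          then have "ord ! l \<in> set (take (Suc i) ord)" using l(1) by (auto simp: in_set_conv_nth)
          then show False using 2(1) l(2) by simp
        qed
        moreover have "l \<in> S" unfolding S_def using l 2 uy by (auto intro: rtrancl_trans)
        ultimately show False using finS unfolding i_def using Max_ge by blast
      qed
    qed
    then show ?thesis using uy by simp
  qed
  show "mk' u \<le> mk' v" if "(u, v) \<in> E"
  proof -
    have "v \<in> set ord" using that field by (auto simp: Field_def)
    then have "mk' v \<noteq> 0" using X by blast
    then show ?thesis using F2c[of u v] that by blast
  qed
  have "inj_on rep' {1..k'}"
    by (rule inj_on_inverseI[where g = mk']) (use F2 in \<open>auto simp: forest_inv_def\<close>)
  moreover have "rep' ` {1..k'} \<subseteq> set ord"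
  proof
    fix x assume "x \<in> rep' ` {1..k'}"
    then obtain q where "q \<in> {1..k'}" "x = rep' q" by blast
    then have "mk' x = q" "q \<noteq> 0" using F2 unfolding forest_inv_def by auto
    then show "x \<in> set ord" using X by blast
  qed
  ultimately show "k' \<le> card (set ord)"
    by (metis card_atLeastAtMost card_inj_on_le diff_Suc_1 finite_set)
qed

section \<open>Emitting output edges\<close>

text \<open>The table \<open>sn\<close> prevents duplicates in the output list; it needs no initialisation pass.\<close>

definition OUT :: "nat \<Rightarrow> (nat \<times> nat) set \<Rightarrow> store \<Rightarrow> bool" where
  "OUT n S s \<longleftrightarrow> distinct (output_list s) \<and> set (output_list s) = S \<and> var s ''n'' = n \<and>
     S \<subseteq> {..<n} \<times> {..<n} \<and> (\<forall>u<n. \<forall>v<n. arr s ''sn'' (u * n + v) \<noteq> 0 \<longleftrightarrow> (u, v) \<in> S)"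

lemma OUT_cong:
  assumes "var s' ''h'' = var s ''h''" "var s' ''n'' = var s ''n''" "arr s' ''hsrc'' = arr s ''hsrc''"
    "arr s' ''hdst'' = arr s ''hdst''" "arr s' ''sn'' = arr s ''sn''"
  shows "OUT n S s' = OUT n S s"
  using assms by (simp add: OUT_def output_list_def)

lemma OUT_setv [simp]: "x \<notin> {''h'', ''n''} \<Longrightarrow> OUT n S (setv s x v) = OUT n S s"
  by (rule OUT_cong) auto

lemma OUT_seta [simp]: "a \<notin> {''hsrc'', ''hdst'', ''sn''} \<Longrightarrow> OUT n S (seta s a i v) = OUT n S s"
  by (rule OUT_cong) auto

lemma OUT_eqx:
  assumes "eqx X Y s s'" "OUT n S s" "''h'' \<notin> X" "''n'' \<notin> X" "''hsrc'' \<notin> Y" "''hdst'' \<notin> Y" "''sn'' \<notin> Y"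
  shows "OUT n S s'"
  using assms OUT_cong[of s' s] by (simp add: eqx_def)

definition EMIT :: "exp \<Rightarrow> exp \<Rightarrow> com" where
  "EMIT e1 e2 = (''eu'' ::= e1 ;; ''ev'' ::= e2 ;;
     Cond (Read ''sn'' (vv ''eu'' [*] vv ''n'' [+] vv ''ev'')) Skip
       (Write ''sn'' (vv ''eu'' [*] vv ''n'' [+] vv ''ev'') (ll 1) ;;
        Write ''hsrc'' (vv ''h'') (vv ''eu'') ;;
        Write ''hdst'' (vv ''h'') (vv ''ev'') ;;
        ''h'' ::= vv ''h'' [+] ll 1))"

lemma mod_vars_EMIT [simp]: "mod_vars (EMIT e1 e2) = {''eu'', ''ev'', ''h''}"
  and mod_arrs_EMIT [simp]: "mod_arrs (EMIT e1 e2) = {''sn'', ''hsrc'', ''hdst''}"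
  by (auto simp: EMIT_def)

lemma index_inj: "u * n + v = u' * n + v' \<longleftrightarrow> u = u' \<and> v = v'" if "v < n" "v' < n" for u v u' v' n :: nat
proof
  assume eq: "u * n + v = u' * n + v'"
  have "(u * n + v) div n = u" "(u' * n + v') div n = u'" using that by auto
  with eq show "u = u' \<and> v = v'" by simp
qed simp

lemma W_EMIT:
  assumes "OUT n S s" "ival s e1 = u" "ival (setv s ''eu'' u) e2 = v" "u < n" "v < n"
    and "\<And>t s'. OUT n (insert (u, v) S) s' \<Longrightarrow> eqx {''eu'', ''ev'', ''h''} {''sn'', ''hsrc'', ''hdst''} s s' \<Longrightarrow>
      t \<le> exp_cost e1 + exp_cost e2 + 40 \<Longrightarrow> Q t s'"
  shows "W (EMIT e1 e2) s Q"
proof -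
  have n: "var s ''n'' = n" using assms(1) by (simp add: OUT_def)
  have sn: "arr s ''sn'' (u * n + v) \<noteq> 0 \<longleftrightarrow> (u, v) \<in> S"
    using assms(1,4,5) by (simp add: OUT_def)
  show ?thesis
  proof (cases "(u, v) \<in> S")
    case True
    then have 0: "0 < arr s ''sn'' (u * n + v)" using sn by simp
    show ?thesis
      unfolding EMIT_def using assms(2,3) n 0
      by (simp, intro assms(6)) (use assms(1) True in \<open>auto simp: eqx_def insert_absorb\<close>)
  next
    case False
    then have "arr s ''sn'' (u * n + v) = 0" using sn by simp
    moreover define s' where "s' = setv (seta (seta (seta (setv (setv s ''eu'' u) ''ev'' v) ''sn'' (u * n + v) 1)
      ''hsrc'' (var s ''h'') u) ''hdst'' (var s ''h'') v) ''h'' (Suc (var s ''h''))"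
    moreover have ol: "output_list s' = output_list s @ [(u, v)]"
      by (simp add: output_list_def s'_def)
    moreover have "arr s' ''sn'' (x * n + y) \<noteq> 0 \<longleftrightarrow> (x, y) \<in> insert (u, v) S" if "x < n" "y < n" for x y
      using that assms(1,5) unfolding s'_def OUT_def by (auto simp: index_inj)
    then have "OUT n (insert (u, v) S) s'"
      using assms(1,4,5) False unfolding OUT_def ol by (auto simp: s'_def)
    ultimately show ?thesis
      unfolding EMIT_def using assms(2,3) n
      by (simp, intro assms(6)) (auto simp: eqx_def)
  qed
qed

section \<open>The condensation\<close>

text \<open>Components are numbered topologically from 1; isolated vertices have number 0. In the condensed
  graph, component \<open>Suc a\<close> becomes vertex \<open>a\<close>.\<close>

definition condensation :: "nat \<Rightarrow> (nat \<times> nat) set \<Rightarrow> nat \<Rightarrow> (nat \<Rightarrow> nat) \<Rightarrow> (nat \<Rightarrow> nat) \<Rightarrow> bool" where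
  "condensation n G K mk rep \<longleftrightarrow>
     (\<forall>u. mk u \<noteq> 0 \<longrightarrow> u < n \<and> (u, rep (mk u)) \<in> G\<^sup>* \<and> (rep (mk u), u) \<in> G\<^sup>*) \<and>
     (\<forall>(u, v) \<in> G. mk u \<noteq> 0 \<and> mk u \<le> mk v) \<and> (\<forall>u. mk u \<le> K) \<and>
     (\<forall>q. 1 \<le> q \<and> q \<le> K \<longrightarrow> mk (rep q) = q)"

definition cond_edges :: "(nat \<times> nat) set \<Rightarrow> (nat \<Rightarrow> nat) \<Rightarrow> (nat \<times> nat) set" where
  "cond_edges G mk = {(a, b). a < b \<and> (\<exists>(x, y) \<in> G. mk x = Suc a \<and> mk y = Suc b)}"

text \<open>Any two vertices of a component are two hops apart through the representative, at the
  price of linearly many edges.\<close>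

definition star_edges :: "(nat \<Rightarrow> nat) \<Rightarrow> (nat \<Rightarrow> nat) \<Rightarrow> (nat \<times> nat) set" where
  "star_edges mk rep = (\<Union>u \<in> {u. mk u \<noteq> 0}. {(u, rep (mk u)), (rep (mk u), u)})"

text \<open>The roots are the endpoints of the edges, not all vertices: isolated vertices are never
  visited, so the time is linear in \<open>m\<close> alone.\<close>

definition INIT :: com where
  "INIT = For ''i'' (vv ''m'')
     (Write ''A'' (vv ''i'') (Read ''src'' (vv ''i'')) ;;
      Write ''B'' (vv ''i'') (Read ''dst'' (vv ''i'')) ;;
      Write ''rt'' (vv ''R'') (Read ''src'' (vv ''i'')) ;;
      ''R'' ::= vv ''R'' [+] ll 1 ;;
      Write ''rt'' (vv ''R'') (Read ''dst'' (vv ''i'')) ;;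
      ''R'' ::= vv ''R'' [+] ll 1) ;;
    ''M'' ::= vv ''m''"

lemma W_INIT:
  fixes s :: store
  defines "m \<equiv> var s ''m''" and "sr \<equiv> arr s ''src''" and "ds \<equiv> arr s ''dst''"
  assumes R: "var s ''R'' = 0"
    and Q: "\<And>t s'. eqx {''i'', ''R'', ''M''} {''A'', ''B'', ''rt''} s s' \<Longrightarrow> var s' ''M'' = m \<Longrightarrow> var s' ''R'' = 2 * m \<Longrightarrow>
      (\<And>e. e < m \<Longrightarrow> arr s' ''A'' e = sr e \<and> arr s' ''B'' e = ds e \<and>
         arr s' ''rt'' (2 * e) = sr e \<and> arr s' ''rt'' (2 * e + 1) = ds e) \<Longrightarrow>
      t \<le> 100 * m + 50 \<Longrightarrow> Q t s'"
  shows "W INIT s Q"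
  unfolding INIT_def W_Seq
proof (rule W_For[where N = m and T = "80" and
    I = "\<lambda>k s'. var s' ''R'' = 2 * k \<and> (\<forall>e<k. arr s' ''A'' e = sr e \<and> arr s' ''B'' e = ds e \<and>
         arr s' ''rt'' (2 * e) = sr e \<and> arr s' ''rt'' (2 * e + 1) = ds e)"], goal_cases)
  case (4 k s')
  have "arr s' ''src'' = sr" "arr s' ''dst'' = ds" using 4(1) by (simp_all add: eqx_def sr_def ds_def)
  then show ?case using 4 by (auto simp: less_Suc_eq)
next
  case (5 t s')
  have "var s' ''m'' = m" using 5(1) by (simp add: eqx_def m_def)
  then show ?case using 5 by (simp, intro Q) (auto simp: eqx_def)
qed (use R in \<open>auto simp: eqx_def m_def\<close>)

text \<open>Only the visited vertices are unmarked, for the same reason that only endpoints serve as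
  roots. The roots of the second pass are the finished vertices, last one first.\<close>

definition SWAP :: com where
  "SWAP = For ''i'' (vv ''c'')
      (Write ''rt'' (vv ''i'') (Read ''ord'' (vv ''c'' [-] ll 1 [-] vv ''i'')) ;;
       Write ''mk'' (Read ''ord'' (vv ''i'')) (ll 0)) ;;
    ''R'' ::= vv ''c'' ;;
    For ''i'' (vv ''M'')
      (''x'' ::= Read ''A'' (vv ''i'') ;;
       Write ''A'' (vv ''i'') (Read ''B'' (vv ''i'')) ;;
       Write ''B'' (vv ''i'') (vv ''x'')) ;;
    ''c'' ::= ll 0 ;; ''k'' ::= ll 0"

lemma W_SWAP:
  fixes s :: store
  defines "N \<equiv> var s ''c''" and "M \<equiv> var s ''M''"
  assumes mk: "{u. arr s ''mk'' u \<noteq> 0} \<subseteq> set (alist s ''ord'' N)"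
    and Q: "\<And>t s'. eqx {''i'', ''R'', ''x'', ''c'', ''k''} {''A'', ''B'', ''rt'', ''mk''} s s' \<Longrightarrow>
      var s' ''R'' = N \<Longrightarrow> var s' ''c'' = 0 \<Longrightarrow> var s' ''k'' = 0 \<Longrightarrow>
      (\<And>j. j < N \<Longrightarrow> arr s' ''rt'' j = arr s ''ord'' (N - 1 - j)) \<Longrightarrow> (\<And>u. arr s' ''mk'' u = 0) \<Longrightarrow>
      (\<And>e. e < M \<Longrightarrow> arr s' ''A'' e = arr s ''B'' e \<and> arr s' ''B'' e = arr s ''A'' e) \<Longrightarrow>
      t \<le> 100 * (N + M) + 50 \<Longrightarrow> Q t s'"
  shows "W SWAP s Q"
  unfolding SWAP_def W_Seq
proof (rule W_For[where N = N and T = "30" and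
    I = "\<lambda>k s'. (\<forall>j<k. arr s' ''rt'' j = arr s ''ord'' (N - 1 - j)) \<and>
      (\<forall>u. arr s' ''mk'' u \<noteq> 0 \<longrightarrow> (\<exists>j. k \<le> j \<and> j < N \<and> arr s ''ord'' j = u))"], goal_cases)
  case 2
  have "\<exists>j<N. arr s ''ord'' j = u" if "arr s ''mk'' u \<noteq> 0" for u
  proof -
    have "u \<in> set (alist s ''ord'' N)" using mk that by blast
    then show ?thesis by auto
  qed
  then show ?case by simp
next
  case (4 k s')
  have fr: "arr s' ''ord'' = arr s ''ord''" "var s' ''c'' = N" using 4(1) by (simp_all add: eqx_def N_def)
  have "\<exists>j\<ge>Suc k. j < N \<and> arr s ''ord'' j = u" if "arr s' ''mk'' u \<noteq> 0" "u \<noteq> arr s ''ord'' k" for u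
  proof -
    from 4(4) that obtain j where "k \<le> j" "j < N" "arr s ''ord'' j = u" by blast
    moreover from this that(2) have "j \<noteq> k" by blast
    ultimately show ?thesis by (intro exI[of _ j]) auto
  qed
  then show ?case using 4 by (auto simp: less_Suc_eq fr)
next
  case (5 t s1)
  have e1: "eqx {''i''} {''rt'', ''mk''} s s1" using 5(1) by (simp add: insert_commute)
  note t1 = 5(4) and rt1 = 5(2)
  have mk1: "arr s1 ''mk'' u = 0" for u using 5(2) by (meson leD)
  show ?case
    unfolding W_Assign
  proof (rule W_For[where N = M and T = "30" and
      I = "\<lambda>k s'. (\<forall>e<k. arr s' ''A'' e = arr s ''B'' e \<and> arr s' ''B'' e = arr s ''A'' e) \<and>
         (\<forall>e\<ge>k. arr s' ''A'' e = arr s ''A'' e \<and> arr s' ''B'' e = arr s ''B'' e)"], goal_cases)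
    case 2
    show ?case using e1 by (simp add: eqx_def)
  next
    case (3 s')
    then show ?case using e1 by (simp add: eqx_def M_def)
  next
    case (4 k s')
    then show ?case by (auto simp: less_Suc_eq)
  next
    case (5 t' s')
    have R: "var s' ''R'' = N" using 5(1) e1 by (simp add: eqx_def N_def)
    show ?case
      unfolding W_Assign
      by (rule Q) (use 5 e1 mk1 R t1 rt1 in \<open>auto simp: eqx_def\<close>)
  qed simp
qed (auto simp: eqx_def N_def)

definition CONDENSE :: com where
  "CONDENSE = ''K'' ::= vv ''k'' ;; ''M'' ::= ll 0 ;;
    For ''i'' (vv ''m'')
      (''a'' ::= Read ''mk'' (Read ''src'' (vv ''i'')) [-] ll 1 ;;
       ''b'' ::= Read ''mk'' (Read ''dst'' (vv ''i'')) [-] ll 1 ;;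
       Cond (vv ''a'' [<] vv ''b'')
         (Write ''A'' (vv ''M'') (vv ''a'') ;; Write ''B'' (vv ''M'') (vv ''b'') ;; ''M'' ::= vv ''M'' [+] ll 1)
         Skip)"

lemma edges_Suc: "edges A B (Suc m) = insert (A m, B m) (edges A B m)"
  by (simp add: edges_def lessThan_Suc)

lemma edges_upd: "edges (A(m := a)) (B(m := b)) m = edges A B m"
  by (auto simp: edges_def)

lemma W_CONDENSE:
  fixes s :: store
  defines "m \<equiv> var s ''m''" and "sr \<equiv> arr s ''src''" and "ds \<equiv> arr s ''dst''" and "mk \<equiv> arr s ''mk''"
  assumes mk: "\<And>i. i < m \<Longrightarrow> mk (sr i) \<noteq> 0 \<and> mk (ds i) \<noteq> 0"
    and Q: "\<And>t s'. eqx {''i'', ''a'', ''b'', ''M'', ''K''} {''A'', ''B''} s s' \<Longrightarrow> var s' ''K'' = var s ''k'' \<Longrightarrow>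
      var s' ''M'' \<le> m \<Longrightarrow> edges (arr s' ''A'') (arr s' ''B'') (var s' ''M'') = cond_edges (edges sr ds m) mk \<Longrightarrow>
      t \<le> 100 * m + 50 \<Longrightarrow> Q t s'"
  shows "W CONDENSE s Q"
  unfolding CONDENSE_def W_Seq W_Assign
proof (rule W_For[where N = m and T = "50" and
    I = "\<lambda>k s'. var s' ''M'' \<le> k \<and>
        edges (arr s' ''A'') (arr s' ''B'') (var s' ''M'') = cond_edges (edges sr ds k) mk"], goal_cases)
  case 2
  show ?case by (auto simp: edges_def cond_edges_def)
next
  case (4 k s')
  have fr: "arr s' ''src'' = sr" "arr s' ''dst'' = ds" "arr s' ''mk'' = mk"
    using 4(1) by (simp_all add: eqx_def sr_def ds_def mk_def)
  have c: "cond_edges (edges sr ds (Suc k)) mk = (if mk (sr k) - 1 < mk (ds k) - 1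
    then insert (mk (sr k) - 1, mk (ds k) - 1) else id) (cond_edges (edges sr ds k) mk)"
    using mk[OF 4(3)] by (auto simp: cond_edges_def edges_Suc)
  show ?case
    using 4(2,4) unfolding c
    by (cases "mk (sr k) - 1 < mk (ds k) - 1") (simp_all add: fr edges_Suc edges_upd)
next
  case (5 t s')
  have "var s' ''K'' = var s ''k''" using 5(1) by (simp add: eqx_def)
  then show ?case by (intro Q) (use 5 in \<open>auto simp: eqx_def\<close>)
qed (auto simp: eqx_def m_def)

definition STAR :: com where
  "STAR = For ''i'' (vv ''c'')
    (EMIT (Read ''ord'' (vv ''i'')) (Read ''rep'' (Read ''mk'' (Read ''ord'' (vv ''i'')))) ;;
     EMIT (Read ''rep'' (Read ''mk'' (Read ''ord'' (vv ''i'')))) (Read ''ord'' (vv ''i'')))"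

lemma W_STAR:
  fixes s :: store
  defines "ord \<equiv> arr s ''ord''" and "rep \<equiv> arr s ''rep''" and "mk \<equiv> arr s ''mk''" and "N \<equiv> var s ''c''"
  assumes OUT: "OUT n {} s" and lt: "\<And>i. i < N \<Longrightarrow> ord i < n \<and> rep (mk (ord i)) < n"
    and X: "{u. mk u \<noteq> 0} = ord ` {..<N}"
    and Q: "\<And>t s'. eqx {''i'', ''eu'', ''ev'', ''h''} {''sn'', ''hsrc'', ''hdst''} s s' \<Longrightarrow>
      OUT n (star_edges mk rep) s' \<Longrightarrow> t \<le> 200 * N + 50 \<Longrightarrow> Q t s'"
  shows "W STAR s Q"
  unfolding STAR_def
proof (rule W_For[where N = N and T = "150" and
    I = "\<lambda>k s'. OUT n (\<Union>i<k. {(ord i, rep (mk (ord i))), (rep (mk (ord i)), ord i)}) s'"], goal_cases)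
  case 2
  show ?case using OUT by simp
next
  case (4 k s')
  have fr: "arr s' ''ord'' = ord" "arr s' ''rep'' = rep" "arr s' ''mk'' = mk"
    using 4(1) by (simp_all add: eqx_def ord_def rep_def mk_def)
  show ?case
    unfolding W_Seq
  proof (rule W_EMIT[OF 4(4) refl refl], goal_cases)
    case (3 t1 s1)
    have fr1: "arr s1 ''ord'' = ord" "arr s1 ''rep'' = rep" "arr s1 ''mk'' = mk" "var s1 ''i'' = k"
      using 3(2) fr 4(2) by (simp_all add: eqx_def)
    show ?case
    proof (rule W_EMIT[OF 3(1) refl refl], goal_cases)
      case (3 t2 s2)
      have "insert (rep (mk (ord k)), ord k) (insert (ord k, rep (mk (ord k)))
         (\<Union>i<k. {(ord i, rep (mk (ord i))), (rep (mk (ord i)), ord i)})) =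
         (\<Union>i<Suc k. {(ord i, rep (mk (ord i))), (rep (mk (ord i)), ord i)})"
        by (auto simp: lessThan_Suc)
      then show ?case using 3 \<open>t1 \<le> _\<close> by (simp add: fr fr1 4(2))
    qed (use lt[OF 4(3)] in \<open>auto simp: fr1\<close>)
  qed (use lt[OF 4(3)] 4(2) in \<open>auto simp: fr\<close>)
next
  case (5 t s')
  have "(\<Union>i<N. {(ord i, rep (mk (ord i))), (rep (mk (ord i)), ord i)}) = star_edges mk rep"
    unfolding star_edges_def X by auto
  then show ?case using 5 by (intro Q) (auto simp: insert_commute)
qed (auto simp: eqx_def N_def)

definition SCC :: com where
  "SCC = INIT ;; BUILD ;; FOREST ;; SWAP ;; BUILD ;; FOREST ;; CONDENSE ;; STAR"

lemma mod_vars_stages [simp]: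
  "mod_vars BUILD = {''e''}"
  "mod_vars INIT = {''i'', ''R'', ''M''}"
  "mod_vars FOREST = {''i'', ''r'', ''k'', ''u'', ''e'', ''c'', ''sp'', ''v''}"
  "mod_vars SWAP = {''i'', ''R'', ''x'', ''c'', ''k''}"
  "mod_vars CONDENSE = {''i'', ''a'', ''b'', ''M'', ''K''}"
  "mod_vars STAR = {''i'', ''eu'', ''ev'', ''h''}"
  by (auto simp: BUILD_def INIT_def FOREST_def SWAP_def CONDENSE_def STAR_def)

lemma mod_arrs_stages [simp]:
  "mod_arrs BUILD = {''nx'', ''hd''}"
  "mod_arrs INIT = {''A'', ''B'', ''rt''}"
  "mod_arrs FOREST = {''rep'', ''ord'', ''hd'', ''mk'', ''stk''}"
  "mod_arrs SWAP = {''A'', ''B'', ''rt'', ''mk''}"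
  "mod_arrs CONDENSE = {''A'', ''B''}"
  "mod_arrs STAR = {''sn'', ''hsrc'', ''hdst''}"
  by (auto simp: BUILD_def INIT_def FOREST_def SWAP_def CONDENSE_def STAR_def)

lemma edges_cong: "(\<And>e. e < m \<Longrightarrow> A e = A' e \<and> B e = B' e) \<Longrightarrow> edges A B m = edges A' B' m"
  by (auto simp: edges_def)

lemma edges_converse: "edges B A m = (edges A B m)\<inverse>"
  by (auto simp: edges_def)

text \<open>Lists of marked vertices are exhausted and unmarked vertices have no edges, so
  \<open>hd\<close> can be reused without being cleared.\<close>

lemma forest_hd_zero:
  assumes "forest_inv E rt R hp A m mk rep k ord" "\<And>e. e < m \<Longrightarrow> mk (A e) \<noteq> 0"
  shows "hp u = 0"
proof -
  have "hp u = (if mk u = 0 then prv A u m else 0)" using assms(1) unfolding forest_inv_def by blast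
  moreover have "prv A u m = 0" if "mk u = 0"
    using prv_eq_0[of m A u] assms(2) that by metis
  ultimately show ?thesis by simp
qed

lemma W_SCC:
  fixes n D :: nat and es :: "(nat \<times> nat) list"
  defines "s0 \<equiv> input_store n es D" and "G \<equiv> set es" and "m \<equiv> length es"
  assumes G: "digraph n G"
    and Q: "\<And>t s' K mk rep. eqx {''i'', ''R'', ''M'', ''e'', ''r'', ''k'', ''u'', ''c'', ''sp'', ''v'', ''x'', ''a'', ''b'', ''K'', ''eu'', ''ev'', ''h''}
         {''A'', ''B'', ''rt'', ''nx'', ''hd'', ''rep'', ''ord'', ''mk'', ''stk'', ''sn'', ''hsrc'', ''hdst''} s0 s' \<Longrightarrow>
      condensation n G K mk rep \<Longrightarrow> var s' ''K'' = K \<Longrightarrow> arr s' ''rep'' = rep \<Longrightarrow> K \<le> n \<Longrightarrow> K \<le> 2 * m \<Longrightarrow>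
      edges (arr s' ''A'') (arr s' ''B'') (var s' ''M'') = cond_edges G mk \<Longrightarrow> var s' ''M'' \<le> m \<Longrightarrow>
      OUT n (star_edges mk rep) s' \<Longrightarrow> (\<And>u. arr s' ''hd'' u = 0) \<Longrightarrow> t \<le> 3000 * m + 1000 \<Longrightarrow> Q t s'"
  shows "W SCC s0 Q"
proof -
  let ?sr = "arr s0 ''src''" and ?ds = "arr s0 ''dst''"
  have s0: "var s0 ''m'' = m" "var s0 ''n'' = n" "var s0 ''R'' = 0" "var s0 ''k'' = 0" "var s0 ''c'' = 0"
    "var s0 ''h'' = 0" "arr s0 ''hd'' = (\<lambda>_. 0)" "arr s0 ''mk'' = (\<lambda>_. 0)" "arr s0 ''sn'' = (\<lambda>_. 0)"
    by (simp_all add: s0_def input_store_def m_def)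
  have es: "?sr e = fst (es ! e)" "?ds e = snd (es ! e)" if "e < m" for e
    using that by (simp_all add: s0_def input_store_def m_def)
  have GE: "edges ?sr ?ds m = G"
    unfolding edges_def G_def m_def set_conv_nth using es[unfolded m_def] by (auto simp: image_iff)
  show ?thesis
    unfolding SCC_def W_Seq
  proof (rule W_INIT, goal_cases)
    case 1 show ?case by (simp add: s0)
  next
    case (2 t1 s1)
    note e1 = 2(1) and p1 = 2(2-)
    let ?A = "arr s1 ''A''" and ?B = "arr s1 ''B''" and ?rt = "arr s1 ''rt''"
    have E1: "edges ?A ?B m = G"
      unfolding GE[symmetric] by (rule edges_cong) (use p1(3) s0 in simp)
    have rt_sub: "?rt j \<in> fst ` G \<union> snd ` G" if "j < 2 * m" for j
    proof -
      obtain e where "e < m" "j = 2 * e \<or> j = 2 * e + 1"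
        using \<open>j < 2 * m\<close> by (intro that[of "j div 2"]) presburger+
      then show ?thesis using p1(3)[of e] es[of e] s0 by (force simp: G_def m_def)
    qed
    show ?case
    proof (rule W_BUILD, goal_cases)
      case 1 show ?case using e1 by (simp add: eqx_def s0)
    next
      case (2 t2 s2)
      note e2 = 2(1) and p2 = 2(2-)
      have f2: "arr s2 ''A'' = ?A" "arr s2 ''B'' = ?B" "arr s2 ''rt'' = ?rt" "var s2 ''M'' = m" "var s2 ''R'' = 2 * m"
        using e2 p1 s0 by (simp_all add: eqx_def)
      show ?case
      proof (rule W_FOREST, goal_cases)
        case (6 t3 s3)
        note e3 = 6(1) and p3 = 6(2,3)
        let ?ord = "alist s3 ''ord'' (var s3 ''c'')"
        have F1: "forest_inv G ?rt (2 * m) (arr s3 ''hd'') ?A m (arr s3 ''mk'') (arr s3 ''rep'') (var s3 ''k'') ?ord"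
          using p3(1) by (simp add: f2 E1)
        have X1: "set ?ord = {u. arr s3 ''mk'' u \<noteq> 0}" "distinct ?ord"
          using forest_invD(1,2)[OF F1] by simp_all
        have mk3: "arr s3 ''mk'' (?sr e) \<noteq> 0" "arr s3 ''mk'' (?ds e) \<noteq> 0" if "e < m" for e
        proof -
          have "2 * e < 2 * m" "2 * e + 1 < 2 * m" using that by auto
          then have "arr s3 ''mk'' (?rt (2 * e)) \<noteq> 0" "arr s3 ''mk'' (?rt (2 * e + 1)) \<noteq> 0"
            using forest_invD(5)[OF F1] by blast+
          then show "arr s3 ''mk'' (?sr e) \<noteq> 0" "arr s3 ''mk'' (?ds e) \<noteq> 0"
            using p1(3)[of e] that s0 by simp_all
        qed
        have hd3: "arr s3 ''hd'' u = 0" for u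
          by (rule forest_hd_zero[OF F1]) (use p1(3) mk3 s0 in simp)
        have field: "Field G \<subseteq> set ?ord"
          unfolding X1(1) GE[symmetric] using mk3 by (auto simp: Field_def edges_def)
        have ordsub: "set ?ord \<subseteq> fst ` G \<union> snd ` G"
        proof
          fix u assume "u \<in> set ?ord"
          then have "arr s3 ''mk'' u \<noteq> 0" using X1(1) by blast
          then obtain j where j: "j < 2 * m" "(?rt j, u) \<in> G\<^sup>*" using forest_invD(6)[OF F1] by blast
          from j(2) show "u \<in> fst ` G \<union> snd ` G" using rt_sub[OF j(1)] by (cases rule: rtranclE) force+
        qed
        define N where "N = var s3 ''c''"
        have lenN: "length ?ord = N" by (simp add: N_def)
        have cardord: "card (set ?ord) = N" using distinct_card[OF X1(2)] lenN by simp
        have "card (set ?ord) \<le> card (fst ` G \<union> snd ` G)"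
          by (rule card_mono) (use ordsub in \<open>auto simp: G_def\<close>)
        also have "\<dots> \<le> card (fst ` G) + card (snd ` G)" by (rule card_Un_le)
        also have "\<dots> \<le> m + m"
          by (intro add_mono order.trans[OF card_image_le]) (auto simp: G_def m_def card_length)
        finally have N2: "N \<le> 2 * m" using cardord by simp
        have ordn: "set ?ord \<subseteq> {..<n}" using ordsub G by (force simp: digraph_def)
        have Nn: "N \<le> n" using card_mono[OF _ ordn] cardord by simp
        have f3: "arr s3 ''A'' = ?A" "arr s3 ''B'' = ?B" "var s3 ''M'' = m"
          using e3 f2 by (simp_all add: eqx_def)
        show ?case
        proof (rule W_SWAP, goal_cases)
          case 1 show ?case using X1(1) by simp
        next
          case (2 t4 s4)
          note e4 = 2(1) and p4 = 2(2-)
          have E4: "edges (arr s4 ''A'') (arr s4 ''B'') m = G\<inverse>"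
            unfolding E1[symmetric] edges_converse[symmetric] by (rule edges_cong) (use p4(6) f3 in simp)
          have f4: "var s4 ''M'' = m" using e4 f3 by (simp add: eqx_def)
          show ?case
          proof (rule W_BUILD, goal_cases)
            case 1 show ?case using e4 hd3 by (simp add: eqx_def)
          next
            case (2 t5 s5)
            note e5 = 2(1) and p5 = 2(2-)
            have f5: "arr s5 ''A'' = arr s4 ''A''" "arr s5 ''B'' = arr s4 ''B''" "arr s5 ''rt'' = arr s4 ''rt''"
              "var s5 ''M'' = m" "var s5 ''R'' = N"
              using e5 f4 p4 by (simp_all add: eqx_def N_def)
            show ?case
            proof (rule W_FOREST, goal_cases)
              case (6 t6 s6)
              note e6 = 6(1) and p6 = 6(2,3)
              let ?mk = "arr s6 ''mk''" and ?rep = "arr s6 ''rep''" and ?k = "var s6 ''k''"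
              let ?ord6 = "alist s6 ''ord'' (var s6 ''c'')"
              have F2: "forest_inv (G\<inverse>) (arr s4 ''rt'') (length ?ord) (arr s6 ''hd'') (arr s4 ''A'') m ?mk ?rep ?k ?ord6"
                using p6(1) by (simp add: f5 E4 N_def)
              have rt4: "\<forall>j<length ?ord. arr s4 ''rt'' j = ?ord ! (length ?ord - 1 - j)"
                using p4(4) by simp
              note K = forest_twice[OF F1 F2 rt4 field]
              have X6: "set ?ord6 = {u. ?mk u \<noteq> 0}" "distinct ?ord6" using forest_invD(1,2)[OF F2] by simp_all
              then have c6: "var s6 ''c'' = N" using K(1) cardord distinct_card[OF X6(2)] by simp
              have mkr: "u \<in> set ?ord \<Longrightarrow> ?rep (?mk u) \<in> set ?ord" for u
              proof -
                assume u: "u \<in> set ?ord"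
                then have "1 \<le> ?mk u" "?mk u \<le> ?k" using K(1) forest_invD(3)[OF F2] by (auto simp: Suc_le_eq)
                then have "?mk (?rep (?mk u)) = ?mk u" by (rule forest_invD(4)[OF F2])
                then have "?mk (?rep (?mk u)) \<noteq> 0" using \<open>1 \<le> ?mk u\<close> by linarith
                then show ?thesis using K(1) by blast
              qed
              have cond: "condensation n G ?k ?mk ?rep"
                unfolding condensation_def
              proof (intro conjI ballI allI impI)
                fix u assume "?mk u \<noteq> 0"
                then have "u \<in> set ?ord" using K(1) by blast
                with K(2)[OF this] ordn show "u < n" "(u, ?rep (?mk u)) \<in> G\<^sup>*" "(?rep (?mk u), u) \<in> G\<^sup>*" by blast+
              next
                fix e assume "e \<in> G"
                moreover obtain u v where e: "e = (u, v)" by (cases e)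
                ultimately have "u \<in> set ?ord" "?mk u \<le> ?mk v" using K(3) field by (auto simp: Field_def)
                then show "case e of (u, v) \<Rightarrow> ?mk u \<noteq> 0 \<and> ?mk u \<le> ?mk v"
                  using K(1) unfolding e prod.case by blast
              next
                show "?mk u \<le> ?k" for u by (rule forest_invD(3)[OF F2])
              next
                show "?mk (?rep q) = q" if "1 \<le> q \<and> q \<le> ?k" for q using forest_invD(4)[OF F2] that by blast
              qed
              have f6: "var s6 ''m'' = m" "arr s6 ''src'' = ?sr" "arr s6 ''dst'' = ?ds"
                using e1 e2 e3 e4 e5 e6 s0 by (simp_all add: eqx_def)
              have hd6: "arr s6 ''hd'' u = 0" for u
              proof (rule forest_hd_zero[OF F2])
                fix e assume "e < m"
                then show "?mk (arr s4 ''A'' e) \<noteq> 0"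
                  using p4(6)[of e] p1(3)[of e] mk3(2)[of e] K(1) X1(1) s0 by (auto simp: f3)
              qed
              have O6: "OUT n {} s6"
                using e1 e2 e3 e4 e5 e6 s0 by (simp add: OUT_def output_list_def eqx_def)
              show ?case
              proof (rule W_CONDENSE, goal_cases)
                case (1 i)
                then show ?case using mk3[of i] K(1) X1(1) by (auto simp: f6)
              next
                case (2 t7 s7)
                note e7 = 2(1) and p7 = 2(2-)
                have f7: "arr s7 ''ord'' = arr s6 ''ord''" "arr s7 ''rep'' = ?rep" "arr s7 ''mk'' = ?mk" "var s7 ''c'' = N"
                  using e7 c6 by (simp_all add: eqx_def)
                show ?case
                proof (rule W_STAR[where n = n], goal_cases)
                  case 1 show ?case using OUT_eqx[OF e7 O6] by simp
                next
                  case (2 i)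
                  then have "arr s6 ''ord'' i \<in> set ?ord6" using c6 f7 by auto
                  then have "arr s6 ''ord'' i \<in> set ?ord" using X6 K(1) by blast
                  then show ?case using mkr ordn unfolding f7 by (meson lessThan_iff subsetD)
                next
                  case 3
                  show ?case using X6(1) c6 by (simp add: f7 atLeast0LessThan)
                next
                  case (4 t8 s8)
                  note e8 = 4(1) and p8 = 4(2-)
                  show ?case
                  proof (rule Q[OF _ cond], goal_cases)
                    case 1
                    show ?case using e1 e2 e3 e4 e5 e6 e7 e8 by (simp add: eqx_def)
                  next
                    case 2
                    show ?case using e8 p7 by (simp add: eqx_def)
                  next
                    case 3
                    show ?case using e8 f7 by (simp add: eqx_def)
                  next
                    case 4
                    show ?case using K(4) cardord Nn by simp
                  next
                    case 5
                    show ?case using K(4) cardord N2 by simp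
                  next
                    case 6
                    show ?case using e8 p7(3) by (simp add: eqx_def f6 GE)
                  next
                    case 7
                    show ?case using e8 p7(2) by (simp add: eqx_def f6)
                  next
                    case 8
                    show ?case using p8(1) by (simp add: f7)
                  next
                    case (9 u)
                    show ?case using e7 e8 hd6 by (simp add: eqx_def)
                  next
                    case 10
                    show ?case
                      using p1(4) p2(3) p3(2) p4(7) p5(3) p6(2) p7(4) p8(2) N2 s0 f2 f3 f4 f5 f6 f7 p1(1,2)
                      by (simp add: N_def)
                  qed
                qed
              qed
            qed (use p5 f5 p4 e5 e4 in \<open>simp_all add: eqx_def adj_def\<close>)
          qed
        qed
      qed (use p2 f2 e1 e2 s0 p1 in \<open>simp_all add: eqx_def adj_def\<close>)
    qed
  qed
qed

section \<open>Sorting edges by source\<close>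

text \<open>Bucket sort: the adjacency lists are emptied from the largest source downwards,
  \<open>S\<close> being a strict bound on the sources. The emptied lists leave \<open>hd\<close>
  ready for the next use.\<close>

definition SORT :: com where
  "SORT = BUILD ;; ''p'' ::= ll 0 ;;
    For ''i'' (vv ''S'')
      (''u'' ::= vv ''S'' [-] ll 1 [-] vv ''i'' ;;
       While (Read ''hd'' (vv ''u''))
         (''e'' ::= Read ''hd'' (vv ''u'') ;;
          Write ''A2'' (vv ''p'') (vv ''u'') ;;
          Write ''B2'' (vv ''p'') (Read ''B'' (vv ''e'' [-] ll 1)) ;;
          ''p'' ::= vv ''p'' [+] ll 1 ;;
          Write ''hd'' (vv ''u'') (Read ''nx'' (vv ''e'')))) ;;
    For ''i'' (vv ''p'')
      (Write ''A'' (vv ''i'') (Read ''A2'' (vv ''i'')) ;; Write ''B'' (vv ''i'') (Read ''B2'' (vv ''i'')))"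

definition sorted_desc :: "(nat \<Rightarrow> nat) \<Rightarrow> nat \<Rightarrow> bool" where
  "sorted_desc A m \<longleftrightarrow> (\<forall>i j. i < j \<longrightarrow> j < m \<longrightarrow> A j \<le> A i)"

lemma W_SORT:
  fixes s :: store
  defines "A \<equiv> arr s ''A''" and "B \<equiv> arr s ''B''" and "m \<equiv> var s ''M''" and "S \<equiv> var s ''S''"
  assumes hd0: "\<And>u. arr s ''hd'' u = 0" and lt: "\<And>e. e < m \<Longrightarrow> A e < S"
    and Q: "\<And>t s'. eqx {''e'', ''p'', ''i'', ''u''} {''nx'', ''hd'', ''A2'', ''B2'', ''A'', ''B''} s s' \<Longrightarrow>
      edges (arr s' ''A'') (arr s' ''B'') m = edges A B m \<Longrightarrow> sorted_desc (arr s' ''A'') m \<Longrightarrow>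
      (\<And>u. arr s' ''hd'' u = 0) \<Longrightarrow> t \<le> 200 * (m + S) + 100 \<Longrightarrow> Q t s'"
  shows "W SORT s Q"
  unfolding SORT_def W_Seq
proof (rule W_BUILD[OF hd0], goal_cases)
  case (1 t1 s1)
  note e1 = 1(1) and adj = 1(2)[folded A_def m_def] and hd1 = 1(3)[folded A_def m_def] and t1 = 1(4)[folded m_def]
  have f1: "arr s1 ''A'' = A" "arr s1 ''B'' = B" "var s1 ''S'' = S" "var s1 ''M'' = m"
    using e1 by (simp_all add: eqx_def A_def B_def S_def m_def)
  let ?P = "\<lambda>s'. edges (arr s' ''A2'') (arr s' ''B2'') (var s' ''p'') =
       (\<lambda>e. (A e, B e)) ` ({..<m} - unproc A m (arr s' ''hd'')) \<and>
     sorted_desc (arr s' ''A2'') (var s' ''p'') \<and> var s' ''p'' + card (unproc A m (arr s' ''hd'')) = m"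
  have un0: "unproc A m (\<lambda>u. prv A u m) = {..<m}"
    using prv_edge[of _ m A] by (auto simp: unproc_def)
  show ?case
    unfolding W_Assign
  proof (rule W_For_pot[where N = S and T = 50 and \<Phi> = "\<lambda>s'. 50 * card (unproc A m (arr s' ''hd''))" and
      I = "\<lambda>k s'. ?P s' \<and> (\<forall>u. arr s' ''hd'' u = (if S - k \<le> u \<and> u < S then 0 else prv A u m)) \<and>
        (\<forall>j<var s' ''p''. S - k \<le> arr s' ''A2'' j)"], goal_cases)
    case 2
    have "arr s1 ''hd'' = (\<lambda>u. prv A u m)" using hd1 by blast
    then show ?case using un0 by (auto simp: edges_def sorted_desc_def)
  next
    case (3 s')
    then show ?case using f1 by (simp add: eqx_def)
  next
    case (4 k s')
    define u where "u = S - 1 - k"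
    have fr: "arr s' ''A'' = A" "arr s' ''B'' = B" "var s' ''S'' = S" "arr s' ''nx'' = arr s1 ''nx''"
      using 4(1) f1 by (simp_all add: eqx_def)
    note I4 = 4(4)
    have u: "S - k = Suc u" "u < S" "S - Suc k = u" using 4(3) by (auto simp: u_def)
    show ?case
      unfolding W_Seq W_Assign
    proof (rule W_While[where \<mu> = "\<lambda>s''. 50 * card (unproc A m (arr s'' ''hd''))" and
        I = "\<lambda>s''. ?P s'' \<and> (\<exists>q\<le>m. arr s'' ''hd'' u = prv A u q) \<and>
        (\<forall>x. x \<noteq> u \<longrightarrow> arr s'' ''hd'' x = arr s' ''hd'' x) \<and> (\<forall>j<var s'' ''p''. u \<le> arr s'' ''A2'' j)"], goal_cases)
      case 1
      have "\<exists>q\<le>m. arr s' ''hd'' u = prv A u q" using I4 u by auto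
      then show ?case using I4 u by (auto intro: Suc_leD)
    next
      case (2 s2)
      have fr2: "arr s2 ''B'' = B" "arr s2 ''nx'' = arr s1 ''nx''" "var s2 ''u'' = u"
        using 2(1) fr 4(2) by (simp_all add: eqx_def u_def)
      obtain e where e: "arr s2 ''hd'' u = Suc e" using 2(3) fr2 by (cases "arr s2 ''hd'' u") auto
      obtain q where q: "q \<le> m" "arr s2 ''hd'' u = prv A u q" using 2(2) by blast
      note st = unproc_step[of "arr s2 ''hd''" u e A q m, OF e q(2,1)]
      have nx: "arr s1 ''nx'' (Suc e) = prv A u e" using adj st(1,2) by (simp add: adj_def)
      let ?un = "unproc A m (arr s2 ''hd'')"
      have c: "card ?un = Suc (card (?un - {e}))" using st(4) by (metis card_Suc_Diff1 finite_unproc)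
      have "{..<m} - (?un - {e}) = insert e ({..<m} - ?un)" using st(1) by auto
      then have ed: "(\<lambda>e. (A e, B e)) ` ({..<m} - (?un - {e})) = insert (u, B e) ((\<lambda>e. (A e, B e)) ` ({..<m} - ?un))"
        using st(2) by simp
      have sd: "sorted_desc ((arr s2 ''A2'')(var s2 ''p'' := u)) (Suc (var s2 ''p''))"
        using 2(2) by (auto simp: sorted_desc_def less_Suc_eq)
      have "\<exists>q\<le>m. prv A u e = prv A u q" using st(1) by (intro exI[of _ e]) simp
      then show ?case using 2(2) sd c
        by (simp add: fr2 e nx st(3) ed edges_Suc edges_upd less_Suc_eq)
    next
      case (3 t s2)
      have fr2: "var s2 ''u'' = u" using 3(1) 4(2) fr by (simp add: eqx_def u_def)
      have "arr s2 ''hd'' u = 0" using 3(3) fr2 by simp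
      then have "arr s2 ''hd'' x = (if S - Suc k \<le> x \<and> x < S then 0 else prv A x m)" for x
        using 3(2) I4 u by (cases "x = u") auto
      then show ?case using 3(2,4) u by simp
    qed
  next
    case (5 t2 s2)
    note e2 = 5(1) and I5 = 5(2) and t2 = 5(4)
    have hd2: "arr s2 ''hd'' u = 0" for u
    proof (cases "u < S")
      case True
      then show ?thesis using I5 by simp
    next
      case False
      then have "prv A u m = 0" using lt by (intro prv_eq_0) auto
      then show ?thesis using I5 False by simp
    qed
    then have "unproc A m (arr s2 ''hd'') = {}" by (simp add: unproc_def)
    then have p2: "var s2 ''p'' = m" and ed2: "edges (arr s2 ''A2'') (arr s2 ''B2'') m = edges A B m"
      and sd2: "sorted_desc (arr s2 ''A2'') m"
      using I5 by (auto simp: edges_def)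
    show ?case
    proof (rule W_For[where N = m and T = 30 and I = "\<lambda>k s'. \<forall>j<k. arr s' ''A'' j = arr s2 ''A2'' j \<and> arr s' ''B'' j = arr s2 ''B2'' j"], goal_cases)
      case (4 k s')
      have "arr s' ''A2'' = arr s2 ''A2''" "arr s' ''B2'' = arr s2 ''B2''" using 4(1) by (simp_all add: eqx_def)
      then show ?case using 4 by (simp add: less_Suc_eq)
    next
      case (5 t3 s3)
      show ?case
      proof (rule Q, goal_cases)
        case 1
        show ?case using e1 e2 5(1) by (simp add: eqx_def)
      next
        case 2
        show ?case unfolding ed2[symmetric] using 5(2) by (intro edges_cong) simp
      next
        case 3
        show ?case using sd2 5(2) by (simp add: sorted_desc_def)
      next
        case (4 u)
        show ?case using hd2 5(1) by (simp add: eqx_def)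
      next
        case 5
        have "card (unproc A m (arr s1 ''hd'')) \<le> card {..<m}" by (rule card_mono) (auto simp: unproc_def)
        then show ?case using t1 t2 \<open>t3 \<le> _\<close> by simp
      qed
    qed (use p2 in \<open>auto simp: eqx_def\<close>)
  qed simp
qed

lemma mod_vars_SORT [simp]: "mod_vars SORT = {''e'', ''p'', ''i'', ''u''}"
  and mod_arrs_SORT [simp]: "mod_arrs SORT = {''nx'', ''hd'', ''A2'', ''B2'', ''A'', ''B''}"
  by (auto simp: SORT_def)

section \<open>Chains\<close>

text \<open>The numbering is topological and sources descend, so all edges out of \<open>B e\<close>
  precede \<open>e\<close> in the list. One pass over the list therefore evaluates any recursion
  from the sinks upwards.\<close>

definition dag :: "nat \<Rightarrow> (nat \<Rightarrow> nat) \<Rightarrow> (nat \<Rightarrow> nat) \<Rightarrow> nat \<Rightarrow> bool" where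
  "dag K A B m \<longleftrightarrow> (\<forall>e<m. A e < B e \<and> B e < K) \<and> sorted_desc A m"

definition LONG :: com where
  "LONG = For ''a'' (vv ''K'')
      (Write ''ln'' (vv ''a'') (Read ''cid'' (vv ''a'') [=] ll 0) ;; Write ''nxv'' (vv ''a'') (ll 0)) ;;
    For ''e'' (vv ''M'')
      (''a'' ::= Read ''A'' (vv ''e'') ;; ''b'' ::= Read ''B'' (vv ''e'') ;;
       Cond (Read ''ln'' (vv ''a'') [<] (Read ''ln'' (vv ''b'') [+] (Read ''cid'' (vv ''a'') [=] ll 0)))
         (Write ''ln'' (vv ''a'') (Read ''ln'' (vv ''b'') [+] (Read ''cid'' (vv ''a'') [=] ll 0)) ;;
          Write ''nxv'' (vv ''a'') (vv ''b'' [+] ll 1))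
         Skip)"

text \<open>\<open>U\<close> is 1 on vertices that are on no chain yet, so \<open>len a\<close> is
  the largest number of such vertices on a path from \<open>a\<close>. Paths may run through used
  vertices: a chain only has to be ordered by reachability. \<open>nxv\<close> is shifted by one,
  with 0 at the end of a path.\<close>

definition long_paths :: "(nat \<times> nat) set \<Rightarrow> nat \<Rightarrow> (nat \<Rightarrow> nat) \<Rightarrow> (nat \<Rightarrow> nat) \<Rightarrow> (nat \<Rightarrow> nat) \<Rightarrow> bool" where
  "long_paths E K U len nxv \<longleftrightarrow>
     (\<forall>a<K. U a \<le> len a) \<and> (\<forall>(a, b)\<in>E. len b + U a \<le> len a) \<and>
     (\<forall>a<K. nxv a = 0 \<and> len a = U a \<or> (\<exists>b. nxv a = Suc b \<and> (a, b) \<in> E \<and> len a = len b + U a))"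

text \<open>No earlier edge ends in \<open>A k\<close>, so a new value there does not affect the
  conditions on other sources; at \<open>A k\<close> itself the value only grows.\<close>

lemma long_paths_step:
  assumes L: "long_paths (edges A B k) K U len nxv" and d: "dag K A B m" "k < m"
  shows "\<not> len (A k) < len (B k) + U (A k) \<Longrightarrow> long_paths (edges A B (Suc k)) K U len nxv"
    and "len (A k) < len (B k) + U (A k) \<Longrightarrow> long_paths (edges A B (Suc k)) K U
      (len(A k := len (B k) + U (A k))) (nxv(A k := Suc (B k)))"
proof -
  have lt: "A k < B k" "B k < K" using d by (auto simp: dag_def)
  have ne: "b \<noteq> A k" if ab: "(a, b) \<in> edges A B k" for a b
  proof -
    obtain e where e: "e < k" "a = A e" "b = B e" using ab by (auto simp: edges_def)
    then have "A k \<le> A e" "A e < B e" using d by (auto simp: dag_def sorted_desc_def)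
    then show ?thesis using e by simp
  qed
  show "\<not> len (A k) < len (B k) + U (A k) \<Longrightarrow> long_paths (edges A B (Suc k)) K U len nxv"
    using L by (fastforce simp: long_paths_def edges_Suc)
  assume c: "len (A k) < len (B k) + U (A k)"
  let ?len = "len(A k := len (B k) + U (A k))" and ?nxv = "nxv(A k := Suc (B k))"
  show "long_paths (edges A B (Suc k)) K U ?len ?nxv"
    unfolding long_paths_def
  proof (intro conjI allI impI ballI)
    fix a assume "a < K"
    then show "U a \<le> ?len a" using L by (auto simp: long_paths_def)
  next
    fix p assume p: "p \<in> edges A B (Suc k)"
    obtain a b where ab: "p = (a, b)" by (cases p)
    have "?len b + U a \<le> ?len a"
    proof (cases "(a, b) \<in> edges A B k")
      case True
      then have "len b + U a \<le> len a" using L by (auto simp: long_paths_def)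
      then show ?thesis using ne[OF True] c by auto
    next
      case False
      then have "a = A k" "b = B k" using p ab by (auto simp: edges_Suc)
      then show ?thesis using lt by simp
    qed
    then show "case p of (a, b) \<Rightarrow> ?len b + U a \<le> ?len a" using ab by simp
  next
    fix a assume a: "a < K"
    show "?nxv a = 0 \<and> ?len a = U a \<or> (\<exists>b. ?nxv a = Suc b \<and> (a, b) \<in> edges A B (Suc k) \<and> ?len a = ?len b + U a)"
    proof (cases "a = A k")
      case True
      then show ?thesis using lt by (simp add: edges_Suc)
    next
      case False
      have "nxv a = 0 \<and> len a = U a \<or> (\<exists>b. nxv a = Suc b \<and> (a, b) \<in> edges A B k \<and> len a = len b + U a)"
        using L a by (auto simp: long_paths_def)
      then show ?thesis using False ne by (auto simp: edges_Suc)
    qed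
  qed
qed

lemma W_LONG:
  fixes s :: store
  defines "A \<equiv> arr s ''A''" and "B \<equiv> arr s ''B''" and "m \<equiv> var s ''M''" and "K \<equiv> var s ''K''" and
    "U \<equiv> \<lambda>a. of_bool (arr s ''cid'' a = 0)"
  assumes d: "dag K A B m"
    and Q: "\<And>t s'. eqx {''a'', ''b'', ''e''} {''ln'', ''nxv''} s s' \<Longrightarrow>
      long_paths (edges A B m) K U (arr s' ''ln'') (arr s' ''nxv'') \<Longrightarrow> t \<le> 100 * (m + K) + 50 \<Longrightarrow> Q t s'"
  shows "W LONG s Q"
  unfolding LONG_def W_Seq
proof (rule W_For[where N = K and T = 20 and
    I = "\<lambda>k s'. \<forall>a<k. arr s' ''ln'' a = U a \<and> arr s' ''nxv'' a = 0"], goal_cases)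
  case (4 k s')
  have "arr s' ''cid'' = arr s ''cid''" using 4(1) by (simp add: eqx_def)
  then show ?case using 4 by (auto simp: less_Suc_eq U_def)
next
  case (5 t1 s1)
  note e1 = 5(1) and I1 = 5(2) and t1 = 5(4)
  show ?case
  proof (rule W_For[where N = m and T = 80 and
      I = "\<lambda>k s'. long_paths (edges A B k) K U (arr s' ''ln'') (arr s' ''nxv'')"], goal_cases)
    case 2
    show ?case using I1 by (simp add: long_paths_def edges_def)
  next
    case (3 s')
    then show ?case using e1 by (simp add: eqx_def m_def)
  next
    case (4 k s')
    have fr: "arr s' ''A'' = A" "arr s' ''B'' = B" "of_bool (arr s' ''cid'' a = 0) = U a" for a
      using 4(1) e1 by (simp_all add: eqx_def A_def B_def U_def)
    note st = long_paths_step[OF 4(4) d 4(3)]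
    show ?case
    proof (cases "arr s' ''ln'' (A k) < arr s' ''ln'' (B k) + U (A k)")
      case True
      show ?thesis using st(2)[OF True] True 4(2) by (simp add: fr)
    next
      case False
      show ?thesis using st(1)[OF False] False 4(2) by (simp add: fr)
    qed
  next
    case (5 t2 s2)
    show ?case by (rule Q) (use 5 e1 t1 in \<open>auto simp: eqx_def\<close>)
  qed simp
qed (auto simp: eqx_def K_def)

definition no_long_chain :: "(nat \<times> nat) set \<Rightarrow> nat \<Rightarrow> nat \<Rightarrow> (nat \<Rightarrow> nat) \<Rightarrow> bool" where
  "no_long_chain E K D cid \<longleftrightarrow> (\<forall>xs. sorted_wrt (\<lambda>a b. (a, b) \<in> E\<^sup>+) xs \<longrightarrow>
     (\<forall>a\<in>set xs. a < K \<and> cid a = 0) \<longrightarrow> length xs < D)"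

lemma no_long_chain_antimono:
  assumes "no_long_chain E K D cid" "\<And>x. cid' x = 0 \<Longrightarrow> cid x = 0"
  shows "no_long_chain E K D cid'"
  using assms unfolding no_long_chain_def by simp

lemma long_paths_no_long_chain:
  assumes L: "long_paths E K (\<lambda>a. of_bool (cid a = 0)) len nxv" and D: "\<And>a. a < K \<Longrightarrow> len a < D" "0 < D"
  shows "no_long_chain E K D cid"
proof -
  let ?U = "\<lambda>a. of_bool (cid a = 0) :: nat"
  have E: "len b + ?U a \<le> len a" if "(a, b) \<in> E" for a b using L that by (auto simp: long_paths_def)
  have plus: "len b + ?U a \<le> len a" if "(a, b) \<in> E\<^sup>+" for a b
    using that
  proof (induction rule: trancl_induct)
    case (step y z)
    then show ?case using E[of y z] by simp
  qed (rule E)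
  have len: "length xs \<le> (case xs of [] \<Rightarrow> 0 | a # _ \<Rightarrow> len a)"
    if "sorted_wrt (\<lambda>a b. (a, b) \<in> E\<^sup>+) xs" "\<forall>a\<in>set xs. a < K \<and> cid a = 0" for xs
    using that
  proof (induction xs)
    case (Cons a xs)
    show ?case
    proof (cases xs)
      case Nil
      have "?U a \<le> len a" using L Cons.prems by (auto simp: long_paths_def)
      then show ?thesis using Nil Cons.prems by simp
    next
      case (Cons b ys)
      then have "length xs \<le> len b" using Cons.IH Cons.prems by simp
      moreover have "len b + ?U a \<le> len a" using plus[of a b] Cons.prems Cons by simp
      ultimately show ?thesis using Cons.prems by simp
    qed
  qed simp
  show ?thesis unfolding no_long_chain_def
  proof (intro allI impI)
    fix xs assume xs: "sorted_wrt (\<lambda>a b. (a, b) \<in> E\<^sup>+) xs" "\<forall>a\<in>set xs. a < K \<and> cid a = 0"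
    show "length xs < D"
    proof (cases xs)
      case Nil
      then show ?thesis using D(2) by simp
    next
      case (Cons a ys)
      then have "length xs \<le> len a" using len[OF xs] by simp
      moreover have "len a < D" using D(1) xs(2) Cons by simp
      ultimately show ?thesis by simp
    qed
  qed
qed

text \<open>Chain \<open>c\<close> occupies the positions \<open>c * D + i\<close> of \<open>chv\<close>, and \<open>cid\<close> is \<open>Suc c\<close> on it (0 off all chains).\<close>

definition chains :: "(nat \<times> nat) set \<Rightarrow> nat \<Rightarrow> nat \<Rightarrow> nat \<Rightarrow> (nat \<Rightarrow> nat) \<Rightarrow> (nat \<Rightarrow> nat) \<Rightarrow> bool" where
  "chains E K D q cid chv \<longleftrightarrow>
     (\<forall>x<q * D. chv x < K \<and> cid (chv x) = Suc (x div D)) \<and>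
     (\<forall>x y. x < y \<longrightarrow> y < q * D \<longrightarrow> x div D = y div D \<longrightarrow> (chv x, chv y) \<in> E\<^sup>+) \<and>
     (\<forall>a. cid a \<noteq> 0 \<longrightarrow> (\<exists>x<q * D. chv x = a))"

lemma trancl_less:
  fixes E :: "(nat \<times> nat) set"
  shows "(\<And>a b. (a, b) \<in> E \<Longrightarrow> a < b) \<Longrightarrow> (a, b) \<in> E\<^sup>+ \<Longrightarrow> a < b"
  by (erule trancl_induct) (auto intro: less_trans)

text \<open>Equal vertices have equal \<open>cid\<close>, hence lie on the same chain, and along a
  chain the vertices strictly increase.\<close>

lemma chains_inj:
  assumes "chains E K D q cid chv" "\<And>a b. (a, b) \<in> E \<Longrightarrow> a < b"
  shows "inj_on chv {..<q * D}"
proof (rule linorder_inj_onI)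
  fix x y assume xy: "x < y" "x \<in> {..<q * D}" "y \<in> {..<q * D}"
  show "chv x \<noteq> chv y"
  proof
    assume eq: "chv x = chv y"
    have "cid (chv x) = Suc (x div D)" "cid (chv y) = Suc (y div D)"
      using assms(1) xy unfolding chains_def by auto
    then have "x div D = y div D" using eq by simp
    moreover have "\<forall>x y. x < y \<longrightarrow> y < q * D \<longrightarrow> x div D = y div D \<longrightarrow> (chv x, chv y) \<in> E\<^sup>+"
      using assms(1) unfolding chains_def by (elim conjE)
    ultimately have "(chv x, chv y) \<in> E\<^sup>+" using xy by simp
    then have "chv x < chv y" using trancl_less assms(2) by blast
    then show False using eq by simp
  qed
qed auto

text \<open>\<open>K div D\<close> disjoint chains of \<open>D\<close> vertices leave fewer than
  \<open>D\<close> vertices altogether, so that many rounds are enough.\<close>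

lemma chains_full:
  assumes C: "chains E K D (K div D) cid chv" and lt: "\<And>a b. (a, b) \<in> E \<Longrightarrow> a < b" and "0 < D"
  shows "no_long_chain E K D cid"
  unfolding no_long_chain_def
proof (intro allI impI)
  fix xs assume xs: "sorted_wrt (\<lambda>a b. (a, b) \<in> E\<^sup>+) xs" "\<forall>a\<in>set xs. a < K \<and> cid a = 0"
  let ?q = "K div D"
  have "sorted_wrt (<) xs"
    by (rule sorted_wrt_mono_rel[OF _ xs(1)]) (use trancl_less lt in blast)
  then have "card (set xs) = length xs" by (simp add: strict_sorted_iff distinct_card)
  moreover have "set xs \<inter> chv ` {..<?q * D} = {}" using C xs(2) by (force simp: chains_def)
  then have "card (set xs) + card (chv ` {..<?q * D}) = card (set xs \<union> chv ` {..<?q * D})"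
    by (simp add: card_Un_disjoint)
  moreover have "card (set xs \<union> chv ` {..<?q * D}) \<le> card {..<K}"
    by (rule card_mono) (use xs(2) C in \<open>auto simp: chains_def\<close>)
  moreover have "card (chv ` {..<?q * D}) = ?q * D" using card_image[OF chains_inj[OF C lt]] by simp
  ultimately have "length xs + ?q * D \<le> K" by simp
  moreover have "K < D + ?q * D" using dividend_less_div_times[OF \<open>0 < D\<close>, of K] by simp
  ultimately show "length xs < D" by linarith
qed

section \<open>Removing one chain after another\<close>

definition WALK :: com where
  "WALK = ''a'' ::= vv ''st'' [-] ll 1 ;; ''i'' ::= ll 0 ;;
    While (vv ''i'' [<] vv ''D'')
      (Cond (Read ''cid'' (vv ''a'') [=] ll 0)
         (Write ''chv'' (vv ''Q'' [*] vv ''D'' [+] vv ''i'') (vv ''a'') ;;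
          Write ''cid'' (vv ''a'') (vv ''Q'' [+] ll 1) ;;
          ''i'' ::= vv ''i'' [+] ll 1)
         Skip ;;
       ''a'' ::= Read ''nxv'' (vv ''a'') [-] ll 1) ;;
    ''Q'' ::= vv ''Q'' [+] ll 1"

definition walk_inv where
  "walk_inv E K D q len cid0 chv0 cid chv i a \<longleftrightarrow> i \<le> D \<and> (i < D \<longrightarrow> a < K \<and> D \<le> len a + i) \<and>
     (\<forall>j<i. chv (q * D + j) < K \<and> cid0 (chv (q * D + j)) = 0 \<and> (i < D \<longrightarrow> (chv (q * D + j), a) \<in> E\<^sup>+)) \<and>
     (\<forall>j j'. j < j' \<longrightarrow> j' < i \<longrightarrow> (chv (q * D + j), chv (q * D + j')) \<in> E\<^sup>+) \<and>
     (\<forall>x. cid x = (if \<exists>j<i. chv (q * D + j) = x then Suc q else cid0 x)) \<and>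
     (\<forall>x<q * D. chv x = chv0 x)"

lemma walk_step:
  fixes len nxv cid0 :: "nat \<Rightarrow> nat"
  assumes I: "walk_inv E K D q len cid0 chv0 cid chv i a" and "i < D"
    and L: "long_paths E K (\<lambda>a. of_bool (cid0 a = 0)) len nxv"
    and ltE: "\<forall>(a, b) \<in> E. a < b \<and> b < K"
  shows "cid a = 0 \<Longrightarrow> walk_inv E K D q len cid0 chv0 (cid(a := Suc q)) (chv(q * D + i := a)) (Suc i) (nxv a - 1) \<and>
      (Suc i < D \<longrightarrow> a < nxv a - 1)"
    and "cid a \<noteq> 0 \<Longrightarrow> walk_inv E K D q len cid0 chv0 cid chv i (nxv a - 1) \<and> a < nxv a - 1"
proof -
  have lt: "a < b \<and> b < K" if "(a, b) \<in> E" for a b using ltE that by auto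
  have a: "a < K" "D \<le> len a + i" using I \<open>i < D\<close> by (auto simp: walk_inv_def)
  \<comment> \<open>The walk moves strictly upwards, so \<open>a\<close> is not among the vertices
    recorded in this walk and its entry in \<open>cid\<close> is still the old one.\<close>
  have "chv (q * D + j) \<noteq> a" if "j < i" for j
  proof -
    have "(chv (q * D + j), a) \<in> E\<^sup>+" using I that \<open>i < D\<close> by (auto simp: walk_inv_def)
    then have "chv (q * D + j) < a" using trancl_less[of E] lt by blast
    then show ?thesis by simp
  qed
  then have cid: "cid a = cid0 a" using I by (auto simp: walk_inv_def)
  have nxt: "nxv a = 0 \<and> len a = of_bool (cid0 a = 0) \<or>
      (\<exists>b. nxv a = Suc b \<and> (a, b) \<in> E \<and> len a = len b + of_bool (cid0 a = 0))"
    using L a(1) by (auto simp: long_paths_def)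
  {
    assume c: "cid a = 0"
    have nx: "\<exists>b. nxv a = Suc b \<and> (a, b) \<in> E \<and> len a = Suc (len b)" if "Suc i < D"
      using nxt a(2) that c cid by auto
    have "walk_inv E K D q len cid0 chv0 (cid(a := Suc q)) (chv(q * D + i := a)) (Suc i) (nxv a - 1)"
      unfolding walk_inv_def
    proof (intro conjI allI impI)
      show "Suc i \<le> D" using \<open>i < D\<close> by simp
    next
      assume "Suc i < D"
      then show "nxv a - 1 < K" "D \<le> len (nxv a - 1) + Suc i" using nx lt a by auto
    next
      fix j assume j: "j < Suc i"
      show "(chv(q * D + i := a)) (q * D + j) < K" "cid0 ((chv(q * D + i := a)) (q * D + j)) = 0"
        using j I a c cid by (auto simp: walk_inv_def less_Suc_eq)
      assume "Suc i < D"
      then obtain b where b: "nxv a = Suc b" "(a, b) \<in> E" using nx by blast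
      show "((chv(q * D + i := a)) (q * D + j), nxv a - 1) \<in> E\<^sup>+"
      proof (cases "j = i")
        case True
        then show ?thesis using b by auto
      next
        case False
        then have "(chv (q * D + j), a) \<in> E\<^sup>+" using I j \<open>i < D\<close> by (auto simp: walk_inv_def)
        then show ?thesis using b False by (auto intro: trancl_into_trancl)
      qed
    next
      fix j j' assume "j < j'" "j' < Suc i"
      then show "((chv(q * D + i := a)) (q * D + j), (chv(q * D + i := a)) (q * D + j')) \<in> E\<^sup>+"
        using I \<open>i < D\<close> by (cases "j' = i") (auto simp: walk_inv_def)
    next
      fix x
      have "(\<exists>j<Suc i. (chv(q * D + i := a)) (q * D + j) = x) \<longleftrightarrow> x = a \<or> (\<exists>j<i. chv (q * D + j) = x)"
        by (auto simp: less_Suc_eq)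
      then show "(cid(a := Suc q)) x = (if \<exists>j<Suc i. (chv(q * D + i := a)) (q * D + j) = x then Suc q else cid0 x)"
        using I unfolding walk_inv_def by auto
    next
      fix x assume "x < q * D"
      then show "(chv(q * D + i := a)) x = chv0 x" using I by (simp add: walk_inv_def)
    qed
    then show "walk_inv E K D q len cid0 chv0 (cid(a := Suc q)) (chv(q * D + i := a)) (Suc i) (nxv a - 1) \<and>
      (Suc i < D \<longrightarrow> a < nxv a - 1)" using nx lt by auto
  next
    assume c: "cid a \<noteq> 0"
    then obtain b where b: "nxv a = Suc b" "(a, b) \<in> E" "len a = len b"
      using nxt a(2) \<open>i < D\<close> cid by auto
    show "walk_inv E K D q len cid0 chv0 cid chv i (nxv a - 1) \<and> a < nxv a - 1"
      using I b lt[OF b(2)] a unfolding walk_inv_def by (auto intro: trancl_into_trancl)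
  }
qed

lemma walk_end:
  assumes C: "chains E K D q cid0 chv0" and I: "walk_inv E K D q len cid0 chv0 cid chv D a" and D: "0 < D"
  shows "chains E K D (Suc q) cid chv"
proof -
  have split: "x < q * D \<or> (\<exists>j<D. x = q * D + j)" if "x < Suc q * D" for x
  proof (cases "x < q * D")
    case False
    then show ?thesis using that by (intro disjI2 exI[of _ "x - q * D"]) auto
  qed simp
  have dv: "(q * D + j) div D = q" if "j < D" for j using that by simp
  have old: "chv x = chv0 x" if "x < q * D" for x using I that by (simp add: walk_inv_def)
  have cidx: "cid x = (if \<exists>j<D. chv (q * D + j) = x then Suc q else cid0 x)" for x
    using I by (simp add: walk_inv_def)
  have new: "chv (q * D + j) < K" "cid0 (chv (q * D + j)) = 0" "cid (chv (q * D + j)) = Suc q" if "j < D" for j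
    using I that by (auto simp: walk_inv_def)
  show ?thesis
    unfolding chains_def
  proof (intro conjI allI impI)
    fix x assume "x < Suc q * D"
    then consider "x < q * D" | j where "j < D" "x = q * D + j" using split by blast
    then have "chv x < K \<and> cid (chv x) = Suc (x div D)"
    proof cases
      case 1
      then have "chv0 x < K" "cid0 (chv0 x) = Suc (x div D)" using C by (auto simp: chains_def)
      moreover from this(2) have "\<not> (\<exists>j<D. chv (q * D + j) = chv0 x)" using new(2) by force
      ultimately show ?thesis using old[OF 1] cidx by auto
    next
      case 2
      then show ?thesis using new dv by auto
    qed
    then show "chv x < K" "cid (chv x) = Suc (x div D)" by simp_all
  next
    fix x y assume xy: "x < y" "y < Suc q * D" "x div D = y div D"
    consider "y < q * D" | j where "j < D" "y = q * D + j" using split xy(2) by blast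
    then show "(chv x, chv y) \<in> E\<^sup>+"
    proof cases
      case 1
      then show ?thesis using C xy old by (auto simp: chains_def)
    next
      case 2
      then have "x div D = q" using dv xy(3) by simp
      then have "\<not> x < q * D" using D by (metis div_less_iff_less_mult less_irrefl)
      then obtain i where "i < D" "x = q * D + i" using split[of x] xy by auto
      then show ?thesis using I 2 xy(1) by (auto simp: walk_inv_def)
    qed
  next
    fix a assume "cid a \<noteq> 0"
    then consider j where "j < D" "chv (q * D + j) = a" | "cid0 a \<noteq> 0" using cidx by (metis)
    then show "\<exists>x<Suc q * D. chv x = a"
    proof cases
      case 1
      then show ?thesis by (intro exI[of _ "q * D + j"]) auto
    next
      case 2
      moreover have "\<forall>a. cid0 a \<noteq> 0 \<longrightarrow> (\<exists>x<q * D. chv0 x = a)" using C unfolding chains_def by (elim conjE)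
      ultimately obtain x where "x < q * D" "chv0 x = a" by blast
      then show ?thesis using old by (intro exI[of _ x]) auto
    qed
  qed
qed

text \<open>The current vertex increases in every round, so there are at most \<open>K\<close>
  rounds. The potential distinguishes \<open>i < D\<close> because after the last recorded vertex
  ''a'' may hold the default \<open>0 - 1 = 0\<close>.\<close>

lemma W_WALK:
  fixes s :: store
  defines "K \<equiv> var s ''K''" and "D \<equiv> var s ''D''" and "q \<equiv> var s ''Q''"
  assumes C: "chains E K D q (arr s ''cid'') (arr s ''chv'')"
    and L: "long_paths E K (\<lambda>a. of_bool (arr s ''cid'' a = 0)) (arr s ''ln'') (arr s ''nxv'')"
    and lt: "\<forall>(a, b) \<in> E. a < b \<and> b < K" and D: "0 < D"
    and st: "0 < var s ''st''" "var s ''st'' - 1 < K" "D \<le> arr s ''ln'' (var s ''st'' - 1)"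
    and Q: "\<And>t s'. eqx {''a'', ''i'', ''Q''} {''cid'', ''chv''} s s' \<Longrightarrow> var s' ''Q'' = Suc q \<Longrightarrow>
      chains E K D (Suc q) (arr s' ''cid'') (arr s' ''chv'') \<Longrightarrow>
      (\<And>x. arr s' ''cid'' x = 0 \<Longrightarrow> arr s ''cid'' x = 0) \<Longrightarrow> t \<le> 100 * K + 50 \<Longrightarrow> Q t s'"
  shows "W WALK s Q"
  unfolding WALK_def W_Seq W_Assign
proof (rule W_While[where \<mu> = "\<lambda>s'. if var s' ''i'' < D then 80 * (K - var s' ''a'') else 0" and
    I = "\<lambda>s'. walk_inv E K D q (arr s ''ln'') (arr s ''cid'') (arr s ''chv'') (arr s' ''cid'') (arr s' ''chv'')
      (var s' ''i'') (var s' ''a'')"], goal_cases)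
  case 1
  show ?case using st D by (auto simp: walk_inv_def)
next
  case (2 s')
  have fr: "var s' ''D'' = D" "var s' ''Q'' = q" "arr s' ''nxv'' = arr s ''nxv''"
    using 2(1) by (simp_all add: eqx_def D_def q_def)
  have iD: "var s' ''i'' < D" using 2(3) fr by (simp split: if_splits)
  have aK: "var s' ''a'' < K" using 2(2) iD by (simp add: walk_inv_def)
  note st = walk_step[OF 2(2) iD L lt]
  obtain d where d: "K = Suc (var s' ''a'' + d)" using aK less_natE by blast
  show ?case
  proof (cases "arr s' ''cid'' (var s' ''a'') = 0")
    case True
    show ?thesis using st(1)[OF True] True iD d by (auto simp: fr)
  next
    case False
    then show ?thesis using st(2)[OF False] iD d by (auto simp: fr)
  qed
next
  case (3 t s')
  have fr: "var s' ''D'' = D" "var s' ''Q'' = q" using 3(1) by (simp_all add: eqx_def D_def q_def)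
  have i: "var s' ''i'' = D" using 3(2,3) fr by (auto simp: walk_inv_def split: if_splits)
  then have I: "walk_inv E K D q (arr s ''ln'') (arr s ''cid'') (arr s ''chv'') (arr s' ''cid'') (arr s' ''chv'')
      D (var s' ''a'')" using 3(2) by simp
  have "arr s' ''cid'' x = 0 \<Longrightarrow> arr s ''cid'' x = 0" for x
    using I by (auto simp: walk_inv_def split: if_splits)
  then show ?case
    by (intro Q) (use 3 walk_end[OF C I D] fr i in \<open>auto simp: eqx_def split: if_splits\<close>)
qed

definition CHAINS :: com where
  "CHAINS = ''Q'' ::= ll 0 ;;
    For ''r'' (Op Div (vv ''K'') (vv ''D''))
     (LONG ;;
      ''st'' ::= ll 0 ;;
      For ''a'' (vv ''K'') (Cond (Read ''ln'' (vv ''a'') [<] vv ''D'') Skip (''st'' ::= vv ''a'' [+] ll 1)) ;;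
      Cond (vv ''st'') WALK Skip)"

lemma mod_vars_CHAINS [simp]:
  "mod_vars LONG = {''a'', ''b'', ''e''}" "mod_vars WALK = {''a'', ''i'', ''Q''}"
  "mod_vars CHAINS = {''a'', ''b'', ''e'', ''i'', ''Q'', ''r'', ''st''}"
  by (auto simp: LONG_def WALK_def CHAINS_def)

lemma mod_arrs_CHAINS [simp]:
  "mod_arrs LONG = {''ln'', ''nxv''}" "mod_arrs WALK = {''cid'', ''chv''}"
  "mod_arrs CHAINS = {''ln'', ''nxv'', ''cid'', ''chv''}"
  by (auto simp: LONG_def WALK_def CHAINS_def)

text \<open>A round that finds no start vertex certifies that no long chain is left, and this
  remains true when more vertices become used. If every round succeeds, all \<open>K div D\<close>
  chains exist and counting gives the same conclusion.\<close>

lemma W_CHAINS: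
  fixes s :: store
  defines "A \<equiv> arr s ''A''" and "B \<equiv> arr s ''B''" and "m \<equiv> var s ''M''" and "K \<equiv> var s ''K''" and "D \<equiv> var s ''D''"
  defines "E \<equiv> edges A B m"
  assumes d: "dag K A B m" and D: "0 < D" and cid: "\<And>a. arr s ''cid'' a = 0"
    and Q: "\<And>t s'. eqx {''a'', ''b'', ''e'', ''i'', ''Q'', ''r'', ''st''} {''ln'', ''nxv'', ''cid'', ''chv''} s s' \<Longrightarrow>
      chains E K D (var s' ''Q'') (arr s' ''cid'') (arr s' ''chv'') \<Longrightarrow> var s' ''Q'' \<le> K div D \<Longrightarrow>
      no_long_chain E K D (arr s' ''cid'') \<Longrightarrow> t \<le> (K div D) * (400 * (m + K + 1)) + 50 \<Longrightarrow> Q t s'"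
  shows "W CHAINS s Q"
  unfolding CHAINS_def W_Seq W_Assign
proof (rule W_For[where N = "K div D" and T = "300 * (m + K + 1)" and
    I = "\<lambda>k s'. chains E K D (var s' ''Q'') (arr s' ''cid'') (arr s' ''chv'') \<and> var s' ''Q'' \<le> k \<and>
      (var s' ''Q'' < k \<longrightarrow> no_long_chain E K D (arr s' ''cid''))"], goal_cases)
  case 2
  show ?case using cid by (simp add: chains_def)
next
  case (3 s')
  then show ?case by (simp add: eqx_def K_def D_def)
next
  case (4 k s0)
  note I0 = 4(4)
  have fr: "arr s0 ''A'' = A" "arr s0 ''B'' = B" "var s0 ''M'' = m" "var s0 ''K'' = K" "var s0 ''D'' = D"
    using 4(1) by (simp_all add: eqx_def A_def B_def m_def K_def D_def)
  have lt: "\<forall>(a, b) \<in> E. a < b \<and> b < K" using d by (auto simp: E_def edges_def dag_def)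
  show ?case
    unfolding W_Seq
  proof (rule W_LONG, goal_cases)
    case 1 show ?case using d by (simp add: fr)
  next
    case (2 t1 s1)
    note e1 = 2(1) and L1 = 2(2)[unfolded fr, folded E_def] and t1 = 2(3)[unfolded fr]
    have fr1: "var s1 ''K'' = K" "var s1 ''D'' = D" "var s1 ''Q'' = var s0 ''Q''" "arr s1 ''cid'' = arr s0 ''cid''"
      "arr s1 ''chv'' = arr s0 ''chv''" using e1 fr by (simp_all add: eqx_def)
    show ?case
      unfolding W_Assign
    proof (rule W_For[where N = K and T = 20 and I = "\<lambda>k s'. if var s' ''st'' = 0 then \<forall>a<k. arr s1 ''ln'' a < D
        else var s' ''st'' - 1 < K \<and> D \<le> arr s1 ''ln'' (var s' ''st'' - 1)"], goal_cases)
      case (3 s') then show ?case using fr1 by (simp add: eqx_def)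
    next
      case (4 k s')
      have "arr s' ''ln'' = arr s1 ''ln''" "var s' ''D'' = D" using 4(1) fr1 by (simp_all add: eqx_def)
      then show ?case using 4(2-4) by (auto simp: less_Suc_eq split: if_splits)
    next
      case (5 t2 s2)
      note e2 = 5(1) and I2 = 5(2) and t2 = 5(4)
      have fr2: "var s2 ''K'' = K" "var s2 ''D'' = D" "var s2 ''Q'' = var s0 ''Q''" "arr s2 ''cid'' = arr s0 ''cid''"
        "arr s2 ''chv'' = arr s0 ''chv''" "arr s2 ''ln'' = arr s1 ''ln''" "arr s2 ''nxv'' = arr s1 ''nxv''"
        using e2 fr1 by (simp_all add: eqx_def)
      show ?case
      proof (cases "var s2 ''st'' = 0")
        case True
        then have "no_long_chain E K D (arr s0 ''cid'')"
          using I2 by (intro long_paths_no_long_chain[OF L1]) (auto simp: D)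
        then show ?thesis using True t1 t2 I0 by (simp add: fr2)
      next
        case False
        show ?thesis
          unfolding W_Cond using False apply simp
        proof (rule W_WALK[where E = E], goal_cases)
          case (8 t3 s3)
          have "no_long_chain E K D (arr s3 ''cid'')" if "no_long_chain E K D (arr s0 ''cid'')"
            by (rule no_long_chain_antimono[OF that]) (use 8(5) fr2 in simp)
          moreover have "Suc (var s0 ''Q'') \<le> Suc k" "var s0 ''Q'' < k \<Longrightarrow> no_long_chain E K D (arr s0 ''cid'')" using I0 by simp_all
          moreover have "t3 \<le> 100 * K + 50" "var s3 ''Q'' = Suc (var s0 ''Q'')"
            "chains E K D (Suc (var s0 ''Q'')) (arr s3 ''cid'') (arr s3 ''chv'')" using 8(3,4,6) by (simp_all add: fr2)
          ultimately show ?case using t1 t2 by simp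
        qed (use I0 I2 L1 lt D False in \<open>simp_all add: fr2\<close>)
      qed
    qed simp_all
  qed
next
  case (5 t s')
  have lt: "(a, b) \<in> E \<Longrightarrow> a < b" for a b using d by (auto simp: E_def edges_def dag_def)
  show ?case
  proof (rule Q, goal_cases)
    case 4
    show ?case
    proof (cases "var s' ''Q'' = K div D")
      case True
      show ?thesis by (rule chains_full[OF _ lt D]) (use 5(2) True in \<open>simp_all\<close>)
    next
      case False
      then show ?thesis using 5(2) by simp
    qed
  next
    case 5
    have "t \<le> K div D * (300 * (m + K + 1) + 10) + 8" using \<open>t \<le> _\<close> by simp
    also have "\<dots> \<le> (K div D) * (400 * (m + K + 1)) + 40" by (intro add_mono mult_le_mono) auto
    finally show ?case by simp
  qed (use 5 in \<open>auto simp: eqx_def\<close>)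
qed simp

section \<open>Two-hop shortcuts inside the chains\<close>

text \<open>Chain shortcuts become edges of the working graph as well as of the output, because the
  forests have to be shortest with respect to them.\<close>

definition ADDE :: "exp \<Rightarrow> exp \<Rightarrow> com" where
  "ADDE e1 e2 = (''a'' ::= e1 ;; ''b'' ::= e2 ;;
     Write ''A'' (vv ''M'') (vv ''a'') ;; Write ''B'' (vv ''M'') (vv ''b'') ;; ''M'' ::= vv ''M'' [+] ll 1 ;;
     EMIT (Read ''rep'' (vv ''a'' [+] ll 1)) (Read ''rep'' (vv ''b'' [+] ll 1)))"

lemma mod_vars_ADDE [simp]: "mod_vars (ADDE e1 e2) = {''a'', ''b'', ''M'', ''eu'', ''ev'', ''h''}"
  and mod_arrs_ADDE [simp]: "mod_arrs (ADDE e1 e2) = {''A'', ''B'', ''sn'', ''hsrc'', ''hdst''}"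
  by (auto simp: ADDE_def)

lemma W_ADDE:
  assumes "OUT n S s" "ival s e1 = a" "ival (setv s ''a'' a) e2 = b"
    and "arr s ''rep'' (Suc a) < n" "arr s ''rep'' (Suc b) < n"
    and Q: "\<And>t s'. OUT n (insert (arr s ''rep'' (Suc a), arr s ''rep'' (Suc b)) S) s' \<Longrightarrow>
      eqx {''a'', ''b'', ''M'', ''eu'', ''ev'', ''h''} {''A'', ''B'', ''sn'', ''hsrc'', ''hdst''} s s' \<Longrightarrow>
      var s' ''M'' = Suc (var s ''M'') \<Longrightarrow>
      edges (arr s' ''A'') (arr s' ''B'') (var s' ''M'') = insert (a, b) (edges (arr s ''A'') (arr s ''B'') (var s ''M'')) \<Longrightarrow>
      t \<le> exp_cost e1 + exp_cost e2 + 70 \<Longrightarrow> Q t s'"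
  shows "W (ADDE e1 e2) s Q"
proof -
  let ?s = "setv (seta (seta (setv (setv s ''a'' a) ''b'' b) ''A'' (var s ''M'') a) ''B'' (var s ''M'') b) ''M'' (Suc (var s ''M''))"
  show ?thesis
    unfolding ADDE_def using assms(2,3) apply simp
  proof (rule W_EMIT[OF _ refl refl, where n = n and S = S], goal_cases)
    case 1
    show ?case using assms(1) by simp
  next
    case 2 show ?case using assms(4) by simp
  next
    case 3 show ?case using assms(5) by simp
  next
    case (4 t s')
    note 6 = 4
    show ?case
    proof (rule Q, goal_cases)
      case 1 show ?case using 6(3) by simp
    next
      case 2 show ?case using 6(4) by (auto simp: eqx_def)
    next
      case 3 show ?case using 6(4) by (auto simp: eqx_def)
    next
      case 4
      have "arr s' ''A'' = (arr s ''A'')(var s ''M'' := a)" "arr s' ''B'' = (arr s ''B'')(var s ''M'' := b)"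
        "var s' ''M'' = Suc (var s ''M'')" using 6(4) by (auto simp: eqx_def)
      then show ?case by (simp add: edges_Suc edges_upd)
    next
      case 5 show ?case using 6(5) by simp
    qed
  qed
qed

text \<open>For blocks of size \<open>p\<close> inside each chain, \<open>i\<close> is the offset of
  \<open>x\<close> in its chain and \<open>r\<close> the offset at which its block starts. The two
  edges lead from the start of the block to \<open>x\<close> and from \<open>x\<close> to the start
  of the next block.\<close>

definition hops :: "nat \<Rightarrow> (nat \<Rightarrow> nat) \<Rightarrow> nat \<Rightarrow> nat \<Rightarrow> (nat \<times> nat) set" where
  "hops D chv x p = (let i = x mod D; r = i - i mod p in
     (if r < i then {(chv (x - i + r), chv x)} else {}) \<union>
     (if r + p < D then {(chv x, chv (x - i + (r + p)))} else {}))"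

definition chain_hops :: "nat \<Rightarrow> (nat \<Rightarrow> nat) \<Rightarrow> nat \<Rightarrow> (nat \<times> nat) set" where
  "chain_hops D chv l = (\<Union>x<l. \<Union>j\<in>{j. 2 ^ j < D}. hops D chv x (2 ^ j))"

lemma div_mod_block: "x div D = y div D" if "y = x - x mod D + k" "k < D" for x y k D :: nat
proof -
  have "y = (x div D) * D + k" using that by (simp add: minus_mod_eq_div_mult)
  then show ?thesis using that(2) by simp
qed

text \<open>For \<open>i < k\<close> take the largest block size \<open>2 ^ j\<close> for which \<open>i\<close> and \<open>k\<close> lie in different blocks;
  these blocks are adjacent, and the start of the block of \<open>k\<close> is reached from \<open>i\<close> and reaches \<open>k\<close>.\<close>

lemma adjacent_blocks:
  fixes i k :: nat
  assumes "i < k"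
  obtains j where "2 ^ j \<le> k" "k div 2 ^ j = Suc (i div 2 ^ j)"
proof -
  let ?S = "{j. i div 2 ^ j < k div 2 ^ j}"
  have sub: "j < k" if "j \<in> ?S" for j
  proof -
    have "2 ^ j \<le> k" using that by (metis (mono_tags) div_less leI mem_Collect_eq not_less_zero)
    then show ?thesis using less_exp[of j] by linarith
  qed
  then have fin: "finite ?S" by (meson finite_nat_set_iff_bounded)
  moreover have "0 \<in> ?S" using assms by simp
  ultimately have M: "Max ?S \<in> ?S" using Max_in by blast
  define j where "j = Max ?S"
  have 1: "i div 2 ^ j < k div 2 ^ j" using M by (simp add: j_def)
  have "Suc j \<notin> ?S" using fin Max_ge unfolding j_def by (metis Suc_n_not_le_n)
  then have "\<not> i div 2 ^ j div 2 < k div 2 ^ j div 2" by (simp add: power_Suc2 div_mult2_eq del: power_Suc)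
  then have "k div 2 ^ j = Suc (i div 2 ^ j)" using 1 by linarith
  moreover have "2 ^ j \<le> k" using 1 by (metis div_less leI not_less_zero)
  ultimately show ?thesis using that by blast
qed

lemma chain_hops_two:
  assumes xy: "x < y" "y < l" "x div D = y div D" and D: "0 < D"
  shows "\<exists>z. (chv x, z) \<in> chain_hops D chv l \<and> (z = chv y \<or> (z, chv y) \<in> chain_hops D chv l)"
proof -
  define q i k where "q = x div D" and "i = x mod D" and "k = y mod D"
  have x: "x = q * D + i" and y: "y = q * D + k"
    using div_mult_mod_eq[of x D] div_mult_mod_eq[of y D] unfolding q_def i_def k_def xy(3)[symmetric] by linarith+
  have ik: "i < k" using xy(1) x y by linarith
  have kD: "k < D" using D by (simp add: k_def)
  note ik = ik kD
  obtain j where j: "2 ^ j \<le> k" "k div 2 ^ j = Suc (i div 2 ^ j)" using adjacent_blocks[OF ik(1)] by blast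
  define p :: nat where "p = 2 ^ j"
  have p: "0 < p" "p < D" using j ik by (simp_all add: p_def)
  have c: "i - i mod p + p = k - k mod p"
    using j(2) by (simp add: p_def minus_mod_eq_div_mult)
  define z where "z = chv (q * D + (k - k mod p))"
  have jD: "j \<in> {j. 2 ^ j < D}" using p by (simp add: p_def)
  have xm: "x mod D = i" "x - i = q * D" "y mod D = k" "y - k = q * D" using x y ik by auto
  have "(chv x, z) \<in> hops D chv x p"
    unfolding hops_def Let_def xm using c ik by (simp add: z_def)
  moreover have "z = chv y \<or> (z, chv y) \<in> hops D chv y p"
  proof (cases "k mod p = 0")
    case True
    then show ?thesis by (simp add: z_def y)
  next
    case False
    then have "k - k mod p < k" using ik by simp
    then show ?thesis unfolding hops_def Let_def xm by (simp add: z_def)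
  qed
  moreover have "hops D chv v p \<subseteq> chain_hops D chv l" if "v < l" for v
    using that jD unfolding chain_hops_def p_def by blast
  ultimately show ?thesis using xy(1,2) by (metis less_trans subsetD)
qed

lemma hops_chain:
  assumes C: "chains E K D q cid chv" and x: "x < q * D" and p: "0 < p" and ab: "(a, b) \<in> hops D chv x p"
  shows "(a, b) \<in> E\<^sup>+ \<and> a < K \<and> b < K"
proof -
  have D: "0 < D" using x by (cases D) auto
  define i r where "i = x mod D" and "r = i - i mod p"
  have i: "i < D" "i \<le> x" using D by (simp_all add: i_def)
  have block: "x - i + k < q * D \<and> (x - i + k) div D = x div D" if "k < D" for k
  proof -
    have dv: "(x - i + k) div D = x div D" using div_mod_block[of "x - i + k" x D k] that by (simp add: i_def)
    moreover have "x div D < q" using x D by (simp add: div_less_iff_less_mult)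
    ultimately show ?thesis using D by (metis div_less_iff_less_mult)
  qed
  have ord: "(chv u, chv v) \<in> E\<^sup>+ \<and> chv u < K \<and> chv v < K" if "u < v" "v < q * D" "u div D = v div D" for u v
    using C that by (auto simp: chains_def)
  consider "r < i" "a = chv (x - i + r)" "b = chv x" | "r + p < D" "a = chv x" "b = chv (x - i + (r + p))"
    using ab by (auto simp: hops_def Let_def i_def r_def split: if_splits)
  then show ?thesis
  proof cases
    case 1
    then show ?thesis using ord[of "x - i + r" x] block[of r] i x by simp
  next
    case 2
    have "i mod p < p" using p by simp
    then have "i < r + p" unfolding r_def by arith
    then show ?thesis using 2 ord[of x "x - i + (r + p)"] block[of "r + p"] i by simp
  qed
qed

lemma chain_hops_sub:
  assumes "chains E K D q cid chv"
  shows "chain_hops D chv (q * D) \<subseteq> E\<^sup>+ \<inter> {..<K} \<times> {..<K}"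
proof
  fix e assume "e \<in> chain_hops D chv (q * D)"
  then obtain x j where x: "x < q * D" "e \<in> hops D chv x (2 ^ j)" unfolding chain_hops_def by blast
  obtain a b where "e = (a, b)" by (cases e)
  then show "e \<in> E\<^sup>+ \<inter> {..<K} \<times> {..<K}" using hops_chain[OF assms x(1), of "2 ^ j" a b] x(2) by simp
qed

text \<open>The sum of a variable with itself has no growth bound, so doubling \<open>p\<close> is
  written as the minimum of \<open>p + p\<close> and \<open>D\<close> in the form that
  \<open>growth\<close> recognises.\<close>

definition H1 :: com where
  "H1 = For ''x'' (vv ''Q'' [*] vv ''D'')
    (''p'' ::= ll 1 ;; ''j'' ::= ll 0 ;;
     While (vv ''p'' [<] vv ''D'')
       (''i'' ::= Op Mod (vv ''x'') (vv ''D'') ;;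
        ''r'' ::= vv ''i'' [-] Op Mod (vv ''i'') (vv ''p'') ;;
        Cond (vv ''r'' [<] vv ''i'')
          (ADDE (Read ''chv'' (vv ''x'' [-] vv ''i'' [+] vv ''r'')) (Read ''chv'' (vv ''x''))) Skip ;;
        Cond ((vv ''r'' [+] vv ''p'') [<] vv ''D'')
          (ADDE (Read ''chv'' (vv ''x'')) (Read ''chv'' (vv ''x'' [-] vv ''i'' [+] (vv ''r'' [+] vv ''p'')))) Skip ;;
        ''p'' ::= (vv ''p'' [+] vv ''p'') [-] ((vv ''p'' [+] vv ''p'') [-] vv ''D'') ;;
        ''j'' ::= vv ''j'' [+] ll 1))"

definition rep_image :: "(nat \<Rightarrow> nat) \<Rightarrow> (nat \<times> nat) set \<Rightarrow> (nat \<times> nat) set" where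
  "rep_image rep X = (\<lambda>(a, b). (rep (Suc a), rep (Suc b))) ` X"

lemma rep_image_simps [simp]:
  "rep_image rep {} = {}" "rep_image rep (insert (a, b) X) = insert (rep (Suc a), rep (Suc b)) (rep_image rep X)"
  "rep_image rep (X \<union> Y) = rep_image rep X \<union> rep_image rep Y"
  by (auto simp: rep_image_def)

lemma min_double: "min (2 ^ j) D + min (2 ^ j) D - (min (2 ^ j) D + min (2 ^ j) D - D) = min (2 ^ Suc j) (D :: nat)"
  by (auto simp: min_def)

lemma W_H1:
  fixes s :: store
  defines "D \<equiv> var s ''D''" and "q \<equiv> var s ''Q''" and "chv \<equiv> arr s ''chv''" and "rep \<equiv> arr s ''rep''" and "M \<equiv> var s ''M''"
  defines "E \<equiv> edges (arr s ''A'') (arr s ''B'') M"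
  assumes C: "chains E K D q cid chv" and OUT: "OUT n S s" and rep: "\<And>a. a < K \<Longrightarrow> rep (Suc a) < n" and lam: "D \<le> 2 ^ l"
    and Q: "\<And>t s'. eqx {''x'', ''p'', ''j'', ''i'', ''r'', ''a'', ''b'', ''M'', ''eu'', ''ev'', ''h''} {''A'', ''B'', ''sn'', ''hsrc'', ''hdst''} s s' \<Longrightarrow>
      edges (arr s' ''A'') (arr s' ''B'') (var s' ''M'') = E \<union> chain_hops D chv (q * D) \<Longrightarrow>
      var s' ''M'' \<le> M + 2 * l * (q * D) \<Longrightarrow>
      OUT n (S \<union> rep_image rep (chain_hops D chv (q * D))) s' \<Longrightarrow> t \<le> 500 * (q * D) * (l + 1) + 50 \<Longrightarrow> Q t s'"
  shows "W H1 s Q"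
  unfolding H1_def
proof (rule W_For[where N = "q * D" and T = "400 * l + 20" and
    I = "\<lambda>k s'. edges (arr s' ''A'') (arr s' ''B'') (var s' ''M'') = E \<union> chain_hops D chv k \<and>
      var s' ''M'' \<le> M + 2 * l * k \<and> OUT n (S \<union> rep_image rep (chain_hops D chv k)) s'"], goal_cases)
  case 2
  show ?case using OUT by (simp add: chain_hops_def E_def M_def)
next
  case (3 s')
  then show ?case by (simp add: eqx_def q_def D_def)
next
  case (4 k s0)
  note e0 = 4(1) and I0 = 4(4) and kq = 4(3)
  have fr0: "var s0 ''D'' = D" "arr s0 ''chv'' = chv" "arr s0 ''rep'' = rep" "var s0 ''x'' = k"
    using 4(1,2) by (simp_all add: eqx_def chv_def rep_def D_def)
  let ?X = "\<lambda>j. chain_hops D chv k \<union> (\<Union>j'\<in>{j'. j' < j \<and> 2 ^ j' < D}. hops D chv k (2 ^ j'))"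
  have hlt: "a < K \<and> b < K" if "(a, b) \<in> hops D chv k p" "0 < p" for a b p
    using hops_chain[OF C kq that(2,1)] by simp
  show ?case
    unfolding W_Seq W_Assign
  proof (rule W_While[where \<mu> = "\<lambda>s'. 400 * (l - var s' ''j'')" and
      I = "\<lambda>s'. var s' ''p'' = min (2 ^ var s' ''j'') D \<and> var s' ''j'' \<le> l \<and>
        edges (arr s' ''A'') (arr s' ''B'') (var s' ''M'') = E \<union> ?X (var s' ''j'') \<and>
        var s' ''M'' \<le> M + 2 * l * k + 2 * var s' ''j'' \<and> OUT n (S \<union> rep_image rep (?X (var s' ''j''))) s'"], goal_cases)
    case 1
    have "0 < D" using kq by (cases D) auto
    then show ?case using I0 by simp
  next
    case (2 s1)
    define j where "j = var s1 ''j''"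
    have fr1: "var s1 ''D'' = D" "arr s1 ''chv'' = chv" "arr s1 ''rep'' = rep" "var s1 ''x'' = k"
      using 2(1) fr0 by (simp_all add: eqx_def)
    have lt: "2 ^ j < D" and p: "var s1 ''p'' = 2 ^ j" using 2(2,3) fr1 by (auto simp: j_def split: if_splits)
    have jl: "j < l"
    proof (rule ccontr)
      assume "\<not> j < l"
      then have "(2::nat) ^ l \<le> 2 ^ j" by (intro power_increasing) auto
      then show False using lt lam by linarith
    qed
    define i r where "i = k mod D" and "r = i - i mod 2 ^ j"
    define H where "H = hops D chv k (2 ^ j)"
    define Y1 where "Y1 = (if r < i then {(chv (k - i + r), chv k)} else {})"
    define Y2 where "Y2 = (if r + 2 ^ j < D then {(chv k, chv (k - i + (r + 2 ^ j)))} else {})"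
    have H: "H = Y1 \<union> Y2" unfolding H_def hops_def Let_def Y1_def Y2_def i_def r_def by simp
    have XS: "?X (Suc j) = ?X j \<union> Y1 \<union> Y2"
    proof -
      have "{j'. j' < Suc j \<and> 2 ^ j' < D} = insert j {j'. j' < j \<and> 2 ^ j' < D}" using lt by auto
      then have "?X (Suc j) = ?X j \<union> H" unfolding H_def by auto
      then show ?thesis using H by auto
    qed
    have Y1lt: "a < K \<and> b < K" if "(a, b) \<in> Y1" for a b using hlt[of a b "2 ^ j"] that H unfolding H_def by auto
    have Y2lt: "a < K \<and> b < K" if "(a, b) \<in> Y2" for a b using hlt[of a b "2 ^ j"] that H unfolding H_def by auto
    let ?s1 = "setv (setv s1 ''i'' i) ''r'' r"
    define R2 where "R2 = (\<lambda>s2 (Q :: nat \<Rightarrow> store \<Rightarrow> bool). W (Cond ((vv ''r'' [+] vv ''p'') [<] vv ''D'')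
          (ADDE (Read ''chv'' (vv ''x'')) (Read ''chv'' (vv ''x'' [-] vv ''i'' [+] (vv ''r'' [+] vv ''p'')))) Skip) s2 Q)"
    let ?V = "{''a'', ''b'', ''M'', ''eu'', ''ev'', ''h''}" and ?W = "{''A'', ''B'', ''sn'', ''hsrc'', ''hdst''}"
    have step2: "R2 s2 (\<lambda>t s3. eqx ?V ?W s2 s3 \<and>
        edges (arr s3 ''A'') (arr s3 ''B'') (var s3 ''M'') = edges (arr s2 ''A'') (arr s2 ''B'') (var s2 ''M'') \<union> Y2 \<and>
        var s3 ''M'' \<le> Suc (var s2 ''M'') \<and> OUT n (S' \<union> rep_image rep Y2) s3 \<and> t \<le> 130)"
      if "eqx ?V ?W ?s1 s2" "OUT n S' s2" for s2 S'
    proof -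
      have f: "var s2 ''D'' = D" "arr s2 ''chv'' = chv" "arr s2 ''rep'' = rep" "var s2 ''x'' = k" "var s2 ''p'' = 2 ^ j"
        "var s2 ''i'' = i" "var s2 ''r'' = r" using that(1) fr1 p by (simp_all add: eqx_def)
      show ?thesis
      proof (cases "r + 2 ^ j < D")
        case True
        then have Y2: "Y2 = {(chv k, chv (k - i + (r + 2 ^ j)))}" by (simp add: Y2_def)
        show ?thesis unfolding R2_def W_Cond using True f(1,5,7) apply simp
        proof (rule W_ADDE[OF that(2) refl refl], goal_cases)
          case 1 then show ?case using Y2lt rep Y2 by (simp add: f)
        next
          case 2 then show ?case using Y2lt rep Y2 by (simp add: f)
        next
          case (3 t s3)
          show ?case using 3 by (simp add: f Y2)
        qed
      next
        case False
        then show ?thesis unfolding R2_def using that f by (simp add: Y2_def)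
      qed
    qed
    have step1: "W (Cond (vv ''r'' [<] vv ''i'')
          (ADDE (Read ''chv'' (vv ''x'' [-] vv ''i'' [+] vv ''r'')) (Read ''chv'' (vv ''x''))) Skip) ?s1 (\<lambda>t s3. eqx ?V ?W ?s1 s3 \<and>
        edges (arr s3 ''A'') (arr s3 ''B'') (var s3 ''M'') = edges (arr s1 ''A'') (arr s1 ''B'') (var s1 ''M'') \<union> Y1 \<and>
        var s3 ''M'' \<le> Suc (var s1 ''M'') \<and> OUT n (S \<union> rep_image rep (?X j) \<union> rep_image rep Y1) s3 \<and> t \<le> 130)"
    proof (cases "r < i")
      case True
      then have Y1: "Y1 = {(chv (k - i + r), chv k)}" by (simp add: Y1_def)
      have O1: "OUT n (S \<union> rep_image rep (?X j)) ?s1" using 2(2) by (simp add: j_def)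
      show ?thesis unfolding W_Cond using True apply simp
      proof (rule W_ADDE[OF O1 refl refl], goal_cases)
        case 1 then show ?case using Y1lt rep Y1 by (simp add: fr1)
      next
        case 2 then show ?case using Y1lt rep Y1 by (simp add: fr1)
      next
        case (3 t s3)
        show ?case using 3 by (simp add: fr1 Y1)
      qed
    next
      case False
      then show ?thesis using 2(2) by (simp add: Y1_def j_def)
    qed
    have s1: "setv (setv s1 ''i'' (ival s1 (Op Mod (vv ''x'') (vv ''D'')))) ''r''
        (ival (setv s1 ''i'' (ival s1 (Op Mod (vv ''x'') (vv ''D'')))) (vv ''i'' [-] Op Mod (vv ''i'') (vv ''p''))) = ?s1"
      by (simp add: fr1 p i_def r_def)
    show ?case
      unfolding W_Seq W_Assign s1
    proof (rule W_eqx[OF step1], goal_cases)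
      case (1 t2 s2)
      note a2 = 1(2)
      have e2: "eqx ?V ?W ?s1 s2" and O2: "OUT n (S \<union> rep_image rep (?X j) \<union> rep_image rep Y1) s2"
        using a2 by blast+
      show ?case
      proof (rule W_eqx[OF step2[OF e2 O2, unfolded R2_def]], goal_cases)
        case (1 t3 s3)
        note a3 = 1(2)
        have f3: "var s3 ''p'' = 2 ^ j" "var s3 ''j'' = j" "var s3 ''D'' = D"
          using a2 a3 p fr1 by (simp_all add: eqx_def j_def)
        have ed: "edges (arr s3 ''A'') (arr s3 ''B'') (var s3 ''M'') = E \<union> ?X (Suc j)"
          unfolding XS using a2 a3 2(2) by (simp add: j_def Un_assoc)
        have out: "OUT n (S \<union> rep_image rep (?X (Suc j))) s3"
          unfolding XS using a3 by (simp add: Un_assoc)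
        have Mb: "var s3 ''M'' \<le> M + 2 * l * k + 2 * Suc j"
          using a2 a3 2(2) by (simp add: j_def)
        have pd: "2 ^ j + 2 ^ j - (2 ^ j + 2 ^ j - D) = min (2 ^ Suc j) D"
          using min_double[of j D] lt by (simp add: min_def)
        obtain d where d: "l = Suc (j + d)" using jl less_natE by blast
        have "t2 \<le> 130" "t3 \<le> 130" using a2 a3 by blast+
        then show ?case using ed out Mb pd jl f3 by (simp add: d flip: j_def)
      qed
    qed
  next
    case (3 t s1)
    have f1: "var s1 ''D'' = D" "var s1 ''x'' = k" using 3(1) fr0 by (simp_all add: eqx_def)
    have ge: "D \<le> 2 ^ var s1 ''j''" using 3(2,3) f1 by (auto split: if_splits)
    have "{j'. j' < var s1 ''j'' \<and> 2 ^ j' < D} = {j'. 2 ^ j' < D}"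
    proof (intro Collect_cong iffI)
      fix j' :: nat assume "2 ^ j' < D"
      then have "(2::nat) ^ j' < 2 ^ var s1 ''j''" using ge by linarith
      then show "j' < var s1 ''j'' \<and> 2 ^ j' < D" using \<open>2 ^ j' < D\<close> by simp
    qed simp
    then have X: "?X (var s1 ''j'') = chain_hops D chv (Suc k)"
      by (auto simp: chain_hops_def lessThan_Suc)
    have "t \<le> 400 * l + 4" using 3(4) by simp
    then show ?case using 3(2) X by simp
  qed
next
  case (5 t s')
  show ?case
  proof (rule Q, goal_cases)
    case 1
    show ?case using 5(1) by (simp add: insert_commute)
  next
    case 5
    have "t \<le> q * D * (400 * l + 30) + 8" using \<open>t \<le> _\<close> by (simp add: add.commute)
    also have "\<dots> \<le> 500 * (q * D) * (l + 1) + 50" by (simp add: algebra_simps)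
    finally show ?case .
  qed (use 5 in auto)
qed auto

section \<open>Adding a reversed copy of the graph\<close>

text \<open>In the reversed copy, forests towards chains are forests from chains to the original vertices, so
  one routine serves both directions and hits windows of both kinds with the same set of chains.\<close>

definition mirror :: "nat \<Rightarrow> nat \<Rightarrow> nat" where
  "mirror K a = 2 * K - 1 - a"

definition double_edges :: "nat \<Rightarrow> (nat \<times> nat) set \<Rightarrow> (nat \<times> nat) set" where
  "double_edges K E = E \<union> (\<lambda>(a, b). (mirror K b, mirror K a)) ` E"

definition double_cid :: "nat \<Rightarrow> (nat \<Rightarrow> nat) \<Rightarrow> nat \<Rightarrow> nat" where
  "double_cid K cid a = (if K \<le> a \<and> a < 2 * K then cid (mirror K a) else cid a)"

text \<open>The table is reversed as a whole, so that the mirrored chains run forward too; chain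
  \<open>c\<close> reappears as row \<open>2 * q - 1 - c\<close>.\<close>

definition double_chv :: "nat \<Rightarrow> nat \<Rightarrow> (nat \<Rightarrow> nat) \<Rightarrow> nat \<Rightarrow> nat" where
  "double_chv K l chv x = (if l \<le> x \<and> x < 2 * l then mirror K (chv (2 * l - 1 - x)) else chv x)"

text \<open>''KK'' is counted up one by one instead of being computed as a product, because stored
  values may grow only by constants. Reversing an edge and mirroring both ends preserves that edges
  lead upwards.\<close>

definition DOUBLE :: com where
  "DOUBLE = ''KK'' ::= vv ''K'' ;; For ''i'' (vv ''K'') (''KK'' ::= vv ''KK'' [+] ll 1) ;;
    ''M0'' ::= vv ''M'' ;;
    For ''e'' (vv ''M0'')
      (Write ''A'' (vv ''M'') (vv ''KK'' [-] ll 1 [-] Read ''B'' (vv ''e'')) ;;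
       Write ''B'' (vv ''M'') (vv ''KK'' [-] ll 1 [-] Read ''A'' (vv ''e'')) ;;
       ''M'' ::= vv ''M'' [+] ll 1) ;;
    For ''a'' (vv ''K'') (Write ''cid'' (vv ''KK'' [-] ll 1 [-] vv ''a'') (Read ''cid'' (vv ''a''))) ;;
    For ''x'' (vv ''Q'' [*] vv ''D'')
      (Write ''chv'' (ll 2 [*] (vv ''Q'' [*] vv ''D'') [-] ll 1 [-] vv ''x'') (vv ''KK'' [-] ll 1 [-] Read ''chv'' (vv ''x'')))"

lemma mod_DOUBLE [simp]:
  "mod_vars DOUBLE = {''KK'', ''i'', ''M0'', ''e'', ''M'', ''a'', ''x''}" "mod_arrs DOUBLE = {''A'', ''B'', ''cid'', ''chv''}"
  by (auto simp: DOUBLE_def)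

lemma W_DOUBLE:
  fixes s :: store
  defines "D \<equiv> var s ''D''" and "q \<equiv> var s ''Q''" and "chv \<equiv> arr s ''chv''" and "cid \<equiv> arr s ''cid''" and
    "M \<equiv> var s ''M''" and "K \<equiv> var s ''K''"
  defines "E \<equiv> edges (arr s ''A'') (arr s ''B'') M"
  assumes Q: "\<And>t s'. eqx {''KK'', ''i'', ''M0'', ''e'', ''M'', ''a'', ''x''} {''A'', ''B'', ''cid'', ''chv''} s s' \<Longrightarrow>
      var s' ''KK'' = 2 * K \<Longrightarrow> var s' ''M'' = 2 * M \<Longrightarrow>
      edges (arr s' ''A'') (arr s' ''B'') (2 * M) = double_edges K E \<Longrightarrow>
      arr s' ''cid'' = double_cid K cid \<Longrightarrow> arr s' ''chv'' = double_chv K (q * D) chv \<Longrightarrow>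
      t \<le> 100 * (K + M + q * D) + 100 \<Longrightarrow> Q t s'"
  shows "W DOUBLE s Q"
  unfolding DOUBLE_def W_Seq W_Assign
proof (rule W_For[where N = K and T = 10 and I = "\<lambda>k s'. var s' ''KK'' = K + k"], goal_cases)
  case (4 k s') then show ?case by simp
next
  case (5 t1 s1)
  note e1 = 5(1) and t1 = 5(4)
  have f1: "var s1 ''KK'' = 2 * K" "var s1 ''K'' = K" "var s1 ''M'' = M" "var s1 ''D'' = D" "var s1 ''Q'' = q"
    "arr s1 ''A'' = arr s ''A''" "arr s1 ''B'' = arr s ''B''" "arr s1 ''cid'' = cid" "arr s1 ''chv'' = chv"
    using 5(1,2) by (simp_all add: eqx_def K_def M_def D_def q_def cid_def chv_def)
  show ?case
  proof (rule W_For[where N = M and T = 40 and I = "\<lambda>k s'. var s' ''M'' = M + k \<and>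
      (\<forall>e<M. arr s' ''A'' e = arr s ''A'' e \<and> arr s' ''B'' e = arr s ''B'' e) \<and>
      (\<forall>e<k. arr s' ''A'' (M + e) = mirror K (arr s ''B'' e) \<and> arr s' ''B'' (M + e) = mirror K (arr s ''A'' e))"], goal_cases)
    case (3 s') then show ?case using f1 by (simp add: eqx_def)
  next
    case (4 k s')
    have "var s' ''KK'' = 2 * K" using 4(1) f1 by (simp add: eqx_def)
    then show ?case using 4(2-4) by (auto simp: less_Suc_eq mirror_def)
  next
    case (5 t2 s2)
    note e2 = 5(1) and t2 = 5(4) and I2 = 5(2)
    have f2: "var s2 ''KK'' = 2 * K" "var s2 ''K'' = K" "var s2 ''D'' = D" "var s2 ''Q'' = q" "var s2 ''M'' = 2 * M"
      "arr s2 ''cid'' = cid" "arr s2 ''chv'' = chv"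
      using 5(1,2) f1 by (simp_all add: eqx_def)
    have ed: "edges (arr s2 ''A'') (arr s2 ''B'') (2 * M) = double_edges K E"
    proof -
      have "{..<2 * M} = {..<M} \<union> (+) M ` {..<M}"
      proof (intro set_eqI iffI)
        fix x assume x: "x \<in> {..<2 * M}"
        show "x \<in> {..<M} \<union> (+) M ` {..<M}"
        proof (cases "x < M")
          case False
          then show ?thesis using x by (intro UnI2 image_eqI[of _ _ "x - M"]) auto
        qed simp
      qed auto
      then have "edges (arr s2 ''A'') (arr s2 ''B'') (2 * M) =
          (\<lambda>e. (arr s2 ''A'' e, arr s2 ''B'' e)) ` {..<M} \<union> (\<lambda>e. (arr s2 ''A'' (M + e), arr s2 ''B'' (M + e))) ` {..<M}"
        by (simp add: edges_def image_Un image_image)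
      also have "\<dots> = double_edges K E"
        unfolding double_edges_def E_def edges_def image_image
        by (intro arg_cong2[of _ _ _ _ "(\<union>)"] image_cong) (use I2 in auto)
      finally show ?thesis .
    qed
    show ?case
    proof (rule W_For[where N = K and T = 20 and I = "\<lambda>k s'. arr s' ''cid'' =
        (\<lambda>a. if 2 * K - k \<le> a \<and> a < 2 * K then cid (mirror K a) else cid a)"], goal_cases)
      case 2 show ?case using f2 by (auto simp: mirror_def)
    next
      case (3 s') then show ?case using f2 by (simp add: eqx_def)
    next
      case (4 k s')
      have "var s' ''KK'' = 2 * K" using 4(1) f2 by (simp add: eqx_def)
      then show ?case using 4(2-4) by (auto simp: mirror_def fun_eq_iff)
    next
      case (5 t3 s3)
      note e3 = 5(1) and t3 = 5(4) and I3 = 5(2)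
      have f3: "var s3 ''KK'' = 2 * K" "var s3 ''D'' = D" "var s3 ''Q'' = q" "arr s3 ''chv'' = chv"
        "var s3 ''M'' = 2 * M" "arr s3 ''A'' = arr s2 ''A''" "arr s3 ''B'' = arr s2 ''B''"
        using e3 f2 by (simp_all add: eqx_def)
      show ?case
      proof (rule W_For[where N = "q * D" and T = 40 and I = "\<lambda>k s'. arr s' ''chv'' =
          (\<lambda>x. if 2 * (q * D) - k \<le> x \<and> x < 2 * (q * D) then mirror K (chv (2 * (q * D) - 1 - x)) else chv x)"], goal_cases)
        case 2 show ?case using f3 by (auto)
      next
        case (3 s') then show ?case using f3 by (simp add: eqx_def)
      next
        case (4 k s')
        have "var s' ''KK'' = 2 * K" "var s' ''D'' = D" "var s' ''Q'' = q" using 4(1) f3 by (simp_all add: eqx_def)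
        then show ?case using 4(2-4) by (auto simp: mirror_def fun_eq_iff)
      next
        case (5 t4 s4)
        show ?case
        proof (rule Q, goal_cases)
          case 1 show ?case using e1 e2 e3 5(1) by (auto simp: eqx_def)
        next
          case 2 show ?case using 5(1) f3 by (simp add: eqx_def)
        next
          case 3 show ?case using 5(1) f3 by (simp add: eqx_def)
        next
          case 4 show ?case using 5(1) f3 ed by (simp add: eqx_def)
        next
          case 5
          have "arr s4 ''cid'' = arr s3 ''cid''" using \<open>eqx _ _ s3 s4\<close> by (simp add: eqx_def)
          then show ?case using I3 by (auto simp: double_cid_def fun_eq_iff)
        next
          case 6
          have h: "2 * (q * D) - q * D = q * D" by simp
          show ?case using 5(2) unfolding h double_chv_def by simp
        next
          case 7 show ?case using t1 t2 t3 \<open>t4 \<le> _\<close> by simp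
        qed
      qed auto
    qed auto
  qed (use f1 in auto)
qed (auto simp: eqx_def K_def)

section \<open>Shortest path forests towards the chains\<close>

text \<open>\<open>f a = D - i\<close> where \<open>rt i\<close> is the first vertex of the chain reachable from \<open>a\<close> (\<open>f a = 0\<close> if there is none),
  \<open>d a\<close> is the distance from \<open>a\<close> to it and \<open>p a\<close> the next vertex on the way. The distances are minimal because
  \<open>d a \<le> Suc (d b)\<close> on every edge preserving \<open>f\<close>.\<close>

definition forest_to_chain :: "(nat \<times> nat) set \<Rightarrow> nat \<Rightarrow> nat \<Rightarrow> (nat \<Rightarrow> nat) \<Rightarrow> (nat \<Rightarrow> nat) \<Rightarrow> (nat \<Rightarrow> nat) \<Rightarrow> (nat \<Rightarrow> nat) \<Rightarrow> bool" where
  "forest_to_chain E K D rt f d p \<longleftrightarrow>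
     (\<forall>i<D. D - i \<le> f (rt i)) \<and>
     (\<forall>(a, b)\<in>E. f b \<le> f a \<and> (f a = f b \<longrightarrow> 0 < f b \<longrightarrow> d a \<le> Suc (d b))) \<and>
     (\<forall>a<K. f a \<le> D \<and> (f a = 0 \<longrightarrow> d a = 0) \<and> (0 < f a \<longrightarrow> d a = 0 \<and> rt (D - f a) = a \<or>
       (d a = Suc (d (p a)) \<and> (a, p a) \<in> E \<and> f (p a) = f a)))"

lemma forest_to_chain_init:
  assumes "\<And>i. i < D \<Longrightarrow> f (rt i) = D - i" "\<And>a. a \<notin> rt ` {..<D} \<Longrightarrow> f a = 0"
  shows "forest_to_chain {} K D rt f (\<lambda>_. 0) p"
  unfolding forest_to_chain_def
proof (intro conjI allI impI ballI)
  fix a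
  consider i where "i < D" "a = rt i" | "f a = 0" using assms(2)[of a] by (cases "a \<in> rt ` {..<D}") auto
  then show "f a \<le> D" by cases (use assms(1) in auto)
  assume "0 < f a"
  then obtain i where "i < D" "a = rt i" using assms(2)[of a] by fastforce
  then show "0 = 0 \<and> rt (D - f a) = a \<or> (0 = Suc 0 \<and> (a, p a) \<in> {} \<and> f (p a) = f a)"
    using assms(1)[of i] by simp
qed (use assms in auto)

text \<open>Relaxation is lexicographic: an earlier target on the chain takes precedence over a
  smaller distance. As no earlier edge ends in \<open>A k\<close>, only the conditions on edges out
  of \<open>A k\<close> have to be checked again.\<close>

lemma forest_to_chain_step:
  assumes T: "forest_to_chain (edges A B k) K D rt f d p" and dag: "dag K A B m" "k < m"
  shows "\<not> (f (A k) < f (B k) \<or> f (A k) = f (B k) \<and> Suc (d (B k)) < d (A k)) \<Longrightarrow>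
      forest_to_chain (edges A B (Suc k)) K D rt f d p"
    and "f (A k) < f (B k) \<or> f (A k) = f (B k) \<and> Suc (d (B k)) < d (A k) \<Longrightarrow>
      forest_to_chain (edges A B (Suc k)) K D rt (f(A k := f (B k))) (d(A k := Suc (d (B k)))) (p(A k := B k))"
proof -
  have lt: "A k < B k" "B k < K" using dag by (auto simp: dag_def)
  have ne: "b \<noteq> A k" if ab: "(a, b) \<in> edges A B k" for a b
  proof -
    obtain e where e: "e < k" "a = A e" "b = B e" using ab by (auto simp: edges_def)
    then have "A k \<le> A e" "A e < B e" using dag by (auto simp: dag_def sorted_desc_def)
    then show ?thesis using e by simp
  qed
  have T2: "f b \<le> f a \<and> (f a = f b \<longrightarrow> 0 < f b \<longrightarrow> d a \<le> Suc (d b))" if "(a, b) \<in> edges A B k" for a b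
    using T that by (auto simp: forest_to_chain_def)
  have T3: "f a \<le> D \<and> (f a = 0 \<longrightarrow> d a = 0) \<and> (0 < f a \<longrightarrow> d a = 0 \<and> rt (D - f a) = a \<or>
       (d a = Suc (d (p a)) \<and> (a, p a) \<in> edges A B k \<and> f (p a) = f a))" if "a < K" for a
    using T that by (auto simp: forest_to_chain_def)
  show "forest_to_chain (edges A B (Suc k)) K D rt f d p"
    if "\<not> (f (A k) < f (B k) \<or> f (A k) = f (B k) \<and> Suc (d (B k)) < d (A k))"
    using T that unfolding forest_to_chain_def edges_Suc by auto
  assume c: "f (A k) < f (B k) \<or> f (A k) = f (B k) \<and> Suc (d (B k)) < d (A k)"
  let ?f = "f(A k := f (B k))" and ?d = "d(A k := Suc (d (B k)))" and ?p = "p(A k := B k)"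
  have pos: "0 < f (B k)" using c T3[of "A k"] lt by auto
  have fle: "f a \<le> ?f a" for a using c by auto
  show "forest_to_chain (edges A B (Suc k)) K D rt ?f ?d ?p"
    unfolding forest_to_chain_def
  proof (intro conjI allI impI ballI)
    fix i assume "i < D"
    then have "D - i \<le> f (rt i)" using T by (auto simp: forest_to_chain_def)
    then show "D - i \<le> ?f (rt i)" using fle le_trans by blast
  next
    fix e assume e: "e \<in> edges A B (Suc k)"
    obtain a b where ab: "e = (a, b)" by (cases e)
    have "?f b \<le> ?f a \<and> (?f a = ?f b \<longrightarrow> 0 < ?f b \<longrightarrow> ?d a \<le> Suc (?d b))"
    proof (cases "(a, b) \<in> edges A B k")
      case True
      show ?thesis using ne[OF True] T2[OF True] c by auto
    next
      case False
      then have "a = A k" "b = B k" using e ab by (auto simp: edges_Suc)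
      then show ?thesis using lt by simp
    qed
    then show "case e of (a, b) \<Rightarrow> ?f b \<le> ?f a \<and> (?f a = ?f b \<longrightarrow> 0 < ?f b \<longrightarrow> ?d a \<le> Suc (?d b))"
      using ab by simp
  next
    fix a assume a: "a < K"
    show "?f a \<le> D" using T3[OF a] T3[of "B k"] lt by auto
    show "?d a = 0" if "?f a = 0" using that T3[OF a] pos by (auto split: if_splits)
    show "?d a = 0 \<and> rt (D - ?f a) = a \<or> (?d a = Suc (?d (?p a)) \<and> (a, ?p a) \<in> edges A B (Suc k) \<and> ?f (?p a) = ?f a)"
      if "0 < ?f a"
    proof (cases "a = A k")
      case True
      then show ?thesis using lt by (simp add: edges_Suc)
    next
      case False
      then have "0 < f a" using that by simp
      with T3[OF a] have "d a = 0 \<and> rt (D - f a) = a \<or> (d a = Suc (d (p a)) \<and> (a, p a) \<in> edges A B k \<and> f (p a) = f a)"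
        by simp
      then consider "d a = 0" "rt (D - f a) = a" |
        "d a = Suc (d (p a))" "(a, p a) \<in> edges A B k" "f (p a) = f a" by auto
      then show ?thesis
      proof cases
        case 2
        then show ?thesis using False ne[OF 2(2)] by (simp add: edges_Suc)
      qed (use False in simp)
    qed
  qed
qed

definition TREES :: com where
  "TREES = For ''q'' (ll 2 [*] vv ''Q'')
    (For ''i'' (vv ''D'')
       (Write ''F'' (vv ''q'' [*] vv ''KK'' [+] Read ''chv'' (vv ''q'' [*] vv ''D'' [+] vv ''i'')) (vv ''D'' [-] vv ''i'')) ;;
     For ''e'' (vv ''M'')
       (''a'' ::= Read ''A'' (vv ''e'') ;; ''b'' ::= Read ''B'' (vv ''e'') ;;
        ''x'' ::= Read ''F'' (vv ''q'' [*] vv ''KK'' [+] vv ''a'') ;;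
        ''y'' ::= Read ''F'' (vv ''q'' [*] vv ''KK'' [+] vv ''b'') ;;
        Cond ((vv ''x'' [<] vv ''y'') [+] (vv ''x'' [=] vv ''y'') [*]
             ((Read ''dep'' (vv ''q'' [*] vv ''KK'' [+] vv ''b'') [+] ll 1) [<] Read ''dep'' (vv ''q'' [*] vv ''KK'' [+] vv ''a'')))
          (Write ''F'' (vv ''q'' [*] vv ''KK'' [+] vv ''a'') (vv ''y'') ;;
           Write ''dep'' (vv ''q'' [*] vv ''KK'' [+] vv ''a'') (Read ''dep'' (vv ''q'' [*] vv ''KK'' [+] vv ''b'') [+] ll 1) ;;
           Write ''par'' (vv ''q'' [*] vv ''KK'' [+] vv ''a'') (vv ''b''))
          Skip))"

abbreviation row :: "store \<Rightarrow> string \<Rightarrow> nat \<Rightarrow> nat \<Rightarrow> nat \<Rightarrow> nat" where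
  "row s a K q \<equiv> \<lambda>v. arr s a (q * K + v)"

lemma forest_to_chain_cong:
  assumes "forest_to_chain E K D rt f d p" "\<And>a. a < K \<Longrightarrow> f' a = f a \<and> d' a = d a \<and> p' a = p a"
    "\<And>a b. (a, b) \<in> E \<Longrightarrow> a < K \<and> b < K" "\<And>i. i < D \<Longrightarrow> rt i < K"
  shows "forest_to_chain E K D rt f' d' p'"
proof -
  have "\<And>a. a < K \<Longrightarrow> 0 < f a \<Longrightarrow> \<not> (d a = 0 \<and> rt (D - f a) = a) \<Longrightarrow> p a < K"
    using assms(1,3) unfolding forest_to_chain_def by blast
  then show ?thesis
    using assms unfolding forest_to_chain_def by (auto 4 3)
qed

lemma W_TREES:
  fixes s :: store
  defines "D \<equiv> var s ''D''" and "nq \<equiv> 2 * var s ''Q''" and "chv \<equiv> arr s ''chv''" and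
    "m \<equiv> var s ''M''" and "K \<equiv> var s ''KK''" and "A \<equiv> arr s ''A''" and "B \<equiv> arr s ''B''"
  assumes d: "dag K A B m"
    and zero: "\<And>x. arr s ''F'' x = 0" "\<And>x. arr s ''dep'' x = 0"
    and rt: "\<And>x. x < nq * D \<Longrightarrow> chv x < K" and inj: "inj_on chv {..<nq * D}"
    and Q: "\<And>t s'. eqx {''q'', ''i'', ''e'', ''a'', ''b'', ''x'', ''y''} {''F'', ''dep'', ''par''} s s' \<Longrightarrow>
      (\<And>q. q < nq \<Longrightarrow> forest_to_chain (edges A B m) K D (\<lambda>i. chv (q * D + i)) (row s' ''F'' K q) (row s' ''dep'' K q) (row s' ''par'' K q)) \<Longrightarrow>
      t \<le> nq * (200 * (D + m + 1)) + 50 \<Longrightarrow> Q t s'"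
  shows "W TREES s Q"
  unfolding TREES_def
proof (rule W_For[where N = nq and T = "150 * (D + m + 1)" and I = "\<lambda>k s'.
      (\<forall>q<k. forest_to_chain (edges A B m) K D (\<lambda>i. chv (q * D + i)) (row s' ''F'' K q) (row s' ''dep'' K q) (row s' ''par'' K q)) \<and>
      (\<forall>x\<ge>k * K. arr s' ''F'' x = 0 \<and> arr s' ''dep'' x = 0)"], goal_cases)
  case 2
  show ?case using zero by simp
next
  case (3 s') then show ?case by (simp add: eqx_def nq_def)
next
  case (4 q s0)
  note I0 = 4(4) and qn = 4(3)
  have f0: "var s0 ''D'' = D" "arr s0 ''chv'' = chv" "var s0 ''M'' = m" "var s0 ''KK'' = K" "arr s0 ''A'' = A" "arr s0 ''B'' = B"
    "var s0 ''q'' = q" using 4(1,2) by (simp_all add: eqx_def D_def chv_def m_def K_def A_def B_def)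
  have ilt: "q * D + i < nq * D" if "i < D" for i
  proof -
    have "q * D + i < q * D + D" using that by simp
    also have "\<dots> = Suc q * D" by simp
    also have "\<dots> \<le> nq * D" using qn by (intro mult_le_mono1) simp
    finally show ?thesis .
  qed
  have inj': "i = j" if "i < D" "j < D" "chv (q * D + i) = chv (q * D + j)" for i j
    using inj_onD[OF inj that(3)] ilt[OF that(1)] ilt[OF that(2)] by simp
  let ?rt = "\<lambda>i. chv (q * D + i)"
  have Elt: "(a, b) \<in> edges A B m \<Longrightarrow> a < K \<and> b < K" for a b using d by (fastforce simp: edges_def dag_def)
  show ?case
    unfolding W_Seq
  proof (rule W_For[where N = D and T = 30 and I = "\<lambda>k s'.
        (\<forall>x<q * K. arr s' ''F'' x = arr s0 ''F'' x) \<and> (\<forall>x\<ge>Suc q * K. arr s' ''F'' x = 0) \<and>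
        (\<forall>i<k. arr s' ''F'' (q * K + ?rt i) = D - i) \<and>
        (\<forall>a. a \<notin> ?rt ` {..<D} \<longrightarrow> arr s' ''F'' (q * K + a) = 0)"], goal_cases)
    case 2
    show ?case using I0 by simp
  next
    case (3 s') then show ?case using f0 by (simp add: eqx_def)
  next
    case (4 k s')
    have f: "var s' ''D'' = D" "arr s' ''chv'' = chv" "var s' ''KK'' = K" "var s' ''q'' = q" using 4(1) f0 by (simp_all add: eqx_def)
    have "?rt k < K" using rt ilt 4(3) by simp
    moreover have "?rt i \<noteq> ?rt k" if "i < k" for i using inj'[of i k] that 4(3) by auto
    ultimately show ?case using 4(2-4) by (auto simp: f less_Suc_eq)
  next
    case (5 t1 s1)
    note I1 = 5(2) and t1 = 5(4) and e1 = 5(1)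
    have f1: "var s1 ''D'' = D" "arr s1 ''chv'' = chv" "var s1 ''M'' = m" "var s1 ''KK'' = K" "arr s1 ''A'' = A" "arr s1 ''B'' = B"
      "var s1 ''q'' = q" "arr s1 ''dep'' = arr s0 ''dep''" "arr s1 ''par'' = arr s0 ''par''" using e1 f0 by (simp_all add: eqx_def)
    show ?case
    proof (rule W_For[where N = m and T = 120 and I = "\<lambda>k s'.
        (\<forall>x<q * K. arr s' ''F'' x = arr s0 ''F'' x \<and> arr s' ''dep'' x = arr s0 ''dep'' x \<and> arr s' ''par'' x = arr s0 ''par'' x) \<and>
        (\<forall>x\<ge>Suc q * K. arr s' ''F'' x = 0 \<and> arr s' ''dep'' x = 0) \<and>
        forest_to_chain (edges A B k) K D ?rt (row s' ''F'' K q) (row s' ''dep'' K q) (row s' ''par'' K q)"], goal_cases)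
      case 2
      have "row s1 ''dep'' K q = (\<lambda>_. 0)" using I0 f1 by auto
      moreover have "forest_to_chain {} K D ?rt (row s1 ''F'' K q) (\<lambda>_. 0) (row s1 ''par'' K q)"
        by (rule forest_to_chain_init) (use I1 in auto)
      ultimately have "forest_to_chain {} K D ?rt (row s1 ''F'' K q) (row s1 ''dep'' K q) (row s1 ''par'' K q)" by simp
      moreover have "edges A B 0 = {}" by (simp add: edges_def)
      ultimately show ?case using I1 I0 f1 by simp
    next
      case (3 s') then show ?case using f1 by (simp add: eqx_def)
    next
      case (4 k s')
      have f: "var s' ''KK'' = K" "var s' ''q'' = q" "arr s' ''A'' = A" "arr s' ''B'' = B" "var s' ''e'' = k"
        using 4(1,2) f1 by (simp_all add: eqx_def)
      have Ak: "A k < K" using d 4(3) by (fastforce simp: dag_def)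
      have T: "forest_to_chain (edges A B k) K D ?rt (row s' ''F'' K q) (row s' ''dep'' K q) (row s' ''par'' K q)"
        using 4(4) by blast
      note st = forest_to_chain_step[OF T d 4(3)]
      let ?c = "arr s' ''F'' (q * K + A k) < arr s' ''F'' (q * K + B k) \<or> arr s' ''F'' (q * K + A k) = arr s' ''F'' (q * K + B k)
         \<and> Suc (arr s' ''dep'' (q * K + B k)) < arr s' ''dep'' (q * K + A k)"
      show ?case
      proof (cases ?c)
        case True
        show ?thesis using st(2)[OF True, unfolded fun_upd_def] True 4(4) Ak by (simp add: f cong: if_cong)
      next
        case False
        show ?thesis using st(1)[OF False] False 4(4) by (auto simp: f)
      qed
    next
      case (5 t2 s2)
      have "forest_to_chain (edges A B m) K D (\<lambda>i. chv (q' * D + i)) (row s2 ''F'' K q') (row s2 ''dep'' K q') (row s2 ''par'' K q')"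
        if q': "q' < Suc q" for q'
      proof (cases "q' = q")
        case True
        then show ?thesis using 5(2) by simp
      next
        case False
        then have lt: "q' < q" using q' by simp
        show ?thesis
        proof (rule forest_to_chain_cong[of _ _ _ _ "row s0 ''F'' K q'" "row s0 ''dep'' K q'" "row s0 ''par'' K q'"])
          show "forest_to_chain (edges A B m) K D (\<lambda>i. chv (q' * D + i)) (row s0 ''F'' K q') (row s0 ''dep'' K q') (row s0 ''par'' K q')"
            using I0 lt by blast
          fix a assume "a < K"
          then have "q' * K + a < Suc q' * K" by simp
          also have "\<dots> \<le> q * K" using lt by (intro mult_le_mono1) simp
          finally show "row s2 ''F'' K q' a = row s0 ''F'' K q' a \<and> row s2 ''dep'' K q' a = row s0 ''dep'' K q' a \<and>
              row s2 ''par'' K q' a = row s0 ''par'' K q' a" using 5(2) by blast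
        next
          fix i assume "i < D"
          then have "q' * D + i < Suc q' * D" by simp
          also have "\<dots> \<le> nq * D" using lt qn by (intro mult_le_mono1) simp
          finally show "chv (q' * D + i) < K" using rt by blast
        qed (use Elt in auto)
      qed
      then show ?case using 5(2,4) t1 by simp
    qed auto
  qed auto
next
  case (5 t s')
  show ?case
  proof (rule Q, goal_cases)
    case 3
    have "t \<le> nq * (150 * (D + m + 1) + 10) + 8" using 5(4) by simp
    also have "\<dots> \<le> nq * (200 * (D + m + 1)) + 50" by (intro add_mono mult_le_mono2) auto
    finally show ?case .
  qed (use 5 in \<open>auto simp: insert_commute\<close>)
qed auto

section \<open>Windows\<close>

text \<open>A window consists of the first \<open>4 D\<close> vertices on the forest path from a vertex whose depth is at least
  \<open>4 D\<close> and congruent to \<open>r\<close>; every path of \<open>8 D\<close> forest edges contains one. Averaging over \<open>r\<close> keeps their number small.\<close>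

abbreviation "L_exp \<equiv> ll 4 [*] vv ''D''"
abbreviation "N_exp \<equiv> ll 2 [*] vv ''Q'' [*] vv ''KK''"

definition selected :: "(nat \<Rightarrow> nat) \<Rightarrow> nat \<Rightarrow> nat \<Rightarrow> nat \<Rightarrow> bool" where
  "selected dep l r x \<longleftrightarrow> l \<le> dep x \<and> dep x mod l = r"

definition RESIDUE :: com where
  "RESIDUE = For ''x'' N_exp
      (Cond (Read ''dep'' (vv ''x'') [<] L_exp) Skip
         (Write ''cn'' (Op Mod (Read ''dep'' (vv ''x'')) L_exp)
            (Read ''cn'' (Op Mod (Read ''dep'' (vv ''x'')) L_exp) [+] ll 1))) ;;
    ''r'' ::= ll 0 ;;
    For ''i'' L_exp (Cond (Read ''cn'' (vv ''i'') [<] Read ''cn'' (vv ''r'')) (''r'' ::= vv ''i'') Skip)"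

lemma W_RESIDUE:
  fixes s :: store
  defines "N \<equiv> 2 * var s ''Q'' * var s ''KK''" and "l \<equiv> 4 * var s ''D''" and "dep \<equiv> arr s ''dep''"
  assumes cn: "\<And>i. arr s ''cn'' i = 0" and l: "0 < l"
    and Q: "\<And>t s'. eqx {''x'', ''r'', ''i''} {''cn''} s s' \<Longrightarrow>
      var s' ''r'' < l \<Longrightarrow> card {x. x < N \<and> selected dep l (var s' ''r'') x} * l \<le> N \<Longrightarrow> t \<le> 100 * (N + l) + 100 \<Longrightarrow> Q t s'"
  shows "W RESIDUE s Q"
proof -
  let ?C = "\<lambda>k i. card {x. x < k \<and> selected dep l i x}"
  have CS: "?C (Suc k) i = (if selected dep l i k then Suc (?C k i) else ?C k i)" for k i
  proof -
    have "{x. x < Suc k \<and> selected dep l i x} = (if selected dep l i k then insert k else id) {x. x < k \<and> selected dep l i x}"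
      by (auto simp: less_Suc_eq)
    then show ?thesis by (simp add: card_insert_if)
  qed
  show ?thesis
    unfolding RESIDUE_def W_Seq
  proof (rule W_For[where N = N and T = 50 and I = "\<lambda>k s'. \<forall>i<l. arr s' ''cn'' i = ?C k i"], goal_cases)
    case 2
    show ?case using cn by simp
  next
    case (3 s') then show ?case by (simp add: eqx_def N_def)
  next
    case (4 k s')
    have f: "arr s' ''dep'' = dep" "4 * var s' ''D'' = l" using 4(1) by (simp_all add: eqx_def dep_def l_def)
    have "selected dep l i k \<longleftrightarrow> \<not> dep k < l \<and> dep k mod l = i" for i by (auto simp: selected_def)
    then show ?case
      using 4(2-4) l by (auto simp: f CS)
  next
    case (5 t1 s1)
    note e1 = 5(1) and I1 = 5(2) and t1 = 5(4)
    have f1: "4 * var s1 ''D'' = l" using e1 by (simp add: eqx_def l_def)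
    show ?case
      unfolding W_Assign
    proof (rule W_For[where N = l and T = 20 and I = "\<lambda>k s'. var s' ''r'' < l \<and> (\<forall>i<k. arr s1 ''cn'' (var s' ''r'') \<le> arr s1 ''cn'' i)"], goal_cases)
      case 2 show ?case using l by simp
    next
      case (3 s') then show ?case using f1 by (simp add: eqx_def)
    next
      case (4 k s')
      have "arr s' ''cn'' = arr s1 ''cn''" using 4(1) by (simp add: eqx_def)
      then show ?case using 4(2-4) by (auto simp: less_Suc_eq)
    next
      case (5 t2 s2)
      let ?r = "var s2 ''r''"
      \<comment> \<open>The classes of the \<open>l\<close> residues are disjoint and
        \<open>?r\<close> has a smallest one, so \<open>l\<close> times its size is at most
        \<open>N\<close>.\<close>
      have "?C N ?r * l = (\<Sum>i<l. ?C N ?r)" by simp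
      also have "\<dots> \<le> (\<Sum>i<l. ?C N i)"
      proof (rule sum_mono)
        fix i assume "i \<in> {..<l}"
        then have "arr s1 ''cn'' ?r \<le> arr s1 ''cn'' i" "i < l" "?r < l" using 5(2) by auto
        then show "?C N ?r \<le> ?C N i" using I1 by simp
      qed
      also have "\<dots> = card (\<Union>i<l. {x. x < N \<and> selected dep l i x})"
        by (rule card_UN_disjoint[symmetric]) (auto simp: selected_def)
      also have "\<dots> \<le> card {..<N}" by (rule card_mono) auto
      finally have "?C N ?r * l \<le> N" by simp
      note cN = this
      show ?case
      proof (rule Q[OF _ _ cN], goal_cases)
        case 1
        show ?case using 5(1) e1 by (auto simp: eqx_def)
      next
        case 2
        show ?case using 5(2) by blast
      next
        case 3
        show ?case using 5(4) t1 by simp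
      qed
    qed simp
  qed simp
qed

section \<open>Listing the windows\<close>

text \<open>A table position \<open>x\<close> encodes the forest \<open>x div K\<close> and the
  vertex \<open>x mod K\<close>; the row of the forest starts at \<open>x - x mod K\<close>. The
  value is the vertex after \<open>i\<close> forest edges.\<close>

definition vtx :: "(nat \<Rightarrow> nat) \<Rightarrow> nat \<Rightarrow> nat \<Rightarrow> nat \<Rightarrow> nat" where
  "vtx par K x i = ((\<lambda>a. par (x - x mod K + a)) ^^ i) (x mod K)"

text \<open>Incidences between chain labels and windows, as pairs of label and window
  number.\<close>

definition occ :: "(nat \<Rightarrow> nat) \<Rightarrow> (nat \<Rightarrow> nat) \<Rightarrow> nat \<Rightarrow> nat \<Rightarrow> nat \<Rightarrow> nat \<Rightarrow> (nat \<times> nat) set" where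
  "occ cid par K l x j = {(cid (vtx par K x i), j) |i. i < l \<and> cid (vtx par K x i) \<noteq> 0}"

definition occs :: "(nat \<Rightarrow> nat) \<Rightarrow> (nat \<Rightarrow> nat) \<Rightarrow> nat \<Rightarrow> nat \<Rightarrow> (nat \<Rightarrow> nat) \<Rightarrow> nat \<Rightarrow> (nat \<times> nat) set" where
  "occs cid par K l win w = (\<Union>j<w. occ cid par K l (win j) j)"

lemma occs_Suc: "occs cid par K l (win(w := x)) (Suc w) = occs cid par K l win w \<union> occ cid par K l x w"
proof -
  have "(\<Union>j<w. occ cid par K l ((win(w := x)) j) j) = (\<Union>j<w. occ cid par K l (win j) j)" by auto
  then show ?thesis by (simp add: occs_def lessThan_Suc Un_commute)
qed

definition enumerates :: "(nat \<Rightarrow> bool) \<Rightarrow> nat \<Rightarrow> (nat \<Rightarrow> nat) \<Rightarrow> nat \<Rightarrow> bool" where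
  "enumerates sel k win w \<longleftrightarrow> w = card {x. x < k \<and> sel x} \<and> win ` {..<w} = {x. x < k \<and> sel x}"

lemma selected_Suc: "{x. x < Suc k \<and> sel x} = (if sel k then insert k else id) {x. x < k \<and> sel x}"
  by (auto simp: less_Suc_eq)

lemma enumerates_skip:
  assumes "enumerates sel k win w" "\<not> sel k"
  shows "enumerates sel (Suc k) win w"
proof -
  have eq: "{x. x < Suc k \<and> sel x} = {x. x < k \<and> sel x}" using assms(2) by (auto simp: less_Suc_eq)
  show ?thesis using assms(1) unfolding enumerates_def eq .
qed

lemma enumerates_add:
  assumes "enumerates sel k win w" "sel k"
  shows "enumerates sel (Suc k) (win(w := k)) (Suc w)"
proof -
  let ?S = "{x. x < k \<and> sel x}"
  have w: "w = card ?S" "win ` {..<w} = ?S" using assms(1) unfolding enumerates_def by blast+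
  have "(win(w := k)) ` {..<Suc w} = insert k (win ` {..<w})" by (auto simp: lessThan_Suc)
  then have "(win(w := k)) ` {..<Suc w} = insert k ?S" unfolding w(2) .
  moreover have "Suc w = card (insert k ?S)" using w(1) by simp
  ultimately show ?thesis using assms(2) unfolding enumerates_def selected_Suc by simp
qed

text \<open>The edge arrays are overwritten with the incidences: the forests are complete, and in
  this form \<open>SORT\<close> can group the incidences by label.\<close>

definition WINDOWS :: com where
  "WINDOWS = ''W'' ::= ll 0 ;; ''M'' ::= ll 0 ;;
    For ''x'' N_exp
      (Cond (Read ''dep'' (vv ''x'') [<] L_exp) Skip
        (Cond (Op Mod (Read ''dep'' (vv ''x'')) L_exp [=] vv ''r'')
          (''a'' ::= Op Mod (vv ''x'') (vv ''KK'') ;; ''o'' ::= vv ''x'' [-] vv ''a'' ;;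
           For ''i'' L_exp
             (Cond (Read ''cid'' (vv ''a''))
                (Write ''A'' (vv ''M'') (Read ''cid'' (vv ''a'')) ;; Write ''B'' (vv ''M'') (vv ''W'') ;;
                 ''M'' ::= vv ''M'' [+] ll 1)
                Skip ;;
              ''a'' ::= Read ''par'' (vv ''o'' [+] vv ''a'')) ;;
           Write ''win'' (vv ''W'') (vv ''x'') ;;
           ''W'' ::= vv ''W'' [+] ll 1)
          Skip))"

text \<open>Only selected positions cost about \<open>l\<close> steps. The potential reserves this
  amount for each window still to come, so that the other positions are charged a constant.\<close>

lemma W_WINDOWS:
  fixes s :: store
  defines "N \<equiv> 2 * var s ''Q'' * var s ''KK''" and "l \<equiv> 4 * var s ''D''" and "dep \<equiv> arr s ''dep''" and
    "par \<equiv> arr s ''par''" and "K \<equiv> var s ''KK''" and "cid \<equiv> arr s ''cid''" and "r \<equiv> var s ''r''"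
  defines "sel \<equiv> selected dep l r"
  assumes Q: "\<And>t s'. eqx {''x'', ''i'', ''a'', ''o'', ''W'', ''M''} {''A'', ''B'', ''win''} s s' \<Longrightarrow>
      enumerates sel N (arr s' ''win'') (var s' ''W'') \<Longrightarrow> var s' ''M'' \<le> l * var s' ''W'' \<Longrightarrow>
      edges (arr s' ''A'') (arr s' ''B'') (var s' ''M'') = occs cid par K l (arr s' ''win'') (var s' ''W'') \<Longrightarrow>
      t \<le> 100 * N + 100 * (l + 1) * var s' ''W'' + 100 \<Longrightarrow> Q t s'"
  shows "W WINDOWS s Q"
  unfolding WINDOWS_def W_Seq W_Assign
proof (rule W_For_pot[where N = N and T = 60 and \<Phi> = "\<lambda>s'. 80 * (l + 1) * (card {x. x < N \<and> sel x} - var s' ''W'')" and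
    I = "\<lambda>k s'. enumerates sel k (arr s' ''win'') (var s' ''W'') \<and> var s' ''M'' \<le> l * var s' ''W'' \<and>
      edges (arr s' ''A'') (arr s' ''B'') (var s' ''M'') = occs cid par K l (arr s' ''win'') (var s' ''W'')"], goal_cases)
  case 2
  show ?case by (simp add: edges_def enumerates_def occs_def)
next
  case (3 s') then show ?case by (simp add: eqx_def N_def)
next
  case (4 k s0)
  note I0 = 4(4) and kN = 4(3)
  have f0: "arr s0 ''dep'' = dep" "4 * var s0 ''D'' = l" "arr s0 ''par'' = par" "var s0 ''KK'' = K" "arr s0 ''cid'' = cid"
    "var s0 ''r'' = r" "var s0 ''x'' = k"
    using 4(1,2) by (simp_all add: eqx_def dep_def l_def par_def K_def cid_def r_def)
  show ?case
  proof (cases "sel k")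
    case False
    then have "dep k < l \<or> dep k mod l \<noteq> r" by (auto simp: sel_def selected_def)
    then show ?thesis using I0 False 4(2) enumerates_skip[of sel k] by (auto simp: f0)
  next
    case True
    then have d: "\<not> dep k < l" "dep k mod l = r" by (auto simp: sel_def selected_def)
    let ?w = "var s0 ''W''" and ?M = "var s0 ''M''"
    have en: "enumerates sel (Suc k) ((arr s0 ''win'')(?w := k)) (Suc ?w)"
      using enumerates_add[of sel k] I0 True by blast
    then have "Suc ?w = card {x. x < Suc k \<and> sel x}" by (simp add: enumerates_def)
    also have "\<dots> \<le> card {x. x < N \<and> sel x}" by (rule card_mono) (use kN in auto)
    finally have lt: "?w < card {x. x < N \<and> sel x}" by simp
    have vS: "vtx par K k (Suc i) = par (k - k mod K + vtx par K k i)" for i by (simp add: vtx_def)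
    show ?thesis
      unfolding W_Cond W_Seq W_Assign using d apply (simp add: f0)
    proof (rule W_For[where N = l and T = 40 and I = "\<lambda>i s'. var s' ''a'' = vtx par K k i \<and> var s' ''M'' \<le> ?M + i \<and>
        edges (arr s' ''A'') (arr s' ''B'') (var s' ''M'') = edges (arr s0 ''A'') (arr s0 ''B'') ?M \<union>
          {(cid (vtx par K k i'), ?w) |i'. i' < i \<and> cid (vtx par K k i') \<noteq> 0}"], goal_cases)
      case 2 show ?case by (simp add: vtx_def)
    next
      case (3 s') then show ?case using f0 by (simp add: eqx_def)
    next
      case (4 i s')
      have f: "arr s' ''cid'' = cid" "arr s' ''par'' = par" "var s' ''o'' = k - k mod K" "var s' ''W'' = ?w"
        using 4(3) f0 by (simp_all add: eqx_def)
      have "{(cid (vtx par K k i'), ?w) |i'. i' < Suc i \<and> cid (vtx par K k i') \<noteq> 0} =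
        (if cid (vtx par K k i) \<noteq> 0 then insert (cid (vtx par K k i), ?w) else id)
          {(cid (vtx par K k i'), ?w) |i'. i' < i \<and> cid (vtx par K k i') \<noteq> 0}"
        by (auto simp: less_Suc_eq)
      then show ?case using 4(4-) by (simp add: f vS edges_Suc edges_upd)
    next
      case (5 t s1)
      have f1: "var s1 ''W'' = ?w" "arr s1 ''win'' = arr s0 ''win''" "var s1 ''x'' = k" using 5(3) f0 by (simp_all add: eqx_def)
      have ed: "edges (arr s1 ''A'') (arr s1 ''B'') (var s1 ''M'') = occs cid par K l ((arr s0 ''win'')(?w := k)) (Suc ?w)"
        using 5(4) I0 by (simp add: occs_Suc occ_def)
      obtain c where c: "card {x. x < N \<and> sel x} = Suc (?w + c)" using lt less_natE by blast
      have "var s1 ''M'' \<le> ?M + l" "?M \<le> l * ?w" using 5(4) I0 by blast+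
      then have M: "var s1 ''M'' \<le> l + l * ?w" by linarith
      have "t \<le> 40 * l + 10 * l + 10" using 5(6) by simp
      then show ?case using ed en M by (simp add: f1 f0 c)
    qed simp
  qed
next
  case (5 t s')
  note five = 5
  show ?case
  proof (rule Q, goal_cases)
    case 1 show ?case using 5(1) by (auto simp: eqx_def)
  next
    case 5
    note 5 = five
    have w: "card {x. x < N \<and> sel x} = var s' ''W''" using 5(2) unfolding enumerates_def by metis
    have "t \<le> 72 * N + 10 + 80 * (l + 1) * var s' ''W''" using 5(4) by (simp add: w)
    moreover have "80 * (l + 1) * var s' ''W'' \<le> 100 * (l + 1) * var s' ''W''" by (intro mult_le_mono1) simp
    ultimately show ?case unfolding exp_cost.simps by linarith
  qed (use 5(2) in auto)
qed auto

section \<open>Greedy hitting set\<close>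

text \<open>The number of binary digits, with 0 for 0.\<close>

fun lg :: "nat \<Rightarrow> nat" where
  "lg n = (if n = 0 then 0 else Suc (lg (n div 2)))"

declare lg.simps [simp del]

lemma lg_0 [simp]: "lg 0 = 0"
  by (simp add: lg.simps)

lemma lg_mono: "m \<le> n \<Longrightarrow> lg m \<le> lg n"
proof (induction m arbitrary: n rule: less_induct)
  case (less m)
  show ?case
  proof (cases "m = 0")
    case False
    then have "lg (m div 2) \<le> lg (n div 2)" using less by (simp add: div_le_mono)
    then show ?thesis using False less.prems lg.simps[of m] lg.simps[of n] by simp
  qed simp
qed

lemma lg_halve: "2 * m \<le> n \<Longrightarrow> 0 < n \<Longrightarrow> Suc (lg m) \<le> lg n"
  using lg_mono[of m "n div 2"] lg.simps[of n] by simp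

lemma less_power_lg: "n < 2 ^ lg n"
proof (induction n rule: less_induct)
  case (less n)
  show ?case
  proof (cases "n = 0")
    case False
    then have "n div 2 < 2 ^ lg (n div 2)" using less by simp
    then show ?thesis using lg.simps[of n] False by simp
  qed simp
qed

lemma power_lg_le: "0 < n \<Longrightarrow> 2 ^ lg n \<le> 2 * n"
proof (induction n rule: less_induct)
  case (less n)
  show ?case
  proof (cases "n div 2 = 0")
    case True
    then show ?thesis using less.prems lg.simps[of n] by simp
  next
    case False
    then have "2 ^ lg (n div 2) \<le> 2 * (n div 2)" using less by simp
    then show ?thesis using lg.simps[of n] less.prems by simp
  qed
qed

text \<open>Tentatively covers the windows that meet chain \<open>q\<close> and keeps the chain if this covers enough new
  windows (or if it was picked before), otherwise undoes the covering.\<close>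

definition HIT_LABEL :: com where
  "HIT_LABEL = (''q'' ::= vv ''Q'' [-] vv ''j'' ;; ''x0'' ::= vv ''x'' ;; ''ct'' ::= ll 0 ;;
        While ((vv ''x'' [<] vv ''M'') [*] (Read ''A'' (vv ''x'') [=] vv ''q''))
          (Cond (Read ''cov'' (Read ''B'' (vv ''x'')) [=] ll 0)
             (Write ''cov'' (Read ''B'' (vv ''x'')) (vv ''q'') ;; ''ct'' ::= vv ''ct'' [+] ll 1) Skip ;;
           ''x'' ::= vv ''x'' [+] ll 1) ;;
        Cond ((Read ''pk'' (vv ''q'') [=] ll 0) [*] ((vv ''ct'' [*] (ll 2 [*] vv ''Q'')) [<] (vv ''N0'' [*] vv ''D'')))
          (''y'' ::= vv ''x0'' ;;
           While (vv ''y'' [<] vv ''x'')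
             (Cond (Read ''cov'' (Read ''B'' (vv ''y'')) [=] vv ''q'') (Write ''cov'' (Read ''B'' (vv ''y'')) (ll 0)) Skip ;;
              ''y'' ::= vv ''y'' [+] ll 1))
          (Write ''pk'' (vv ''q'') (ll 1) ;; ''N'' ::= vv ''N'' [-] vv ''ct''))"

text \<open>After sorting, the incidences of one label are consecutive and labels descend, so a
  single pointer ''x'' serves all labels of a scan. ''N'' counts the uncovered windows and ''N0'' is
  its value at the start of the scan.\<close>

definition HIT :: com where
  "HIT = ''S'' ::= vv ''Q'' [+] ll 1 ;; SORT ;; ''N'' ::= vv ''W'' ;;
    While (vv ''N'') (''N0'' ::= vv ''N'' ;; ''x'' ::= ll 0 ;; For ''j'' (vv ''Q'') HIT_LABEL)"

text \<open>\<open>cov j\<close> names the label that covered window \<open>j\<close>, so that a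
  tentative covering can be undone by comparing labels.\<close>

definition hit_inv :: "(nat \<times> nat) set \<Rightarrow> nat \<Rightarrow> nat \<Rightarrow> (nat \<Rightarrow> nat) \<Rightarrow> (nat \<Rightarrow> nat) \<Rightarrow> nat \<Rightarrow> bool" where
  "hit_inv Oc w q cov pk N \<longleftrightarrow>
     (\<forall>j. cov j \<noteq> 0 \<longrightarrow> pk (cov j) \<noteq> 0 \<and> (cov j, j) \<in> Oc) \<and>
     (\<forall>l j. pk l \<noteq> 0 \<longrightarrow> (l, j) \<in> Oc \<longrightarrow> cov j \<noteq> 0) \<and>
     N = card {j. j < w \<and> cov j = 0} \<and> {l. pk l \<noteq> 0} \<subseteq> {1..q}"

text \<open>The second conjunct is the account of a scan that starts with \<open>P0\<close> picked
  labels and \<open>N0\<close> uncovered windows: every label picked since then has covered at least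
  \<open>N0 * D / (2 * q)\<close> new windows. The third says that labels above \<open>k\<close>,
  which have been scanned already, meet few uncovered windows if they are not picked.\<close>

definition scan_inv :: "(nat \<times> nat) set \<Rightarrow> nat \<Rightarrow> nat \<Rightarrow> nat \<Rightarrow> nat \<Rightarrow> nat \<Rightarrow> nat \<Rightarrow> (nat \<Rightarrow> nat) \<Rightarrow> (nat \<Rightarrow> nat) \<Rightarrow> nat \<Rightarrow> bool" where
  "scan_inv Oc w q D P0 N0 k cov pk N \<longleftrightarrow> hit_inv Oc w q cov pk N \<and>
     card {l. pk l \<noteq> 0} * (N0 * D) + 2 * q * N \<le> P0 * (N0 * D) + 2 * q * N0 \<and>
     (\<forall>l. k < l \<longrightarrow> l \<le> q \<longrightarrow> pk l = 0 \<longrightarrow> card {j. (l, j) \<in> Oc \<and> cov j = 0} * (2 * q) \<le> N0 * D)"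

definition fresh :: "(nat \<times> nat) set \<Rightarrow> nat \<Rightarrow> (nat \<Rightarrow> nat) \<Rightarrow> nat set" where
  "fresh Oc l cov = {j. (l, j) \<in> Oc \<and> cov j = 0}"

lemma scan_skip:
  assumes "scan_inv Oc w q D P0 N0 (Suc k) cov pk N" "card (fresh Oc (Suc k) cov) * (2 * q) \<le> N0 * D"
  shows "scan_inv Oc w q D P0 N0 k cov pk N"
  unfolding scan_inv_def
proof (intro conjI allI impI)
  fix l assume l: "k < l" "l \<le> q" "pk l = 0"
  show "card {j. (l, j) \<in> Oc \<and> cov j = 0} * (2 * q) \<le> N0 * D"
    using assms l unfolding scan_inv_def fresh_def by (cases "l = Suc k") auto
qed (use assms in \<open>auto simp: scan_inv_def\<close>)

lemma scan_pick:
  assumes I: "scan_inv Oc w q D P0 N0 (Suc k) cov pk N" and k: "Suc k \<le> q"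
    and fin: "finite Oc" and Ow: "\<And>l j. (l, j) \<in> Oc \<Longrightarrow> j < w"
    and c: "pk (Suc k) \<noteq> 0 \<or> N0 * D \<le> card (fresh Oc (Suc k) cov) * (2 * q)"
  shows "scan_inv Oc w q D P0 N0 k (\<lambda>j. if j \<in> fresh Oc (Suc k) cov then Suc k else cov j) (pk(Suc k := 1))
     (N - card (fresh Oc (Suc k) cov))"
proof -
  let ?F = "fresh Oc (Suc k) cov" and ?cov = "\<lambda>j. if j \<in> fresh Oc (Suc k) cov then Suc k else cov j" and ?pk = "pk(Suc k := 1)"
  have H: "hit_inv Oc w q cov pk N" using I by (simp add: scan_inv_def)
  have Fw: "?F \<subseteq> {j. j < w \<and> cov j = 0}" using Ow by (auto simp: fresh_def)
  have N: "N = card {j. j < w \<and> cov j = 0}" and pk1: "{l. pk l \<noteq> 0} \<subseteq> {1..q}" using H by (auto simp: hit_inv_def)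
  have finF: "finite ?F" using Fw by (rule finite_subset) simp
  have cF: "card ?F \<le> N" unfolding N by (rule card_mono[OF _ Fw]) simp
  have "{j. j < w \<and> ?cov j = 0} = {j. j < w \<and> cov j = 0} - ?F" by auto
  then have N': "card {j. j < w \<and> ?cov j = 0} = N - card ?F"
    using card_Diff_subset[OF finF Fw] N by simp
  have H': "hit_inv Oc w q ?cov ?pk (N - card ?F)"
    unfolding hit_inv_def
  proof (intro conjI allI impI)
    fix j assume "?cov j \<noteq> 0"
    then show "?pk (?cov j) \<noteq> 0" "(?cov j, j) \<in> Oc" using H by (auto simp: hit_inv_def fresh_def split: if_splits)
  next
    fix l j assume "?pk l \<noteq> 0" "(l, j) \<in> Oc"
    then show "?cov j \<noteq> 0" using H by (auto simp: hit_inv_def fresh_def split: if_splits)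
  next
    show "{l. ?pk l \<noteq> 0} \<subseteq> {1..q}" using pk1 k by auto
  qed (simp add: N')
  have S: "{l. ?pk l \<noteq> 0} = insert (Suc k) {l. pk l \<noteq> 0}" by auto
  have fp: "finite {l. pk l \<noteq> 0}" using pk1 by (rule finite_subset) simp
  have B: "card {l. pk l \<noteq> 0} * (N0 * D) + 2 * q * N \<le> P0 * (N0 * D) + 2 * q * N0" using I by (simp add: scan_inv_def)
  have B': "card {l. ?pk l \<noteq> 0} * (N0 * D) + 2 * q * (N - card ?F) \<le> P0 * (N0 * D) + 2 * q * N0"
  proof (cases "pk (Suc k) = 0")
    case True
    then have cS: "card {l. ?pk l \<noteq> 0} = Suc (card {l. pk l \<noteq> 0})" unfolding S using fp by simp
    have "N0 * D \<le> 2 * q * card ?F" using c True by (simp add: ac_simps)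
    moreover have "2 * q * (N - card ?F) + 2 * q * card ?F = 2 * q * N" using cF by (simp flip: distrib_left)
    ultimately show ?thesis using B unfolding cS by simp
  next
    case False
    then have eq: "card {l. ?pk l \<noteq> 0} = card {l. pk l \<noteq> 0}" unfolding S by (simp add: insert_absorb)
    have "2 * q * (N - card ?F) \<le> 2 * q * N" by simp
    then show ?thesis using B unfolding eq by linarith
  qed
  have "card {j. (l, j) \<in> Oc \<and> ?cov j = 0} * (2 * q) \<le> N0 * D" if l: "k < l" "l \<le> q" "?pk l = 0" for l
  proof -
    have l': "Suc k < l" "pk l = 0" using l by (auto split: if_splits)
    have "{j. (l, j) \<in> Oc} \<subseteq> {..<w}" using Ow by auto
    then have fl: "finite {j. (l, j) \<in> Oc \<and> cov j = 0}" by (rule finite_subset[rotated, OF finite_subset]) auto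
    have "card {j. (l, j) \<in> Oc \<and> ?cov j = 0} \<le> card {j. (l, j) \<in> Oc \<and> cov j = 0}"
      by (rule card_mono[OF fl]) auto
    then have "card {j. (l, j) \<in> Oc \<and> ?cov j = 0} * (2 * q) \<le> card {j. (l, j) \<in> Oc \<and> cov j = 0} * (2 * q)" by (rule mult_le_mono1)
    also have "\<dots> \<le> N0 * D" using I l' l unfolding scan_inv_def by blast
    finally show ?thesis .
  qed
  then show ?thesis using H' B' unfolding scan_inv_def by blast
qed

text \<open>Every uncovered window still contains \<open>D\<close> unpicked labels, so double counting against the
  threshold shows that a scan halves the number of uncovered windows.\<close>

lemma scan_halves:
  assumes I: "scan_inv Oc w q D P0 N0 0 cov pk N" and "0 < D" "0 < q"
    and O1: "Oc \<subseteq> {1..q} \<times> {..<w}" and D: "\<And>j. j < w \<Longrightarrow> D \<le> card {l. (l, j) \<in> Oc}"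
  shows "2 * N \<le> N0"
proof -
  let ?J = "{j. j < w \<and> cov j = 0}" and ?L = "{l \<in> {1..q}. pk l = 0}"
  have N: "N = card ?J" using I by (simp add: scan_inv_def hit_inv_def)
  have unp: "pk l = 0" if "(l, j) \<in> Oc" "cov j = 0" for l j
  proof (rule ccontr)
    assume "pk l \<noteq> 0"
    then show False using I that unfolding scan_inv_def hit_inv_def by blast
  qed
  have finO: "finite Oc" using O1 by (rule finite_subset) simp
  have "N * D = (\<Sum>j\<in>?J. D)" by (simp add: N)
  also have "\<dots> \<le> (\<Sum>j\<in>?J. card {l. (l, j) \<in> Oc})" by (rule sum_mono) (use D in auto)
  also have "\<dots> = card (SIGMA j:?J. {l. (l, j) \<in> Oc})"
  proof (rule card_SigmaI[symmetric])
    show "\<forall>j\<in>?J. finite {l. (l, j) \<in> Oc}"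
    proof
      fix j
      have "{l. (l, j) \<in> Oc} \<subseteq> {1..q}" using O1 by auto
      then show "finite {l. (l, j) \<in> Oc}" by (rule finite_subset) simp
    qed
  qed simp
  also have "\<dots> = card (SIGMA l:?L. {j. (l, j) \<in> Oc \<and> cov j = 0})"
    by (rule bij_betw_same_card[of prod.swap]) (use O1 unp in \<open>auto simp: bij_betw_def inj_on_def image_iff\<close>)
  also have "\<dots> = (\<Sum>l\<in>?L. card {j. (l, j) \<in> Oc \<and> cov j = 0})"
  proof (rule card_SigmaI)
    show "\<forall>l\<in>?L. finite {j. (l, j) \<in> Oc \<and> cov j = 0}"
    proof
      fix l
      have "{j. (l, j) \<in> Oc \<and> cov j = 0} \<subseteq> {..<w}" using O1 by auto
      then show "finite {j. (l, j) \<in> Oc \<and> cov j = 0}" by (rule finite_subset) simp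
    qed
  qed simp
  finally have "N * D * (2 * q) \<le> (\<Sum>l\<in>?L. card {j. (l, j) \<in> Oc \<and> cov j = 0}) * (2 * q)" by (rule mult_le_mono1)
  also have "\<dots> = (\<Sum>l\<in>?L. card {j. (l, j) \<in> Oc \<and> cov j = 0} * (2 * q))" by (rule sum_distrib_right)
  also have "\<dots> \<le> (\<Sum>l\<in>?L. N0 * D)" by (rule sum_mono) (use I in \<open>auto simp: scan_inv_def\<close>)
  also have "\<dots> = card ?L * (N0 * D)" by simp
  also have "\<dots> \<le> q * (N0 * D)"
  proof -
    have "card ?L \<le> card {1..q}" by (rule card_mono) auto
    then show ?thesis by (intro mult_le_mono1) simp
  qed
  finally have "(2 * N) * (D * q) \<le> N0 * (D * q)" by (simp add: ac_simps)
  then show ?thesis using \<open>0 < D\<close> \<open>0 < q\<close> by simp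
qed

lemma mod_vars_HIT_LABEL [simp]: "mod_vars HIT_LABEL = {''q'', ''x0'', ''ct'', ''x'', ''y'', ''N''}" "mod_arrs HIT_LABEL = {''cov'', ''pk''}"
  by (auto simp: HIT_LABEL_def)

lemma W_HIT_LABEL:
  fixes s :: store
  defines "A \<equiv> arr s ''A''" and "B \<equiv> arr s ''B''" and "M \<equiv> var s ''M''" and "q \<equiv> var s ''Q''" and "D \<equiv> var s ''D''"
    and "N0 \<equiv> var s ''N0''" and "k \<equiv> var s ''Q'' - Suc (var s ''j'')"
  defines "Oc \<equiv> edges A B M"
  assumes j: "var s ''j'' < q" and sorted: "sorted_desc A M" and Ow: "Oc \<subseteq> {1..q} \<times> {..<w}"
    and x: "var s ''x'' \<le> M" "\<And>y. y < var s ''x'' \<Longrightarrow> Suc k < A y" "\<And>y. var s ''x'' \<le> y \<Longrightarrow> y < M \<Longrightarrow> A y \<le> Suc k"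
    and I: "scan_inv Oc w q D P0 N0 (Suc k) (arr s ''cov'') (arr s ''pk'') (var s ''N'')"
    and Q: "\<And>t s'. eqx {''q'', ''x0'', ''ct'', ''x'', ''y'', ''N''} {''cov'', ''pk''} s s' \<Longrightarrow>
      scan_inv Oc w q D P0 N0 k (arr s' ''cov'') (arr s' ''pk'') (var s' ''N'') \<Longrightarrow>
      var s' ''x'' \<le> M \<Longrightarrow> (\<And>y. y < var s' ''x'' \<Longrightarrow> k < A y) \<Longrightarrow> (\<And>y. var s' ''x'' \<le> y \<Longrightarrow> y < M \<Longrightarrow> A y \<le> k) \<Longrightarrow>
      t + 100 * (M - var s' ''x'') \<le> 100 * (M - var s ''x'') + 100 \<Longrightarrow> Q t s'"
  shows "W HIT_LABEL s Q"
proof -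
  define l where "l = Suc k"
  have l: "q - var s ''j'' = l" "0 < l" "l \<le> q" using j by (auto simp: l_def k_def q_def)
  let ?x0 = "var s ''x''" and ?cov = "arr s ''cov''" and ?pk = "arr s ''pk''"
  \<comment> \<open>The windows newly covered while the pointer moves from \<open>?x0\<close> to
    \<open>x\<close>. An incidence may be listed repeatedly, since a window can have several
    vertices on one chain; hence a set.\<close>
  define T where "T x = {w. ?cov w = 0 \<and> (\<exists>y. ?x0 \<le> y \<and> y < x \<and> B y = w)}" for x
  have T0: "T ?x0 = {}" by (auto simp: T_def)
  have TS: "T (Suc x) = (if ?cov (B x) = 0 then insert (B x) (T x) else T x)" if "?x0 \<le> x" for x
    using that by (auto simp: T_def less_Suc_eq)
  have finT: "finite (T x)" for x
    unfolding T_def by (rule finite_subset[of _ "B ` {..<x}"]) auto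
  have H: "hit_inv Oc w q ?cov ?pk (var s ''N'')" using I by (simp add: scan_inv_def)
  show ?thesis
    unfolding HIT_LABEL_def W_Seq W_Assign
  proof (rule W_While[where \<mu> = "\<lambda>s'. 40 * (M - var s' ''x'')" and
      I = "\<lambda>s'. ?x0 \<le> var s' ''x'' \<and> var s' ''x'' \<le> M \<and> (\<forall>y. ?x0 \<le> y \<longrightarrow> y < var s' ''x'' \<longrightarrow> A y = l) \<and>
        arr s' ''cov'' = (\<lambda>w. if w \<in> T (var s' ''x'') then l else ?cov w) \<and> var s' ''ct'' = card (T (var s' ''x''))"], goal_cases)
    case 1
    show ?case using x(1) by (simp add: T0)
  next
    case (2 s')
    have f: "arr s' ''A'' = A" "arr s' ''B'' = B" "var s' ''M'' = M" "var s' ''q'' = l"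
      using 2(1) l by (simp_all add: eqx_def A_def B_def M_def q_def)
    have c: "var s' ''x'' < M" "A (var s' ''x'') = l" using 2(3) by (auto simp: f)
    obtain d where d: "M = Suc (var s' ''x'' + d)" using c less_natE by blast
    have x0: "?x0 \<le> var s' ''x''" using 2(2) by simp
    have cov: "arr s' ''cov'' = (\<lambda>w. if w \<in> T (var s' ''x'') then l else ?cov w)" using 2(2) by simp
    show ?case
    proof (cases "arr s' ''cov'' (B (var s' ''x'')) = 0")
      case True
      then have n: "B (var s' ''x'') \<notin> T (var s' ''x'')" "?cov (B (var s' ''x'')) = 0" using cov l by (auto split: if_splits)
      have "arr s' ''cov'' (B (var s' ''x'')) = 0" by (rule True)
      moreover have "card (T (Suc (var s' ''x''))) = Suc (card (T (var s' ''x'')))"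
        using n finT by (simp add: TS[OF x0])
      moreover have "(arr s' ''cov'')(B (var s' ''x'') := l) = (\<lambda>w. if w \<in> T (Suc (var s' ''x'')) then l else ?cov w)"
        unfolding TS[OF x0] using n by (auto simp: cov fun_eq_iff)
      ultimately show ?thesis using 2(2) c d by (simp add: f less_Suc_eq)
    next
      case False
      have "T (Suc (var s' ''x'')) = T (var s' ''x'')"
      proof (cases "?cov (B (var s' ''x'')) = 0")
        case True
        then have "B (var s' ''x'') \<in> T (var s' ''x'')" using False cov by (auto split: if_splits)
        then show ?thesis unfolding TS[OF x0] using True by auto
      qed (simp add: TS[OF x0])
      then show ?thesis using 2(2) c d False by (simp add: f less_Suc_eq)
    qed
  next
    case (3 t1 s1)
    let ?x1 = "var s1 ''x''"
    have f1: "arr s1 ''A'' = A" "arr s1 ''B'' = B" "var s1 ''M'' = M" "var s1 ''q'' = l" "var s1 ''Q'' = q" "var s1 ''D'' = D"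
      "var s1 ''N0'' = N0" "arr s1 ''pk'' = ?pk" "var s1 ''x0'' = ?x0" "var s1 ''N'' = var s ''N''"
      using 3(1) l by (simp_all add: eqx_def A_def B_def M_def q_def D_def N0_def)
    have I1: "?x0 \<le> ?x1" "?x1 \<le> M" "\<And>y. ?x0 \<le> y \<Longrightarrow> y < ?x1 \<Longrightarrow> A y = l" "arr s1 ''cov'' = (\<lambda>w. if w \<in> T ?x1 then l else ?cov w)"
      "var s1 ''ct'' = card (T ?x1)" using 3(2) by auto
    have lo: "A y < l" if "?x1 \<le> y" "y < M" for y
    proof -
      have "A ?x1 \<noteq> l" using 3(3) that by (auto simp: f1 split: if_splits)
      then have "A ?x1 < l" using x(3)[of ?x1] I1(1) that by (simp add: l_def)
      moreover have "A y \<le> A ?x1" using sorted that by (cases "y = ?x1") (auto simp: sorted_desc_def)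
      ultimately show ?thesis by simp
    qed
    have lab: "A y = l \<longleftrightarrow> ?x0 \<le> y \<and> y < ?x1" if "y < M" for y
    proof
      assume "A y = l"
      then have "\<not> y < ?x0" "\<not> ?x1 \<le> y" using x(2)[of y] lo[of y] that by (auto simp: l_def)
      then show "?x0 \<le> y \<and> y < ?x1" by simp
    qed (use I1(3) in blast)
    have T: "T ?x1 = fresh Oc l ?cov"
    proof (intro set_eqI iffI)
      fix v assume "v \<in> T ?x1"
      then obtain y where y: "?x0 \<le> y" "y < ?x1" "B y = v" "?cov v = 0" unfolding T_def by blast
      then have "(l, v) = (A y, B y)" "y < M" using I1(2) I1(3)[of y] by auto
      then have "(l, v) \<in> Oc" unfolding Oc_def edges_def by blast
      then show "v \<in> fresh Oc l ?cov" using y(4) by (simp add: fresh_def)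
    next
      fix v assume "v \<in> fresh Oc l ?cov"
      then obtain y where "y < M" "A y = l" "B y = v" "?cov v = 0" by (auto simp: fresh_def Oc_def edges_def)
      then show "v \<in> T ?x1" using lab unfolding T_def by blast
    qed
    have xk: "k < A y" if "y < ?x1" for y
      using x(2)[of y] I1(3)[of y] that by (cases "y < ?x0") (auto simp: l_def)
    have xk2: "A y \<le> k" if "?x1 \<le> y" "y < M" for y using lo[OF that] by (simp add: l_def)
    have t1: "t1 + 40 * (M - ?x1) \<le> 40 * (M - ?x0) + 20" using 3(4) by simp
    show ?case
    proof (cases "?pk l = 0 \<and> var s1 ''ct'' * (2 * q) < N0 * D")
      case True
      note tr = True
      \<comment> \<open>An unpicked label covered nothing before, so erasing all entries equal to
        \<open>l\<close> undoes exactly the tentative covering.\<close>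
      have c0: "?cov v \<noteq> l" for v
      proof
        assume "?cov v = l"
        moreover have "\<forall>j. ?cov j \<noteq> 0 \<longrightarrow> ?pk (?cov j) \<noteq> 0 \<and> (?cov j, j) \<in> Oc" using H unfolding hit_inv_def by (elim conjE)
        ultimately have "?pk l \<noteq> 0" using l(2) by (metis less_not_refl)
        then show False using True by simp
      qed
      show ?thesis
        unfolding W_Cond W_Seq W_Assign using True apply (simp add: f1)
      proof (rule W_While[where \<mu> = "\<lambda>s'. 40 * (?x1 - var s' ''y'')" and
        I = "\<lambda>s'. ?x0 \<le> var s' ''y'' \<and> var s' ''y'' \<le> ?x1 \<and>
          arr s' ''cov'' = (\<lambda>w. if w \<in> T ?x1 \<and> w \<notin> T (var s' ''y'') then l else ?cov w)"], goal_cases)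
        case 1
        show ?case using I1 by (simp add: f1 T0)
      next
        case (2 s')
        have f: "arr s' ''B'' = B" "var s' ''x'' = ?x1" "var s' ''q'' = l" using 2(2) f1 by (simp_all add: eqx_def)
        have y: "?x0 \<le> var s' ''y''" "var s' ''y'' < ?x1" using 2(3,4) by (auto simp: f split: if_splits)
        have cov: "arr s' ''cov'' = (\<lambda>w. if w \<in> T ?x1 \<and> w \<notin> T (var s' ''y'') then l else ?cov w)" using 2(3) by simp
        obtain d where d: "?x1 = Suc (var s' ''y'' + d)" using y less_natE by blast
        show ?case
        proof (cases "arr s' ''cov'' (B (var s' ''y'')) = l")
          case True
          then have n: "B (var s' ''y'') \<in> T ?x1" using cov c0 by (auto split: if_splits)
          then have n0: "?cov (B (var s' ''y'')) = 0" by (simp add: T_def)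
          note n = n n0
          have "(arr s' ''cov'')(B (var s' ''y'') := 0) = (\<lambda>w. if w \<in> T ?x1 \<and> w \<notin> T (Suc (var s' ''y'')) then l else ?cov w)"
            unfolding TS[OF y(1)] using n by (auto simp: cov fun_eq_iff)
          then show ?thesis using True y d by (simp add: f)
        next
          case False
          have "(\<lambda>w. if w \<in> T ?x1 \<and> w \<notin> T (Suc (var s' ''y'')) then l else ?cov w) = arr s' ''cov''"
            unfolding TS[OF y(1)] cov using False y unfolding cov by (auto simp: fun_eq_iff split: if_splits)
          then show ?thesis using False y d by (simp add: f)
        qed
      next
        case (3 t2 s2)
        have f: "var s2 ''x'' = ?x1" "arr s2 ''pk'' = ?pk" "var s2 ''N'' = var s ''N''" using 3(2) f1 by (simp_all add: eqx_def)
        have "var s2 ''y'' = ?x1" using 3(3,4) f by (auto split: if_splits)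
        then have cov: "arr s2 ''cov'' = ?cov" using 3(3) by auto
        show ?case
        proof (rule Q, goal_cases)
          case 1 show ?case using 3(2) \<open>eqx _ _ _ s1\<close> by (simp add: eqx_def)
        next
          case 2
          show ?case unfolding cov f
            by (rule scan_skip[OF I]) (use tr I1(5) T in \<open>simp add: l_def\<close>)
        next
          case 6
          show ?case using t1 3(5) I1(1,2) by (simp add: f)
        qed (use I1 xk xk2 f in auto)
      qed
    next
      case False
      have "?pk l \<noteq> 0 \<or> N0 * D \<le> card (fresh Oc (Suc k) ?cov) * (2 * q)"
        using False I1(5) T by (auto simp: l_def)
      note st = scan_pick[OF I _ _ _ this[unfolded l_def]]
      have "scan_inv Oc w q D P0 N0 k (arr s1 ''cov'') (?pk(l := 1)) (var s ''N'' - var s1 ''ct'')"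
        unfolding I1(4,5) T l_def by (rule st) (use l Ow in \<open>auto simp: l_def Oc_def edges_def\<close>)
      moreover have "\<not> (?pk l = 0 \<and> var s1 ''ct'' * (2 * q) < N0 * D)" by (rule False)
      ultimately show ?thesis
        using t1 \<open>eqx _ _ _ s1\<close> I1(1,2) xk xk2
        by (auto simp: f1 eqx_def intro!: Q)
    qed
  qed
qed

text \<open>A scan adds at most \<open>2 * q / D\<close> labels and halves the number of uncovered
  windows, so at most \<open>lg w\<close> scans take place. Both facts are combined in the invariant
  that adds \<open>2 * q * lg\<close> of the remaining windows to \<open>D\<close> times the number
  of picked labels.\<close>

lemma W_HIT:
  fixes s :: store
  defines "A \<equiv> arr s ''A''" and "B \<equiv> arr s ''B''" and "M \<equiv> var s ''M''" and "q \<equiv> var s ''Q''" and "D \<equiv> var s ''D''"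
    and "w \<equiv> var s ''W''"
  defines "Oc \<equiv> edges A B M"
  assumes hd: "\<And>u. arr s ''hd'' u = 0" and zero: "\<And>u. arr s ''cov'' u = 0" "\<And>u. arr s ''pk'' u = 0"
    and D: "0 < D" and Oc: "Oc \<subseteq> {1..q} \<times> {..<w}" and many: "\<And>j. j < w \<Longrightarrow> D \<le> card {l. (l, j) \<in> Oc}"
    and Q: "\<And>t s'. eqx {''S'', ''e'', ''p'', ''i'', ''u'', ''N'', ''N0'', ''x'', ''j'', ''q'', ''x0'', ''ct'', ''y''}
        {''nx'', ''hd'', ''A2'', ''B2'', ''A'', ''B'', ''cov'', ''pk''} s s' \<Longrightarrow>
      (\<And>j. j < w \<Longrightarrow> \<exists>l. (l, j) \<in> Oc \<and> arr s' ''pk'' l \<noteq> 0) \<Longrightarrow> {l. arr s' ''pk'' l \<noteq> 0} \<subseteq> {1..q} \<Longrightarrow>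
      card {l. arr s' ''pk'' l \<noteq> 0} * D \<le> 2 * q * lg w \<Longrightarrow> t \<le> 300 * (M + q + 1) * (lg w + 1) + 100 \<Longrightarrow> Q t s'"
  shows "W HIT s Q"
  unfolding HIT_def W_Seq W_Assign
proof (rule W_SORT, goal_cases)
  case 1 show ?case using hd by simp
next
  case (2 e)
  then have "(A e, B e) \<in> Oc" by (simp add: Oc_def edges_def A_def B_def M_def)
  then show ?case using Oc by (auto simp: A_def q_def)
next
  case (3 t1 s1)
  have f1: "var s1 ''M'' = M" "var s1 ''Q'' = q" "var s1 ''D'' = D" "var s1 ''W'' = w" "arr s1 ''cov'' = arr s ''cov''"
    "arr s1 ''pk'' = arr s ''pk''" using 3(1) by (simp_all add: eqx_def M_def q_def D_def w_def)
  let ?A = "arr s1 ''A''" and ?B = "arr s1 ''B''"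
  have O1: "edges ?A ?B M = Oc" and sd: "sorted_desc ?A M" using 3(2,3) by (simp_all add: Oc_def A_def B_def M_def)
  have q0: "0 < q" if "0 < w" using many[OF that] Oc D by (cases "q = 0") auto
  show ?case
    unfolding W_Assign
  proof (rule W_While[where \<mu> = "\<lambda>s'. 250 * (M + q + 1) * lg (var s' ''N'')" and
      I = "\<lambda>s'. hit_inv Oc w q (arr s' ''cov'') (arr s' ''pk'') (var s' ''N'') \<and>
        card {l. arr s' ''pk'' l \<noteq> 0} * D + 2 * q * lg (var s' ''N'') \<le> 2 * q * lg w"], goal_cases)
    case 1
    show ?case using zero by (simp add: f1 hit_inv_def)
  next
    case (2 s2)
    have f2: "var s2 ''M'' = M" "var s2 ''Q'' = q" "var s2 ''D'' = D" "arr s2 ''A'' = ?A" "arr s2 ''B'' = ?B"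
      using 2(1) f1 by (simp_all add: eqx_def)
    define N0 where "N0 = var s2 ''N''"
    define P0 where "P0 = card {l. arr s2 ''pk'' l \<noteq> 0}"
    have N0: "0 < N0" using 2(3) by (simp add: N0_def)
    have H: "hit_inv Oc w q (arr s2 ''cov'') (arr s2 ''pk'') N0" using 2(2) by (simp add: N0_def)
    have w: "0 < w"
    proof (rule ccontr)
      assume "\<not> 0 < w"
      then show False using H N0 by (simp add: hit_inv_def)
    qed
    have S0: "scan_inv Oc w q D P0 N0 q (arr s2 ''cov'') (arr s2 ''pk'') N0"
      using H by (simp add: scan_inv_def P0_def)
    show ?case
      unfolding W_Seq W_Assign
    proof (rule W_For_pot[where N = q and T = 110 and \<Phi> = "\<lambda>s'. 100 * (M - var s' ''x'')" and
        I = "\<lambda>k s'. scan_inv Oc w q D P0 N0 (q - k) (arr s' ''cov'') (arr s' ''pk'') (var s' ''N'') \<and> var s' ''x'' \<le> M \<and>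
          (\<forall>y<var s' ''x''. q - k < ?A y) \<and> (\<forall>y\<ge>var s' ''x''. y < M \<longrightarrow> ?A y \<le> q - k)"], goal_cases)
      case 2
      have "?A y \<le> q" if "y < M" for y
      proof -
        have "(?A y, ?B y) \<in> Oc" using that unfolding O1[symmetric] by (simp add: edges_def)
        then show ?thesis using Oc by auto
      qed
      then show ?case using S0 by (simp add: N0_def)
    next
      case (3 s') then show ?case using f2 by (simp add: eqx_def)
    next
      case (4 k s')
      have f: "arr s' ''A'' = ?A" "arr s' ''B'' = ?B" "var s' ''M'' = M" "var s' ''Q'' = q" "var s' ''D'' = D" "var s' ''N0'' = N0"
        "var s' ''j'' = k"
        using 4(1,2) f2 by (simp_all add: eqx_def N0_def)
      have k: "Suc (q - Suc k) = q - k" using 4(3) by simp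
      note I4 = 4(4)
      show ?case
      proof (rule W_HIT_LABEL[where w = w and ?P0.0 = P0], goal_cases)
        case 1 show ?case using 4(3) by (simp add: f)
      next
        case 2 show ?case using sd by (simp add: f)
      next
        case 3 show ?case using Oc by (simp add: f O1)
      next
        case 4 show ?case using I4 by (simp add: f)
      next
        case (5 y) then show ?case using I4 k by (simp add: f)
      next
        case (6 y) then show ?case using I4 k by (simp add: f)
      next
        case 7 show ?case using I4 k by (simp add: f O1)
      next
        case (8 t s'')
        show ?case using 8(2-) by (simp add: f O1)
      qed
    next
      case (5 t s')
      have S: "scan_inv Oc w q D P0 N0 0 (arr s' ''cov'') (arr s' ''pk'') (var s' ''N'')" using 5(2) by simp
      have half: "2 * var s' ''N'' \<le> N0" by (rule scan_halves[OF S D q0[OF w] Oc many])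
      then have lgN: "Suc (lg (var s' ''N'')) \<le> lg N0" using N0 by (rule lg_halve)
      then obtain d where d: "lg N0 = Suc (lg (var s' ''N'') + d)" using Suc_le_D by (metis add_Suc le_Suc_ex)
      have "card {l. arr s' ''pk'' l \<noteq> 0} * (N0 * D) \<le> P0 * (N0 * D) + 2 * q * N0"
        using S unfolding scan_inv_def by linarith
      then have "(card {l. arr s' ''pk'' l \<noteq> 0} * D) * N0 \<le> (P0 * D + 2 * q) * N0" by (simp add: algebra_simps)
      then have c: "card {l. arr s' ''pk'' l \<noteq> 0} * D \<le> P0 * D + 2 * q" using N0 by simp
      have "P0 * D + 2 * q * lg N0 \<le> 2 * q * lg w" using 2(2) by (simp add: P0_def N0_def)
      moreover have "2 * q * Suc (lg (var s' ''N'')) \<le> 2 * q * lg N0" using lgN by (rule mult_le_mono2)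
      ultimately have c': "card {l. arr s' ''pk'' l \<noteq> 0} * D + 2 * q * lg (var s' ''N'') \<le> 2 * q * lg w"
        using c by simp
      have hit: "hit_inv Oc w q (arr s' ''cov'') (arr s' ''pk'') (var s' ''N'')" using S by (simp add: scan_inv_def)
      have "t \<le> 118 * q + 6 + 100 * M" using 5(4) by simp
      then have t: "t + 20 \<le> 250 * (M + q + 1)" by simp
      have "250 * (M + q + 1) * lg N0 = 250 * (M + q + 1) * (lg (var s' ''N'') + d) + 250 * (M + q + 1)"
        unfolding d by simp
      moreover have "250 * (M + q + 1) * lg (var s' ''N'') \<le> 250 * (M + q + 1) * (lg (var s' ''N'') + d)" by simp
      ultimately have "t + 20 + 250 * (M + q + 1) * lg (var s' ''N'') \<le> 250 * (M + q + 1) * lg N0"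
        using t by linarith
      then show ?case using c' hit unfolding exp_cost.simps N0_def by simp
    qed simp
  next
    case (3 t2 s2)
    have H: "hit_inv Oc w q (arr s2 ''cov'') (arr s2 ''pk'') 0" using 3(2,3) by simp
    show ?case
    proof (rule Q, goal_cases)
      case 1 show ?case using 3(1) \<open>eqx _ _ _ s1\<close> by (auto simp: eqx_def)
    next
      case (2 j)
      have "card {j. j < w \<and> arr s2 ''cov'' j = 0} = 0" using H unfolding hit_inv_def by simp
      then have "arr s2 ''cov'' j \<noteq> 0" using 2 by auto
      moreover have "\<forall>j. arr s2 ''cov'' j \<noteq> 0 \<longrightarrow> arr s2 ''pk'' (arr s2 ''cov'' j) \<noteq> 0 \<and> (arr s2 ''cov'' j, j) \<in> Oc"
        using H unfolding hit_inv_def by (elim conjE)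
      ultimately show ?case by blast
    next
      case 3
      show ?case using H unfolding hit_inv_def by (elim conjE)
    next
      case 4
      show ?case using 3(2) by simp
    next
      case 5
      define X where "X = (M + q + 1) * lg w"
      have "t2 \<le> 250 * X + 2" using 3(3,4) by (simp add: f1 X_def algebra_simps)
      moreover have "t1 \<le> 200 * (M + Suc q) + 100" using \<open>t1 \<le> _\<close> by (simp add: M_def q_def)
      ultimately have "1 + 1 + 1 + 1 + (t1 + (1 + 1 + t2)) \<le> 300 * (X + (M + q + 1)) + 100" by simp
      also have "X + (M + q + 1) = (M + q + 1) * (lg w + 1)" by (simp add: X_def)
      finally show ?case unfolding exp_cost.simps by (simp only: mult.assoc)
    qed
  qed
qed

section \<open>The remaining shortcuts\<close>

text \<open>\<open>l\<close> and \<open>r\<close> record the progress of the two loops: the pairs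
  \<open>(x, c)\<close> lexicographically below \<open>(l, r)\<close> have been treated. Rows
  \<open>c < q\<close> belong to the original copy, whose edges are the ones to be output.
  \<open>D - F\<close> is the offset of the first reachable vertex, and \<open>F = 0\<close> means
  that there is none.\<close>

definition final_hops :: "nat \<Rightarrow> nat \<Rightarrow> nat \<Rightarrow> (nat \<Rightarrow> nat) \<Rightarrow> (nat \<Rightarrow> nat) \<Rightarrow> (nat \<Rightarrow> nat) \<Rightarrow> nat \<Rightarrow> nat \<Rightarrow> (nat \<times> nat) set" where
  "final_hops q D K pk chv F l r = {(chv x, chv (c * D + (D - F (c * K + chv x)))) | x c.
     (x < l \<or> x = l \<and> c < r) \<and> c < q \<and> pk (Suc (x div D)) \<noteq> 0 \<and> pk (Suc c) \<noteq> 0 \<and> F (c * K + chv x) \<noteq> 0}"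

definition FINAL :: com where
  "FINAL = For ''x'' (vv ''Q'' [*] vv ''D'')
     (Cond (Read ''pk'' (Op Div (vv ''x'') (vv ''D'') [+] ll 1))
       (For ''q'' (vv ''Q'')
         (Cond (Read ''pk'' (vv ''q'' [+] ll 1) [*] Read ''F'' (vv ''q'' [*] vv ''KK'' [+] Read ''chv'' (vv ''x'')))
           (EMIT (Read ''rep'' (Read ''chv'' (vv ''x'') [+] ll 1))
             (Read ''rep'' (Read ''chv'' (vv ''q'' [*] vv ''D'' [+] (vv ''D'' [-] Read ''F'' (vv ''q'' [*] vv ''KK'' [+] Read ''chv'' (vv ''x'')))) [+] ll 1)))
           Skip))
       Skip)"

lemma mod_RESIDUE_WINDOWS_TREES [simp]:
  "mod_vars RESIDUE = {''x'', ''r'', ''i''}" "mod_arrs RESIDUE = {''cn''}"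
  "mod_vars WINDOWS = {''x'', ''i'', ''a'', ''o'', ''W'', ''M''}" "mod_arrs WINDOWS = {''A'', ''B'', ''win''}"
  "mod_vars TREES = {''q'', ''i'', ''e'', ''a'', ''b'', ''x'', ''y''}" "mod_arrs TREES = {''F'', ''dep'', ''par''}"
  by (auto simp: RESIDUE_def WINDOWS_def TREES_def)

lemma W_FINAL:
  fixes s :: store
  defines "q \<equiv> var s ''Q''" and "D \<equiv> var s ''D''" and "K \<equiv> var s ''KK''" and "pk \<equiv> arr s ''pk''" and "chv \<equiv> arr s ''chv''"
    and "F \<equiv> arr s ''F''" and "rep \<equiv> arr s ''rep''"
  assumes OUT: "OUT n S s" and rep: "\<And>x. x < q * D \<Longrightarrow> rep (Suc (chv x)) < n"
    and Q: "\<And>t s'. eqx {''x'', ''q'', ''eu'', ''ev'', ''h''} {''sn'', ''hsrc'', ''hdst''} s s' \<Longrightarrow>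
      OUT n (S \<union> rep_image rep (final_hops q D K pk chv F (q * D) 0)) s' \<Longrightarrow>
      t \<le> (q * D) * (200 * q + 50) + 50 \<Longrightarrow> Q t s'"
  shows "W FINAL s Q"
  unfolding FINAL_def
proof (rule W_For[where N = "q * D" and T = "150 * q + 30" and
    I = "\<lambda>k s'. OUT n (S \<union> rep_image rep (final_hops q D K pk chv F k 0)) s'"], goal_cases)
  case 2
  show ?case using OUT by (simp add: final_hops_def)
next
  case (3 s') then show ?case by (simp add: eqx_def q_def D_def)
next
  case (4 x s0)
  have f0: "var s0 ''Q'' = q" "var s0 ''D'' = D" "var s0 ''KK'' = K" "arr s0 ''pk'' = pk" "arr s0 ''chv'' = chv" "arr s0 ''F'' = F"
    "arr s0 ''rep'' = rep" "var s0 ''x'' = x"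
    using 4(1,2) by (simp_all add: eqx_def q_def D_def K_def pk_def chv_def F_def rep_def)
  have D: "0 < D" using 4(3) by (cases D) auto
  show ?case
  proof (cases "pk (Suc (x div D)) = 0")
    case True
    have "final_hops q D K pk chv F (Suc x) 0 = final_hops q D K pk chv F x 0"
      unfolding final_hops_def using True by (auto simp: less_Suc_eq)
    then show ?thesis using True 4(4) by (simp add: f0)
  next
    case False
    show ?thesis
      unfolding W_Cond using False apply (simp add: f0)
    proof (rule W_For[where N = q and T = 100 and I = "\<lambda>c s'. OUT n (S \<union> rep_image rep (final_hops q D K pk chv F x c)) s'"], goal_cases)
      case 2 show ?case using 4(4) by simp
    next
      case (3 s') then show ?case using f0 by (simp add: eqx_def)
    next
      case (4 c s')
      have f: "var s' ''D'' = D" "var s' ''KK'' = K" "arr s' ''pk'' = pk" "arr s' ''chv'' = chv" "arr s' ''F'' = F"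
        "arr s' ''rep'' = rep" "var s' ''x'' = x" "var s' ''q'' = c" using 4 f0 by (simp_all add: eqx_def)
      have OU: "OUT n (S \<union> rep_image rep (final_hops q D K pk chv F x c)) s'" and cq: "c < q" using 4 by blast+
      let ?f = "F (c * K + chv x)"
      show ?case
      proof (cases "pk (Suc c) = 0 \<or> ?f = 0")
        case True
        have "final_hops q D K pk chv F x (Suc c) = final_hops q D K pk chv F x c"
          unfolding final_hops_def using True by (auto simp: less_Suc_eq)
        then show ?thesis using True OU by (auto simp: f)
      next
        case F: False
        have e: "final_hops q D K pk chv F x (Suc c) = insert (chv x, chv (c * D + (D - ?f))) (final_hops q D K pk chv F x c)"
          unfolding final_hops_def using F False cq by (auto simp: less_Suc_eq)
        have "c * D + (D - ?f) < Suc c * D" using F D by simp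
        also have "\<dots> \<le> q * D" using cq by (intro mult_le_mono1) simp
        finally have r: "rep (Suc (chv (c * D + (D - ?f)))) < n" by (rule rep)
        show ?thesis unfolding W_Cond using F apply (simp add: f)
        proof (rule W_EMIT[OF OU refl refl], goal_cases)
          case 1
          show ?case using rep \<open>x < q * D\<close> by (simp add: f)
        next
          case 2 show ?case using r by (simp add: f)
        next
          case (3 t s'')
          then show ?case by (simp add: f e)
        qed
      qed
    next
      case (5 t s1)
      have "final_hops q D K pk chv F x q = final_hops q D K pk chv F (Suc x) 0"
        unfolding final_hops_def by (auto simp: less_Suc_eq)
      then show ?case using 5 by simp
    qed auto
  qed
next
  case (5 t s')
  show ?case
  proof (rule Q, goal_cases)
    case 1 show ?case using 5(1) by (simp add: insert_commute)
  next
    case 3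
    have "t \<le> q * D * (150 * q + 40) + 8" using 5(4) by (simp add: add.commute)
    also have "\<dots> \<le> (q * D) * (200 * q + 50) + 50" by (intro add_mono mult_le_mono2) auto
    finally show ?case .
  qed (use 5 in auto)
qed auto

section \<open>Few hops suffice\<close>

lemma relpow_mono:
  fixes R S :: "('a \<times> 'a) set"
  shows "(a, b) \<in> R ^^ k \<Longrightarrow> R \<subseteq> S \<Longrightarrow> (a, b) \<in> S ^^ k"
proof (induction k arbitrary: b)
  case (Suc k)
  from Suc.prems(1) obtain c where "(a, c) \<in> R ^^ k" "(c, b) \<in> R" by (rule relpow_Suc_E)
  then show ?case using Suc.IH Suc.prems(2) by (meson relpow_Suc_I subsetD)
qed simp

lemma relpow_add_I: "(a, b) \<in> R ^^ i \<Longrightarrow> (b, c) \<in> R ^^ j \<Longrightarrow> (a, c) \<in> R ^^ (i + j)"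
  by (auto simp: relpow_add)

locale chain_graph =
  fixes E :: "(nat \<times> nat) set" and K D q :: nat and cid chv :: "nat \<Rightarrow> nat"
  assumes E_less: "(a, b) \<in> E \<Longrightarrow> a < b \<and> b < K"
    and chains: "chains E K D q cid chv"
    and no_long: "no_long_chain E K D cid"
    and D_pos: "0 < D"
begin

section \<open>The graph with chain shortcuts and its doubled version\<close>

definition "E1 = E \<union> chain_hops D chv (q * D)"
definition "E2 = double_edges K E1"
definition "cid2 = double_cid K cid"
definition "chv2 = double_chv K (q * D) chv"

lemma E_trancl_less: "(a, b) \<in> E\<^sup>+ \<Longrightarrow> a < b \<and> b < K"
  by (induction rule: trancl_induct) (auto dest: E_less)

lemma E1_sub: "E1 \<subseteq> E\<^sup>+"
  using chain_hops_sub[OF chains] by (auto simp: E1_def)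

lemma E1_less: "(a, b) \<in> E1 \<Longrightarrow> a < b \<and> b < K"
  using E1_sub E_trancl_less by blast

lemma E1_rtrancl: "E1\<^sup>* = E\<^sup>*"
proof
  show "E1\<^sup>* \<subseteq> E\<^sup>*" using rtrancl_mono[OF E1_sub] by simp
  show "E\<^sup>* \<subseteq> E1\<^sup>*" by (rule rtrancl_mono) (auto simp: E1_def)
qed

lemma E1_trancl: "E1\<^sup>+ = E\<^sup>+"
proof
  show "E1\<^sup>+ \<subseteq> E\<^sup>+"
    using trancl_mono[OF _ E1_sub] by fastforce
  show "E\<^sup>+ \<subseteq> E1\<^sup>+" using trancl_mono[of _ E E1] by (auto simp: E1_def)
qed

lemma mirror_mirror: "a < 2 * K \<Longrightarrow> mirror K (mirror K a) = a"
  by (simp add: mirror_def)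

lemma mirror_ge: "a < K \<Longrightarrow> K \<le> mirror K a \<and> mirror K a < 2 * K"
  by (simp add: mirror_def)

lemma mirror_less: "K \<le> a \<Longrightarrow> a < 2 * K \<Longrightarrow> mirror K a < K"
  by (simp add: mirror_def)

lemma E2_cases:
  assumes "(a, b) \<in> E2"
  obtains "(a, b) \<in> E1" "a < K" "b < K" |
    "(mirror K b, mirror K a) \<in> E1" "K \<le> a" "a < 2 * K" "K \<le> b" "b < 2 * K"
proof -
  from assms consider "(a, b) \<in> E1" | x y where "(x, y) \<in> E1" "a = mirror K y" "b = mirror K x"
    unfolding E2_def double_edges_def by auto
  then show ?thesis
  proof cases
    case 1
    then show ?thesis using that(1) E1_less[OF 1] by simp
  next
    case 2
    have xy: "x < K" "y < K" using E1_less[OF 2(1)] by auto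
    then show ?thesis using that(2) 2 mirror_ge[OF xy(1)] mirror_ge[OF xy(2)] by (simp add: mirror_mirror)
  qed
qed

lemma E2_less:
  assumes "(a, b) \<in> E2"
  shows "a < b \<and> b < 2 * K"
  using assms
proof (cases rule: E2_cases)
  case 1
  then show ?thesis using E1_less[OF 1(1)] by simp
next
  case 2
  then show ?thesis using E1_less[OF 2(1)] by (simp add: mirror_def) linarith
qed

lemma relpow_E2_lo: "(a, b) \<in> E2 ^^ j \<Longrightarrow> a < K \<Longrightarrow> (a, b) \<in> E1 ^^ j \<and> b < K"
proof (induction j arbitrary: b)
  case (Suc j)
  then obtain c where c: "(a, c) \<in> E2 ^^ j" "(c, b) \<in> E2" by (auto elim: relpow_Suc_E)
  have ih: "(a, c) \<in> E1 ^^ j" "c < K" using Suc.IH[OF c(1) Suc.prems(2)] by auto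
  from c(2) show ?case by (cases rule: E2_cases) (use ih in \<open>auto intro: relpow_Suc_I\<close>)
qed simp

lemma relpow_E2_hi: "(a, b) \<in> E2 ^^ j \<Longrightarrow> K \<le> a \<Longrightarrow> a < 2 * K \<Longrightarrow>
    (mirror K b, mirror K a) \<in> E1 ^^ j \<and> K \<le> b \<and> b < 2 * K"
proof (induction j arbitrary: b)
  case (Suc j)
  then obtain c where c: "(a, c) \<in> E2 ^^ j" "(c, b) \<in> E2" by (auto elim: relpow_Suc_E)
  have ih: "(mirror K c, mirror K a) \<in> E1 ^^ j" "K \<le> c" "c < 2 * K" using Suc.IH[OF c(1)] Suc.prems by auto
  from c(2) show ?case by (cases rule: E2_cases) (use ih in \<open>auto simp del: relpow.simps intro: relpow_Suc_I2\<close>)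
qed simp

lemma relpow_E1_E2: "(a, b) \<in> E1 ^^ j \<Longrightarrow> (a, b) \<in> E2 ^^ j"
  by (rule relpow_mono) (auto simp: E2_def double_edges_def)

lemma relpow_E1_mirror: "(a, b) \<in> E1 ^^ j \<Longrightarrow> (mirror K b, mirror K a) \<in> E2 ^^ j"
proof (induction j arbitrary: b)
  case (Suc j)
  then obtain c where c: "(a, c) \<in> E1 ^^ j" "(c, b) \<in> E1" by (auto elim: relpow_Suc_E)
  have "(mirror K b, mirror K c) \<in> E2" using c(2) unfolding E2_def double_edges_def by force
  then show ?case using Suc.IH[OF c(1)] by (rule relpow_Suc_I2)
qed simp

lemma chain_two_hop:
  assumes "x < y" "y < q * D" "x div D = y div D"
  shows "\<exists>j\<le>2. (chv x, chv y) \<in> E1 ^^ j"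
proof -
  obtain z where z: "(chv x, z) \<in> chain_hops D chv (q * D)" "z = chv y \<or> (z, chv y) \<in> chain_hops D chv (q * D)"
    using chain_hops_two[OF assms D_pos] by blast
  then have 1: "(chv x, z) \<in> E1 ^^ 1" by (simp add: E1_def)
  from z(2) show ?thesis
  proof
    assume "z = chv y"
    then show ?thesis using 1 by (intro exI[of _ 1]) simp
  next
    assume "(z, chv y) \<in> chain_hops D chv (q * D)"
    then have "(z, chv y) \<in> E1 ^^ 1" by (simp add: E1_def)
    from relpow_add_I[OF 1 this] show ?thesis by (intro exI[of _ "1 + 1"]) simp
  qed
qed

lemma chvD: "x < q * D \<Longrightarrow> chv x < K \<and> cid (chv x) = Suc (x div D)"
  using chains by (simp add: chains_def)

lemma cidD: "cid a \<noteq> 0 \<Longrightarrow> \<exists>x<q * D. chv x = a"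
  using chains unfolding chains_def by blast

lemma chv2_lo: "x < q * D \<Longrightarrow> chv2 x = chv x"
  by (simp add: chv2_def double_chv_def)

lemma chv2_hi: "q * D \<le> x \<Longrightarrow> x < 2 * (q * D) \<Longrightarrow> chv2 x = mirror K (chv (2 * (q * D) - 1 - x))"
  by (simp add: chv2_def double_chv_def)

lemma chv2_less: "x < 2 * (q * D) \<Longrightarrow> chv2 x < 2 * K"
proof (cases "x < q * D")
  case True
  then show ?thesis using chvD[OF True] by (simp add: chv2_lo)
next
  case False
  assume x: "x < 2 * (q * D)"
  have "chv (2 * (q * D) - 1 - x) < K" using chvD[of "2 * (q * D) - 1 - x"] False x by simp
  then show ?thesis using mirror_ge False x by (simp add: chv2_hi)
qed

lemma chv_inj: "inj_on chv {..<q * D}"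
  by (rule chains_inj[OF chains]) (use E_less in blast)

lemma chv2_inj: "inj_on chv2 {..<2 * (q * D)}"
proof (rule inj_onI)
  let ?l = "q * D"
  fix x y assume x: "x \<in> {..<2 * ?l}" and y: "y \<in> {..<2 * ?l}" and eq: "chv2 x = chv2 y"
  have lo: "chv2 z < K" if "z < ?l" for z using that chvD[OF that] by (simp add: chv2_lo)
  have hi: "K \<le> chv2 z \<and> mirror K (chv2 z) = chv (2 * ?l - 1 - z)" if "?l \<le> z" "z < 2 * ?l" for z
  proof -
    have "chv (2 * ?l - 1 - z) < K" using chvD[of "2 * ?l - 1 - z"] that by simp
    then show ?thesis using that mirror_ge mirror_mirror by (simp add: chv2_hi)
  qed
  show "x = y"
  proof (cases "x < ?l"; cases "y < ?l")
    assume "x < ?l" "y < ?l"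
    then show ?thesis using eq inj_onD[OF chv_inj, of x y] by (simp add: chv2_lo)
  next
    assume xy: "\<not> x < ?l" "\<not> y < ?l"
    then have "chv (2 * ?l - 1 - x) = chv (2 * ?l - 1 - y)" using hi[of x] hi[of y] x y eq by simp
    then have "2 * ?l - 1 - x = 2 * ?l - 1 - y" by (rule inj_onD[OF chv_inj]) (use xy x y in auto)
    then show ?thesis using x y by simp
  qed (use lo[of x] lo[of y] hi[of x] hi[of y] x y eq in auto)
qed

lemma div_reverse:
  assumes "x < n * D"
  shows "(n * D - 1 - x) div D = n - 1 - x div D"
proof -
  have xd: "x div D < n" using assms D_pos by (simp add: div_less_iff_less_mult)
  have x: "x = (x div D) * D + x mod D" by simp
  have "n * D = (n - 1 - x div D) * D + (x div D) * D + D"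
    using xd by (metis Suc_diff_Suc add.commute add_diff_cancel_left' add_mult_distrib diff_add_inverse2 diff_Suc_1 le_add_diff_inverse less_imp_Suc_add less_imp_le mult_Suc plus_1_eq_Suc)
  then have "n * D - 1 - x = (n - 1 - x div D) * D + (D - 1 - x mod D)"
    using x mod_less_divisor[OF D_pos, of x] by linarith
  moreover have "D - 1 - x mod D < D" using D_pos by simp
  ultimately show ?thesis by simp
qed

text \<open>From position \<open>q * D\<close> on, a pair on one row is the mirror image of a pair
  of the original table in the opposite order.\<close>

lemma chain2_two_hop:
  assumes "x < y" "y < 2 * (q * D)" "x div D = y div D"
  shows "\<exists>j\<le>2. (chv2 x, chv2 y) \<in> E2 ^^ j"
proof -
  let ?l = "q * D"
  show ?thesis
  proof (cases "y < ?l")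
    case True
    then show ?thesis using chain_two_hop[OF assms(1) True assms(3)] assms(1) relpow_E1_E2 by (auto simp: chv2_lo)
  next
    case False
    then have "q \<le> y div D" using D_pos by (simp add: less_eq_div_iff_mult_less_eq)
    then have "q \<le> x div D" using assms(3) by simp
    then have "?l \<le> x" using D_pos by (simp add: less_eq_div_iff_mult_less_eq)
    define x' y' where "x' = 2 * ?l - 1 - x" and "y' = 2 * ?l - 1 - y"
    have "y' < x'" "x' < ?l" using assms(1,2) \<open>?l \<le> x\<close> by (auto simp: x'_def y'_def)
    moreover have "y' div D = x' div D"
      using div_reverse[of x "2 * q"] div_reverse[of y "2 * q"] assms by (simp add: x'_def y'_def mult.assoc)
    ultimately obtain j where "j \<le> 2" "(chv y', chv x') \<in> E1 ^^ j" using chain_two_hop by blast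
    then show ?thesis using relpow_E1_mirror[of "chv y'" "chv x'" j] \<open>?l \<le> x\<close> False assms
      by (auto simp: chv2_hi x'_def y'_def)
  qed
qed

lemma cid2_lo: "a < K \<Longrightarrow> cid2 a = cid a"
  by (simp add: cid2_def double_cid_def)

lemma cid2_hi: "K \<le> a \<Longrightarrow> a < 2 * K \<Longrightarrow> cid2 a = cid (mirror K a)"
  by (simp add: cid2_def double_cid_def)

text \<open>The numbering is topological, so reachability between two vertices of a chain agrees
  with their order on the chain, and the two-hop shortcuts apply.\<close>

lemma same_chain_E1:
  assumes "cid a = cid b" "cid a \<noteq> 0" "(a, b) \<in> E1\<^sup>*"
  shows "\<exists>j\<le>2. (a, b) \<in> E1 ^^ j"
proof -
  obtain x y where xy: "x < q * D" "chv x = a" "y < q * D" "chv y = b" using cidD assms(1,2) by metis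
  then have dv: "x div D = y div D" using chvD[of x] chvD[of y] assms(1) by simp
  have ab: "(a, b) \<in> E\<^sup>*" using assms(3) E1_rtrancl by simp
  consider "x < y" | "x = y" | "y < x" by linarith
  then show ?thesis
  proof cases
    case 1
    then show ?thesis using chain_two_hop[OF 1 xy(3) dv] xy by simp
  next
    case 2
    then show ?thesis using xy by (intro exI[of _ 0]) simp
  next
    case 3
    then have "(b, a) \<in> E\<^sup>+" using chains xy dv unfolding chains_def by metis
    then have "b < a" using E_trancl_less by blast
    moreover have "a \<le> b" using ab by (induction rule: rtrancl_induct) (auto dest: E_less)
    ultimately show ?thesis by simp
  qed
qed

text \<open>A chain and its mirror image share a label, but a path of \<open>E2\<close> stays in one
  half of the doubled graph.\<close>

lemma same_chain_E2:
  assumes "cid2 a = cid2 b" "cid2 a \<noteq> 0" "(a, b) \<in> E2\<^sup>*" "a < 2 * K"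
  shows "\<exists>j\<le>2. (a, b) \<in> E2 ^^ j"
proof -
  obtain k where k: "(a, b) \<in> E2 ^^ k" using assms(3) rtrancl_imp_relpow by blast
  show ?thesis
  proof (cases "a < K")
    case True
    then have "(a, b) \<in> E1 ^^ k" "b < K" using relpow_E2_lo[OF k] by auto
    then show ?thesis using same_chain_E1[of a b] assms True relpow_imp_rtrancl relpow_E1_E2 by (metis cid2_lo)
  next
    case False
    then have b: "(mirror K b, mirror K a) \<in> E1 ^^ k" "K \<le> b" "b < 2 * K" using relpow_E2_hi[OF k] assms(4) by auto
    then have "cid (mirror K b) = cid (mirror K a)" "cid (mirror K b) \<noteq> 0"
      using assms(1,2,4) False by (auto simp: cid2_hi)
    then obtain j where j: "j \<le> 2" "(mirror K b, mirror K a) \<in> E1 ^^ j"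
      using same_chain_E1 relpow_imp_rtrancl[OF b(1)] by blast
    then have "(a, b) \<in> E2 ^^ j" using relpow_E1_mirror[OF j(2)] b assms(4) by (simp add: mirror_mirror)
    then show ?thesis using j(1) by blast
  qed
qed

lemma trancl_relpow: "(a, b) \<in> R\<^sup>+ \<Longrightarrow> \<exists>k>0. (a, b) \<in> R ^^ k"
  by (simp add: trancl_power)

text \<open>The chain stays in one half; in the mirrored half it is read backwards.\<close>

lemma no_long_E2:
  assumes xs: "sorted_wrt (\<lambda>a b. (a, b) \<in> E2\<^sup>+) xs" "\<forall>a\<in>set xs. a < 2 * K \<and> cid2 a = 0"
  shows "length xs < D"
proof (cases xs)
  case Nil
  then show ?thesis using D_pos by simp
next
  case (Cons a0 ys)
  have lo: "(a, b) \<in> E\<^sup>+ \<and> b < K" if ab: "(a, b) \<in> E2\<^sup>+" "a < K" for a b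
  proof -
    obtain k where "k > 0" "(a, b) \<in> E2 ^^ k" using trancl_relpow[OF ab(1)] by blast
    then have "(a, b) \<in> E1\<^sup>+" "b < K" using relpow_E2_lo[OF _ ab(2)] by (auto simp: trancl_power)
    then show ?thesis using E1_trancl by simp
  qed
  have hi: "(mirror K b, mirror K a) \<in> E\<^sup>+ \<and> K \<le> b" if ab: "(a, b) \<in> E2\<^sup>+" "K \<le> a" "a < 2 * K" for a b
  proof -
    obtain k where "k > 0" "(a, b) \<in> E2 ^^ k" using trancl_relpow[OF ab(1)] by blast
    then have "(mirror K b, mirror K a) \<in> E1\<^sup>+" "K \<le> b" using relpow_E2_hi[OF _ ab(2,3)] by (auto simp: trancl_power)
    then show ?thesis using E1_trancl by simp
  qed
  show ?thesis
  proof (cases "a0 < K")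
    case True
    have all: "\<forall>a\<in>set xs. a < K" using xs(1) Cons lo[OF _ True] True by auto
    have "sorted_wrt (\<lambda>a b. (a, b) \<in> E\<^sup>+) xs"
      by (rule sorted_wrt_mono_rel[OF _ xs(1)]) (use lo all in blast)
    moreover have "\<forall>a\<in>set xs. a < K \<and> cid a = 0" using all xs(2) by (metis cid2_lo)
    ultimately show ?thesis using no_long unfolding no_long_chain_def by blast
  next
    case False
    have a0: "K \<le> a0" "a0 < 2 * K" using False xs(2) Cons by auto
    have all: "\<forall>a\<in>set xs. K \<le> a \<and> a < 2 * K" using xs Cons hi[OF _ a0] a0 by auto
    have "sorted_wrt (\<lambda>a b. (mirror K b, mirror K a) \<in> E\<^sup>+) xs"
      by (rule sorted_wrt_mono_rel[OF _ xs(1)]) (use hi all in blast)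
    then have "sorted_wrt (\<lambda>a b. (a, b) \<in> E\<^sup>+) (rev (map (mirror K) xs))"
      by (simp add: sorted_wrt_rev sorted_wrt_map)
    moreover have "\<forall>a\<in>set (rev (map (mirror K) xs)). a < K \<and> cid a = 0"
      using all xs(2) mirror_less cid2_hi by auto
    ultimately have "length (rev (map (mirror K) xs)) < D" using no_long unfolding no_long_chain_def by blast
    then show ?thesis by simp
  qed
qed

lemma E2_double_lt: "(a, b) \<in> E2 \<Longrightarrow> a < 2 * K \<and> b < 2 * K"
  using E2_less by fastforce

section \<open>Paths in a single forest\<close>

context
  fixes rt f d p :: "nat \<Rightarrow> nat"
  assumes T: "forest_to_chain E2 (2 * K) D rt f d p"
begin

lemma tree_mono: "(a, b) \<in> E2\<^sup>* \<Longrightarrow> f b \<le> f a"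
proof (induction rule: rtrancl_induct)
  case (step b c)
  then show ?case using T unfolding forest_to_chain_def by fastforce
qed simp

text \<open>\<open>f\<close> is monotone along the path and equal at its ends, hence constant, and
  then \<open>d\<close> drops by at most one per edge. So following the parents is a shortest
  way.\<close>

lemma tree_short:
  assumes "(u, v) \<in> E2 ^^ j" "f u = f v" "0 < f v"
  shows "d u \<le> j + d v"
  using assms
proof (induction j arbitrary: u)
  case (Suc j)
  from Suc.prems(1) obtain w where w: "(u, w) \<in> E2" "(w, v) \<in> E2 ^^ j" by (rule relpow_Suc_E2)
  have "f v \<le> f w" by (rule tree_mono[OF relpow_imp_rtrancl[OF w(2)]])
  moreover have "\<forall>(a, b)\<in>E2. f b \<le> f a \<and> (f a = f b \<longrightarrow> 0 < f b \<longrightarrow> d a \<le> Suc (d b))"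
    using T unfolding forest_to_chain_def by (elim conjE)
  then have "f w \<le> f u" "f u = f w \<longrightarrow> 0 < f w \<longrightarrow> d u \<le> Suc (d w)"
    using w(1) by auto
  ultimately show ?case using Suc.IH[OF w(2)] Suc.prems by simp
qed simp

lemma tree_path:
  assumes a: "a < 2 * K" "0 < f a"
  shows "i \<le> d a \<Longrightarrow> (p ^^ i) a < 2 * K \<and> f ((p ^^ i) a) = f a \<and> d ((p ^^ i) a) = d a - i \<and> (a, (p ^^ i) a) \<in> E2 ^^ i"
proof (induction i)
  case (Suc i)
  define v where "v = (p ^^ i) a"
  have v: "v < 2 * K" "f v = f a" "d v = d a - i" "(a, v) \<in> E2 ^^ i" using Suc by (auto simp: v_def)
  have "d v \<noteq> 0" using v Suc.prems by simp
  moreover have "0 < f v \<longrightarrow> d v = 0 \<and> rt (D - f v) = v \<or> (d v = Suc (d (p v)) \<and> (v, p v) \<in> E2 \<and> f (p v) = f v)"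
    using T v(1) unfolding forest_to_chain_def by blast
  ultimately have s: "d v = Suc (d (p v))" "(v, p v) \<in> E2" "f (p v) = f v" using v(2) a(2) by auto
  then have "p v < 2 * K" using E2_double_lt by blast
  moreover have "d (p v) = d a - Suc i" using s(1) v(3) by simp
  ultimately show ?case using s v relpow_Suc_I[OF v(4) s(2)] by (simp add: v_def)
qed (use a in simp)

lemma tree_root:
  assumes a: "a < 2 * K" "0 < f a"
  shows "(p ^^ d a) a = rt (D - f a)" "(a, rt (D - f a)) \<in> E2 ^^ d a"
proof -
  define v where "v = (p ^^ d a) a"
  have v: "v < 2 * K" "f v = f a" "d v = 0" "(a, v) \<in> E2 ^^ d a" using tree_path[OF a, of "d a"] by (auto simp: v_def)
  have "0 < f v \<longrightarrow> d v = 0 \<and> rt (D - f v) = v \<or> (d v = Suc (d (p v)) \<and> (v, p v) \<in> E2 \<and> f (p v) = f v)"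
    using T v(1) unfolding forest_to_chain_def by blast
  then have "rt (D - f a) = v" using v a(2) by simp
  then show "(p ^^ d a) a = rt (D - f a)" "(a, rt (D - f a)) \<in> E2 ^^ d a" using v by (auto simp: v_def)
qed

lemma dep_pos: "a < 2 * K \<Longrightarrow> 0 < d a \<Longrightarrow> 0 < f a"
  using T unfolding forest_to_chain_def by (metis gr0I)

lemma tree_segment:
  assumes a: "a < 2 * K" "0 < f a" and ij: "i \<le> j" "j \<le> d a"
  shows "((p ^^ i) a, (p ^^ j) a) \<in> E2 ^^ (j - i)"
proof -
  have v: "(p ^^ i) a < 2 * K" "f ((p ^^ i) a) = f a" "d ((p ^^ i) a) = d a - i"
    using tree_path[OF a, of i] ij by auto
  have "((p ^^ i) a, (p ^^ (j - i)) ((p ^^ i) a)) \<in> E2 ^^ (j - i)"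
    using tree_path[of "(p ^^ i) a" "j - i"] v a ij by simp
  moreover have "(p ^^ (j - i)) ((p ^^ i) a) = (p ^^ j) a"
    using ij by (metis comp_apply funpow_add le_add_diff_inverse2)
  ultimately show ?thesis by simp
qed

text \<open>A window is a shortest path, so it has fewer than \<open>D\<close> vertices outside the chains and, because of
  the two-hop shortcuts, at most three vertices on every chain.\<close>

lemma window_labels:
  assumes a: "a < 2 * K" and l: "4 * D \<le> d a"
  shows "D \<le> card {cid2 ((p ^^ i) a) |i. i < 4 * D \<and> cid2 ((p ^^ i) a) \<noteq> 0}"
proof -
  define v where "v i = (p ^^ i) a" for i
  have fa: "0 < f a" using dep_pos[OF a] l D_pos by simp
  have v: "v i < 2 * K" "f (v i) = f a" "d (v i) = d a - i" if "i < 4 * D" for i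
    using tree_path[OF a fa, of i] that l by (auto simp: v_def)
  have seg: "(v i, v j) \<in> E2 ^^ (j - i)" if "i \<le> j" "j < 4 * D" for i j
    using tree_segment[OF a fa, of i j] that l by (simp add: v_def)
  \<comment> \<open>Two hops suffice between vertices of one chain, so their depths differ by at
    most 2; along the window the depth falls by exactly one per step.\<close>
  have near: "j - i \<le> 2" if ij: "i \<le> j" "j < 4 * D" "cid2 (v i) = cid2 (v j)" "cid2 (v i) \<noteq> 0" for i j
  proof -
    have "(v i, v j) \<in> E2\<^sup>*" by (rule relpow_imp_rtrancl[OF seg[OF ij(1,2)]])
    then obtain k where k: "k \<le> 2" "(v i, v j) \<in> E2 ^^ k"
      using same_chain_E2[OF ij(3,4)] v(1)[of i] ij by auto
    then have "d (v i) \<le> k + d (v j)" using tree_short[OF k(2)] v(2)[of i] v(2)[of j] fa ij by simp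
    then show ?thesis using v(3)[of i] v(3)[of j] ij k l by simp
  qed
  define I0 I1 where "I0 = {i. i < 4 * D \<and> cid2 (v i) = 0}" and "I1 = {i. i < 4 * D \<and> cid2 (v i) \<noteq> 0}"
  have "card I0 < D"
  proof -
    let ?is = "sorted_list_of_set I0"
    have fin: "finite I0" by (simp add: I0_def)
    have "sorted_wrt (<) ?is" by simp
    then have "sorted_wrt (\<lambda>i j. (v i, v j) \<in> E2\<^sup>+) ?is"
    proof (rule sorted_wrt_mono_rel[rotated])
      fix i j assume ij: "i \<in> set ?is" "j \<in> set ?is" "i < j"
      then have "(v i, v j) \<in> E2 ^^ (j - i)" "0 < j - i" using seg fin by (auto simp: I0_def)
      then show "(v i, v j) \<in> E2\<^sup>+" unfolding trancl_power by blast
    qed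
    then have "sorted_wrt (\<lambda>a b. (a, b) \<in> E2\<^sup>+) (map v ?is)" by (simp add: sorted_wrt_map)
    then have "length (map v ?is) < D" by (rule no_long_E2) (use v(1) fin in \<open>auto simp: I0_def\<close>)
    then show ?thesis by simp
  qed
  moreover have "card I0 + card I1 = 4 * D"
  proof -
    have "I0 \<union> I1 = {..<4 * D}" "I0 \<inter> I1 = {}" by (auto simp: I0_def I1_def)
    then show ?thesis using card_Un_disjoint[of I0 I1] by (simp add: I0_def I1_def)
  qed
  \<comment> \<open>At least 3 D + 1 vertices of the window lie on chains. Positions with the same
    label lie within a range of three, so there are at least \<open>D\<close> labels.\<close>
  moreover have "card I1 \<le> 3 * card ((\<lambda>i. cid2 (v i)) ` I1)"
  proof -
    have fin: "finite I1" by (simp add: I1_def)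
    have "card I1 = (\<Sum>c\<in>(\<lambda>i. cid2 (v i)) ` I1. card {i \<in> I1. cid2 (v i) = c})"
      using sum.image_gen[OF fin, of "\<lambda>_. 1::nat" "\<lambda>i. cid2 (v i)"] by simp
    also have "\<dots> \<le> (\<Sum>c\<in>(\<lambda>i. cid2 (v i)) ` I1. 3)"
    proof (rule sum_mono)
      fix c assume "c \<in> (\<lambda>i. cid2 (v i)) ` I1"
      then have ne: "{i \<in> I1. cid2 (v i) = c} \<noteq> {}" by blast
      define m where "m = Min {i \<in> I1. cid2 (v i) = c}"
      have m: "m \<in> {i \<in> I1. cid2 (v i) = c}" unfolding m_def using ne fin by (intro Min_in) auto
      have "{i \<in> I1. cid2 (v i) = c} \<subseteq> {m..m + 2}"
      proof
        fix i assume i: "i \<in> {i \<in> I1. cid2 (v i) = c}"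
        then have "m \<le> i" unfolding m_def using fin by (intro Min_le) auto
        moreover from this have "i - m \<le> 2" using near[of m i] i m by (auto simp: I1_def)
        ultimately show "i \<in> {m..m + 2}" by simp
      qed
      then have "card {i \<in> I1. cid2 (v i) = c} \<le> card {m..m + 2}" by (rule card_mono[rotated]) simp
      then show "card {i \<in> I1. cid2 (v i) = c} \<le> 3" by simp
    qed
    finally show ?thesis by simp
  qed
  moreover have "(\<lambda>i. cid2 (v i)) ` I1 = {cid2 ((p ^^ i) a) |i. i < 4 * D \<and> cid2 ((p ^^ i) a) \<noteq> 0}"
    by (auto simp: I1_def v_def)
  ultimately show ?thesis by simp
qed

end

section \<open>Routing through picked chains\<close>

definition row_forest :: "(nat \<Rightarrow> nat) \<Rightarrow> (nat \<Rightarrow> nat) \<Rightarrow> (nat \<Rightarrow> nat) \<Rightarrow> nat \<Rightarrow> bool" where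
  "row_forest F dep par c \<longleftrightarrow> forest_to_chain E2 (2 * K) D (\<lambda>i. chv2 (c * D + i))
     (\<lambda>v. F (c * (2 * K) + v)) (\<lambda>v. dep (c * (2 * K) + v)) (\<lambda>v. par (c * (2 * K) + v))"

definition hit :: "(nat \<Rightarrow> nat) \<Rightarrow> (nat \<Rightarrow> nat) \<Rightarrow> (nat \<Rightarrow> nat) \<Rightarrow> nat \<Rightarrow> bool" where
  "hit dep par pk r \<longleftrightarrow> (\<forall>c<2 * q. \<forall>a<2 * K. selected dep (4 * D) r (c * (2 * K) + a) \<longrightarrow>
     (\<exists>i<4 * D. cid2 (((\<lambda>v. par (c * (2 * K) + v)) ^^ i) a) \<noteq> 0 \<and> pk (cid2 (((\<lambda>v. par (c * (2 * K) + v)) ^^ i) a)) \<noteq> 0))"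

context
  fixes F dep par pk :: "nat \<Rightarrow> nat" and r :: nat
  assumes rows: "\<And>c. c < 2 * q \<Longrightarrow> row_forest F dep par c"
    and hits: "hit dep par pk r" and r: "r < 4 * D"
begin

text \<open>The first vertex of the chain that \<open>a\<close> reaches comes no later than the
  vertex at offset \<open>i\<close>, so the shortcuts on the chain connect the two.\<close>

lemma chain_target:
  assumes c: "c < 2 * q" and i: "i < D" and a: "a < 2 * K" and ab: "(a, chv2 (c * D + i)) \<in> E2\<^sup>*"
  shows "0 < F (c * (2 * K) + a)" "\<exists>j\<le>2. (chv2 (c * D + (D - F (c * (2 * K) + a))), chv2 (c * D + i)) \<in> E2 ^^ j"
proof -
  let ?f = "\<lambda>v. F (c * (2 * K) + v)" and ?d = "\<lambda>v. dep (c * (2 * K) + v)" and ?p = "\<lambda>v. par (c * (2 * K) + v)"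
  let ?rt = "\<lambda>i. chv2 (c * D + i)"
  have T: "forest_to_chain E2 (2 * K) D ?rt ?f ?d ?p" using rows[OF c] by (simp add: row_forest_def)
  have "D - i \<le> ?f (?rt i)" using T i unfolding forest_to_chain_def by blast
  also have "\<dots> \<le> ?f a" by (rule tree_mono[OF T ab])
  finally have f: "D - i \<le> ?f a" .
  then show "0 < ?f a" using i by simp
  have fD: "?f a \<le> D" using T a unfolding forest_to_chain_def by blast
  show "\<exists>j\<le>2. (?rt (D - ?f a), ?rt i) \<in> E2 ^^ j"
  proof (cases "D - ?f a = i")
    case True
    then show ?thesis by (intro exI[of _ 0]) simp
  next
    case False
    then have "D - ?f a < i" using f i fD by simp
    moreover have "c * D + i < Suc c * D" using i by simp
    moreover have "Suc c * D \<le> 2 * q * D" using c by (intro mult_le_mono1) simp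
    ultimately show ?thesis using i by (intro chain2_two_hop) (auto simp: mult.assoc)
  qed
qed

text \<open>The root of the forest path from \<open>a\<close> is at most two hops away from the
  given chain vertex. As the latter is at distance at least 8 D + 2, the depth of \<open>a\<close>
  is at least 8 D, so there is room for a whole window and for the approach to it.\<close>

lemma half:
  assumes c: "c < 2 * q" and i: "i < D" and a: "a < 2 * K" and ab: "(a, chv2 (c * D + i)) \<in> E2\<^sup>*"
    and far: "\<And>j. j < 8 * D + 2 \<Longrightarrow> (a, chv2 (c * D + i)) \<notin> E2 ^^ j"
  shows "\<exists>v j. j < 8 * D \<and> (a, v) \<in> E2 ^^ j \<and> cid2 v \<noteq> 0 \<and> pk (cid2 v) \<noteq> 0 \<and> (v, chv2 (c * D + i)) \<in> E2\<^sup>*"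
proof -
  let ?f = "\<lambda>v. F (c * (2 * K) + v)" and ?d = "\<lambda>v. dep (c * (2 * K) + v)" and ?p = "\<lambda>v. par (c * (2 * K) + v)"
  let ?rt = "\<lambda>i. chv2 (c * D + i)" and ?l = "4 * D"
  have T: "forest_to_chain E2 (2 * K) D ?rt ?f ?d ?p" using rows[OF c] by (simp add: row_forest_def)
  note ct = chain_target[OF c i a ab]
  note rt = tree_root[OF T a ct(1)]
  obtain k where k: "k \<le> 2" "(?rt (D - ?f a), ?rt i) \<in> E2 ^^ k" using ct(2) by blast
  have "\<not> ?d a + k < 8 * D + 2" using far relpow_add_I[OF rt(2) k(2)] by blast
  then have da: "8 * D \<le> ?d a" using k(1) by simp
  \<comment> \<open>After \<open>i0\<close> steps, fewer than 4 D, the depth is congruent to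
    \<open>r\<close> modulo 4 D and still exceeds 4 D, so a selected window starts there. The
    subtraction is exact because \<open>r < 4 * D\<close> lies below the depth.\<close>
  define i0 where "i0 = (?d a - r) mod ?l"
  have i0: "i0 < ?l" using D_pos by (simp add: i0_def)
  define u where "u = (?p ^^ i0) a"
  have u: "u < 2 * K" "?d u = ?d a - i0" using tree_path[OF T a ct(1), of i0] i0 da by (auto simp: u_def)
  have "(?d a - i0) mod ?l = r"
  proof -
    have "?d a - r = ((?d a - r) div ?l) * ?l + i0" unfolding i0_def by (rule div_mult_mod_eq[symmetric])
    then have "?d a - i0 = r + ((?d a - r) div ?l) * ?l" using da r i0 by linarith
    then show ?thesis using r by simp
  qed
  then have "selected dep ?l r (c * (2 * K) + u)" using u da i0 by (simp add: selected_def)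
  with hits[unfolded hit_def, rule_format, OF c u(1)]
  obtain i1 where i1: "i1 < ?l" "cid2 ((?p ^^ i1) u) \<noteq> 0" "pk (cid2 ((?p ^^ i1) u)) \<noteq> 0"
    by blast
  let ?v = "(?p ^^ (i1 + i0)) a"
  have v: "?v = (?p ^^ i1) u" by (simp add: u_def funpow_add)
  have le: "i1 + i0 < 8 * D" "i1 + i0 \<le> ?d a" using i1(1) i0 da by auto
  have "(a, ?v) \<in> E2 ^^ (i1 + i0)" using tree_path[OF T a ct(1) le(2)] by blast
  moreover have "(?v, ?rt (D - ?f a)) \<in> E2\<^sup>*"
    using tree_segment[OF T a ct(1) le(2) order_refl] relpow_imp_rtrancl rt(1) by metis
  then have "(?v, ?rt i) \<in> E2\<^sup>*" using relpow_imp_rtrancl[OF k(2)] by (rule rtrancl_trans)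
  ultimately show ?thesis using le(1) i1 v by metis
qed

definition "FH = final_hops q D (2 * K) pk chv F (q * D) 0"

lemma FH_reach:
  assumes "(a, b) \<in> FH"
  shows "(a, b) \<in> E\<^sup>* \<and> a < K \<and> b < K"
proof -
  obtain x c where x: "x < q * D" "c < q" "a = chv x" "b = chv (c * D + (D - F (c * (2 * K) + chv x)))"
      "F (c * (2 * K) + chv x) \<noteq> 0"
    using assms unfolding FH_def final_hops_def by auto
  have a: "a < K" using x chvD by simp
  then have a2: "a < 2 * K" by simp
  have c2: "c < 2 * q" using x(2) by simp
  note T = rows[OF c2, unfolded row_forest_def]
  have "(a, chv2 (c * D + (D - F (c * (2 * K) + a)))) \<in> E2 ^^ dep (c * (2 * K) + a)"
    using tree_root(2)[OF T a2] x(3,5) by simp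
  moreover have "c * D + (D - F (c * (2 * K) + a)) < q * D"
  proof -
    have "c * D + (D - F (c * (2 * K) + a)) < Suc c * D" using x(3,5) D_pos by simp
    also have "\<dots> \<le> q * D" using x(2) by (intro mult_le_mono1) simp
    finally show ?thesis .
  qed
  ultimately have "(a, b) \<in> E2 ^^ dep (c * (2 * K) + a)" using x(3,4) by (simp add: chv2_lo)
  then have "(a, b) \<in> E1 ^^ dep (c * (2 * K) + a)" and b: "b < K" using relpow_E2_lo a by blast+
  then have "(a, b) \<in> E1\<^sup>*" by (intro relpow_imp_rtrancl)
  then show ?thesis using a b unfolding E1_rtrancl by simp
qed

text \<open>On a path that is shortest in \<open>E1\<close>, subpaths are shortest as well. A chain
  vertex \<open>b\<close> far from both ends therefore satisfies the distance condition of
  \<open>half\<close> twice: seen from \<open>s\<close>, and, in the mirrored copy, seen from the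
  image of \<open>t\<close>.\<close>

lemma few_hops:
  assumes s: "s < K" and st: "(s, t) \<in> E\<^sup>*"
  shows "\<exists>j\<le>25 * D. (s, t) \<in> (E1 \<union> FH) ^^ j"
proof -
  define k where "k = (LEAST k. (s, t) \<in> E1 ^^ k)"
  have "\<exists>k. (s, t) \<in> E1 ^^ k" using st E1_rtrancl rtrancl_imp_relpow by metis
  then have k: "(s, t) \<in> E1 ^^ k" unfolding k_def by (rule LeastI_ex)
  have min: "k \<le> j" if "(s, t) \<in> E1 ^^ j" for j unfolding k_def using that by (rule Least_le)
  have up: "(a, b) \<in> E1 ^^ j \<Longrightarrow> (a, b) \<in> (E1 \<union> FH) ^^ j" for a b j by (rule relpow_mono) auto
  show ?thesis
  proof (cases "k \<le> 25 * D")
    case True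
    then show ?thesis using up[OF k] by blast
  next
    case False
    obtain \<pi> where \<pi>: "\<pi> 0 = s" "\<pi> k = t" "\<And>i. i < k \<Longrightarrow> (\<pi> i, \<pi> (Suc i)) \<in> E1"
      using k unfolding relpow_fun_conv by blast
    have seg: "(\<pi> i, \<pi> (i + n)) \<in> E1 ^^ n" if "i + n \<le> k" for i n
      using that
    proof (induction n)
      case (Suc n)
      then show ?case using \<pi>(3)[of "i + n"] by (auto intro: relpow_Suc_I)
    qed simp
    have \<pi>K: "\<pi> i < K" if "i \<le> k" for i
      using that s \<pi>(1) \<pi>(3)[of "i - 1"] E1_less by (cases i) auto
    \<comment> \<open>\<open>D\<close> consecutive vertices of a path cannot all avoid the chains.
      The offset 8 D + 2 is the distance from \<open>s\<close> that \<open>half\<close> demands;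
      towards \<open>t\<close>, at least 25 D + 1 - (9 D + 1) = 16 D \<ge> 8 D + 2 edges
      remain.\<close>
    have "\<exists>i. 8 * D + 2 \<le> i \<and> i < 9 * D + 2 \<and> cid (\<pi> i) \<noteq> 0"
    proof (rule ccontr)
      assume "\<not> ?thesis"
      then have 0: "\<And>i. 8 * D + 2 \<le> i \<Longrightarrow> i < 9 * D + 2 \<Longrightarrow> cid (\<pi> i) = 0" by blast
      let ?xs = "map \<pi> [8 * D + 2..<9 * D + 2]"
      have "sorted_wrt (<) [8 * D + 2..<9 * D + 2]" by (rule sorted_wrt_upt)
      then have "sorted_wrt (\<lambda>i j. (\<pi> i, \<pi> j) \<in> E\<^sup>+) [8 * D + 2..<9 * D + 2]"
      proof (rule sorted_wrt_mono_rel[rotated])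
        fix i j assume ij: "i \<in> set [8 * D + 2..<9 * D + 2]" "j \<in> set [8 * D + 2..<9 * D + 2]" "i < j"
        then have "i < j" "j < 9 * D + 2" by (simp_all only: set_upt atLeastLessThan_iff)
        then have "(\<pi> i, \<pi> j) \<in> E1 ^^ (j - i)" using seg[of i "j - i"] False D_pos by simp
        then have "(\<pi> i, \<pi> j) \<in> E1\<^sup>+" using ij(3) unfolding trancl_power by (metis zero_less_diff)
        then show "(\<pi> i, \<pi> j) \<in> E\<^sup>+" by (simp add: E1_trancl)
      qed
      then have "sorted_wrt (\<lambda>a b. (a, b) \<in> E\<^sup>+) ?xs" by (simp add: sorted_wrt_map)
      moreover have "\<forall>a\<in>set ?xs. a < K \<and> cid a = 0" using 0 \<pi>K False by auto
      ultimately have "length ?xs < D" using no_long unfolding no_long_chain_def by blast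
      then show False unfolding length_map length_upt by linarith
    qed
    then obtain i where i: "8 * D + 2 \<le> i" "i < 9 * D + 2" "cid (\<pi> i) \<noteq> 0" by blast
    define b where "b = \<pi> i"
    have ik: "i \<le> k" using i False by simp
    have bK: "b < K" using \<pi>K ik by (simp add: b_def)
    have sb: "(s, b) \<in> E1 ^^ i" using seg[of 0 i] ik \<pi>(1) by (simp add: b_def)
    have bt: "(b, t) \<in> E1 ^^ (k - i)" using seg[of i "k - i"] ik \<pi>(2) by (simp add: b_def)
    have tK: "t < K" using \<pi>K[of k] \<pi>(2) by simp
    have sbmin: "i \<le> j" if "(s, b) \<in> E1 ^^ j" for j using min[OF relpow_add_I[OF that bt]] ik by simp
    have btmin: "k - i \<le> j" if "(b, t) \<in> E1 ^^ j" for j using min[OF relpow_add_I[OF sb that]] by simp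
    obtain x where x: "x < q * D" "chv x = b" using cidD i(3) b_def by blast
    define c o' where "c = x div D" and "o' = x mod D"
    have xc: "x = c * D + o'" "o' < D" using D_pos by (simp_all add: c_def o'_def)
    have cq: "c < q" using x(1) D_pos by (simp add: c_def div_less_iff_less_mult)
    have b2: "chv2 (c * D + o') = b" using x xc by (simp add: chv2_lo)
    have "\<exists>v j. j < 8 * D \<and> (s, v) \<in> E2 ^^ j \<and> cid2 v \<noteq> 0 \<and> pk (cid2 v) \<noteq> 0 \<and> (v, chv2 (c * D + o')) \<in> E2\<^sup>*"
    proof (rule half)
      show "(s, chv2 (c * D + o')) \<in> E2\<^sup>*" using relpow_imp_rtrancl[OF relpow_E1_E2[OF sb]] b2 by simp
      fix j assume j: "j < 8 * D + 2"
      show "(s, chv2 (c * D + o')) \<notin> E2 ^^ j"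
      proof
        assume "(s, chv2 (c * D + o')) \<in> E2 ^^ j"
        then have "(s, b) \<in> E1 ^^ j" using relpow_E2_lo[of s b j] s b2 by simp
        then show False using sbmin[of j] j i(1) by simp
      qed
    qed (use cq xc s in auto)
    then obtain v j1 where v: "j1 < 8 * D" "(s, v) \<in> E2 ^^ j1" "cid2 v \<noteq> 0" "pk (cid2 v) \<noteq> 0" "(v, b) \<in> E2\<^sup>*"
      using b2 by auto
    have sv: "(s, v) \<in> E1 ^^ j1" "v < K" using relpow_E2_lo[OF v(2) s] by auto
    \<comment> \<open>The position of the mirror image of \<open>b\<close> in the reversed half of
      \<open>chv2\<close>.\<close>
    define x' where "x' = 2 * (q * D) - 1 - x"
    have x'D: "x' div D = 2 * q - 1 - c" using div_reverse[of x "2 * q"] x(1) by (simp add: x'_def c_def mult.assoc)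
    define c' p' where "c' = x' div D" and "p' = x' mod D"
    have xc': "x' = c' * D + p'" unfolding c'_def p'_def by (rule div_mult_mod_eq[symmetric])
    have pc': "p' < D" "c' < 2 * q" using D_pos x'D cq by (simp_all add: c'_def p'_def)
    have b2': "chv2 (c' * D + p') = mirror K b"
    proof -
      have "2 * (q * D) - 1 - x' = x" using x(1) by (simp add: x'_def)
      then have "chv2 x' = mirror K b" using chv2_hi[of x'] x by (simp add: x'_def)
      then show ?thesis using xc' by simp
    qed
    let ?t = "mirror K t"
    have t2: "K \<le> ?t" "?t < 2 * K" using mirror_ge[OF tK] by auto
    have "\<exists>z j. j < 8 * D \<and> (?t, z) \<in> E2 ^^ j \<and> cid2 z \<noteq> 0 \<and> pk (cid2 z) \<noteq> 0 \<and> (z, chv2 (c' * D + p')) \<in> E2\<^sup>*"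
    proof (rule half)
      show "(?t, chv2 (c' * D + p')) \<in> E2\<^sup>*" using relpow_imp_rtrancl[OF relpow_E1_mirror[OF bt]] b2' by simp
      fix j assume j: "j < 8 * D + 2"
      show "(?t, chv2 (c' * D + p')) \<notin> E2 ^^ j"
      proof
        assume "(?t, chv2 (c' * D + p')) \<in> E2 ^^ j"
        then have "(b, t) \<in> E1 ^^ j" using relpow_E2_hi[of ?t "mirror K b" j] t2 b2' bK tK by (simp add: mirror_mirror)
        then show False using btmin[of j] j i False by simp
      qed
    qed (use pc' t2 in auto)
    then obtain z' j2 where z': "j2 < 8 * D" "(?t, z') \<in> E2 ^^ j2" "cid2 z' \<noteq> 0" "pk (cid2 z') \<noteq> 0" "(z', mirror K b) \<in> E2\<^sup>*"
      using b2' by auto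
    define z where "z = mirror K z'"
    have z2: "(z, t) \<in> E1 ^^ j2" "K \<le> z'" "z' < 2 * K" using relpow_E2_hi[OF z'(2) t2] tK by (auto simp: z_def mirror_mirror)
    have zK: "z < K" using mirror_less[OF z2(2,3)] by (simp add: z_def)
    have cz: "cid z \<noteq> 0" "pk (cid z) \<noteq> 0" using z'(3,4) cid2_hi[OF z2(2,3)] by (auto simp: z_def)
    have bz: "(b, z) \<in> E1\<^sup>*"
    proof -
      obtain n where "(z', mirror K b) \<in> E2 ^^ n" using z'(5) rtrancl_imp_relpow by blast
      then have "(mirror K (mirror K b), mirror K z') \<in> E1 ^^ n" using relpow_E2_hi z2 by blast
      then show ?thesis using relpow_imp_rtrancl bK by (auto simp: z_def mirror_mirror)
    qed
    have "(v, b) \<in> E1\<^sup>*"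
    proof -
      obtain n where "(v, b) \<in> E2 ^^ n" using v(5) rtrancl_imp_relpow by blast
      then have "(v, b) \<in> E1 ^^ n" using relpow_E2_lo[of v b n] sv(2) by simp
      then show ?thesis by (rule relpow_imp_rtrancl)
    qed
    then have "(v, z) \<in> E1\<^sup>*" using bz by (rule rtrancl_trans)
    then obtain n where "(v, z) \<in> E1 ^^ n" using rtrancl_imp_relpow by blast
    then have vz: "(v, z) \<in> E2\<^sup>*" by (intro relpow_imp_rtrancl[OF relpow_E1_E2])
    obtain y where y: "y < q * D" "chv y = z" using cidD cz(1) by blast
    define e w where "e = y div D" and "w = y mod D"
    have yw: "y = e * D + w" "w < D" "e < q" using y(1) D_pos by (simp_all add: e_def w_def div_less_iff_less_mult)
    have e2: "e < 2 * q" using yw(3) by simp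
    have v2K: "v < 2 * K" using sv(2) by simp
    have vz': "(v, chv2 (e * D + w)) \<in> E2\<^sup>*" using vz y yw by (simp add: chv2_lo)
    note ct = chain_target[OF e2 yw(2) v2K vz']
    let ?g = "chv (e * D + (D - F (e * (2 * K) + v)))"
    have glt: "e * D + (D - F (e * (2 * K) + v)) < q * D"
    proof -
      have "e * D + (D - F (e * (2 * K) + v)) < Suc e * D" using ct(1) D_pos by simp
      also have "\<dots> \<le> q * D" using yw(3) by (intro mult_le_mono1) simp
      finally show ?thesis .
    qed
    have gK: "?g < K" using chvD[OF glt] by simp
    obtain j3 where j3: "j3 \<le> 2" "(?g, z) \<in> E2 ^^ j3" using ct(2) glt y yw by (auto simp: chv2_lo)
    then have gz: "(?g, z) \<in> E1 ^^ j3" using relpow_E2_lo gK by blast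
    have cv: "cid v \<noteq> 0" "pk (cid v) \<noteq> 0" using v(3,4) cid2_lo[OF sv(2)] by auto
    obtain xv where xv: "xv < q * D" "chv xv = v" using cidD cv(1) by blast
    have "pk (Suc (xv div D)) \<noteq> 0" using cv(2) chvD[OF xv(1)] xv(2) by simp
    moreover have "pk (Suc e) \<noteq> 0" using cz(2) chvD[OF y(1)] y(2) by (simp add: e_def)
    ultimately have "(v, ?g) \<in> FH"
      unfolding FH_def final_hops_def using xv yw(3) ct(1) by blast
    then have vg: "(v, ?g) \<in> (E1 \<union> FH) ^^ 1" by simp
    have "(s, t) \<in> (E1 \<union> FH) ^^ (j1 + (1 + (j3 + j2)))"
      by (rule relpow_add_I[OF up[OF sv(1)] relpow_add_I[OF vg relpow_add_I[OF up[OF gz] up[OF z2(1)]]]])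
    \<comment> \<open>At most (8 D - 1) + 1 + 2 + (8 D - 1) hops.\<close>
    moreover have "j1 + (1 + (j3 + j2)) \<le> 25 * D" using v(1) z'(1) j3(1) D_pos by linarith
    ultimately show ?thesis by blast
  qed
qed

end

end

section \<open>Back to the original graph\<close>

lemma hop_dist_le: "(s, t) \<in> R ^^ k \<Longrightarrow> hop_dist R s t \<le> enat k"
  unfolding hop_dist_def by (rule INF_lower) simp

lemma condensationD:
  assumes "condensation n G K mk rep"
  shows "mk u \<noteq> 0 \<Longrightarrow> u < n" "mk u \<noteq> 0 \<Longrightarrow> (u, rep (mk u)) \<in> G\<^sup>*" "mk u \<noteq> 0 \<Longrightarrow> (rep (mk u), u) \<in> G\<^sup>*"
    "(u, v) \<in> G \<Longrightarrow> mk u \<noteq> 0 \<and> mk u \<le> mk v" "mk u \<le> K" "1 \<le> c \<Longrightarrow> c \<le> K \<Longrightarrow> mk (rep c) = c"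
  using assms unfolding condensation_def by auto

lemma cond_edges_less:
  assumes "condensation n G K mk rep" "(a, b) \<in> cond_edges G mk"
  shows "a < b \<and> b < K"
proof -
  obtain x y where "a < b" "mk y = Suc b" using assms(2) by (auto simp: cond_edges_def)
  then show ?thesis using condensationD(5)[OF assms(1), of y] by simp
qed

lemma cond_reach:
  assumes C: "condensation n G K mk rep" and ab: "(a, b) \<in> (cond_edges G mk)\<^sup>*" and "a < K"
  shows "(rep (Suc a), rep (Suc b)) \<in> G\<^sup>*"
  using ab
proof (induction rule: rtrancl_induct)
  case (step b c)
  obtain x y where xy: "(x, y) \<in> G" "mk x = Suc b" "mk y = Suc c" using step(2) by (auto simp: cond_edges_def)
  have "(rep (Suc b), x) \<in> G\<^sup>*" "(y, rep (Suc c)) \<in> G\<^sup>*"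
    using condensationD(3)[OF C, of x] condensationD(2)[OF C, of y] xy by simp_all
  then show ?case using step(3) xy(1) by (meson rtrancl.rtrancl_into_rtrancl rtrancl_trans)
qed simp

lemma reach_cond:
  assumes C: "condensation n G K mk rep" and st: "(s, t) \<in> G\<^sup>*" and "mk s \<noteq> 0"
  shows "mk t \<noteq> 0 \<and> (mk s - 1, mk t - 1) \<in> (cond_edges G mk)\<^sup>*"
  using st
proof (induction rule: rtrancl_induct)
  case (step u v)
  have uv: "mk u \<le> mk v" "mk u \<noteq> 0" using condensationD(4)[OF C step(2)] by auto
  show ?case
  proof (cases "mk u = mk v")
    case True
    then show ?thesis using step by simp
  next
    case False
    then have "(mk u - 1, mk v - 1) \<in> cond_edges G mk"
      unfolding cond_edges_def using step(2) uv by (auto intro!: bexI[of _ "(u, v)"])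
    then show ?thesis using step(3) uv by (auto intro: rtrancl.rtrancl_into_rtrancl)
  qed
qed (use \<open>mk s \<noteq> 0\<close> in simp)

text \<open>A condensed edge becomes a star edge, an edge of \<open>G\<close> and another star edge,
  hence the factor 3. Shortcuts join representatives directly.\<close>

lemma lift_hops:
  assumes C: "condensation n G K mk rep"
    and H: "star_edges mk rep \<subseteq> H" "rep_image rep X \<subseteq> H"
  shows "(a, b) \<in> (cond_edges G mk \<union> X) ^^ j \<Longrightarrow> \<exists>i\<le>3 * j. (rep (Suc a), rep (Suc b)) \<in> (G \<union> H) ^^ i"
proof (induction j arbitrary: b)
  case (Suc j)
  from Suc.prems obtain c where c: "(a, c) \<in> (cond_edges G mk \<union> X) ^^ j" "(c, b) \<in> cond_edges G mk \<union> X"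
    by (rule relpow_Suc_E)
  obtain i where i: "i \<le> 3 * j" "(rep (Suc a), rep (Suc c)) \<in> (G \<union> H) ^^ i" using Suc.IH[OF c(1)] by blast
  have "\<exists>i'\<le>3. (rep (Suc c), rep (Suc b)) \<in> (G \<union> H) ^^ i'"
    using c(2)
  proof
    assume "(c, b) \<in> cond_edges G mk"
    then obtain x y where xy: "(x, y) \<in> G" "mk x = Suc c" "mk y = Suc b" by (auto simp: cond_edges_def)
    have "mk x \<noteq> 0" "mk y \<noteq> 0" using xy by simp_all
    then have "(rep (mk x), x) \<in> star_edges mk rep" "(y, rep (mk y)) \<in> star_edges mk rep"
      unfolding star_edges_def by blast+
    then have "(rep (Suc c), x) \<in> (G \<union> H) ^^ 1" "(x, y) \<in> (G \<union> H) ^^ 1" "(y, rep (Suc b)) \<in> (G \<union> H) ^^ 1"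
      using xy H by auto
    from relpow_add_I[OF this(1) relpow_add_I[OF this(2,3)]]
    show ?thesis by (intro exI[of _ "1 + (1 + 1)"]) simp
  next
    assume "(c, b) \<in> X"
    then have "(rep (Suc c), rep (Suc b)) \<in> rep_image rep X" by (force simp: rep_image_def)
    then have "(rep (Suc c), rep (Suc b)) \<in> (G \<union> H) ^^ 1" using H by auto
    then show ?thesis by (intro exI[of _ 1]) simp
  qed
  then obtain i' where i': "i' \<le> 3" "(rep (Suc c), rep (Suc b)) \<in> (G \<union> H) ^^ i'" by blast
  show ?case
    by (rule exI[of _ "i + i'"]) (use relpow_add_I[OF i(2) i'(2)] i(1) i'(1) in simp)
qed (auto intro: exI[of _ 0])

context chain_graph
begin

text \<open>25 D condensed hops become 75 D, and two star edges join \<open>s\<close> and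
  \<open>t\<close> to their representatives; 75 D + 2 \<le> 77 D.\<close>

lemma shortcut_set_condensation:
  assumes C: "condensation n G K mk rep" and E: "E = cond_edges G mk"
    and rows: "\<And>c. c < 2 * q \<Longrightarrow> row_forest F dep par c" and hits: "hit dep par pk r" and r: "r < 4 * D"
    and H: "H = star_edges mk rep \<union> rep_image rep (chain_hops D chv (q * D)) \<union> rep_image rep (FH F pk)"
  shows "shortcut_set n G (77 * D) H"
proof -
  have repn: "rep (Suc a) < n" if "a < K" for a
    using condensationD(6)[OF C, of "Suc a"] condensationD(1)[OF C, of "rep (Suc a)"] that by simp
  have image: "(u, v) \<in> TC n G" if uv: "(u, v) \<in> rep_image rep X" and X: "\<And>a b. (a, b) \<in> X \<Longrightarrow> (a, b) \<in> E\<^sup>* \<and> a < K \<and> b < K" for u v X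
  proof -
    obtain a b where "(a, b) \<in> X" "u = rep (Suc a)" "v = rep (Suc b)" using uv by (auto simp: rep_image_def)
    then show ?thesis using X[of a b] cond_reach[OF C, of a b] repn E by (simp add: TC_def)
  qed
  have chain: "(a, b) \<in> E\<^sup>* \<and> a < K \<and> b < K" if "(a, b) \<in> chain_hops D chv (q * D)" for a b
    using chain_hops_sub[OF chains] that by (auto dest: trancl_into_rtrancl)
  have star: "(u, v) \<in> TC n G" if "(u, v) \<in> star_edges mk rep" for u v
  proof -
    obtain x where x: "mk x \<noteq> 0" "(u, v) = (x, rep (mk x)) \<or> (u, v) = (rep (mk x), x)"
      using \<open>(u, v) \<in> star_edges mk rep\<close> unfolding star_edges_def by auto
    have "mk x - 1 < K" using condensationD(5)[OF C, of x] x(1) by simp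
    then have "rep (mk x) < n" using repn[of "mk x - 1"] x(1) by simp
    then show ?thesis using x condensationD(1-3)[OF C x(1)] by (auto simp: TC_def)
  qed
  have sub: "H \<subseteq> TC n G"
  proof
    fix e assume "e \<in> H"
    moreover obtain u v where "e = (u, v)" by (cases e)
    ultimately show "e \<in> TC n G"
      unfolding H using star image[OF _ chain] image[OF _ FH_reach[OF rows hits r]] by blast
  qed
  have "hop_dist (G \<union> H) s t \<le> enat (77 * D)" if st: "(s, t) \<in> TC n G" for s t
  proof (cases "s = t")
    case True
    then have "hop_dist (G \<union> H) s t \<le> enat 0" by (intro hop_dist_le) simp
    then show ?thesis by (rule order_trans) simp
  next
    case False
    have reach: "(s, t) \<in> G\<^sup>*" using st by (simp add: TC_def)
    \<comment> \<open>Since \<open>s\<close> and \<open>t\<close> differ, \<open>s\<close> has an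
      outgoing edge and thus a numbered component; isolated vertices reach only themselves.\<close>
    then obtain u where "(s, u) \<in> G" using False by (auto elim: converse_rtranclE)
    then have ms: "mk s \<noteq> 0" using condensationD(4)[OF C] by blast
    have mt: "mk t \<noteq> 0" and mst: "(mk s - 1, mk t - 1) \<in> E\<^sup>*" using reach_cond[OF C reach ms] E by auto
    have "mk s - 1 < K" using condensationD(5)[OF C, of s] ms by simp
    then obtain j where j: "j \<le> 25 * D" "(mk s - 1, mk t - 1) \<in> (E1 \<union> FH F pk) ^^ j"
      using few_hops[OF rows hits r _ mst] by blast
    have "E1 \<union> FH F pk = cond_edges G mk \<union> (chain_hops D chv (q * D) \<union> FH F pk)"
      unfolding E1_def unfolding E by blast
    moreover have "star_edges mk rep \<subseteq> H" "rep_image rep (chain_hops D chv (q * D) \<union> FH F pk) \<subseteq> H"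
      unfolding H by auto
    ultimately obtain i where i: "i \<le> 3 * j" "(rep (mk s), rep (mk t)) \<in> (G \<union> H) ^^ i"
      using lift_hops[OF C, of H "chain_hops D chv (q * D) \<union> FH F pk" "mk s - 1" "mk t - 1" j] j(2) ms mt by auto
    have "(s, rep (mk s)) \<in> star_edges mk rep" "(rep (mk t), t) \<in> star_edges mk rep"
      unfolding star_edges_def using ms mt by blast+
    then have "(s, rep (mk s)) \<in> (G \<union> H) ^^ 1" "(rep (mk t), t) \<in> (G \<union> H) ^^ 1" unfolding H by auto
    from relpow_add_I[OF this(1) relpow_add_I[OF i(2) this(2)]]
    have "hop_dist (G \<union> H) s t \<le> enat (1 + (i + 1))" by (rule hop_dist_le)
    also have "\<dots> \<le> enat (77 * D)" using i(1) j(1) D_pos by simp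
    finally show ?thesis .
  qed
  then show ?thesis using sub unfolding shortcut_set_def by auto
qed

end

section \<open>Size of the shortcut set\<close>

lemma card_rep_image: "finite X \<Longrightarrow> card (rep_image rep X) \<le> card X"
  unfolding rep_image_def by (rule card_image_le)

lemma hops_finite: "finite (hops D chv x p) \<and> card (hops D chv x p) \<le> 2"
proof -
  have "hops D chv x p \<subseteq> {(chv (x - x mod D + (x mod D - x mod D mod p)), chv x),
      (chv x, chv (x - x mod D + (x mod D - x mod D mod p + p)))}" (is "_ \<subseteq> ?S")
    by (auto simp: hops_def Let_def)
  then have "finite (hops D chv x p)" "card (hops D chv x p) \<le> card ?S"
    by (auto intro: finite_subset card_mono)
  moreover have "card ?S \<le> 2" by (simp add: card_insert_if)
  ultimately show ?thesis by simp
qed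

lemma chain_hops_card: "finite (chain_hops D chv l) \<and> card (chain_hops D chv l) \<le> l * (2 * lg D)"
proof -
  let ?J = "{j. 2 ^ j < D}"
  have J: "?J \<subseteq> {..<lg D}"
  proof
    fix j assume "j \<in> ?J"
    then have "2 ^ j < D" by simp
    then have "(2::nat) ^ j < 2 ^ lg D" using less_power_lg[of D] by (rule less_trans)
    then show "j \<in> {..<lg D}" by simp
  qed
  have finJ: "finite ?J" using J by (rule finite_subset) simp
  have cJ: "card ?J \<le> lg D" using card_mono[OF _ J] by simp
  have inner: "card (\<Union>j\<in>?J. hops D chv x (2 ^ j)) \<le> 2 * lg D" for x
  proof -
    have "card (\<Union>j\<in>?J. hops D chv x (2 ^ j)) \<le> (\<Sum>j\<in>?J. card (hops D chv x (2 ^ j)))" by (rule card_UN_le[OF finJ])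
    also have "\<dots> \<le> (\<Sum>j\<in>?J. 2)" by (rule sum_mono) (use hops_finite in blast)
    also have "\<dots> \<le> 2 * lg D" using cJ by simp
    finally show ?thesis .
  qed
  have "card (chain_hops D chv l) \<le> (\<Sum>x<l. card (\<Union>j\<in>?J. hops D chv x (2 ^ j)))"
    unfolding chain_hops_def by (rule card_UN_le) simp
  also have "\<dots> \<le> (\<Sum>x<l. 2 * lg D)" by (rule sum_mono) (rule inner)
  finally show ?thesis using finJ hops_finite unfolding chain_hops_def by auto
qed

text \<open>The source is given by a picked label and an offset, the target chain by another picked
  label. These data determine the edge.\<close>

lemma final_hops_card:
  assumes pk: "{l. pk l \<noteq> 0} \<subseteq> {1..q}" and D: "0 < D"
  shows "finite (final_hops q D K pk chv F l 0) \<and>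
    card (final_hops q D K pk chv F l 0) \<le> D * card {l. pk l \<noteq> 0} * card {l. pk l \<noteq> 0}"
proof -
  let ?P = "{l. pk l \<noteq> 0}"
  have finP: "finite ?P" using pk by (rule finite_subset) simp
  define g where "g = (\<lambda>((a, i), c). let x = (a - 1) * D + i in (chv x, chv ((c - 1) * D + (D - F ((c - 1) * K + chv x)))))"
  have "final_hops q D K pk chv F l 0 \<subseteq> g ` ((?P \<times> {..<D}) \<times> ?P)"
  proof
    fix e assume "e \<in> final_hops q D K pk chv F l 0"
    then obtain x c where x: "pk (Suc (x div D)) \<noteq> 0" "pk (Suc c) \<noteq> 0"
      "e = (chv x, chv (c * D + (D - F (c * K + chv x))))" by (auto simp: final_hops_def)
    have "e = g ((Suc (x div D), x mod D), Suc c)" using x(3) by (simp add: g_def Let_def)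
    moreover have "((Suc (x div D), x mod D), Suc c) \<in> (?P \<times> {..<D}) \<times> ?P" using x D by simp
    ultimately show "e \<in> g ` ((?P \<times> {..<D}) \<times> ?P)" by blast
  qed
  moreover have "finite ((?P \<times> {..<D}) \<times> ?P)" using finP by simp
  ultimately have "finite (final_hops q D K pk chv F l 0)"
    "card (final_hops q D K pk chv F l 0) \<le> card (g ` ((?P \<times> {..<D}) \<times> ?P))"
    by (auto intro: finite_subset card_mono)
  moreover have "card (g ` ((?P \<times> {..<D}) \<times> ?P)) \<le> card ((?P \<times> {..<D}) \<times> ?P)"
    by (rule card_image_le) (use finP in simp)
  moreover have "card ((?P \<times> {..<D}) \<times> ?P) = D * card ?P * card ?P" by (simp add: card_cartesian_product ac_simps)
  ultimately show ?thesis by simp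
qed

lemma star_edges_card:
  assumes "\<And>u. mk u \<noteq> 0 \<Longrightarrow> u < n"
  shows "finite (star_edges mk rep) \<and> card (star_edges mk rep) \<le> 2 * n"
proof -
  let ?X = "{u. mk u \<noteq> 0}"
  have X: "?X \<subseteq> {..<n}" using assms by auto
  then have fin: "finite ?X" by (rule finite_subset) simp
  have "star_edges mk rep = (\<lambda>u. (u, rep (mk u))) ` ?X \<union> (\<lambda>u. (rep (mk u), u)) ` ?X"
    unfolding star_edges_def by blast
  then have "card (star_edges mk rep) \<le> card ((\<lambda>u. (u, rep (mk u))) ` ?X) + card ((\<lambda>u. (rep (mk u), u)) ` ?X)"
    by (simp add: card_Un_le)
  also have "\<dots> \<le> card ?X + card ?X" by (intro add_mono card_image_le fin)
  also have "card ?X \<le> n" using card_mono[OF _ X] by simp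
  finally show ?thesis using fin unfolding star_edges_def by auto
qed

section \<open>The complete program\<close>

definition MAIN :: com where
  "MAIN = SCC ;; ''S'' ::= vv ''K'' ;; SORT ;; CHAINS ;; H1 ;; DOUBLE ;; ''S'' ::= vv ''KK'' ;; SORT ;;
     TREES ;; RESIDUE ;; WINDOWS ;; HIT ;; FINAL"

text \<open>\<open>FINAL\<close> reads the doubled table of chains, which agrees with the original
  one on the first \<open>q * D\<close> positions.\<close>

lemma final_hops_cong:
  assumes "\<And>x. x < q * D \<Longrightarrow> chv x = chv' x" "0 < D"
  shows "final_hops q D K pk chv F (q * D) 0 = final_hops q D K pk chv' F (q * D) 0"
proof -
  have "c * D + (D - f) < q * D" if "c < q" "f \<noteq> 0" for c f
  proof -
    have "c * D + (D - f) < Suc c * D" using that assms(2) by simp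
    also have "\<dots> \<le> q * D" using that by (intro mult_le_mono1) simp
    finally show ?thesis .
  qed
  then have eq: "chv (c * D + (D - f)) = chv' (c * D + (D - f))" if "c < q" "f \<noteq> 0" for c f using assms(1) that by blast
  show ?thesis
    unfolding final_hops_def
    by (intro Collect_cong ex_cong1) (use assms(1) eq in \<open>auto simp del: neq0_conv\<close>)
qed

text \<open>A pass over the graph, times the number of passes, times a logarithm. The argument of
  \<open>lg\<close> bounds the number \<open>2 * q * (2 * K)\<close> of table positions and thereby
  the number of windows.\<close>

definition steps :: "nat \<Rightarrow> nat \<Rightarrow> nat \<Rightarrow> nat \<Rightarrow> nat" where
  "steps n m K D = (m + K + 1) * (K div D + 1) * (lg (4 * n * n) + 1)"

text \<open>The separate summand \<open>D\<close> stems from the loop over the 4 D residues in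
  \<open>t8\<close>. The chain shortcuts already bring a logarithm into the edge count
  \<open>M1\<close>, but the passes building the forests add no second one, so a single factor
  suffices. Windows cost 4 D each, and averaging has bounded their total length by
  \<open>N\<close>.\<close>

lemma stage_costs:
  fixes n m K D q M1 N w M3 :: nat
  defines "U \<equiv> steps n m K D"
  assumes "0 < D" "K \<le> n" "q \<le> K div D" and M1: "M1 \<le> m + 2 * lg D * (q * D)" and N: "N = 2 * q * (2 * K)" and w: "w * (4 * D) \<le> N"
    and M3: "M3 \<le> 4 * D * w"
    and t1: "t1 \<le> 3000 * m + 1000" and t2: "t2 \<le> 200 * (m + K) + 100" and t3: "t3 \<le> (K div D) * (400 * (m + K + 1)) + 50"
    and t4: "t4 \<le> 500 * (q * D) * (lg D + 1) + 50" and t5: "t5 \<le> 100 * (K + M1 + q * D) + 100"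
    and t6: "t6 \<le> 200 * (2 * M1 + 2 * K) + 100" and t7: "t7 \<le> 2 * q * (200 * (D + 2 * M1 + 1)) + 50"
    and t8: "t8 \<le> 100 * (N + 4 * D) + 100" and t9: "t9 \<le> 100 * N + 100 * (4 * D + 1) * w + 100"
    and t10: "t10 \<le> 300 * (M3 + q + 1) * (lg w + 1) + 100" and t11: "t11 \<le> q * D * (200 * q + 50) + 50"
  shows "t1 + t2 + t3 + t4 + t5 + t6 + t7 + t8 + t9 + t10 + t11 \<le> 30000 * (U + D)"
    and "q * D \<le> K" "q * D * lg D \<le> K * lg (4 * n * n)" "lg w \<le> lg (4 * n * n)"
proof -
  define y z e where "y = m + K + 1" and "z = K div D + 1" and "e = lg (4 * n * n) + 1"
  have U: "U = y * z * e" by (simp add: U_def steps_def y_def z_def e_def)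
  have pos: "1 \<le> y" "1 \<le> z" "1 \<le> e" by (simp_all add: y_def z_def e_def)
  have "q * D \<le> K div D * D" using assms(4) by (rule mult_le_mono1)
  also have "\<dots> \<le> K" by simp
  finally show qD: "q * D \<le> K" .
  have qK: "q \<le> K" using qD \<open>0 < D\<close> by (metis Suc_leI le_trans mult.right_neutral mult_le_mono2 One_nat_def)
  have lgD: "q * D * lg D \<le> q * D * lg (4 * n * n)"
  proof (cases "q = 0")
    case False
    then have "D \<le> n" using qD \<open>K \<le> n\<close> by (metis Suc_leI bot_nat_0.not_eq_extremum le_trans mult_le_mono1 mult_1 One_nat_def)
    also have "n \<le> 4 * n * n" by simp
    finally have "lg D \<le> lg (4 * n * n)" by (rule lg_mono)
    then show ?thesis by (rule mult_le_mono2)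
  qed simp
  also have "\<dots> \<le> K * lg (4 * n * n)" using qD by (rule mult_le_mono1)
  finally show lgD: "q * D * lg D \<le> K * lg (4 * n * n)" .
  have wN: "w \<le> N" using w \<open>0 < D\<close> by (metis le_trans mult_le_mono2 mult.right_neutral Suc_leI nat_0_less_mult_iff zero_less_numeral One_nat_def)
  have "N \<le> 4 * (n * n)"
  proof -
    have "q * K \<le> n * n" using qK \<open>K \<le> n\<close> by (intro mult_le_mono) auto
    then show ?thesis by (simp add: N)
  qed
  then show lgw: "lg w \<le> lg (4 * n * n)" using wN by (intro lg_mono) (simp add: mult.assoc)
  have yz: "y \<le> y * z" "y * z \<le> U" "y * e \<le> U" "y \<le> U" "z \<le> U" "1 \<le> U"
  proof -
    show yyz: "y \<le> y * z" using pos by simp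
    show yzU: "y * z \<le> U" unfolding U using pos mult_le_mono2[of 1 e "y * z"] by simp
    show "y * e \<le> U" unfolding U using pos mult_le_mono2[of 1 z "y * e"] by (simp add: ac_simps)
    show yU: "y \<le> U" using yyz yzU by (rule le_trans)
    have "z \<le> y * z" using pos by simp
    then show "z \<le> U" using yzU by (rule le_trans)
    show "1 \<le> U" using pos(1) yU by (rule le_trans)
  qed
  have mK: "m \<le> y" "K \<le> y" "m + K \<le> y" by (simp_all add: y_def)
  have KeU: "K * e \<le> U" using mult_le_mono1[OF mK(2), of e] yz(3) by (rule le_trans)
  have Klg: "K * lg (4 * n * n) \<le> K * e" by (simp add: e_def)
  have M1e: "M1 \<le> 2 * (y * e)"
  proof -
    have "2 * lg D * (q * D) = 2 * (q * D * lg D)" by (simp add: ac_simps)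
    then have "M1 \<le> m + 2 * (K * lg (4 * n * n))" using M1 lgD by linarith
    also have "\<dots> \<le> y + 2 * (y * lg (4 * n * n))" using mK by (intro add_mono mult_le_mono) auto
    also have "\<dots> \<le> 2 * (y * e)" by (simp add: e_def)
    finally show ?thesis .
  qed
  then have M1U: "M1 \<le> 2 * U" using yz(3) by simp
  have qz: "q \<le> z" using assms(4) by (simp add: z_def)
  have NU: "N \<le> 4 * (y * z)" "N \<le> 4 * U"
  proof -
    have "q * K \<le> z * y" by (rule mult_le_mono[OF qz mK(2)])
    then show "N \<le> 4 * (y * z)" by (simp add: N ac_simps)
    then show "N \<le> 4 * U" using yz(2) by simp
  qed
  have b1: "t1 \<le> 4000 * U" using t1 mK(1) yz(4,6) by (simp add: algebra_simps)
  have b2: "t2 \<le> 300 * U" using t2 order_trans[OF mK(3) yz(4)] yz(6) by simp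
  have b3: "t3 \<le> 450 * U"
  proof -
    have "(K div D) * (400 * (m + K + 1)) \<le> 400 * (y * z)" by (simp add: y_def z_def algebra_simps)
    then show ?thesis using t3 yz(2,6) by (simp add: algebra_simps)
  qed
  have b4: "t4 \<le> 1050 * U"
  proof -
    have "q * D * lg D \<le> U" "q * D \<le> U" using lgD Klg KeU qD mK(2) yz(4) by (meson le_trans)+
    moreover have "500 * (q * D) * (lg D + 1) = 500 * (q * D * lg D) + 500 * (q * D)" by (simp add: algebra_simps)
    ultimately have "500 * (q * D) * (lg D + 1) \<le> 1000 * U" by linarith
    then show ?thesis using t4 yz(6) by linarith
  qed
  have b5: "t5 \<le> 500 * U" using t5 M1U qD mK(2) yz(4,6) by (simp add: algebra_simps)
  have b6: "t6 \<le> 1300 * U" using t6 M1U mK(2) yz(4,6) by (simp add: algebra_simps)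
  have b7: "t7 \<le> 2500 * U"
  proof -
    have "2 * q * (200 * (D + 2 * M1 + 1)) = 400 * (q * D) + 800 * (q * M1) + 400 * q" by (simp add: algebra_simps)
    moreover have "q * M1 \<le> z * (2 * (y * e))" by (rule mult_le_mono[OF qz M1e])
    then have "q * M1 \<le> 2 * U" by (simp add: U ac_simps)
    ultimately show ?thesis using t7 qD qz mK(2) yz(4,5,6) by (simp add: algebra_simps)
  qed
  have b8: "t8 \<le> 500 * U + 400 * D" using t8 NU(2) yz(6) by (simp add: algebra_simps)
  have b9: "t9 \<le> 1300 * U"
  proof -
    have "100 * (4 * D + 1) * w = 100 * (w * (4 * D)) + 100 * w" by (simp add: algebra_simps)
    then show ?thesis using t9 w wN NU(2) yz(6) by (simp add: algebra_simps)
  qed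
  have b10: "t10 \<le> 1900 * U"
  proof -
    have "M3 \<le> N" using M3 w by (simp add: ac_simps)
    then have "M3 + q + 1 \<le> 4 * (y * z) + z + 1" using NU(1) qz by (simp add: algebra_simps)
    also have "\<dots> \<le> 6 * (y * z)"
    proof -
      have zz: "z \<le> y * z" using mult_le_mono1[OF pos(1), of z] by simp
      moreover have "1 \<le> y * z" using pos(2) zz by (rule le_trans)
      ultimately show ?thesis by linarith
    qed
    finally have "(M3 + q + 1) * (lg w + 1) \<le> 6 * (y * z) * e" using lgw by (intro mult_le_mono) (simp_all add: e_def)
    then have "300 * ((M3 + q + 1) * (lg w + 1)) \<le> 1800 * U" by (simp add: U)
    moreover have "t10 \<le> 300 * ((M3 + q + 1) * (lg w + 1)) + 100" using t10 by (simp only: mult.assoc)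
    ultimately show ?thesis using yz(6) by linarith
  qed
  have b11: "t11 \<le> 300 * U"
  proof -
    have "q * D * (200 * q + 50) \<le> y * (250 * z)" using qD qz mK pos by (intro mult_le_mono) linarith+
    then have "q * D * (200 * q + 50) \<le> 250 * (y * z)" by simp
    then show ?thesis using t11 yz(2,6) by (simp add: algebra_simps)
  qed
  show "t1 + t2 + t3 + t4 + t5 + t6 + t7 + t8 + t9 + t10 + t11 \<le> 30000 * (U + D)"
    using b1 b2 b3 b4 b5 b6 b7 b8 b9 b10 b11 by (simp add: distrib_left)
qed

text \<open>\<open>q\<close> is the number of chains and \<open>p\<close> the number of picked ones.
  The two inequalities for them give p = O(n log n / D^2), so that \<open>D * p * p\<close> becomes
  the main term n^2/D^3 up to logarithms.\<close>

lemma W_MAIN: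
  fixes n D :: nat and es :: "(nat \<times> nat) list"
  defines "s0 \<equiv> input_store n es D" and "G \<equiv> set es" and "m \<equiv> length es"
  assumes G: "digraph n G" and D: "0 < D"
  shows "W MAIN s0 (\<lambda>t s'. \<exists>H K q p. OUT n H s' \<and> shortcut_set n G (77 * D) H \<and> finite H \<and>
     card H \<le> 2 * n + 2 * (n * lg (4 * n * n)) + D * p * p \<and> p * D \<le> 2 * q * lg (4 * n * n) \<and> q * D \<le> n \<and>
     K \<le> n \<and> K \<le> 2 * m \<and> t \<le> 40000 * (steps n m K D + D))"
  unfolding MAIN_def W_Seq
proof (rule W_SCC[where D = D, OF G[unfolded G_def], folded s0_def G_def m_def], goal_cases)
  case (1 t1 s1 K mk rep)
  note e1 = 1(1) and C = 1(2) and K1 = 1(3) and rep1 = 1(4) and Kn = 1(5) and K2m = 1(6) and ed1 = 1(7) and M1 = 1(8) and O1 = 1(9)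
    and hd1 = 1(10) and t1 = 1(11)
  let ?E = "cond_edges G mk"
  have z1: "var s1 ''D'' = D" "arr s1 ''cid'' = (\<lambda>_. 0)" "arr s1 ''F'' = (\<lambda>_. 0)" "arr s1 ''dep'' = (\<lambda>_. 0)" "arr s1 ''cn'' = (\<lambda>_. 0)"
    "arr s1 ''cov'' = (\<lambda>_. 0)" "arr s1 ''pk'' = (\<lambda>_. 0)"
    using e1 by (simp_all add: eqx_def s0_def input_store_def)
  have Elt: "(a, b) \<in> ?E \<Longrightarrow> a < b \<and> b < K" for a b by (rule cond_edges_less[OF C])
  have repn: "rep (Suc a) < n" if "a < K" for a
    using condensationD(6)[OF C, of "Suc a"] condensationD(1)[OF C, of "rep (Suc a)"] that by simp
  show ?case
    unfolding W_Assign
  proof (rule W_SORT, goal_cases)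
    case (1 u) show ?case using hd1 by simp
  next
    case (2 e)
    then have "(arr s1 ''A'' e, arr s1 ''B'' e) \<in> ?E" unfolding ed1[symmetric] by (simp add: edges_def)
    then show ?case using Elt K1 by fastforce
  next
    case (3 t2 s2)
    have e2: "eqx {''S'', ''e'', ''p'', ''i'', ''u''} {''nx'', ''hd'', ''A2'', ''B2'', ''A'', ''B''} s1 s2" using 3(1) by (auto simp: eqx_def)
    define m2 where "m2 = var s1 ''M''"
    have f2: "var s2 ''M'' = m2" "var s2 ''K'' = K" "var s2 ''D'' = D" "arr s2 ''cid'' = (\<lambda>_. 0)" "arr s2 ''rep'' = rep"
      using e2 z1 K1 rep1 by (simp_all add: eqx_def m2_def)
    have ed2: "edges (arr s2 ''A'') (arr s2 ''B'') m2 = ?E" using 3(2) ed1 by (simp add: m2_def)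
    have dag2: "dag K (arr s2 ''A'') (arr s2 ''B'') m2"
      unfolding dag_def
    proof (intro conjI allI impI)
      fix e assume "e < m2"
      then have "(arr s2 ''A'' e, arr s2 ''B'' e) \<in> ?E" unfolding ed2[symmetric] by (simp add: edges_def)
      then show "arr s2 ''A'' e < arr s2 ''B'' e" "arr s2 ''B'' e < K" using Elt by blast+
    qed (use 3(3) in \<open>simp add: m2_def\<close>)
    have hd2: "arr s2 ''hd'' u = 0" for u using 3(4) by simp
    have t2: "t2 \<le> 200 * (m2 + K) + 100" using 3(5) K1 by (simp add: m2_def)
    have O2: "OUT n (star_edges mk rep) s2" by (rule OUT_eqx[OF e2 O1]) auto
    show ?case
    proof (rule W_CHAINS, goal_cases)
      case 1 show ?case using dag2 by (simp add: f2)
    next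
      case 2 show ?case using D by (simp add: f2)
    next
      case (3 a) show ?case by (simp add: f2)
    next
      case (4 t3 s3)
      note e3 = 4(1)
      define q where "q = var s3 ''Q''"
      define cid where "cid = arr s3 ''cid''"
      define chv where "chv = arr s3 ''chv''"
      have ch: "chains ?E K D q cid chv" and qK: "q \<le> K div D" and nl: "no_long_chain ?E K D cid"
        and t3: "t3 \<le> (K div D) * (400 * (m2 + K + 1)) + 50"
        using 4(2-5) by (simp_all add: f2 ed2 q_def cid_def chv_def)
      interpret chain_graph ?E K D q cid chv
        by unfold_locales (use Elt ch nl D in auto)
      have f3: "var s3 ''M'' = m2" "var s3 ''K'' = K" "var s3 ''D'' = D" "arr s3 ''rep'' = rep" "var s3 ''Q'' = q"
        "arr s3 ''chv'' = chv" "arr s3 ''cid'' = cid" "arr s3 ''A'' = arr s2 ''A''" "arr s3 ''B'' = arr s2 ''B''"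
        using e3 f2 by (simp_all add: eqx_def q_def cid_def chv_def)
      have O3: "OUT n (star_edges mk rep) s3" by (rule OUT_eqx[OF e3 O2]) auto
      let ?l = "q * D" and ?CH = "chain_hops D chv (q * D)"
      show ?case
      proof (rule W_H1[where K = K and cid = cid and l = "lg D" and n = n and S = "star_edges mk rep"], goal_cases)
        case 1 show ?case using ch by (simp add: f3 ed2)
      next
        case 2 show ?case using O3 .
      next
        case (3 a) then show ?case using repn by (simp add: f3)
      next
        case 4 show ?case using less_power_lg[of D] by (simp add: f3)
      next
        case (5 t4 s4)
        note e4 = 5(1)
        define m4 where "m4 = var s4 ''M''"
        have ed4: "edges (arr s4 ''A'') (arr s4 ''B'') m4 = E1" and m4: "m4 \<le> m2 + 2 * lg D * ?l"
          and O4: "OUT n (star_edges mk rep \<union> rep_image rep ?CH) s4" and t4: "t4 \<le> 500 * ?l * (lg D + 1) + 50"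
          using 5(2-5) by (simp_all add: f3 ed2 m4_def E1_def)
        have f4: "var s4 ''M'' = m4" "var s4 ''K'' = K" "var s4 ''D'' = D" "arr s4 ''rep'' = rep" "var s4 ''Q'' = q"
          "arr s4 ''chv'' = chv" "arr s4 ''cid'' = cid"
          using e4 f3 by (simp_all add: eqx_def m4_def)
        show ?case
        proof (rule W_DOUBLE, goal_cases)
          case (1 t5 s5)
          note e5 = 1(1)
          have f5: "var s5 ''KK'' = 2 * K" "var s5 ''M'' = 2 * m4" "arr s5 ''cid'' = cid2" "arr s5 ''chv'' = chv2"
            "var s5 ''D'' = D" "arr s5 ''rep'' = rep" "var s5 ''Q'' = q"
            using e5 1(2,3,5,6) f4 by (simp_all add: eqx_def cid2_def chv2_def)
          have ed5: "edges (arr s5 ''A'') (arr s5 ''B'') (2 * m4) = E2" using 1(4) by (simp add: f4 ed4 E2_def)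
          have t5: "t5 \<le> 100 * (K + m4 + ?l) + 100" using 1(7) by (simp add: f4)
          have O5: "OUT n (star_edges mk rep \<union> rep_image rep ?CH) s5" by (rule OUT_eqx[OF e5 O4]) auto
          have hd5: "arr s5 ''hd'' u = 0" for u using e3 e4 e5 hd2 by (simp add: eqx_def)
          show ?case
            unfolding W_Assign
          proof (rule W_SORT, goal_cases)
            case (1 u) show ?case using hd5 by simp
          next
            case (2 e)
            then have "(arr s5 ''A'' e, arr s5 ''B'' e) \<in> E2" unfolding ed5[symmetric] by (simp add: edges_def f5)
            then show ?case using E2_double_lt by (fastforce simp: f5)
          next
            case (3 t6 s6)
            have e6: "eqx {''S'', ''e'', ''p'', ''i'', ''u''} {''nx'', ''hd'', ''A2'', ''B2'', ''A'', ''B''} s5 s6" using 3(1) by (auto simp: eqx_def)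
            have f6: "var s6 ''KK'' = 2 * K" "var s6 ''M'' = 2 * m4" "arr s6 ''cid'' = cid2" "arr s6 ''chv'' = chv2"
              "var s6 ''D'' = D" "arr s6 ''rep'' = rep" "var s6 ''Q'' = q"
              using e6 f5 by (simp_all add: eqx_def)
            have ed6: "edges (arr s6 ''A'') (arr s6 ''B'') (2 * m4) = E2" using 3(2) by (simp add: f5 ed5)
            have dag6: "dag (2 * K) (arr s6 ''A'') (arr s6 ''B'') (2 * m4)"
              unfolding dag_def
            proof (intro conjI allI impI)
              fix e assume "e < 2 * m4"
              then have "(arr s6 ''A'' e, arr s6 ''B'' e) \<in> E2" unfolding ed6[symmetric] by (simp add: edges_def)
              then show "arr s6 ''A'' e < arr s6 ''B'' e" "arr s6 ''B'' e < 2 * K" using E2_less by blast+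
            qed (use 3(3) in \<open>simp add: f5\<close>)
            have hd6: "arr s6 ''hd'' u = 0" for u using 3(4) by simp
            have t6: "t6 \<le> 200 * (2 * m4 + 2 * K) + 100" using 3(5) by (simp add: f5)
            have O6: "OUT n (star_edges mk rep \<union> rep_image rep ?CH) s6" by (rule OUT_eqx[OF e6 O5]) auto
            have z6: "arr s6 ''F'' = (\<lambda>_. 0)" "arr s6 ''dep'' = (\<lambda>_. 0)" "arr s6 ''cn'' = (\<lambda>_. 0)" "arr s6 ''cov'' = (\<lambda>_. 0)" "arr s6 ''pk'' = (\<lambda>_. 0)"
              using z1 e2 e3 e4 e5 e6 by (simp_all add: eqx_def)
            show ?case
            proof (rule W_TREES, goal_cases)
              case 1 show ?case using dag6 by (simp add: f6)
            next
              case (2 x) show ?case by (simp add: z6)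
            next
              case (3 x) show ?case by (simp add: z6)
            next
              case (4 x) then show ?case using chv2_less[of x] by (simp add: f6 mult.assoc)
            next
              case 5 show ?case using chv2_inj by (simp add: f6 mult.assoc)
            next
              case (6 t7 s7)
              note e7 = 6(1)
              define F dep par where "F = arr s7 ''F''" and "dep = arr s7 ''dep''" and "par = arr s7 ''par''"
              have rows: "row_forest F dep par c" if "c < 2 * q" for c
                unfolding row_forest_def F_def dep_def par_def using 6(2)[of c] that by (simp add: f6 ed6)
              have t7: "t7 \<le> 2 * q * (200 * (D + 2 * m4 + 1)) + 50" using 6(3) by (simp add: f6)
              have f7: "var s7 ''KK'' = 2 * K" "arr s7 ''cid'' = cid2" "arr s7 ''chv'' = chv2" "var s7 ''D'' = D" "arr s7 ''rep'' = rep"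
                "var s7 ''Q'' = q" "arr s7 ''F'' = F" "arr s7 ''dep'' = dep" "arr s7 ''par'' = par" "arr s7 ''cn'' = (\<lambda>_. 0)"
                using e7 f6 z6 by (simp_all add: eqx_def F_def dep_def par_def)
              have O7: "OUT n (star_edges mk rep \<union> rep_image rep ?CH) s7" by (rule OUT_eqx[OF e7 O6]) auto
              define N where "N = 2 * q * (2 * K)"
              show ?case
              proof (rule W_RESIDUE, goal_cases)
                case (1 i) show ?case by (simp add: f7)
              next
                case 2 show ?case using D by (simp add: f7)
              next
                case (3 t8 s8)
                note e8 = 3(1)
                define r where "r = var s8 ''r''"
                define sel where "sel = selected dep (4 * D) r"
                have r: "r < 4 * D" using 3(2) by (simp add: f7 r_def)
                have cs: "card {x. x < N \<and> sel x} * (4 * D) \<le> N" and t8: "t8 \<le> 100 * (N + 4 * D) + 100"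
                  using 3(3,4) by (simp_all add: f7 N_def sel_def r_def mult.assoc)
                have f8: "var s8 ''KK'' = 2 * K" "arr s8 ''cid'' = cid2" "arr s8 ''chv'' = chv2" "var s8 ''D'' = D" "arr s8 ''rep'' = rep"
                  "var s8 ''Q'' = q" "arr s8 ''F'' = F" "arr s8 ''dep'' = dep" "arr s8 ''par'' = par"
                  using e8 f7 by (simp_all add: eqx_def)
                have O8: "OUT n (star_edges mk rep \<union> rep_image rep ?CH) s8" by (rule OUT_eqx[OF e8 O7]) auto
                show ?case
                proof (rule W_WINDOWS, goal_cases)
                  case (1 t9 s9)
                  note e9 = 1(1)
                  define w win where "w = var s9 ''W''" and "win = arr s9 ''win''"
                  define m9 where "m9 = var s9 ''M''"
                  define Oc where "Oc = edges (arr s9 ''A'') (arr s9 ''B'') m9"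
                  have en: "enumerates sel N win w" and m9: "m9 \<le> 4 * D * w" and Oc: "Oc = occs cid2 par (2 * K) (4 * D) win w"
                    and t9: "t9 \<le> 100 * N + 100 * (4 * D + 1) * w + 100"
                    using 1(2-5) by (simp_all add: f8 N_def w_def win_def m9_def Oc_def sel_def r_def mult.assoc)
                  have wN: "w * (4 * D) \<le> N" using cs en unfolding enumerates_def by metis
                  have winD: "win j < N \<and> sel (win j)" if "j < w" for j using en that unfolding enumerates_def by auto
                  have f9: "var s9 ''KK'' = 2 * K" "arr s9 ''cid'' = cid2" "arr s9 ''chv'' = chv2" "var s9 ''D'' = D" "arr s9 ''rep'' = rep"
                    "var s9 ''Q'' = q" "arr s9 ''F'' = F" "var s9 ''W'' = w" "var s9 ''M'' = m9"
                    using e9 f8 by (simp_all add: eqx_def w_def m9_def)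
                  have O9: "OUT n (star_edges mk rep \<union> rep_image rep ?CH) s9" by (rule OUT_eqx[OF e9 O8]) auto
                  have z9: "arr s9 ''hd'' = arr s6 ''hd''" "arr s9 ''cov'' = (\<lambda>_. 0)" "arr s9 ''pk'' = (\<lambda>_. 0)"
                    using e7 e8 e9 z6 by (simp_all add: eqx_def)
                  have vt: "vtx par (2 * K) (c * (2 * K) + a) i = ((\<lambda>v. par (c * (2 * K) + v)) ^^ i) a" if "a < 2 * K" for c a i
                    using that by (simp add: vtx_def)
                  have cidq: "cid2 a \<le> q" for a
                  proof -
                    have "cid b \<le> q" for b
                    proof (cases "cid b = 0")
                      case False
                      then obtain x where "x < ?l" "chv x = b" using cidD by blast
                      moreover from this have "x div D < q" using D by (simp add: div_less_iff_less_mult)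
                      ultimately show ?thesis using chvD[of x] by simp
                    qed simp
                    then show ?thesis by (simp add: cid2_def double_cid_def)
                  qed
                  have Ocl: "(l, j) \<in> Oc \<longleftrightarrow> j < w \<and> l \<in> {cid2 (vtx par (2 * K) (win j) i) |i. i < 4 * D \<and> cid2 (vtx par (2 * K) (win j) i) \<noteq> 0}" for l j
                    unfolding Oc occs_def occ_def by blast
                  have wd: "\<exists>c a. c < 2 * q \<and> a < 2 * K \<and> win j = c * (2 * K) + a" if "j < w" for j
                  proof (intro exI conjI)
                    have "win j < 2 * q * (2 * K)" using winD[OF that] by (simp add: N_def)
                    moreover from this have "0 < 2 * K" by (cases K) auto
                    ultimately show "win j div (2 * K) < 2 * q" "win j mod (2 * K) < 2 * K" by (auto simp: div_less_iff_less_mult)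
                    show "win j = win j div (2 * K) * (2 * K) + win j mod (2 * K)" by (rule div_mult_mod_eq[symmetric])
                  qed
                  show ?case
                  proof (rule W_HIT, goal_cases)
                    case (1 u) show ?case using hd6 by (simp add: z9)
                  next
                    case (2 u) show ?case by (simp add: z9)
                  next
                    case (3 u) show ?case by (simp add: z9)
                  next
                    case 4 show ?case using D by (simp add: f9)
                  next
                    case 5
                    have "Oc \<subseteq> {1..q} \<times> {..<w}" using Ocl cidq by fastforce
                    then show ?case by (simp add: f9 Oc_def)
                  next
                    case (6 j)
                    then have j: "j < w" by (simp add: f9)
                    obtain c a where ca: "c < 2 * q" "a < 2 * K" "win j = c * (2 * K) + a" using wd[OF j] by blast
                    have "4 * D \<le> dep (c * (2 * K) + a)" using winD[OF j] ca(3) by (simp add: sel_def selected_def)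
                    then have "D \<le> card {cid2 (((\<lambda>v. par (c * (2 * K) + v)) ^^ i) a) |i. i < 4 * D \<and> cid2 (((\<lambda>v. par (c * (2 * K) + v)) ^^ i) a) \<noteq> 0}"
                      by (rule window_labels[OF rows[OF ca(1), unfolded row_forest_def] ca(2)])
                    moreover have "{l. (l, j) \<in> Oc} = {cid2 (((\<lambda>v. par (c * (2 * K) + v)) ^^ i) a) |i. i < 4 * D \<and> cid2 (((\<lambda>v. par (c * (2 * K) + v)) ^^ i) a) \<noteq> 0}"
                      using Ocl[of _ j] j ca by (simp add: vt)
                    ultimately show ?case by (simp add: f9 flip: Oc_def)
                  next
                    case (7 t10 s10)
                    note e10 = 7(1)
                    define pk where "pk = arr s10 ''pk''"
                    define p where "p = card {l. pk l \<noteq> 0}"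
                    have cover: "\<exists>l. (l, j) \<in> Oc \<and> pk l \<noteq> 0" if "j < w" for j
                      using 7(2)[of j] that by (simp add: f9 pk_def flip: Oc_def)
                    have pk: "{l. pk l \<noteq> 0} \<subseteq> {1..q}" and pD: "p * D \<le> 2 * q * lg w" and t10: "t10 \<le> 300 * (m9 + q + 1) * (lg w + 1) + 100"
                      using 7(3-5) by (simp_all add: f9 pk_def p_def)
                    have f10: "var s10 ''KK'' = 2 * K" "arr s10 ''chv'' = chv2" "var s10 ''D'' = D" "arr s10 ''rep'' = rep"
                      "var s10 ''Q'' = q" "arr s10 ''F'' = F" "arr s10 ''pk'' = pk"
                      using e10 f9 by (simp_all add: eqx_def pk_def)
                    have O10: "OUT n (star_edges mk rep \<union> rep_image rep ?CH) s10" by (rule OUT_eqx[OF e10 O9]) auto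
                    have hits: "hit dep par pk r"
                      unfolding hit_def
                    proof (intro allI impI)
                      fix c a assume ca: "c < 2 * q" "a < 2 * K" "selected dep (4 * D) r (c * (2 * K) + a)"
                      have "c * (2 * K) + a < Suc c * (2 * K)" using ca by simp
                      also have "\<dots> \<le> 2 * q * (2 * K)" using ca(1) by (intro mult_le_mono1) simp
                      finally have "c * (2 * K) + a \<in> {x. x < N \<and> sel x}" using ca(3) by (simp add: N_def sel_def)
                      moreover have "win ` {..<w} = {x. x < N \<and> sel x}" using en unfolding enumerates_def by (elim conjE)
                      ultimately have "c * (2 * K) + a \<in> win ` {..<w}" by (simp only:)
                      then obtain j where j: "j < w" "win j = c * (2 * K) + a" by auto
                      obtain l where l: "(l, j) \<in> Oc" "pk l \<noteq> 0" using cover[OF j(1)] by blast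
                      then obtain i where "i < 4 * D" "l = cid2 (vtx par (2 * K) (win j) i)" "l \<noteq> 0" using Ocl by auto
                      then show "\<exists>i<4 * D. cid2 (((\<lambda>v. par (c * (2 * K) + v)) ^^ i) a) \<noteq> 0 \<and> pk (cid2 (((\<lambda>v. par (c * (2 * K) + v)) ^^ i) a)) \<noteq> 0"
                        using l(2) j(2) ca(2) by (auto simp: vt)
                    qed
                    let ?FH = "final_hops q D (2 * K) pk chv F ?l 0"
                    have FHe: "FH F pk = ?FH" by (simp add: FH_def[OF rows hits r])
                    have FH2: "final_hops q D (2 * K) pk chv2 F ?l 0 = ?FH"
                      by (rule final_hops_cong) (use chv2_lo D in auto)
                    show ?case
                    proof (rule W_FINAL[where n = n and S = "star_edges mk rep \<union> rep_image rep ?CH"], goal_cases)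
                      case 1 show ?case using O10 .
                    next
                      case (2 x) then show ?case using repn chvD[of x] by (simp add: f10 chv2_lo)
                    next
                      case (3 t11 s11)
                      let ?H = "star_edges mk rep \<union> rep_image rep ?CH \<union> rep_image rep ?FH"
                      have O11: "OUT n ?H s11" and t11: "t11 \<le> ?l * (200 * q + 50) + 50" using 3(2,3) by (simp_all add: f10 FH2)
                      have sc: "shortcut_set n G (77 * D) ?H"
                        by (rule shortcut_set_condensation[OF C refl rows hits r]) (simp_all add: FHe)
                      have m2m: "m2 \<le> m" using M1 by (simp add: m2_def)
                      have m4': "m4 \<le> m + 2 * lg D * ?l" using m4 m2m by simp
                      have t2': "t2 \<le> 200 * (m + K) + 100" using t2 m2m by simp
                      have "(K div D) * (400 * (m2 + K + 1)) \<le> (K div D) * (400 * (m + K + 1))"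
                        using m2m by (intro mult_le_mono2) simp
                      then have t3': "t3 \<le> (K div D) * (400 * (m + K + 1)) + 50" using t3 by linarith
                      note st = stage_costs[OF D Kn qK m4' N_def wN m9 t1 t2' t3' t4 t5 t6 t7 t8 t9 t10 t11]
                      have star: "finite (star_edges mk rep) \<and> card (star_edges mk rep) \<le> 2 * n"
                        by (rule star_edges_card) (rule condensationD(1)[OF C])
                      have CHc: "finite ?CH" "card ?CH \<le> ?l * (2 * lg D)" using chain_hops_card by blast+
                      have FHc: "finite ?FH" "card ?FH \<le> D * p * p" using final_hops_card[OF pk D] by (simp_all add: p_def)
                      have "card ?H \<le> card (star_edges mk rep) + card (rep_image rep ?CH) + card (rep_image rep ?FH)"
                        by (meson add_le_mono1 card_Un_le le_trans)
                      also have "\<dots> \<le> 2 * n + ?l * (2 * lg D) + D * p * p"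
                        using star CHc FHc by (intro add_mono) (meson card_rep_image le_trans)+
                      also have "?l * (2 * lg D) = 2 * (?l * lg D)" by simp
                      also have "\<dots> \<le> 2 * (K * lg (4 * n * n))" using st(3) by simp
                      also have "\<dots> \<le> 2 * (n * lg (4 * n * n))" using Kn by simp
                      finally have cH: "card ?H \<le> 2 * n + 2 * (n * lg (4 * n * n)) + D * p * p" by simp
                      have pD': "p * D \<le> 2 * q * lg (4 * n * n)" using pD mult_le_mono2[OF st(4), of "2 * q"] by (rule le_trans)
                      have finH: "finite ?H" using star CHc FHc by (simp add: rep_image_def)
                      have "1 \<le> D" using D by simp
                      show ?case
                        by (intro exI[of _ ?H] exI[of _ K] exI[of _ q] exI[of _ p] conjI O11 sc finH cH pD' Kn K2m)
                          (use st(1,2) Kn \<open>1 \<le> D\<close> in \<open>simp_all del: One_nat_def\<close>)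
                    qed
                  qed
                qed
              qed
            qed
          qed
        qed
      qed
    qed
  qed
qed

section \<open>Numerical estimates and the word length\<close>

lemma grows_MAIN: "grows 1 MAIN"
  by (simp add: MAIN_def SCC_def INIT_def BUILD_def FOREST_def DFS_def SWAP_def CONDENSE_def STAR_def EMIT_def
      SORT_def CHAINS_def LONG_def WALK_def H1_def ADDE_def DOUBLE_def TREES_def RESIDUE_def WINDOWS_def HIT_LABEL_def HIT_def FINAL_def For_def)

text \<open>Taking logarithms in \<open>2 ^ lg x \<le> 2 * x\<close>; the factor 2 comes from ln 2
  \<ge> 1/2.\<close>

lemma lg_le_ln: "real (lg x) \<le> 2 * ln (real x + 1) + 1"
proof (cases "x = 0")
  case False
  have "real (2 ^ lg x) \<le> real (2 * x)" using power_lg_le[of x] False of_nat_le_iff by blast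
  then have "(2::real) ^ lg x \<le> 2 * real x" by simp
  then have "ln ((2::real) ^ lg x) \<le> ln (2 * real x)" using False by (subst ln_le_cancel_iff) auto
  then have "real (lg x) * ln 2 \<le> ln 2 + ln (real x)" using False by (simp add: ln_realpow ln_mult)
  moreover have "ln (real x) \<le> ln (real x + 1)" using False by simp
  moreover have l2: "1 / 2 \<le> ln (2::real)"
    using ln_le_minus_one[of "1 / 2 :: real"] by (simp add: ln_div)
  ultimately have "(real (lg x) - 1) * ln 2 \<le> ln (real x + 1)" by (simp add: algebra_simps)
  moreover have "(real (lg x) - 1) * (1 / 2) \<le> (real (lg x) - 1) * ln 2"
  proof (rule mult_left_mono[OF l2])
    have "1 \<le> lg x" using lg.simps[of x] False by simp
    then show "0 \<le> real (lg x) - 1" by simp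
  qed
  ultimately have "(real (lg x) - 1) * (1 / 2) \<le> ln (real x + 1)" by linarith
  then show ?thesis by (simp add: field_simps)
qed simp

lemma lg_log: assumes "1 \<le> n" shows "real (lg (4 * n * n)) + 1 \<le> 10 * ln (real n + 2)"
proof -
  let ?l = "ln (real n + 2)"
  have l1: "1 \<le> ?l"
  proof -
    have "exp 1 \<le> (3::real)" by (rule exp_le)
    then have "ln (exp 1) \<le> ln (real n + 2)" using assms by (subst ln_le_cancel_iff) auto
    then show ?thesis by simp
  qed
  have "real (4 * n * n) + 1 \<le> (real n + 2) ^ 4"
  proof -
    have "1 \<le> real n + 2" by simp
    have "4 * real n * real n + 1 \<le> (real n + 2) ^ 2 * 4" by (simp add: power2_eq_square algebra_simps)
    also have "\<dots> \<le> (real n + 2) ^ 2 * (real n + 2) ^ 2"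
    proof (rule mult_left_mono)
      have "(2::real) ^ 2 \<le> (real n + 2) ^ 2" by (rule power_mono) auto
      then show "4 \<le> (real n + 2) ^ 2" by simp
    qed simp
    finally show ?thesis by (simp flip: power_add)
  qed
  moreover have "0 < real (4 * n * n) + 1" by linarith
  ultimately have "ln (real (4 * n * n) + 1) \<le> ln ((real n + 2) ^ 4)"
    by (subst ln_le_cancel_iff) auto
  also have "\<dots> = 4 * ?l" by (simp add: ln_realpow)
  finally have "real (lg (4 * n * n)) \<le> 8 * ?l + 1" using lg_le_ln[of "4 * n * n"] by linarith
  then show ?thesis using l1 by linarith
qed

lemma lg_le_self: "lg x \<le> x"
proof (induction x rule: less_induct)
  case (less x)
  show ?case
  proof (cases "x = 0")
    case False
    then have "lg (x div 2) \<le> x div 2" using less by simp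
    then show ?thesis using lg.simps[of x] False by simp
  qed simp
qed

text \<open>With x = n + 2, the three factors of \<open>steps\<close> are at most x^2, x and x^3.
  The result bounds the largest stored number and hence the word length that is needed.\<close>

lemma steps_poly:
  assumes "K \<le> n" "m \<le> n * n" "D \<le> c * n" "0 < D"
  shows "n + m + D + 40000 * (steps n m K D + D) + 2 \<le> (40003 * (c + 1)) * (n + 2) ^ 6"
proof -
  let ?x = "n + 2"
  have p: "?x ^ i \<le> ?x ^ 6" if "i \<le> 6" for i using that by (intro power_increasing) auto
  have "m + K + 1 \<le> ?x ^ 2"
  proof -
    have "?x ^ 2 = n * n + 4 * n + 4" by (simp add: power2_eq_square algebra_simps)
    then show ?thesis using assms(1,2) by linarith
  qed
  moreover have "K div D + 1 \<le> ?x"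
  proof -
    have "K div D \<le> K" by simp
    then show ?thesis using assms(1) by linarith
  qed
  moreover have "lg (4 * n * n) + 1 \<le> ?x ^ 3"
  proof -
    have "?x ^ 3 = n * n * n + 6 * (n * n) + 12 * n + 8" by (simp add: power3_eq_cube algebra_simps)
    moreover have "lg (4 * n * n) \<le> 4 * (n * n)" using lg_le_self[of "4 * n * n"] by (simp add: mult.assoc)
    ultimately show ?thesis by linarith
  qed
  ultimately have "steps n m K D \<le> ?x ^ 2 * ?x * ?x ^ 3" unfolding steps_def by (intro mult_le_mono)
  also have "\<dots> = ?x ^ 6"
  proof -
    have "x ^ 2 * x * x ^ 3 = x ^ 6" for x :: nat by (simp add: eval_nat_numeral)
    then show ?thesis .
  qed
  finally have s: "steps n m K D \<le> ?x ^ 6" .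
  have "n \<le> ?x ^ 6" using p[of 1] by simp
  moreover have "m \<le> ?x ^ 6"
  proof -
    have "m \<le> ?x ^ 2" using assms(2) by (simp add: power2_eq_square algebra_simps)
    also have "\<dots> \<le> ?x ^ 6" by (rule p) simp
    finally show ?thesis .
  qed
  moreover have D: "D \<le> c * ?x ^ 6" using assms(3) mult_le_mono2[of n "?x ^ 6" c] calculation(1) by linarith
  moreover have "2 \<le> ?x ^ 6" using p[of 1] by simp
  moreover have "n + m + D + 40000 * (s + D) + 2 \<le> 40003 * X + 40001 * Y"
    if "n \<le> X" "m \<le> X" "D \<le> Y" "2 \<le> X" "s \<le> X" for s X Y :: nat
    using that by simp
  ultimately have "n + m + D + 40000 * (steps n m K D + D) + 2 \<le> 40003 * ?x ^ 6 + 40001 * (c * ?x ^ 6)"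
    using s by blast
  also have "\<dots> \<le> 40003 * ((c + 1) * ?x ^ 6)" by (simp add: algebra_simps)
  finally show ?thesis by (simp only: mult.assoc)
qed

theorem theorem1p3:
  fixes C :: real
  assumes "C > 0"
  shows "\<exists>(P :: com) (a :: nat) (c :: real) (k :: nat).
    \<forall>(n :: nat) (D :: nat) (E :: (nat \<times> nat) set) (es :: (nat \<times> nat) list) (w :: nat).
      D \<ge> 1 \<and> real D \<le> C * real n powr (1 / 3) \<and>
      digraph n E \<and> edge_list_of es E \<and> (n + 2) ^ a \<le> 2 ^ w \<longrightarrow>
      (\<exists>(t :: nat) (s :: store) (H :: (nat \<times> nat) set) (\<beta> :: nat).
        exec w P (input_store n es D) t s \<and>
        real t \<le> c * (real (max 1 (card E)) * real n / real D) * ln (real n + 2) ^ k \<and>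
        edge_list_of (output_list s) H \<and>
        shortcut_set n E \<beta> H \<and>
        real (card H) \<le> c * (real n ^ 2 / real D ^ 3) * ln (real n + 2) ^ k \<and>
        real \<beta> \<le> c * real D)"
proof -
  define c0 where "c0 = nat \<lceil>C\<rceil>"
  have Cc0: "C \<le> real c0" unfolding c0_def by linarith
  define c1 where "c1 = 40003 * (c0 + 1)"
  define sz where "sz = csize MAIN"
  \<comment> \<open>Stored numbers stay below \<open>c1 * (n + 2) ^ 6\<close>. With
    \<open>c1 \<le> (n + 2) ^ c1\<close>, the power \<open>sz\<close> of this is at most
    \<open>(n + 2) ^ ((6 + c1) * sz)\<close>; the additional 1 makes the comparison with
    \<open>2 ^ w\<close> strict.\<close>
  define a where "a = (6 + c1) * sz + 1"
  \<comment> \<open>A common bound for the hopbound factor 77, the time factor 1600000 (1 + C) +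
    40000 C^2 and the size factor 20 C^3 + 400.\<close>
  define c where "c = 77 + 5000000 * (1 + C) * (1 + C) + 500 * (1 + C ^ 3)"
  have "\<exists>(t :: nat) (s :: store) (H :: (nat \<times> nat) set) (\<beta> :: nat).
        exec w MAIN (input_store n es D) t s \<and>
        real t \<le> c * (real (max 1 (card E)) * real n / real D) * ln (real n + 2) ^ 2 \<and>
        edge_list_of (output_list s) H \<and> shortcut_set n E \<beta> H \<and>
        real (card H) \<le> c * (real n ^ 2 / real D ^ 3) * ln (real n + 2) ^ 2 \<and> real \<beta> \<le> c * real D"
    if A: "D \<ge> 1" "real D \<le> C * real n powr (1 / 3)" "digraph n E" "edge_list_of es E" "(n + 2) ^ a \<le> 2 ^ w"
    for n D E es w
  proof -
    have es: "set es = E" "distinct es" using A(4) by (auto simp: edge_list_of_def)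
    define m where "m = length es"
    have mE: "m = card E" using es distinct_card by (metis m_def)
    have "n \<noteq> 0"
    proof
      assume "n = 0"
      then show False using A(1,2) by simp
    qed
    then have n1: "1 \<le> n" by simp
    have D0: "0 < D" "1 \<le> real D" using A(1) by auto
    \<comment> \<open>The cubic form of the bound on \<open>D\<close> is what the size needs; the
      linear form below serves the number of rounds, and the quadratic form the additive
      \<open>D\<close> in the time.\<close>
    have "real D ^ 3 \<le> (C * real n powr (1 / 3)) ^ 3" by (rule power_mono) (use A(2) in auto)
    also have "\<dots> = C ^ 3 * real n"
      using n1 by (simp add: power_mult_distrib powr_powr flip: powr_realpow)
    finally have D3: "real D ^ 3 \<le> C ^ 3 * real n" .
    have pw: "real n powr (1 / 3) \<le> real n" using n1 powr_mono[of "1 / 3" 1 "real n"] by simp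
    have D1: "real D \<le> C * real n" using A(2) mult_left_mono[OF pw, of C] \<open>C > 0\<close> by linarith
    have D2: "real D * real D \<le> C * C * real n"
    proof -
      have "real D * real D \<le> (C * real n powr (1 / 3)) * (C * real n powr (1 / 3))"
        using A(2) by (intro mult_mono) (use \<open>C > 0\<close> in auto)
      also have "\<dots> = C * C * real n powr (2 / 3)" by (simp add: powr_add[symmetric])
      also have "\<dots> \<le> C * C * real n"
        using n1 powr_mono[of "2 / 3" 1 "real n"] \<open>C > 0\<close> by simp
      finally show ?thesis .
    qed
    obtain t s H K q p where run: "iexec MAIN (input_store n es D) t s" and OUT: "OUT n H s"
      and sc: "shortcut_set n E (77 * D) H" and finH: "finite H"
      and cH: "card H \<le> 2 * n + 2 * (n * lg (4 * n * n)) + D * p * p" and pD: "p * D \<le> 2 * q * lg (4 * n * n)"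
      and qD: "q * D \<le> n" and Kn: "K \<le> n" and K2: "K \<le> 2 * m" and t: "t \<le> 40000 * (steps n m K D + D)"
      using W_MAIN[of n es D] A(3) D0 es unfolding W_def m_def by auto
    have En: "E \<subseteq> {..<n} \<times> {..<n}" using A(3) by (simp add: digraph_def)
    have mn: "m \<le> n * n"
      unfolding mE using card_mono[OF _ En] by (simp add: card_cartesian_product)
    have DC: "D \<le> c0 * n"
    proof -
      have "real D \<le> real c0 * real n" using D1 mult_right_mono[OF Cc0, of "real n"] by simp
      then show ?thesis by (simp flip: of_nat_mult)
    qed
    define B where "B = n + m + D + 2"
    have bd: "bounded B (input_store n es D)"
    proof -
      have "fst (es ! i) < n" "snd (es ! i) < n" if "i < length es" for i
        using that En es nth_mem[OF that] by auto
      then have f: "fst (es ! i) \<le> B" "snd (es ! i) \<le> B" if "i < length es" for i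
        using that by (fastforce simp: B_def intro: less_imp_le)+
      show ?thesis
        unfolding bounded_def input_store_def using f by (auto simp: B_def m_def)
    qed
    have pos2: "1 \<le> (n + 2) ^ i" for i :: nat by simp
    have "B + 1 * t \<le> n + m + D + 40000 * (steps n m K D + D) + 2" using t by (simp add: B_def)
    also have "\<dots> \<le> c1 * (n + 2) ^ 6" unfolding c1_def by (rule steps_poly[OF Kn mn DC D0(1)])
    also have "\<dots> \<le> (n + 2) ^ c1 * (n + 2) ^ 6"
    proof (rule mult_le_mono1)
      have "c1 \<le> 2 ^ c1" using less_exp[of c1] by simp
      also have "\<dots> \<le> (n + 2) ^ c1" by (rule power_mono) auto
      finally show "c1 \<le> (n + 2) ^ c1" .
    qed
    also have "\<dots> = (n + 2) ^ (6 + c1)" by (simp add: power_add mult.commute)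
    finally have "(B + 1 * t) ^ sz \<le> ((n + 2) ^ (6 + c1)) ^ sz" by (rule power_mono) simp
    also have "\<dots> = (n + 2) ^ ((6 + c1) * sz)" by (simp add: power_mult)
    also have "\<dots> < (n + 2) ^ a" unfolding a_def by (rule power_strict_increasing) auto
    also have "\<dots> \<le> 2 ^ w" by (rule A(5))
    finally have small: "(B + 1 * t) ^ csize MAIN < 2 ^ w" by (simp add: sz_def)
    have exec: "exec w MAIN (input_store n es D) t s"
      using iexec_exec[OF run grows_MAIN bd _ small] by (simp add: B_def)
    let ?L = "ln (real n + 2)"
    define e where "e = real (lg (4 * n * n)) + 1"
    have e: "1 \<le> e" "e \<le> 10 * ?L" using lg_log[OF n1] by (auto simp: e_def)
    have L1: "1 \<le> ?L"
    proof -
      have "ln (exp 1) \<le> ln (real n + 2)" using n1 exp_le by (subst ln_le_cancel_iff) auto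
      then show ?thesis by simp
    qed
    have L2: "?L \<le> ?L ^ 2" using L1 by (simp add: power2_eq_square)
    define Y where "Y = real (max 1 (card E)) * real n / real D"
    have M1: "1 \<le> real (max 1 (card E))" by simp
    \<comment> \<open>Absorbs the 1 in \<open>K div D + 1\<close>.\<close>
    have nD: "1 \<le> C * (real n / real D)" using D1 D0 by (simp add: field_simps)
    have "real (K div D) \<le> real K / real D" by (rule of_nat_div_le_of_nat)
    also have "\<dots> \<le> real n / real D" using Kn D0 by (simp add: divide_right_mono)
    finally have z: "real (K div D + 1) \<le> (1 + C) * (real n / real D)"
      using nD unfolding distrib_right by simp
    \<comment> \<open>Components are charged to edges by \<open>K \<le> 2 * m\<close>, so the factor
      is 1 + 2 + 1.\<close>
    have y: "real (m + K + 1) \<le> 4 * real (max 1 (card E))" using K2 mE by simp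
    have "real (steps n m K D) = real (m + K + 1) * real (K div D + 1) * e"
      unfolding steps_def e_def by (simp only: of_nat_mult of_nat_add of_nat_1)
    also have "\<dots> \<le> (4 * real (max 1 (card E))) * ((1 + C) * (real n / real D)) * (10 * ?L)"
      using y z e \<open>C > 0\<close> by (intro mult_mono) auto
    also have "\<dots> = 40 * (1 + C) * Y * ?L" by (simp add: Y_def)
    also have "\<dots> \<le> 40 * (1 + C) * Y * ?L ^ 2" using L2 \<open>C > 0\<close> by (intro mult_left_mono) (auto simp: Y_def)
    finally have S: "real (steps n m K D) \<le> 40 * (1 + C) * (Y * ?L ^ 2)" by (simp add: ac_simps)
    have DY: "real D \<le> C * C * (Y * ?L ^ 2)"
    proof -
      have "real D \<le> C * C * (real n / real D)" using D2 D0 by (simp add: field_simps)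
      also have "\<dots> \<le> C * C * (Y * ?L ^ 2)"
      proof (rule mult_left_mono)
        have "real n / real D \<le> Y" unfolding Y_def using mult_right_mono[OF M1, of "real n / real D"] by simp
        moreover have "Y * 1 \<le> Y * ?L ^ 2" using L1 L2 by (intro mult_left_mono) (auto simp: Y_def)
        ultimately show "real n / real D \<le> Y * ?L ^ 2" by simp
      qed simp
      finally show ?thesis .
    qed
    have YL0: "0 \<le> Y * ?L ^ 2" by (simp add: Y_def)
    have "real t \<le> 40000 * (real (steps n m K D) + real D)"
    proof -
      have "real t \<le> real (40000 * (steps n m K D + D))" using t of_nat_le_iff by blast
      then show ?thesis by simp
    qed
    also have "\<dots> \<le> 40000 * (40 * (1 + C) * (Y * ?L ^ 2) + C * C * (Y * ?L ^ 2))" using S DY by simp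
    also have "\<dots> = (1600000 * (1 + C) + 40000 * (C * C)) * (Y * ?L ^ 2)" by (simp add: algebra_simps)
    also have "\<dots> \<le> c * (Y * ?L ^ 2)"
    proof (rule mult_right_mono[OF _ YL0])
      show "1600000 * (1 + C) + 40000 * (C * C) \<le> c"
        unfolding c_def using \<open>C > 0\<close> by (simp add: algebra_simps)
    qed
    finally have tb: "real t \<le> c * Y * ?L ^ 2" by (simp add: mult.assoc)
    define Z where "Z = real n ^ 2 / real D ^ 3"
    have D3p: "0 < real D ^ 3" using D0 by simp
    \<comment> \<open>Through D^3 = O(n), linear terms are absorbed by n^2/D^3.\<close>
    have nZ: "real n \<le> C ^ 3 * Z"
    proof -
      have "real n * real D ^ 3 \<le> real n * (C ^ 3 * real n)" by (rule mult_left_mono[OF D3]) simp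
      then show ?thesis unfolding Z_def using D3p by (simp add: field_simps power2_eq_square)
    qed
    have pb: "real p \<le> 2 * real n * e / real D ^ 2"
    proof -
      have "real p * real D \<le> 2 * real q * e"
      proof -
        have "real (p * D) \<le> real (2 * q * lg (4 * n * n))" using pD of_nat_le_iff by blast
        also have "\<dots> \<le> 2 * real q * e" by (simp add: e_def mult_left_mono)
        finally show ?thesis by simp
      qed
      then have "real p * real D * real D \<le> 2 * real q * e * real D" by (rule mult_right_mono) simp
      also have "\<dots> = 2 * (real q * real D) * e" by simp
      also have "\<dots> \<le> 2 * real n * e"
        using qD e by (intro mult_right_mono) (simp_all flip: of_nat_mult)
      finally show ?thesis using D0 by (simp add: field_simps power2_eq_square)
    qed
    \<comment> \<open>\<open>p\<close> carries one logarithm, so its square produces the exponent 2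
      in the theorem.\<close>
    have "real (D * p * p) = real D * (real p * real p)" by simp
    also have "\<dots> \<le> real D * ((2 * real n * e / real D ^ 2) * (2 * real n * e / real D ^ 2))"
      using pb e by (intro mult_left_mono mult_mono) auto
    also have "\<dots> = 4 * Z * e ^ 2" unfolding Z_def using D0 by (simp add: field_simps power2_eq_square power3_eq_cube)
    also have "\<dots> \<le> 4 * Z * (10 * ?L) ^ 2" using e by (intro mult_left_mono power_mono) (auto simp: Z_def)
    finally have FHb: "real (D * p * p) \<le> 400 * (Z * ?L ^ 2)" by (simp add: power_mult_distrib)
    have "2 * real n + 2 * (real n * real (lg (4 * n * n))) = 2 * (real n * e)" by (simp add: e_def algebra_simps)
    also have "\<dots> \<le> 2 * (C ^ 3 * Z * (10 * ?L))" using nZ e \<open>C > 0\<close> by (intro mult_left_mono mult_mono) (auto simp: Z_def)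
    also have "\<dots> \<le> 2 * (C ^ 3 * Z * (10 * ?L ^ 2))" using L2 \<open>C > 0\<close> by (intro mult_left_mono) (auto simp: Z_def)
    finally have Cb: "2 * real n + 2 * (real n * real (lg (4 * n * n))) \<le> 20 * C ^ 3 * (Z * ?L ^ 2)" by simp
    have ZL0: "0 \<le> Z * ?L ^ 2" by (simp add: Z_def)
    have "real (card H) \<le> real (2 * n + 2 * (n * lg (4 * n * n)) + D * p * p)" using cH of_nat_le_iff by blast
    also have "\<dots> \<le> 20 * C ^ 3 * (Z * ?L ^ 2) + 400 * (Z * ?L ^ 2)" using Cb FHb by simp
    also have "\<dots> = (20 * C ^ 3 + 400) * (Z * ?L ^ 2)" by (simp add: algebra_simps)
    also have "\<dots> \<le> c * (Z * ?L ^ 2)"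
    proof (rule mult_right_mono[OF _ ZL0])
      have "0 \<le> C ^ 3" "0 \<le> (1 + C) * (1 + C)" using \<open>C > 0\<close> by simp_all
      then show "20 * C ^ 3 + 400 \<le> c" unfolding c_def by (simp add: mult.assoc)
    qed
    finally have Hb: "real (card H) \<le> c * Z * ?L ^ 2" by (simp add: mult.assoc)
    have \<beta>: "real (77 * D) \<le> c * real D"
    proof -
      have "77 \<le> c" unfolding c_def using \<open>C > 0\<close> by simp
      then show ?thesis by (simp add: mult_right_mono)
    qed
    have "edge_list_of (output_list s) H" using OUT by (simp add: OUT_def edge_list_of_def)
    then show ?thesis using exec tb sc Hb \<beta> unfolding Y_def Z_def by blast
  qed
  then show ?thesis by (intro exI[of _ MAIN] exI[of _ a] exI[of _ c] exI[of _ 2]) blast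
qed

end
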